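(* Let $n\ge2$ and let $\Omega\subset\mathbb R^n$ be an exterior Lipschitz domain with $0\notin\overline\Omega$, with unit outer normal $\nu$ on $\partial\Omega$. Assume $(v,p)\in H^2_{loc}(\overline\Omega)\times H^1_{loc}(\overline\Omega)$ is a solution of $$-\Delta v+\nabla p=f,\qquad\operatorname{div}v=0\quad\text{in }\Omega,$$ satisfying $|f(x)|\lesssim\langle x\rangle^{-a}$ with $a>n+1$, $$\int_\Omega f+\int_{\partial\Omega}(\nu\cdot\nabla v-p\nu)=0,$$ and $|v(x)|=o(1)$ as $|x|\to\infty$. Then its asymptotics is given by $$v_i(x)=\tilde b_0H_i(x)+\sum_{(j,k)\ne(n,n)}\Phi^{jk}_i(x)\tilde b_{jk}+O(\delta(x)),$$ where the sum is over $1\le j,k\le n$ with $(j,k)\neq(n,n)$, $\delta(x)=\langle x\rangle^{-\min\{n,a-2\}}(1+1_{a=n+2}\log\langle x\rangle)$, $$\tilde b_0=\int_{\partial\Omega}v\cdot\nu\,dS,\qquad H(x)=\nabla E(x)=\frac{-x}{n\omega_n|x|^n},$$ and for $j\neq k$ $$\tilde b_{jk}=-\int_\Omega y_kf_j\,dy+\int_{\partial\Omega}(v_j\nu_k-y_k\nabla v_j\cdot\nu+y_kp\,\nu_j)\,dS,$$ while for $j=k$ $$\tilde b_{jj}=\int_\Omega(y_nf_n-y_jf_j)\,dy+\int_{\partial\Omega}(v_j\nu_j-y_j\nabla v_j\cdot\nu+y_jp\,\nu_j)\,dS-\int_{\partial\Omega}(v_n\nu_n-y_n\nabla v_n\cdot\nu+y_np\,\nu_n)\,dS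 .$$
   Context: An exterior domain is a domain whose complement is compact (and here nonempty). $\langle x\rangle=(2+|x|^2)^{1/2}$; $A\lesssim B$ means $A\le CB$; $1_{a=n+2}$ is $1$ if $a=n+2$ and $0$ otherwise; $\omega_n=\frac{2\pi^{n/2}}{n\Gamma(n/2)}$ is the volume of the unit ball. $E$ is the fundamental solution of $-\Delta E=\delta_0$: $E(x)=\frac{1}{n(n-2)\omega_n}|x|^{2-n}$ for $n\ge3$, $E(x)=-\frac1{2\pi}\log|x|$ for $n=2$. The Lorentz tensor is $U_{ij}(x)=\frac12\delta_{ij}E(x)+\frac1{2n\omega_n}\frac{x_ix_j}{|x|^n}$, and $\Phi^{jk}=(\Phi^{jk}_1,\dots,\Phi^{jk}_n)$ with $\Phi^{jk}_i=\partial_kU_{ij}$. $\nu\cdot\nabla v$ denotes the vector with components $\sum_l\nu_l\partial_lv_i$. The asymptotics are for large $|x|$. The normal $\nu$ points out of $\Omega$ (i.e. into the complement of $\Omega$). *)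

theory Defs
  imports "HOL-Analysis.Analysis"
begin

section \<open>Partial derivatives and smooth functions\<close>

definition partial_deriv :: "'n::finite \<Rightarrow> (real^'n \<Rightarrow> real) \<Rightarrow> real^'n \<Rightarrow> real" where
  "partial_deriv i u x = frechet_derivative u (at x) (axis i 1)"

primrec Ck_fun :: "nat \<Rightarrow> (real^'n::finite \<Rightarrow> real) \<Rightarrow> bool" where
  "Ck_fun 0 u \<longleftrightarrow> continuous_on UNIV u"
| "Ck_fun (Suc k) u \<longleftrightarrow> (\<forall>x. u differentiable (at x)) \<and> (\<forall>i. Ck_fun k (partial_deriv i u))"

definition smooth_fun :: "(real^'n::finite \<Rightarrow> real) \<Rightarrow> bool" where
  "smooth_fun u \<longleftrightarrow> (\<forall>k. Ck_fun k u)"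

definition test_fun :: "(real^'n::finite) set \<Rightarrow> (real^'n \<Rightarrow> real) \<Rightarrow> bool" where
  "test_fun \<Omega> \<phi> \<longleftrightarrow> smooth_fun \<phi> \<and> compact (closure {x. \<phi> x \<noteq> 0}) \<and> closure {x. \<phi> x \<noteq> 0} \<subseteq> \<Omega>"


section \<open>Weak derivatives and local Sobolev spaces\<close>

text \<open>Functions on \<open>\<Omega>\<close> are represented by total functions of which only the values on \<open>\<Omega>\<close>
  matter; elements of Lebesgue and Sobolev spaces are determined up to null sets.\<close>

definition loc_integrable :: "(real^'n::finite) set \<Rightarrow> (real^'n \<Rightarrow> real) \<Rightarrow> bool" where
  "loc_integrable \<Omega> u \<longleftrightarrow> (\<forall>K. compact K \<and> K \<subseteq> \<Omega> \<longrightarrow> set_integrable lebesgue K u)"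

definition has_weak_pderiv ::
  "(real^'n::finite) set \<Rightarrow> 'n \<Rightarrow> (real^'n \<Rightarrow> real) \<Rightarrow> (real^'n \<Rightarrow> real) \<Rightarrow> bool" where
  "has_weak_pderiv \<Omega> i u g \<longleftrightarrow> loc_integrable \<Omega> u \<and> loc_integrable \<Omega> g \<and>
     (\<forall>\<phi>. test_fun \<Omega> \<phi> \<longrightarrow>
        (LINT x:\<Omega>|lebesgue. u x * partial_deriv i \<phi> x) = - (LINT x:\<Omega>|lebesgue. g x * \<phi> x))"

text \<open>The weak derivative is unique almost everywhere in \<open>\<Omega>\<close>; this picks a representative.\<close>

definition weak_pderiv ::
  "(real^'n::finite) set \<Rightarrow> 'n \<Rightarrow> (real^'n \<Rightarrow> real) \<Rightarrow> real^'n \<Rightarrow> real" where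
  "weak_pderiv \<Omega> i u = (SOME g. has_weak_pderiv \<Omega> i u g)"

text \<open>Local spaces up to the boundary: \<open>K\<close> is not required to stay away from the boundary of
  \<open>\<Omega>\<close>. So these are \<open>L\<^sup>2\<close>, \<open>H\<^sup>1\<close> and \<open>H\<^sup>2\<close> on every bounded part of \<open>\<Omega>\<close>.\<close>

definition L2_loc_cl :: "(real^'n::finite) set \<Rightarrow> (real^'n \<Rightarrow> real) \<Rightarrow> bool" where
  "L2_loc_cl \<Omega> u \<longleftrightarrow> u \<in> borel_measurable (lebesgue_on \<Omega>) \<and>
     (\<forall>K. compact K \<longrightarrow> set_integrable lebesgue (\<Omega> \<inter> K) (\<lambda>x. (u x)\<^sup>2))"

definition H1_loc_cl :: "(real^'n::finite) set \<Rightarrow> (real^'n \<Rightarrow> real) \<Rightarrow> bool" where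
  "H1_loc_cl \<Omega> u \<longleftrightarrow> L2_loc_cl \<Omega> u \<and>
     (\<forall>i. (\<exists>g. has_weak_pderiv \<Omega> i u g) \<and> L2_loc_cl \<Omega> (weak_pderiv \<Omega> i u))"

definition H2_loc_cl :: "(real^'n::finite) set \<Rightarrow> (real^'n \<Rightarrow> real) \<Rightarrow> bool" where
  "H2_loc_cl \<Omega> u \<longleftrightarrow> H1_loc_cl \<Omega> u \<and> (\<forall>i. H1_loc_cl \<Omega> (weak_pderiv \<Omega> i u))"


section \<open>Exterior Lipschitz domains, surface measure, normal, traces\<close>

text \<open>A local description of \<open>\<Omega>\<close> inside the open set \<open>V\<close> as the region above a Lipschitz graph in
  direction \<open>e\<close>. The graph function lives on the hyperplane orthogonal to \<open>e\<close>; it is represented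
  by its extension to the whole space that is constant along \<open>e\<close>.\<close>

definition lipschitz_chart ::
  "(real^'n::finite) set \<Rightarrow> real^'n \<Rightarrow> (real^'n \<Rightarrow> real) \<Rightarrow> (real^'n) set \<Rightarrow> bool" where
  "lipschitz_chart \<Omega> e \<gamma> V \<longleftrightarrow> norm e = 1 \<and> open V \<and>
     (\<exists>L. L-lipschitz_on UNIV \<gamma>) \<and> (\<forall>x t. \<gamma> (x + t *\<^sub>R e) = \<gamma> x) \<and>
     \<Omega> \<inter> V = {x \<in> V. \<gamma> x < x \<bullet> e}"

definition exterior_lipschitz_domain :: "(real^'n::finite) set \<Rightarrow> bool" where
  "exterior_lipschitz_domain \<Omega> \<longleftrightarrow> open \<Omega> \<and> connected \<Omega> \<and> compact (- \<Omega>) \<and> - \<Omega> \<noteq> {} \<and>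
     (\<forall>x\<in>frontier \<Omega>. \<exists>e \<gamma> V. x \<in> V \<and> lipschitz_chart \<Omega> e \<gamma> V)"

text \<open>The surface measure is the Borel measure carried by the boundary that in every Lipschitz graph
  chart is given by the density \<open>sqrt (1 + |\<nabla>\<gamma>|\<^sup>2)\<close> with respect to the Lebesgue measure of the
  hyperplane \<open>e\<^sup>\<bottom>\<close>. An integral over \<open>e\<^sup>\<bottom>\<close> is written as an integral over the slab of thickness one
  above it, of an integrand that is constant along \<open>e\<close>; the point of the graph over (or under) \<open>x\<close>
  is \<open>x + (\<gamma> x - x \<bullet> e) e\<close>. By Rademacher's theorem \<open>\<gamma>\<close> is differentiable almost everywhere,
  and by the area formula different charts are compatible.\<close>

definition surface_measure :: "(real^'n::finite) set \<Rightarrow> (real^'n) measure \<Rightarrow> bool" where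
  "surface_measure \<Omega> S \<longleftrightarrow> sets S = sets borel \<and> emeasure S (- frontier \<Omega>) = 0 \<and>
     (\<forall>e \<gamma> V A. lipschitz_chart \<Omega> e \<gamma> V \<and> A \<in> sets borel \<and> A \<subseteq> frontier \<Omega> \<inter> V \<longrightarrow>
        emeasure S A =
          (\<integral>\<^sup>+ x. indicator {x. 0 \<le> x \<bullet> e \<and> x \<bullet> e \<le> 1 \<and> x + (\<gamma> x - x \<bullet> e) *\<^sub>R e \<in> A} x *
                ennreal (sqrt (1 + (\<Sum>i\<in>UNIV. (partial_deriv i \<gamma> x)\<^sup>2))) \<partial>lborel))"

text \<open>The vector \<open>w\<close> is the unit outer normal of \<open>\<Omega>\<close> at the boundary point \<open>x\<close>: to first order
  at \<open>x\<close>, the set \<open>\<Omega>\<close> is the half space of all \<open>y\<close> with \<open>(y - x) \<bullet> w < 0\<close>. For a graph chart this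
  means that \<open>\<gamma>\<close> is differentiable at \<open>x\<close> and \<open>w = (\<nabla>\<gamma> x - e) / sqrt (1 + |\<nabla>\<gamma> x|\<^sup>2)\<close>.\<close>

definition outer_unit_normal_at :: "(real^'n::finite) set \<Rightarrow> real^'n \<Rightarrow> real^'n \<Rightarrow> bool" where
  "outer_unit_normal_at \<Omega> x w \<longleftrightarrow> norm w = 1 \<and>
     (\<forall>\<epsilon>>0. \<exists>r>0. \<forall>y\<in>ball x r.
        ((y - x) \<bullet> w < - \<epsilon> * norm (y - x) \<longrightarrow> y \<in> \<Omega>) \<and>
        (\<epsilon> * norm (y - x) < (y - x) \<bullet> w \<longrightarrow> y \<notin> \<Omega>))"

definition outer_unit_normal ::
  "(real^'n::finite) set \<Rightarrow> (real^'n) measure \<Rightarrow> (real^'n \<Rightarrow> real^'n) \<Rightarrow> bool" where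
  "outer_unit_normal \<Omega> S \<nu> \<longleftrightarrow> \<nu> \<in> borel_measurable S \<and>
     (AE x in S. outer_unit_normal_at \<Omega> x (\<nu> x))"

text \<open>\<open>T\<close> is the boundary trace of \<open>u\<close>: the limit in \<open>L\<^sup>2\<close> of the boundary of the restrictions
  \<open>\<phi> m\<close> of smooth functions that converge to \<open>u\<close> in \<open>H\<^sup>1\<close> of every bounded part of \<open>\<Omega>\<close>.
  On a Lipschitz domain with compact boundary every function in \<open>H1_loc_cl\<close> has a trace, and it is
  unique almost everywhere.\<close>

definition has_trace ::
  "(real^'n::finite) set \<Rightarrow> (real^'n) measure \<Rightarrow> (real^'n \<Rightarrow> real) \<Rightarrow> (real^'n \<Rightarrow> real) \<Rightarrow> bool" where
  "has_trace \<Omega> S u T \<longleftrightarrow> H1_loc_cl \<Omega> u \<and> T \<in> borel_measurable S \<and> integrable S (\<lambda>x. (T x)\<^sup>2) \<and>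
     (\<exists>\<phi>::nat \<Rightarrow> real^'n \<Rightarrow> real. (\<forall>m. smooth_fun (\<phi> m)) \<and>
        (\<forall>K. compact K \<longrightarrow>
           (\<lambda>m. LINT x:\<Omega> \<inter> K|lebesgue. (\<phi> m x - u x)\<^sup>2) \<longlonglongrightarrow> 0 \<and>
           (\<forall>i. (\<lambda>m. LINT x:\<Omega> \<inter> K|lebesgue.
                  (partial_deriv i (\<phi> m) x - weak_pderiv \<Omega> i u x)\<^sup>2) \<longlonglongrightarrow> 0)) \<and>
        (\<lambda>m. LINT x|S. (\<phi> m x - T x)\<^sup>2) \<longlonglongrightarrow> 0)"


section \<open>Fundamental solutions\<close>

definition omega :: "nat \<Rightarrow> real" where
  "omega n = 2 * pi powr (real n / 2) / (real n * Gamma (real n / 2))"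

definition fund_E :: "real^'n::finite \<Rightarrow> real" where
  "fund_E x =
     (if CARD('n) = 2 then - 1 / (2 * pi) * ln (norm x)
      else 1 / (real CARD('n) * (real CARD('n) - 2) * omega CARD('n)) *
             norm x powr (2 - real CARD('n)))"

definition lorentz_U :: "'n::finite \<Rightarrow> 'n \<Rightarrow> real^'n \<Rightarrow> real" where
  "lorentz_U i j x = 1/2 * (if i = j then 1 else 0) * fund_E x +
     1 / (2 * real CARD('n) * omega CARD('n)) * (x $ i * x $ j / norm x ^ CARD('n))"

definition Phi :: "'n::finite \<Rightarrow> 'n \<Rightarrow> 'n \<Rightarrow> real^'n \<Rightarrow> real" where
  "Phi j k i x = partial_deriv k (lorentz_U i j) x"

definition grad_E :: "real^'n::finite \<Rightarrow> real^'n" where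
  "grad_E x = (\<chi> i. partial_deriv i fund_E x)"


section \<open>Coefficients and remainder\<close>

definition japanese :: "real^'n::finite \<Rightarrow> real" where
  "japanese x = sqrt (2 + (norm x)\<^sup>2)"

definition remainder_bound :: "real \<Rightarrow> real^'n::finite \<Rightarrow> real" where
  "remainder_bound a x = japanese x powr (- min (real CARD('n)) (a - 2)) *
     (1 + (if a = real CARD('n) + 2 then ln (japanese x) else 0))"

text \<open>In the following, \<open>vb\<close>, \<open>Gb\<close> and \<open>pb\<close> are the boundary values of the velocity, of its gradient
  (\<open>Gb y $ j $ l\<close> is that of \<open>\<partial>\<^sub>l v\<^sub>j\<close>, so \<open>Gb y $ j\<close> is \<open>\<nabla> v\<^sub>j\<close>) and of the pressure.\<close>

definition coeff_b0 ::
  "(real^'n::finite) measure \<Rightarrow> (real^'n \<Rightarrow> real^'n) \<Rightarrow> (real^'n \<Rightarrow> real^'n) \<Rightarrow> real" where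
  "coeff_b0 S \<nu> vb = (LINT y|S. vb y \<bullet> \<nu> y)"

definition boundary_moment ::
  "(real^'n::finite) measure \<Rightarrow> (real^'n \<Rightarrow> real^'n) \<Rightarrow> (real^'n \<Rightarrow> real^'n) \<Rightarrow>
   (real^'n \<Rightarrow> real^'n^'n) \<Rightarrow> (real^'n \<Rightarrow> real) \<Rightarrow> 'n \<Rightarrow> 'n \<Rightarrow> real" where
  "boundary_moment S \<nu> vb Gb pb j k =
     (LINT y|S. vb y $ j * \<nu> y $ k - y $ k * (Gb y $ j \<bullet> \<nu> y) + y $ k * pb y * \<nu> y $ j)"

text \<open>\<open>N\<close> is the coordinate index that plays the role of the last index \<open>n\<close>.\<close>

definition coeff_b ::
  "'n \<Rightarrow> (real^'n::finite) set \<Rightarrow> (real^'n) measure \<Rightarrow> (real^'n \<Rightarrow> real^'n) \<Rightarrow>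
   (real^'n \<Rightarrow> real^'n) \<Rightarrow> (real^'n \<Rightarrow> real^'n) \<Rightarrow> (real^'n \<Rightarrow> real^'n^'n) \<Rightarrow>
   (real^'n \<Rightarrow> real) \<Rightarrow> 'n \<Rightarrow> 'n \<Rightarrow> real" where
  "coeff_b N \<Omega> S \<nu> f vb Gb pb j k =
     (if j \<noteq> k then
        - (LINT y:\<Omega>|lebesgue. y $ k * f y $ j) + boundary_moment S \<nu> vb Gb pb j k
      else
        (LINT y:\<Omega>|lebesgue. y $ N * f y $ N - y $ j * f y $ j)
        + boundary_moment S \<nu> vb Gb pb j j - boundary_moment S \<nu> vb Gb pb N N)"

end

theory Submission
  imports Defs
begin

text \<open>The Lorentz tensor is \<open>\<partial>\<^sub>i\<partial>\<^sub>j\<Psi> - \<delta>\<^sub>i\<^sub>j \<Delta>\<Psi>\<close> with \<open>\<Psi>\<close> a multiple of the fundamental solution of \<open>\<Delta>\<^sup>2\<close>, and its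
  pressure is \<open>\<partial>\<^sub>i (- \<Delta>\<Psi>)\<close>. Replacing \<open>\<Psi>\<close> by a regularised and truncated radial
  function gives a compactly supported \<open>C\<^sup>1\<close> kernel, for which the Green identity on \<open>\<Omega>\<close> is an instance of the
  divergence theorem: the convolution of \<open>v\<close> with \<open>\<Delta>\<^sup>2\<Psi>\<close> equals force and boundary terms.
  Expanding the kernels in the source point, the zeroth moment vanishes by the balance of forces, the
  first moments give the leading terms, and the second order remainder is controlled by the moments
  of the force; all bounds depend on \<open>\<Psi>\<close> only through the scale invariant size of its derivatives.
  When the regularisation is removed, \<open>\<Delta>\<^sup>2\<Psi>\<close> becomes an approximate identity up to
  an error that is small because \<open>v\<close> tends to zero, so the estimate holds for \<open>v\<close>
  at almost every point.\<close>

section \<open>The divergence theorem on exterior Lipschitz domains\<close>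

text \<open>Nothing is assumed about the gradient of v or about p at infinity, so boundary terms on
  large spheres could not be controlled; truncating the kernel keeps every integration by parts in a
  bounded set. Truncation subtracts from the profile its cubic Taylor polynomial at \<sigma>, the
  square of the truncation radius. Order three makes the bi-Laplacian of \<Psi> continuous, and the
  subtracted part of it has size \<sigma> powr (-n/2), up to a constant the reciprocal of the volume
  of the ball where it lives. The error is thus a mean of |v| over a growing ball, which is why |v|
  = o(1) is enough to remove it. Both unknowns disappear by the structure of the kernel: its rows
  are divergence free, which removes p, and the gradient part of its Laplacian meets div v = 0,
  which leaves only the flux of v through the boundary. This flux produces the term with H, the
  gradient of E. The condition a > n + 1 makes the first moments of f finite.\<close>

definition C1_grad :: "('a::euclidean_space \<Rightarrow> real) \<Rightarrow> ('a \<Rightarrow> 'a) \<Rightarrow> bool" where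
  "C1_grad \<phi> g \<longleftrightarrow> (\<forall>x. GDERIV \<phi> x :> g x) \<and> continuous_on UNIV g"

definition supp_in :: "('a::real_normed_vector \<Rightarrow> real) \<Rightarrow> real \<Rightarrow> bool" where
  "supp_in \<phi> R \<longleftrightarrow> (\<forall>x. R < norm x \<longrightarrow> \<phi> x = 0)"

lemma C1_grad_continuous:
  assumes "C1_grad \<phi> g" shows "continuous_on UNIV \<phi>"
  using assms unfolding C1_grad_def gderiv_def
  by (meson continuous_at_imp_continuous_on has_derivative_continuous)

lemma C1_grad_supp:
  assumes "C1_grad \<phi> g" "supp_in \<phi> R" "R < norm x"
  shows "g x = 0"
proof -
  have "open {y::'a. R < norm y}" by (intro open_Collect_less continuous_intros)
  then have "GDERIV \<phi> x :> 0"
    unfolding gderiv_def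
    using has_derivative_transform_within_open[of "\<lambda>_. 0" "\<lambda>_. 0" x UNIV "{y. R < norm y}" \<phi>] assms(2,3)
    by (auto simp: supp_in_def)
  moreover have "GDERIV \<phi> x :> g x" using assms(1) by (simp add: C1_grad_def)
  ultimately have "(\<lambda>h. inner h (g x)) = (\<lambda>h. inner h 0)"
    unfolding gderiv_def using has_derivative_unique by blast
  then show ?thesis by (metis inner_eq_zero_iff inner_zero_right)
qed

lemma C1_grad_bounded:
  assumes "C1_grad \<phi> g" "supp_in \<phi> R"
  obtains C where "0 < C" "\<And>x. norm (g x) \<le> C" "\<And>x. \<bar>\<phi> x\<bar> \<le> C"
proof -
  have "compact (g ` cball 0 R)"
    using assms(1) unfolding C1_grad_def
    by (intro compact_continuous_image) (auto intro: continuous_on_subset)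
  then obtain C1 where C1: "\<And>x. norm x \<le> R \<Longrightarrow> norm (g x) \<le> C1"
    by (force dest!: compact_imp_bounded simp: bounded_iff)
  have "compact (\<phi> ` cball 0 R)"
    using C1_grad_continuous[OF assms(1)]
    by (intro compact_continuous_image) (auto intro: continuous_on_subset)
  then obtain C2 where C2: "\<And>x. norm x \<le> R \<Longrightarrow> \<bar>\<phi> x\<bar> \<le> C2"
    by (force dest!: compact_imp_bounded simp: bounded_iff)
  show ?thesis
  proof (rule that[of "max (max C1 C2) 1"])
    show "norm (g x) \<le> max (max C1 C2) 1" for x
      using C1[of x] C1_grad_supp[OF assms, of x] by (cases "norm x \<le> R") auto
    show "\<bar>\<phi> x\<bar> \<le> max (max C1 C2) 1" for x
      using C2[of x] assms(2) by (cases "norm x \<le> R") (auto simp: supp_in_def)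
  qed auto
qed

lemma C1_grad_lipschitz:
  assumes "C1_grad \<phi> g" "\<And>x. norm (g x) \<le> C"
  shows "\<bar>\<phi> x - \<phi> y\<bar> \<le> C * norm (x - y)"
proof -
  have "norm (\<phi> x - \<phi> y) \<le> C * norm (x - y)"
  proof (rule differentiable_bound[where S=UNIV and f'="\<lambda>x h. inner h (g x)"])
    show "onorm (\<lambda>h. inner h (g x)) \<le> C" for x
    proof (rule onorm_le)
      show "norm (inner h (g x)) \<le> C * norm h" for h
        using Cauchy_Schwarz_ineq2[of h "g x"] mult_right_mono[OF assms(2)[of x], of "norm h"]
        by (simp add: mult.commute)
    qed
  qed (use assms in \<open>auto simp: C1_grad_def gderiv_def\<close>)
  then show ?thesis by simp
qed

section \<open>Difference quotients, integrals along fibres, and the region above a Lipschitz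
  graph\<close>

text \<open>Directional derivatives are taken along the steps 1/(m+1), so that dominated
  convergence, which is about sequences, applies to difference quotients.\<close>

lemma GDERIV_diff_quot:
  fixes f :: "'a::real_inner \<Rightarrow> real"
  assumes "GDERIV f x :> d"
  shows "(\<lambda>m. (f (x + k /\<^sub>R real (Suc m)) - f x) * real (Suc m)) \<longlonglongrightarrow> k \<bullet> d"
proof -
  have "((\<lambda>s. f (x + s *\<^sub>R k)) has_derivative (\<lambda>s. (s *\<^sub>R k) \<bullet> d)) (at 0)"
  proof -
    have d: "((\<lambda>s. x + s *\<^sub>R k) has_derivative (\<lambda>s. s *\<^sub>R k)) (at 0)"
      by (auto intro!: derivative_eq_intros)
    have "(f has_derivative (\<lambda>h. h \<bullet> d)) (at (x + 0 *\<^sub>R k))"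
      using assms unfolding gderiv_def by simp
    from has_derivative_compose[OF d this] show ?thesis .
  qed
  then have "((\<lambda>s. f (x + s *\<^sub>R k)) has_field_derivative (k \<bullet> d)) (at 0)"
    unfolding has_field_derivative_def
    by (rule has_derivative_eq_rhs) (simp add: fun_eq_iff mult.commute)
  then have "((\<lambda>s. (f (x + s *\<^sub>R k) - f x) / s) \<longlongrightarrow> k \<bullet> d) (at 0)"
    by (simp add: DERIV_def)
  moreover have "filterlim (\<lambda>m. inverse (real (Suc m))) (at 0) sequentially"
    unfolding filterlim_at using LIMSEQ_inverse_real_of_nat by auto
  ultimately have "(\<lambda>m. (f (x + inverse (real (Suc m)) *\<^sub>R k) - f x) / inverse (real (Suc m))) \<longlonglongrightarrow> k \<bullet> d"
    by (rule filterlim_compose)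
  then show ?thesis by (simp add: field_simps del: of_nat_Suc)
qed

lemma lborel_integral_translate:
  fixes f :: "'a::euclidean_space \<Rightarrow> real"
  shows "(LINT x|lborel. f (x + c)) = (LINT x|lborel. f x)"
proof -
  have "lborel = distr lborel borel ((+) c)" by (rule lborel_distr_plus[symmetric])
  then have "(LINT x|lborel. f x) = (LINT x|distr lborel lborel (\<lambda>x. x + c). f x)"
    by (simp add: add.commute[of c] cong: distr_cong)
  also have "\<dots> = (LINT x|lborel. f (x + c))"
  proof (cases "f \<in> borel_measurable borel")
    case True then show ?thesis by (subst integral_distr) auto
  next
    \<comment> \<open>Neither integrand is measurable, so both integrals have the default value
      0.\<close>
    case False
    then have "(\<lambda>x. f (x + c)) \<notin> borel_measurable borel"
    proof (rule contrapos_nn)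
      assume "(\<lambda>x. f (x + c)) \<in> borel_measurable borel"
      then have "(\<lambda>x. (\<lambda>x. f (x + c)) (x - c)) \<in> borel_measurable borel" by measurable
      then show "f \<in> borel_measurable borel" by simp
    qed
    then have "\<not> integrable lborel (\<lambda>x. f (x + c))" "\<not> integrable (distr lborel lborel (\<lambda>x. x + c)) f"
      using False by (auto dest: borel_measurable_integrable)
    then show ?thesis by (simp add: not_integrable_integral_eq)
  qed
  finally show ?thesis by simp
qed

lemma lborel_integrable_translate:
  fixes f :: "'a::euclidean_space \<Rightarrow> real"
  assumes "integrable lborel f"
  shows "integrable lborel (\<lambda>x. f (x + c))"
proof -
  have "integrable (distr lborel borel ((+) c)) f" using assms by (simp only: lborel_distr_plus)
  then show ?thesis using assms by (subst (asm) integrable_distr_eq) (auto simp: add.commute)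
qed

lemma integrable_bounded_support:
  fixes F :: "'a::euclidean_space \<Rightarrow> real"
  assumes "F \<in> borel_measurable borel" "\<And>x. \<bar>F x\<bar> \<le> C" "\<And>x. R < norm x \<Longrightarrow> F x = 0"
  shows "integrable lborel F"
proof (rule Bochner_Integration.integrable_bound)
  show "integrable lborel (\<lambda>x::'a. C * indicat_real (cball 0 R) x)"
    by (intro integrable_mult_right integrable_real_indicator) (auto simp: emeasure_lborel_cball_finite[simplified])
  show "AE x in lborel. norm (F x) \<le> norm (C * indicat_real (cball 0 R) x)"
    using assms(2,3) by (auto simp: indicator_def intro!: AE_I2 order_trans[OF assms(2)])
qed (use assms in auto)

text \<open>Difference quotients of \<open>\<phi>\<close> are integrated instead of \<open>\<phi>\<close> itself, so that the domain of
  integration can be shifted.\<close>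

lemma diff_quot_integral_limit:
  fixes \<phi> :: "'a::euclidean_space \<Rightarrow> real"
  assumes "C1_grad \<phi> g" "supp_in \<phi> R" "A \<in> sets borel"
  shows "(\<lambda>m. ((LINT x|lborel. indicat_real A x * \<phi> (x + k /\<^sub>R real (Suc m)))
             - (LINT x|lborel. indicat_real A x * \<phi> x)) * real (Suc m))
          \<longlonglongrightarrow> (LINT x|lborel. indicat_real A x * (k \<bullet> g x))"
proof -
  obtain C where C: "0 < C" "\<And>x. norm (g x) \<le> C" "\<And>x. \<bar>\<phi> x\<bar> \<le> C"
    using C1_grad_bounded[OF assms(1,2)] by blast
  have cont: "continuous_on UNIV \<phi>" by (rule C1_grad_continuous[OF assms(1)])
  have contg: "continuous_on UNIV g" using assms(1) by (simp add: C1_grad_def)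
  have m\<phi>[measurable]: "\<phi> \<in> borel_measurable borel" by (rule borel_measurable_continuous_onI[OF cont])
  have mg[measurable]: "g \<in> borel_measurable borel" by (rule borel_measurable_continuous_onI[OF contg])
  have mA[measurable]: "A \<in> sets borel" by fact
  define h where "h m = k /\<^sub>R real (Suc m)" for m
  have nh: "norm (h m) \<le> norm k" for m
    unfolding h_def by (simp add: divide_simps mult_le_cancel_left1)
  have supp: "\<phi> (x + h m) = 0" if "R + norm k < norm x" for x m
  proof -
    have "norm x \<le> norm (x + h m) + norm (h m)" by (metis add_diff_cancel norm_triangle_ineq4)
    then show ?thesis using nh[of m] that assms(2) unfolding supp_in_def by auto
  qed
  have i1: "integrable lborel (\<lambda>x. indicat_real A x * \<phi> (x + h m))" for m
    by (rule integrable_bounded_support[where C=C and R="R + norm k"])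
       (use C supp in \<open>auto simp: abs_mult indicator_def\<close>)
  have i2: "integrable lborel (\<lambda>x. indicat_real A x * \<phi> x)"
    by (rule integrable_bounded_support[where C=C and R="R"])
       (use C assms(2) in \<open>auto simp: abs_mult indicator_def supp_in_def\<close>)
  have "(\<lambda>m. LINT x|lborel. indicat_real A x * ((\<phi> (x + h m) - \<phi> x) * real (Suc m)))
      \<longlonglongrightarrow> (LINT x|lborel. indicat_real A x * (k \<bullet> g x))"
  \<comment> \<open>The Lipschitz bound C * norm (h m) times m+1 is C * norm k, and a shift by at
    most norm k enlarges the support by norm k.\<close>
  proof (rule integral_dominated_convergence[where w="\<lambda>x. C * norm k * indicat_real (cball 0 (R + norm k)) x"])
    show "integrable lborel (\<lambda>x::'a. C * norm k * indicat_real (cball 0 (R + norm k)) x)"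
      by (intro integrable_mult_right integrable_real_indicator) (auto simp: emeasure_lborel_cball_finite[simplified])
    show "AE x in lborel. (\<lambda>m. indicat_real A x * ((\<phi> (x + h m) - \<phi> x) * real (Suc m))) \<longlonglongrightarrow> indicat_real A x * (k \<bullet> g x)"
    proof (intro AE_I2 tendsto_mult tendsto_const)
      fix x
      show "(\<lambda>m. (\<phi> (x + h m) - \<phi> x) * real (Suc m)) \<longlonglongrightarrow> k \<bullet> g x"
        unfolding h_def using assms(1) by (intro GDERIV_diff_quot) (simp add: C1_grad_def)
    qed
    show "AE x in lborel. norm (indicat_real A x * ((\<phi> (x + h m) - \<phi> x) * real (Suc m)))
       \<le> C * norm k * indicat_real (cball 0 (R + norm k)) x" for m
    proof (rule AE_I2)
      fix x
      show "norm (indicat_real A x * ((\<phi> (x + h m) - \<phi> x) * real (Suc m)))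
       \<le> C * norm k * indicat_real (cball 0 (R + norm k)) x"
      proof (cases "norm x \<le> R + norm k")
        case True
        have "\<bar>\<phi> (x + h m) - \<phi> x\<bar> \<le> C * norm (h m)"
          using C1_grad_lipschitz[OF assms(1) C(2), of "x + h m" x] by simp
        then have "\<bar>\<phi> (x + h m) - \<phi> x\<bar> * real (Suc m) \<le> C * norm (h m) * real (Suc m)"
          by (intro mult_right_mono) auto
        also have "\<dots> = C * norm k" by (simp add: h_def)
        finally show ?thesis using True C(1) by (auto simp: indicator_def abs_mult)
      next
        case False
        then have "\<phi> x = 0" using assms(2) norm_ge_zero[of k] unfolding supp_in_def
          by (smt (verit))
        then show ?thesis using supp[of x m] False by simp
      qed
    qed
  qed (auto simp: h_def)
  moreover have "(LINT x|lborel. indicat_real A x * ((\<phi> (x + h m) - \<phi> x) * real (Suc m)))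
     = ((LINT x|lborel. indicat_real A x * \<phi> (x + h m)) - (LINT x|lborel. indicat_real A x * \<phi> x)) * real (Suc m)" for m
  proof -
    have "(LINT x|lborel. indicat_real A x * ((\<phi> (x + h m) - \<phi> x) * real (Suc m)))
      = (LINT x|lborel. (indicat_real A x * \<phi> (x + h m) - indicat_real A x * \<phi> x) * real (Suc m))"
      by (intro Bochner_Integration.integral_cong refl) (simp add: algebra_simps)
    then show ?thesis
      by (simp only: integral_mult_left_zero Bochner_Integration.integral_diff[OF i1 i2])
  qed
  ultimately show ?thesis by (simp add: h_def)
qed

text \<open>Over the whole space translation invariance makes every difference quotient of the
  integral zero.\<close>

lemma integral_grad_eq_0:
  fixes \<phi> :: "'a::euclidean_space \<Rightarrow> real"
  assumes "C1_grad \<phi> g" "supp_in \<phi> R"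
  shows "(LINT x|lborel. k \<bullet> g x) = 0"
proof -
  have "(\<lambda>m. ((LINT x|lborel. \<phi> (x + k /\<^sub>R real (Suc m))) - (LINT x|lborel. \<phi> x)) * real (Suc m))
          \<longlonglongrightarrow> (LINT x|lborel. k \<bullet> g x)"
    using diff_quot_integral_limit[OF assms, of UNIV k] by simp
  then show ?thesis
    unfolding lborel_integral_translate by (simp add: LIMSEQ_const_iff)
qed

text \<open>Integration along e over the fibres based in a slab of thickness one counts every point
  with total weight 1, because the \<tau> for which x - \<tau>e lies in the slab form an interval of
  length 1. This matches the way \<open>surface_measure\<close> writes integrals over the hyperplane
  orthogonal to e.\<close>

lemma Fubini_along:
  fixes F :: "'a::euclidean_space \<Rightarrow> real"
  assumes [measurable]: "F \<in> borel_measurable borel"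
    and "\<And>x. \<bar>F x\<bar> \<le> C" "\<And>x. R < norm x \<Longrightarrow> F x = 0" and e: "norm e = 1"
  shows "(LINT x|lborel. F x) =
     (LINT x|lborel. indicat_real {x. 0 \<le> x \<bullet> e \<and> x \<bullet> e \<le> 1} x * (LINT \<tau>|lborel. F (x + \<tau> *\<^sub>R e)))"
proof -
  let ?S = "{x. 0 \<le> x \<bullet> e \<and> x \<bullet> e \<le> 1}"
  have C0: "0 \<le> C" using assms(2)[of 0] by linarith
  have ee: "e \<bullet> e = 1" using e by (simp add: norm_eq_1)
  have Sm[measurable]: "?S \<in> sets borel" by measurable
  define G where "G = (\<lambda>(x, \<tau>). indicat_real ?S x * F (x + \<tau> *\<^sub>R e))"
  have Gm[measurable]: "G \<in> borel_measurable (lborel \<Otimes>\<^sub>M lborel)" unfolding G_def by measurable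
  have iG: "integrable (lborel \<Otimes>\<^sub>M lborel) G"
  proof (rule Bochner_Integration.integrable_bound)
    \<comment> \<open>If x lies in the slab and x + \<tau>e in the ball of radius R, the
      e-components give |\<tau>| \<le> R + 1, and then norm x \<le> 2R + 1.\<close>
    let ?K = "cball (0::'a) (2*R + 1) \<times> {-(R+1)..R+1}"
    have "emeasure (lborel \<Otimes>\<^sub>M lborel) ?K < \<infinity>"
      by (subst lborel.emeasure_pair_measure_Times)
         (auto simp: emeasure_lborel_cball_finite[simplified] emeasure_lborel_Icc_eq ennreal_mult_less_top)
    moreover have "?K \<in> sets (lborel \<Otimes>\<^sub>M lborel)" by (intro pair_measureI) auto
    ultimately show "integrable (lborel \<Otimes>\<^sub>M lborel) (\<lambda>z. C * indicat_real ?K z)"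
      by (intro integrable_mult_right integrable_real_indicator) auto
    show "AE z in lborel \<Otimes>\<^sub>M lborel. norm (G z) \<le> norm (C * indicat_real ?K z)"
    proof (rule AE_I2, clarify)
      fix x :: 'a and \<tau> :: real
      show "norm (G (x, \<tau>)) \<le> norm (C * indicat_real ?K (x, \<tau>))"
      proof (cases "x \<in> ?S \<and> norm (x + \<tau> *\<^sub>R e) \<le> R")
        case True
        have "\<bar>(x + \<tau> *\<^sub>R e) \<bullet> e\<bar> \<le> R" using True Cauchy_Schwarz_ineq2[of "x + \<tau> *\<^sub>R e" e] e by simp
        then have t: "\<bar>\<tau>\<bar> \<le> R + 1" using True ee by (auto simp: inner_add_left)
        have "norm x \<le> norm (x + \<tau> *\<^sub>R e) + norm (\<tau> *\<^sub>R e)" by (metis add_diff_cancel norm_triangle_ineq4)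
        then have "norm x \<le> 2 * R + 1" using t True e by simp
        then show ?thesis using t True assms(2) C0 by (auto simp: G_def indicator_def)
      next
        case False
        then have "G (x, \<tau>) = 0" using assms(3)[of "x + \<tau> *\<^sub>R e"] by (auto simp: G_def indicator_def)
        then show ?thesis by simp
      qed
    qed
  qed measurable
  have "(LINT x|lborel. indicat_real ?S x * (LINT \<tau>|lborel. F (x + \<tau> *\<^sub>R e)))
      = (LINT x|lborel. LINT \<tau>|lborel. G (x, \<tau>))" by (simp add: G_def)
  also have "\<dots> = (LINT \<tau>|lborel. LINT x|lborel. G (x, \<tau>))"
    by (rule lborel_pair.Fubini_integral[symmetric]) (use iG in simp)
  also have "\<dots> = (LINT \<tau>|lborel. LINT x|lborel. indicat_real ?S (x - \<tau> *\<^sub>R e) * F x)"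
  proof (rule Bochner_Integration.integral_cong[OF refl])
    fix \<tau> :: real
    show "(LINT x|lborel. G (x, \<tau>)) = (LINT x|lborel. indicat_real ?S (x - \<tau> *\<^sub>R e) * F x)"
      using lborel_integral_translate[of "\<lambda>x. indicat_real ?S (x - \<tau> *\<^sub>R e) * F x" "\<tau> *\<^sub>R e"]
      by (simp add: G_def)
  qed
  also have "\<dots> = (LINT x|lborel. LINT \<tau>|lborel. indicat_real ?S (x - \<tau> *\<^sub>R e) * F x)"
  proof (rule lborel_pair.Fubini_integral[of "\<lambda>x \<tau>. indicat_real ?S (x - \<tau> *\<^sub>R e) * F x"])
    define H where "H = (\<lambda>(x, \<tau>). indicat_real ?S (x - \<tau> *\<^sub>R e) * F x)"
    let ?K = "cball (0::'a) R \<times> {-(R+1)..R+1}"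
    have "integrable (lborel \<Otimes>\<^sub>M lborel) H"
    proof (rule Bochner_Integration.integrable_bound)
      have "emeasure (lborel \<Otimes>\<^sub>M lborel) ?K < \<infinity>"
        by (subst lborel.emeasure_pair_measure_Times)
           (auto simp: emeasure_lborel_cball_finite[simplified] emeasure_lborel_Icc_eq ennreal_mult_less_top)
      moreover have "?K \<in> sets (lborel \<Otimes>\<^sub>M lborel)" by (intro pair_measureI) auto
      ultimately show "integrable (lborel \<Otimes>\<^sub>M lborel) (\<lambda>z. C * indicat_real ?K z)"
        by (intro integrable_mult_right integrable_real_indicator) auto
      show "AE z in lborel \<Otimes>\<^sub>M lborel. norm (H z) \<le> norm (C * indicat_real ?K z)"
      proof (rule AE_I2, clarify)
        fix x :: 'a and \<tau> :: real
        show "norm (H (x, \<tau>)) \<le> norm (C * indicat_real ?K (x, \<tau>))"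
        proof (cases "x - \<tau> *\<^sub>R e \<in> ?S \<and> norm x \<le> R")
          case True
          have "\<bar>x \<bullet> e\<bar> \<le> R" using True Cauchy_Schwarz_ineq2[of x e] e by simp
          then have t: "\<bar>\<tau>\<bar> \<le> R + 1" using True ee by (auto simp: inner_diff_left)
          then show ?thesis using t True assms(2) C0 by (auto simp: H_def indicator_def)
        next
          case False
          then have "H (x, \<tau>) = 0" using assms(3)[of x] by (auto simp: H_def indicator_def)
          then show ?thesis by simp
        qed
      qed
    qed (simp_all add: H_def)
    then show "integrable (lborel \<Otimes>\<^sub>M lborel) (\<lambda>(x, \<tau>). indicat_real ?S (x - \<tau> *\<^sub>R e) * F x)"
      by (simp add: H_def)
  qed
  also have "\<dots> = (LINT x|lborel. F x)"
  proof (rule Bochner_Integration.integral_cong[OF refl])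
    fix x
    have "indicat_real ?S (x - \<tau> *\<^sub>R e) = indicat_real {x \<bullet> e - 1..x \<bullet> e} \<tau>" for \<tau>
      using ee by (auto simp: indicator_def inner_diff_left)
    then show "(LINT \<tau>|lborel. indicat_real ?S (x - \<tau> *\<^sub>R e) * F x) = F x" by simp
  qed
  finally show ?thesis by simp
qed

text \<open>It will be applied on a fibre: the integral above a height \<sigma>, as a function of
  \<sigma>, has the value at that height with a minus sign as derivative.\<close>

lemma tail_integral_deriv:
  fixes \<psi> :: "real \<Rightarrow> real"
  assumes cont: "continuous_on UNIV \<psi>" and supp: "\<And>t. B < \<bar>t\<bar> \<Longrightarrow> \<psi> t = 0"
  shows "DERIV (\<lambda>\<sigma>. LINT t|lborel. \<psi> t * indicat_real {\<sigma><..} t) s :> - \<psi> s"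
proof -
  \<comment> \<open>Beyond the support of \<psi>, and large enough for s to be interior to the
    interval from -A to A.\<close>
  define A where "A = \<bar>B\<bar> + \<bar>s\<bar> + 1"
  have cont': "continuous_on T \<psi>" for T using cont continuous_on_subset by blast
  have P: "(LINT t|lborel. \<psi> t * indicat_real {\<sigma><..} t) = integral {-A..A} \<psi> - integral {-A..\<sigma>} \<psi>"
    if "\<sigma> \<in> {-A..A}" for \<sigma>
  proof -
    have "(LINT t|lborel. \<psi> t * indicat_real {\<sigma><..} t) = (LINT t:{\<sigma>..A}|lborel. \<psi> t)"
      unfolding set_lebesgue_integral_def
    proof (rule integral_cong_AE)
      show "AE t in lborel. \<psi> t * indicat_real {\<sigma><..} t = indicat_real {\<sigma>..A} t *\<^sub>R \<psi> t"
        using AE_lborel_singleton[of \<sigma>]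
      proof eventually_elim
        case (elim t)
        have "\<psi> t = 0" if "A < t" using that by (intro supp) (auto simp: A_def)
        then show ?case using elim by (auto simp: indicator_def)
      qed
    qed (use borel_measurable_continuous_onI[OF cont] in measurable)
    also have "\<dots> = integral {\<sigma>..A} \<psi>"
      by (rule set_borel_integral_eq_integral(2)) (rule borel_integrable_atLeastAtMost'[OF cont'])
    also have "\<dots> = integral {-A..A} \<psi> - integral {-A..\<sigma>} \<psi>"
      using Henstock_Kurzweil_Integration.integral_combine[of "-A" \<sigma> A \<psi>] that
        integrable_continuous_real[OF cont', of "-A" A] by auto
    finally show ?thesis .
  qed
  have s: "s \<in> {-A<..<A}" by (auto simp: A_def)
  have "((\<lambda>\<sigma>. integral {-A..\<sigma>} \<psi>) has_real_derivative \<psi> s) (at s within {-A..A})"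
    by (rule integral_has_real_derivative) (use s cont' in auto)
  then have "((\<lambda>\<sigma>. integral {-A..\<sigma>} \<psi>) has_real_derivative \<psi> s) (at s)"
    using s at_within_interior[of s "{-A..A}"] by (simp add: interior_atLeastAtMost_real)
  then have "((\<lambda>\<sigma>. integral {-A..A} \<psi> - integral {-A..\<sigma>} \<psi>) has_real_derivative - \<psi> s) (at s)"
    by (auto intro!: derivative_eq_intros)
  then show ?thesis
  proof (rule DERIV_cong_ev[THEN iffD1, rotated -1, OF _ refl _ refl])
    show "\<forall>\<^sub>F x in nhds s. integral {- A..A} \<psi> - integral {- A..x} \<psi> = (LINT t|lborel. \<psi> t * indicat_real {x<..} t)"
      by (rule eventually_nhds_in_open[of "{-A<..<A}" s, THEN eventually_mono]) (use s in \<open>auto simp: P\<close>)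
  qed
qed

text \<open>A chain rule for a Lipschitz inner sequence: if the outer derivative vanishes, the inner
  difference quotients need only be bounded.\<close>

lemma diff_quot_compose:
  fixes P :: "real \<Rightarrow> real"
  assumes P: "DERIV P s :> d" and lim: "\<sigma> \<longlonglongrightarrow> s"
    and bd: "\<And>m. \<bar>(\<sigma> m - s) * c m\<bar> \<le> K"
    and conv: "d \<noteq> 0 \<Longrightarrow> (\<lambda>m. (\<sigma> m - s) * c m) \<longlonglongrightarrow> D"
  shows "(\<lambda>m. (P (\<sigma> m) - P s) * c m) \<longlonglongrightarrow> d * D"
proof -
  obtain g where g: "\<And>z. P z - P s = g z * (z - s)" "isCont g s" "g s = d"
    using P by (auto simp: CARAT_DERIV)
  have gl: "(\<lambda>m. g (\<sigma> m)) \<longlonglongrightarrow> d" using isCont_tendsto_compose[OF g(2) lim] g(3) by simp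
  have eq: "(P (\<sigma> m) - P s) * c m = g (\<sigma> m) * ((\<sigma> m - s) * c m)" for m by (simp add: g(1))
  show ?thesis
  proof (cases "d = 0")
    case False then show ?thesis unfolding eq by (intro tendsto_mult gl conv)
  next
    case True
    have "(\<lambda>m. g (\<sigma> m) * ((\<sigma> m - s) * c m)) \<longlonglongrightarrow> 0"
      by (rule Lim_null_comparison[where g="\<lambda>m. \<bar>g (\<sigma> m)\<bar> * K"])
         (use bd gl True in \<open>auto simp: abs_mult intro!: always_eventually mult_left_mono tendsto_mult_left_zero tendsto_rabs_zero\<close>)
    then show ?thesis by (simp add: eq True)
  qed
qed

text \<open>Shifting \<phi> by h amounts to shifting the region by -h, and after integration along e
  only the height \<open>\<beta>\<close> of the graph is shifted. The integral over a fibre is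
  \<open>P x (\<beta> x)\<close>, where \<open>P x\<close> is differentiable with derivative
  -\<phi>; so the limit of the quotients needs the derivative of \<gamma> only at almost every base
  point, and the Lipschitz bound dominates.\<close>

lemma graph_gauss:
  fixes \<phi> \<gamma> :: "'a::euclidean_space \<Rightarrow> real"
  assumes C1: "C1_grad \<phi> g" and supp: "supp_in \<phi> R" and e: "norm e = 1"
    and lip: "L-lipschitz_on UNIV \<gamma>" and inv: "\<And>x t. \<gamma> (x + t *\<^sub>R e) = \<gamma> x"
    and D: "AE x in lborel. 0 \<le> x \<bullet> e \<and> x \<bullet> e \<le> 1 \<and> \<phi> (x + (\<gamma> x - x \<bullet> e) *\<^sub>R e) \<noteq> 0 \<longrightarrow>
        (\<lambda>m. (\<gamma> (x - k /\<^sub>R real (Suc m)) - \<gamma> x) * real (Suc m)) \<longlonglongrightarrow> - D x"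
    and Dm: "D \<in> borel_measurable borel"
  shows "(LINT x|lborel. indicat_real {x. \<gamma> x < x \<bullet> e} x * (k \<bullet> g x)) =
     (LINT x|lborel. indicat_real {x. 0 \<le> x \<bullet> e \<and> x \<bullet> e \<le> 1} x *
        (\<phi> (x + (\<gamma> x - x \<bullet> e) *\<^sub>R e) * (D x - k \<bullet> e)))"
proof -
  let ?S = "{x. 0 \<le> x \<bullet> e \<and> x \<bullet> e \<le> 1}"
  let ?A = "{x. \<gamma> x < x \<bullet> e}"
  obtain C where C: "0 < C" "\<And>x. norm (g x) \<le> C" "\<And>x. \<bar>\<phi> x\<bar> \<le> C"
    using C1_grad_bounded[OF C1 supp] by blast
  have ee: "e \<bullet> e = 1" using e by (simp add: norm_eq_1)
  have cont: "continuous_on UNIV \<phi>" by (rule C1_grad_continuous[OF C1])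
  have contg: "continuous_on UNIV \<gamma>" by (rule lipschitz_on_continuous_on[OF lip])
  have [measurable]: "\<phi> \<in> borel_measurable borel" "\<gamma> \<in> borel_measurable borel"
    by (auto intro: borel_measurable_continuous_onI cont contg)
  have Am[measurable]: "?A \<in> sets borel" by measurable
  have Sm[measurable]: "?S \<in> sets borel" by measurable
  define h where "h m = k /\<^sub>R real (Suc m)" for m
  define \<beta> where "\<beta> x = \<gamma> x - x \<bullet> e" for x
  define P where "P x \<sigma> = (LINT \<tau>|lborel. \<phi> (x + \<tau> *\<^sub>R e) * indicat_real {\<sigma><..} \<tau>)" for x \<sigma>
  have \<beta>e: "\<beta> (x + \<tau> *\<^sub>R e) = \<beta> x - \<tau>" for x \<tau>
    by (simp add: \<beta>_def inv inner_add_left ee)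
  have \<beta>m[measurable]: "\<beta> \<in> borel_measurable borel" unfolding \<beta>_def by measurable
  have fib: "(LINT x|lborel. indicat_real ?A (x - c) * \<phi> x) = (LINT x|lborel. indicat_real ?S x * P x (\<beta> (x - c)))" for c
  proof -
    have "(LINT x|lborel. indicat_real ?A (x - c) * \<phi> x) = (LINT x|lborel. indicat_real ?S x * (LINT \<tau>|lborel. indicat_real ?A (x + \<tau> *\<^sub>R e - c) * \<phi> (x + \<tau> *\<^sub>R e)))"
      by (rule Fubini_along[where C=C and R=R])
         (use C supp e in \<open>auto simp: supp_in_def abs_mult indicator_def\<close>)
    also have "\<dots> = (LINT x|lborel. indicat_real ?S x * P x (\<beta> (x - c)))"
    proof -
      have "indicat_real ?A (x + \<tau> *\<^sub>R e - c) = indicat_real {\<beta> (x - c)<..} \<tau>" for x \<tau>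
      proof -
        have "x + \<tau> *\<^sub>R e - c = (x - c) + \<tau> *\<^sub>R e" by simp
        then have "\<beta> (x + \<tau> *\<^sub>R e - c) = \<beta> (x - c) - \<tau>" by (simp only: \<beta>e)
        then show ?thesis by (auto simp: indicator_def \<beta>_def)
      qed
      then show ?thesis by (simp add: P_def mult.commute)
    qed
    finally show ?thesis .
  qed
  have Pd: "DERIV (P x) s :> - \<phi> (x + s *\<^sub>R e)" for x s
    unfolding P_def
  proof (rule tail_integral_deriv[where B="R + norm x"])
    show "continuous_on UNIV (\<lambda>\<tau>. \<phi> (x + \<tau> *\<^sub>R e))"
      by (intro continuous_on_compose2[OF cont] continuous_intros) auto
    show "\<phi> (x + t *\<^sub>R e) = 0" if "R + norm x < \<bar>t\<bar>" for t
    proof -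
      have "norm (t *\<^sub>R e) \<le> norm (x + t *\<^sub>R e) + norm x" by (metis add_diff_cancel_left' norm_triangle_ineq4)
      then show ?thesis using that e supp by (auto simp: supp_in_def)
    qed
  qed
  have Pl: "\<bar>P x s - P x s'\<bar> \<le> C * \<bar>s - s'\<bar>" for x s s'
    using field_differentiable_bound[of UNIV "P x" "\<lambda>s. - \<phi> (x + s *\<^sub>R e)" C s s'] Pd C(3) by auto
  have P0: "P x s = 0" if "0 \<le> x \<bullet> e" "x \<bullet> e \<le> 1" "2*R + 1 < norm x" for x s
  proof -
    have "\<phi> (x + \<tau> *\<^sub>R e) = 0" for \<tau>
    proof (rule ccontr)
      assume "\<phi> (x + \<tau> *\<^sub>R e) \<noteq> 0"
      then have n: "norm (x + \<tau> *\<^sub>R e) \<le> R" using supp by (meson linorder_not_less supp_in_def)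
      have "\<bar>(x + \<tau> *\<^sub>R e) \<bullet> e\<bar> \<le> R" using n Cauchy_Schwarz_ineq2[of "x + \<tau> *\<^sub>R e" e] e by simp
      then have t: "\<bar>\<tau>\<bar> \<le> R + 1" using that ee by (auto simp: inner_add_left)
      have "norm x \<le> norm (x + \<tau> *\<^sub>R e) + norm (\<tau> *\<^sub>R e)" by (metis add_diff_cancel norm_triangle_ineq4)
      then show False using t n that e by simp
    qed
    then show ?thesis by (simp add: P_def)
  qed
  have L0: "0 \<le> L" using lip by (rule lipschitz_on_nonneg)
  have \<beta>l: "\<bar>\<beta> (x - c) - \<beta> x\<bar> \<le> (L + 1) * norm c" for x c
  proof -
    have "\<bar>\<gamma> (x - c) - \<gamma> x\<bar> \<le> L * norm c"
      using lipschitz_onD[OF lip, of "x - c" x] by (simp add: dist_norm)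
    moreover have "\<bar>c \<bullet> e\<bar> \<le> norm c" using Cauchy_Schwarz_ineq2[of c e] e by simp
    ultimately show ?thesis by (simp add: \<beta>_def inner_diff_left algebra_simps)
  qed
  have nh: "norm (h m) * real (Suc m) = norm k" for m by (simp add: h_def)
  have h0: "h \<longlonglongrightarrow> 0"
    unfolding h_def using tendsto_scaleR[OF LIMSEQ_inverse_real_of_nat tendsto_const[of k]] by simp
  define w where "w x = C * (L + 1) * norm k * indicat_real (cball 0 (2*R+1)) x" for x :: 'a
  define q where "q x m = indicat_real ?S x * ((P x (\<beta> (x - h m)) - P x (\<beta> x)) * real (Suc m))" for x m
  have qw: "\<bar>q x m\<bar> \<le> w x" for x m
  proof (cases "x \<in> ?S \<and> norm x \<le> 2*R+1")
    case True
    have "\<bar>P x (\<beta> (x - h m)) - P x (\<beta> x)\<bar> * real (Suc m) \<le> C * ((L + 1) * norm (h m)) * real (Suc m)"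
      using Pl[of x "\<beta> (x - h m)" "\<beta> x"] \<beta>l[of x "h m"] C(1)
      by (intro mult_right_mono order_trans[OF Pl] mult_left_mono) auto
    also have "\<dots> = C * (L + 1) * norm k" using nh[of m] by (metis mult.assoc)
    finally show ?thesis using True by (auto simp: q_def w_def abs_mult)
  next
    case False
    then show ?thesis using P0[of x] C(1) L0 by (auto simp: q_def w_def indicator_def)
  qed
  have Pm: "(\<lambda>x. P x (\<beta> (x - c))) \<in> borel_measurable borel" for c
  proof -
    have "(\<lambda>x. LINT \<tau>|lborel. \<phi> (x + \<tau> *\<^sub>R e) * (if \<beta> (x - c) < \<tau> then 1 else 0)) \<in> borel_measurable borel"
      by measurable
    then show ?thesis by (simp add: P_def indicator_def)
  qed
  have qm: "(\<lambda>x. q x m) \<in> borel_measurable borel" for m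
    unfolding q_def using Pm[of "h m"] Pm[of 0] by simp
  have "(\<lambda>m. LINT x|lborel. q x m) \<longlonglongrightarrow> (LINT x|lborel. indicat_real ?S x * (\<phi> (x + \<beta> x *\<^sub>R e) * (D x - k \<bullet> e)))"
  proof (rule integral_dominated_convergence[where w=w])
    show "integrable lborel w" unfolding w_def
      by (intro integrable_mult_right integrable_real_indicator) (auto simp: emeasure_lborel_cball_finite[simplified])
    show "AE x in lborel. (\<lambda>m. q x m) \<longlonglongrightarrow> indicat_real ?S x * (\<phi> (x + \<beta> x *\<^sub>R e) * (D x - k \<bullet> e))"
      using D
    proof eventually_elim
      case (elim x)
      show ?case
      proof (cases "x \<in> ?S")
        case True
        have "(\<lambda>m. (P x (\<beta> (x - h m)) - P x (\<beta> x)) * real (Suc m)) \<longlonglongrightarrow> - \<phi> (x + \<beta> x *\<^sub>R e) * (- (D x - k \<bullet> e))"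
        proof (rule diff_quot_compose[OF Pd, where K="(L+1) * norm k"])
          show "(\<lambda>m. \<beta> (x - h m)) \<longlonglongrightarrow> \<beta> x"
          proof -
            have "isCont \<beta> (x - 0)"
              unfolding \<beta>_def using contg by (auto intro!: continuous_intros simp: continuous_on_eq_continuous_at)
            from isCont_tendsto_compose[OF this tendsto_diff[OF tendsto_const h0]] show ?thesis by simp
          qed
          show "\<bar>(\<beta> (x - h m) - \<beta> x) * real (Suc m)\<bar> \<le> (L+1) * norm k" for m
            using mult_right_mono[OF \<beta>l[of x "h m"], of "real (Suc m)"] nh[of m]
            by (simp add: abs_mult mult.assoc del: of_nat_Suc)
          \<comment> \<open>The derivative of \<gamma> is known only over graph points where \<phi>
            does not vanish; elsewhere the derivative of \<open>P x\<close> is zero and boundedness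
            of the quotients is enough.\<close>
          assume "- \<phi> (x + \<beta> x *\<^sub>R e) \<noteq> 0"
          then have "(\<lambda>m. (\<gamma> (x - h m) - \<gamma> x) * real (Suc m)) \<longlonglongrightarrow> - D x"
            using elim True by (auto simp: h_def \<beta>_def)
          then have "(\<lambda>m. (\<gamma> (x - h m) - \<gamma> x) * real (Suc m) + k \<bullet> e) \<longlonglongrightarrow> - D x + k \<bullet> e"
            by (intro tendsto_add tendsto_const)
          moreover have "(\<beta> (x - h m) - \<beta> x) * real (Suc m) = (\<gamma> (x - h m) - \<gamma> x) * real (Suc m) + k \<bullet> e" for m
          proof -
            have "h m \<bullet> e * real (Suc m) = k \<bullet> e" by (simp add: h_def)
            then show ?thesis by (simp add: \<beta>_def inner_diff_left algebra_simps del: of_nat_Suc)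
          qed
          ultimately show "(\<lambda>m. (\<beta> (x - h m) - \<beta> x) * real (Suc m)) \<longlonglongrightarrow> - (D x - k \<bullet> e)" by simp
        qed
        then show ?thesis using True by (simp add: q_def right_diff_distrib)
      qed (simp add: q_def)
    qed
    show "(\<lambda>x. indicat_real ?S x * (\<phi> (x + \<beta> x *\<^sub>R e) * (D x - k \<bullet> e))) \<in> borel_measurable lborel"
      using Dm by measurable
  qed (use qw qm in auto)
  moreover have "(LINT x|lborel. q x m) = ((LINT x|lborel. indicat_real ?A x * \<phi> (x + h m)) - (LINT x|lborel. indicat_real ?A x * \<phi> x)) * real (Suc m)" for m
  proof -
    have i: "integrable lborel (\<lambda>x. indicat_real ?S x * P x (\<beta> (x - c)))" for c
    proof (rule integrable_bounded_support[where R="2*R+1" and C="C * (2*\<bar>R\<bar>+2)"])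
      show "(\<lambda>x. indicat_real ?S x * P x (\<beta> (x - c))) \<in> borel_measurable borel" using Pm[of c] by simp
      show "indicat_real ?S x * P x (\<beta> (x - c)) = 0" if "2*R+1 < norm x" for x
        using P0[OF _ _ that] by (auto simp: indicator_def)
      fix x
      show "\<bar>indicat_real ?S x * P x (\<beta> (x - c))\<bar> \<le> C * (2*\<bar>R\<bar>+2)"
      proof (cases "x \<in> ?S")
        case True
        have "\<bar>\<phi> (x + \<tau> *\<^sub>R e) * indicat_real {s<..} \<tau>\<bar> \<le> C * indicat_real {-(\<bar>R\<bar>+1)..\<bar>R\<bar>+1} \<tau>" for s \<tau>
        proof (cases "norm (x + \<tau> *\<^sub>R e) \<le> R")
          case t: True
          have "\<bar>(x + \<tau> *\<^sub>R e) \<bullet> e\<bar> \<le> R" using t Cauchy_Schwarz_ineq2[of "x + \<tau> *\<^sub>R e" e] e by simp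
          then have "\<bar>\<tau>\<bar> \<le> \<bar>R\<bar> + 1" using True ee by (auto simp: inner_add_left)
          then show ?thesis using C(1,3) by (auto simp: indicator_def abs_mult)
        next
          case False
          then show ?thesis using supp C(1) by (auto simp: supp_in_def)
        qed
        then have "\<bar>P x s\<bar> \<le> (LINT \<tau>|lborel. C * indicat_real {-(\<bar>R\<bar>+1)..\<bar>R\<bar>+1} \<tau>)" for s
          unfolding P_def
          using C(1) by (intro order_trans[OF integral_abs_bound] integral_mono') auto
        then show ?thesis using True by simp
      next
        case False
        then show ?thesis using C(1) by simp
      qed
    qed
    have "(LINT x|lborel. q x m) = ((LINT x|lborel. indicat_real ?S x * P x (\<beta> (x - h m))) - (LINT x|lborel. indicat_real ?S x * P x (\<beta> (x - 0)))) * real (Suc m)"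
    proof -
      have "(LINT x|lborel. q x m) = (LINT x|lborel. (indicat_real ?S x * P x (\<beta> (x - h m)) - indicat_real ?S x * P x (\<beta> (x - 0))) * real (Suc m))"
        by (intro Bochner_Integration.integral_cong refl) (simp add: q_def algebra_simps)
      then show ?thesis by (simp only: integral_mult_left_zero Bochner_Integration.integral_diff[OF i i])
    qed
    also have "\<dots> = ((LINT x|lborel. indicat_real ?A (x - h m) * \<phi> x) - (LINT x|lborel. indicat_real ?A (x - 0) * \<phi> x)) * real (Suc m)"
      by (simp only: fib)
    also have "(LINT x|lborel. indicat_real ?A (x - h m) * \<phi> x) = (LINT x|lborel. indicat_real ?A x * \<phi> (x + h m))"
      using lborel_integral_translate[of "\<lambda>x. indicat_real ?A (x - h m) * \<phi> x" "h m"] by simp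
    finally show ?thesis by simp
  qed
  ultimately have "(\<lambda>m. ((LINT x|lborel. indicat_real ?A x * \<phi> (x + h m)) - (LINT x|lborel. indicat_real ?A x * \<phi> x)) * real (Suc m))
     \<longlonglongrightarrow> (LINT x|lborel. indicat_real ?S x * (\<phi> (x + \<beta> x *\<^sub>R e) * (D x - k \<bullet> e)))"
    by simp
  with diff_quot_integral_limit[OF C1 supp Am, of k] show ?thesis
    unfolding h_def \<beta>_def by (rule LIMSEQ_unique)
qed

section \<open>Charts: frontier, normal and surface measure\<close>

text \<open>Strictly below the graph a neighbourhood misses \<Omega>, by continuity of \<gamma>;
  strictly above, the point lies in the open set \<Omega>; from the graph itself an arbitrarily
  small move along e enters \<Omega>.\<close>

lemma chart_frontier:
  assumes "open \<Omega>" "lipschitz_chart \<Omega> e \<gamma> V" "q \<in> V"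
  shows "q \<in> frontier \<Omega> \<longleftrightarrow> \<gamma> q = q \<bullet> e"
proof -
  obtain L where L: "L-lipschitz_on UNIV \<gamma>" using assms(2) by (auto simp: lipschitz_chart_def)
  have cont: "continuous_on UNIV \<gamma>" by (rule lipschitz_on_continuous_on[OF L])
  have V: "open V" and inv: "\<And>x t. \<gamma> (x + t *\<^sub>R e) = \<gamma> x" and \<Omega>: "\<Omega> \<inter> V = {x \<in> V. \<gamma> x < x \<bullet> e}"
    and e: "norm e = 1"
    using assms(2) by (auto simp: lipschitz_chart_def)
  have mem: "y \<in> \<Omega> \<longleftrightarrow> \<gamma> y < y \<bullet> e" if "y \<in> V" for y using \<Omega> that by blast
  have ee: "e \<bullet> e = 1" using e by (simp add: norm_eq_1)
  have fr: "q \<in> frontier \<Omega> \<longleftrightarrow> q \<in> closure \<Omega> \<and> q \<notin> \<Omega>"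
    using assms(1) by (simp add: frontier_def interior_open)
  show ?thesis
  proof
    assume "q \<in> frontier \<Omega>"
    then have q: "q \<in> closure \<Omega>" "q \<notin> \<Omega>" using fr by auto
    have "\<not> q \<bullet> e < \<gamma> q"
    proof
      assume lt: "q \<bullet> e < \<gamma> q"
      have "open {x. x \<bullet> e < \<gamma> x}" by (intro open_Collect_less continuous_intros cont)
      then have "open (V \<inter> {x. x \<bullet> e < \<gamma> x})" using V by blast
      moreover have "\<Omega> \<inter> (V \<inter> {x. x \<bullet> e < \<gamma> x}) = {}" using \<Omega> by force
      ultimately have "(V \<inter> {x. x \<bullet> e < \<gamma> x}) \<inter> closure \<Omega> = {}"
        using open_Int_closure_eq_empty[of "V \<inter> {x. x \<bullet> e < \<gamma> x}" \<Omega>] by (simp add: Int_commute)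
      then show False using q(1) assms(3) lt by blast
    qed
    moreover have "\<not> \<gamma> q < q \<bullet> e" using q(2) \<Omega> assms(3) by blast
    ultimately show "\<gamma> q = q \<bullet> e" by linarith
  next
    assume eq: "\<gamma> q = q \<bullet> e"
    have "q \<notin> \<Omega>" using mem[OF assms(3)] eq by simp
    moreover have "q \<in> closure \<Omega>"
      unfolding closure_approachable
    proof (intro allI impI)
      fix \<delta> :: real assume "0 < \<delta>"
      obtain r where r: "0 < r" "ball q r \<subseteq> V" using V assms(3) by (meson openE)
      define t where "t = min \<delta> r / 2"
      have t: "0 < t" "t < \<delta>" "t < r" using \<open>0 < \<delta>\<close> r by (auto simp: t_def)
      have "q + t *\<^sub>R e \<in> V" using r(2) t e by (auto simp: dist_norm subset_iff)
      then have "q + t *\<^sub>R e \<in> \<Omega>" using t eq by (simp add: mem inv inner_add_left ee)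
      then show "\<exists>y\<in>\<Omega>. dist y q < \<delta>" using t e by (intro bexI[of _ "q + t *\<^sub>R e"]) (auto simp: dist_norm)
    qed
    ultimately show "q \<in> frontier \<Omega>" using fr by blast
  qed
qed

text \<open>Where a Lipschitz graph has a normal in the sense of \<open>outer_unit_normal_at\<close>, the graph
  function is differentiable; this replaces Rademacher's theorem.\<close>

lemma normal_imp_GDERIV:
  fixes \<Omega> :: "(real^'n::finite) set"
  assumes "open \<Omega>" "lipschitz_chart \<Omega> e \<gamma> V" "q \<in> V" "\<gamma> q = q \<bullet> e" "outer_unit_normal_at \<Omega> q w"
  shows "w \<bullet> e < 0" "GDERIV \<gamma> q :> e - w /\<^sub>R (w \<bullet> e)"
proof -
  obtain L where L: "L-lipschitz_on UNIV \<gamma>" using assms(2) by (auto simp: lipschitz_chart_def)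
  have L0: "0 \<le> L" using L by (rule lipschitz_on_nonneg)
  have V: "open V" and inv: "\<And>x t. \<gamma> (x + t *\<^sub>R e) = \<gamma> x" and \<Omega>: "\<Omega> \<inter> V = {x \<in> V. \<gamma> x < x \<bullet> e}"
    and e: "norm e = 1"
    using assms(2) by (auto simp: lipschitz_chart_def)
  have mem: "y \<in> \<Omega> \<longleftrightarrow> \<gamma> y < y \<bullet> e" if "y \<in> V" for y using \<Omega> that by blast
  have ee: "e \<bullet> e = 1" using e by (simp add: norm_eq_1)
  have w: "norm w = 1" using assms(5) by (simp add: outer_unit_normal_at_def)
  have ww: "w \<bullet> w = 1" using w by (simp add: norm_eq_1)
  have we: "\<bar>w \<bullet> e\<bar> \<le> 1" using Cauchy_Schwarz_ineq2[of w e] w e by simp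
  have N: "\<exists>r>0. \<forall>y\<in>ball q r. ((y - q) \<bullet> w < - \<epsilon> * norm (y - q) \<longrightarrow> y \<in> \<Omega>) \<and>
        (\<epsilon> * norm (y - q) < (y - q) \<bullet> w \<longrightarrow> y \<notin> \<Omega>)" if "0 < \<epsilon>" for \<epsilon>
    using assms(5) that by (simp add: outer_unit_normal_at_def)
  obtain r0 where r0: "0 < r0" "ball q r0 \<subseteq> V" using V assms(3) by (meson openE)
  have Lq: "\<bar>\<gamma> x - \<gamma> y\<bar> \<le> L * norm (x - y)" for x y
    using lipschitz_onD[OF L, of x y] by (simp add: dist_norm)
  show neg: "w \<bullet> e < 0"
  proof -
    \<comment> \<open>With this \<eta> the direction e + \<eta>w still points above every
      L-Lipschitz graph, since L\<eta> < 1 - \<eta>. Points q + t(e + \<eta>w) therefore lie in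
      \<Omega>, and the normal condition bounds their w-component from above.\<close>
    define \<eta> where "\<eta> = 1 / (2 * (L + 1))"
    have \<eta>: "0 < \<eta>" "\<eta> \<le> 1/2" "\<eta> * (L + 1) = 1/2" using L0 by (auto simp: \<eta>_def field_simps)
    have "w \<bullet> e + \<eta> \<le> \<epsilon> * (1 + \<eta>)" if \<epsilon>: "0 < \<epsilon>" for \<epsilon>
    proof -
      obtain r where r: "0 < r" "\<And>y. y \<in> ball q r \<Longrightarrow> \<epsilon> * norm (y - q) < (y - q) \<bullet> w \<Longrightarrow> y \<notin> \<Omega>"
        using N[OF \<epsilon>] by blast
      define t where "t = min r r0 / 4"
      have t: "0 < t" "4 * t \<le> r" "4 * t \<le> r0" using r r0 by (auto simp: t_def)
      define u where "u = e + \<eta> *\<^sub>R w"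
      have u: "norm u \<le> 1 + \<eta>" unfolding u_def using norm_triangle_ineq[of e "\<eta> *\<^sub>R w"] e w \<eta> by simp
      have "norm (t *\<^sub>R u) \<le> t * (1 + \<eta>)" using u t by simp
      moreover have "t * (1 + \<eta>) \<le> t * 2" using t \<eta> by (intro mult_left_mono) auto
      ultimately have ntu: "norm (t *\<^sub>R u) < min r r0" using t by linarith
      have inV: "q + t *\<^sub>R u \<in> V" "q + t *\<^sub>R u \<in> ball q r" using r0(2) ntu by (auto simp: dist_norm subset_iff)
      have "\<gamma> (q + t *\<^sub>R u) = \<gamma> (q + (t * \<eta>) *\<^sub>R w)"
        using inv[of "q + (t * \<eta>) *\<^sub>R w" t] by (simp add: u_def algebra_simps)
      also have "\<dots> \<le> \<gamma> q + L * (t * \<eta>)"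
        using Lq[of "q + (t * \<eta>) *\<^sub>R w" q] w t \<eta> by (simp add: abs_mult)
      also have "\<dots> < (q + t *\<^sub>R u) \<bullet> e"
      proof -
        have "L * \<eta> < 1 + \<eta> * (w \<bullet> e)"
        proof -
          have "- \<eta> \<le> \<eta> * (w \<bullet> e)" using we \<eta> mult_left_mono[of "-1" "w \<bullet> e" \<eta>] by auto
          then show ?thesis using \<eta> by (simp add: algebra_simps)
        qed
        then have "t * (L * \<eta>) < t * (1 + \<eta> * (w \<bullet> e))" using t by simp
        then show ?thesis using assms(4) by (simp add: u_def inner_add_left ee algebra_simps)
      qed
      finally have "q + t *\<^sub>R u \<in> \<Omega>" using mem[OF inV(1)] by simp
      then have "\<not> \<epsilon> * norm (t *\<^sub>R u) < (t *\<^sub>R u) \<bullet> w" using r(2)[OF inV(2)] by auto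
      then have "t * (u \<bullet> w) \<le> t * (\<epsilon> * norm u)" using t by (simp add: algebra_simps)
      then have "u \<bullet> w \<le> \<epsilon> * norm u" using t by simp
      also have "\<dots> \<le> \<epsilon> * (1 + \<eta>)" using u \<epsilon> by simp
      finally show ?thesis by (simp add: u_def inner_add_left ww inner_commute[of w e])
    qed
    \<comment> \<open>The bound is used with \<epsilon> = \<eta> / (2(1 + \<eta>)), which leaves w
      \<bullet> e \<le> -\<eta>/2.\<close>
    moreover have "\<eta> / (2 * (1 + \<eta>)) * (1 + \<eta>) = \<eta> / 2" using \<eta>(1) by (simp add: divide_simps)
    ultimately have "w \<bullet> e + \<eta> \<le> \<eta> / 2" using \<eta>(1)
      by (metis divide_pos_pos mult_pos_pos add_pos_pos zero_less_numeral zero_less_one)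
    then show ?thesis using \<eta> by simp
  qed
  define a where "a = w \<bullet> e"
  have a: "a < 0" using neg by (simp add: a_def)
  show "GDERIV \<gamma> q :> e - w /\<^sub>R (w \<bullet> e)"
    unfolding gderiv_def has_derivative_at_alt
  proof (intro conjI bounded_linear_inner_left allI impI)
    fix \<epsilon> :: real assume \<epsilon>: "0 < \<epsilon>"
    \<comment> \<open>The projection to the graph along e enlarges distances from q at most by L +
      2, and the w-component of the projected point is a times the error of linearisation.\<close>
    define \<epsilon>' where "\<epsilon>' = \<epsilon> * (- a) / (L + 2)"
    have \<epsilon>': "0 < \<epsilon>'" unfolding \<epsilon>'_def using \<epsilon> a L0 by (intro divide_pos_pos mult_pos_pos) auto
    obtain r where r: "0 < r" "\<And>y. y \<in> ball q r \<Longrightarrow> (y - q) \<bullet> w < - \<epsilon>' * norm (y - q) \<Longrightarrow> y \<in> \<Omega>"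
       "\<And>y. y \<in> ball q r \<Longrightarrow> \<epsilon>' * norm (y - q) < (y - q) \<bullet> w \<Longrightarrow> y \<notin> \<Omega>"
      using N[OF \<epsilon>'] by blast
    define \<delta> where "\<delta> = min r r0 / (L + 2)"
    have \<delta>: "0 < \<delta>" using r r0 L0 by (simp add: \<delta>_def)
    show "\<exists>d>0. \<forall>y. norm (y - q) < d \<longrightarrow> norm (\<gamma> y - \<gamma> q - (y - q) \<bullet> (e - w /\<^sub>R (w \<bullet> e))) \<le> \<epsilon> * norm (y - q)"
    proof (intro exI conjI allI impI)
      fix x assume x: "norm (x - q) < \<delta>"
      define y where "y = x + (\<gamma> x - x \<bullet> e) *\<^sub>R e"
      have "y - q = (x - q) + (\<gamma> x - \<gamma> q - (x - q) \<bullet> e) *\<^sub>R e"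
        by (simp add: y_def assms(4) inner_diff_left algebra_simps)
      then have "norm (y - q) \<le> norm (x - q) + \<bar>\<gamma> x - \<gamma> q - (x - q) \<bullet> e\<bar>"
        using norm_triangle_ineq[of "x - q"] e by (metis mult.right_neutral norm_scaleR real_norm_def)
      also have "\<dots> \<le> norm (x - q) + (L * norm (x - q) + norm (x - q))"
        using Lq[of x q] Cauchy_Schwarz_ineq2[of "x - q" e] e by simp
      finally have ny: "norm (y - q) \<le> (L + 2) * norm (x - q)" by (simp add: algebra_simps)
      also have "\<dots> < min r r0" using x L0 by (simp add: \<delta>_def field_simps)
      finally have ny2: "norm (y - q) < min r r0" .
      have ye: "y \<bullet> e = \<gamma> y" by (simp add: y_def inner_add_left ee inv)
      have yV: "y \<in> V" "y \<in> ball q r" using ny2 r0(2) by (auto simp: dist_norm norm_minus_commute subset_iff)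
      have "y \<notin> \<Omega>" using mem[OF yV(1)] ye by simp
      then have lo: "- \<epsilon>' * norm (y - q) \<le> (y - q) \<bullet> w" using r(2)[OF yV(2)] by force
      \<comment> \<open>The projected point is outside \<Omega>, so the upper bound is not
        immediate. The opposite strict inequality is an open condition, hence would persist slightly
        above the graph, where points do belong to \<Omega>.\<close>
      have up: "(y - q) \<bullet> w \<le> \<epsilon>' * norm (y - q)"
      proof (rule ccontr)
        assume "\<not> ?thesis"
        then have "\<epsilon>' * norm (y - q) < (y - q) \<bullet> w" by simp
        have c: "isCont (\<lambda>t. y + t *\<^sub>R e) 0" by (intro continuous_intros)
        have "\<forall>\<^sub>F t in at_right (0::real). y + t *\<^sub>R e \<in> V \<inter> ball q r \<inter> {z. \<epsilon>' * norm (z - q) < (z - q) \<bullet> w}"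
        proof (rule topological_tendstoD)
          show "((\<lambda>t. y + t *\<^sub>R e) \<longlongrightarrow> y) (at_right 0)"
            using c by (auto simp: isCont_def intro: tendsto_mono[OF at_le])
          show "open (V \<inter> ball q r \<inter> {z. \<epsilon>' * norm (z - q) < (z - q) \<bullet> w})"
            using V by (intro open_Int open_ball open_Collect_less continuous_intros)
        qed (use yV \<open>\<epsilon>' * norm (y - q) < (y - q) \<bullet> w\<close> in auto)
        then have "\<forall>\<^sub>F t in at_right (0::real). y + t *\<^sub>R e \<in> V \<inter> ball q r \<inter> {z. \<epsilon>' * norm (z - q) < (z - q) \<bullet> w} \<and> 0 < t"
          by (intro eventually_conj) (auto simp: eventually_at_right_less)
        then obtain t where t: "y + t *\<^sub>R e \<in> V \<inter> ball q r \<inter> {z. \<epsilon>' * norm (z - q) < (z - q) \<bullet> w}" "0 < t"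
          using eventually_happens[of _ "at_right (0::real)"] by (metis (no_types, lifting) trivial_limit_at_right_real)
        then have "y + t *\<^sub>R e \<in> \<Omega>" using ye by (auto simp: mem inner_add_left ee inv)
        then show False using r(3)[of "y + t *\<^sub>R e"] t by auto
      qed
      have id: "(y - q) \<bullet> w = a * (\<gamma> x - \<gamma> q - (x - q) \<bullet> (e - w /\<^sub>R a))"
        using a by (simp add: y_def assms(4) inner_diff_left inner_diff_right inner_add_left a_def[symmetric] inner_commute[of e w] algebra_simps divide_simps)
      have "\<bar>a\<bar> * \<bar>\<gamma> x - \<gamma> q - (x - q) \<bullet> (e - w /\<^sub>R a)\<bar> = \<bar>(y - q) \<bullet> w\<bar>" by (simp add: id abs_mult)
      also have "\<dots> \<le> \<epsilon>' * norm (y - q)" using lo up by auto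
      also have "\<dots> \<le> \<epsilon>' * ((L + 2) * norm (x - q))" using ny \<epsilon>' by (intro mult_left_mono) auto
      also have "\<dots> = \<bar>a\<bar> * (\<epsilon> * norm (x - q))" using a L0 by (simp add: \<epsilon>'_def field_simps)
      finally show "norm (\<gamma> x - \<gamma> q - (x - q) \<bullet> (e - w /\<^sub>R (w \<bullet> e))) \<le> \<epsilon> * norm (x - q)"
        using a by (simp add: a_def)
    qed (use \<delta> in auto)
  qed
qed

text \<open>A null set of the surface measure has a null preimage among the base points of the slab,
  because the density of the chart formula is at least 1.\<close>

lemma chart_AE_normal:
  fixes \<Omega> :: "(real^'n::finite) set"
  assumes "open \<Omega>" "surface_measure \<Omega> S" "outer_unit_normal \<Omega> S \<nu>" "lipschitz_chart \<Omega> e \<gamma> V"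
  shows "AE x in lborel. 0 \<le> x \<bullet> e \<and> x \<bullet> e \<le> 1 \<and> x + (\<gamma> x - x \<bullet> e) *\<^sub>R e \<in> V \<longrightarrow>
     outer_unit_normal_at \<Omega> (x + (\<gamma> x - x \<bullet> e) *\<^sub>R e) (\<nu> (x + (\<gamma> x - x \<bullet> e) *\<^sub>R e))"
proof -
  obtain L where L: "L-lipschitz_on UNIV \<gamma>" using assms(4) by (auto simp: lipschitz_chart_def)
  have cont: "continuous_on UNIV \<gamma>" by (rule lipschitz_on_continuous_on[OF L])
  have [measurable]: "\<gamma> \<in> borel_measurable borel" by (rule borel_measurable_continuous_onI[OF cont])
  have V: "open V" and inv: "\<And>x t. \<gamma> (x + t *\<^sub>R e) = \<gamma> x" and e: "norm e = 1"
    using assms(4) by (auto simp: lipschitz_chart_def)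
  have ee: "e \<bullet> e = 1" using e by (simp add: norm_eq_1)
  have sS: "sets S = sets borel" and
    S: "\<And>A. A \<in> sets borel \<Longrightarrow> A \<subseteq> frontier \<Omega> \<inter> V \<Longrightarrow> emeasure S A =
          (\<integral>\<^sup>+ x. indicator {x. 0 \<le> x \<bullet> e \<and> x \<bullet> e \<le> 1 \<and> x + (\<gamma> x - x \<bullet> e) *\<^sub>R e \<in> A} x *
                ennreal (sqrt (1 + (\<Sum>i\<in>UNIV. (partial_deriv i \<gamma> x)\<^sup>2))) \<partial>lborel)"
    using assms(2,4) unfolding surface_measure_def by blast+
  let ?p = "\<lambda>x. x + (\<gamma> x - x \<bullet> e) *\<^sub>R e"
  obtain N where N: "N \<in> null_sets S" "{x\<in>space S. \<not> outer_unit_normal_at \<Omega> x (\<nu> x)} \<subseteq> N"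
    using assms(3) unfolding outer_unit_normal_def eventually_ae_filter by blast
  have spS: "space S = UNIV" using sets_eq_imp_space_eq[OF sS] by simp
  define A where "A = N \<inter> frontier \<Omega> \<inter> V"
  have Nb: "N \<in> sets borel" using N(1) sS by auto
  have Ab[measurable]: "A \<in> sets borel" unfolding A_def using Nb V by (intro sets.Int) (auto simp: frontier_closed borel_closed borel_open)
  have "emeasure S A = 0"
    using N(1) Ab sS unfolding A_def by (metis emeasure_mono Int_assoc inf_le1 le_zero_eq null_setsD1 null_setsD2)
  moreover have sub: "A \<subseteq> frontier \<Omega> \<inter> V" by (auto simp: A_def)
  moreover define B where "B = {x. 0 \<le> x \<bullet> e \<and> x \<bullet> e \<le> 1 \<and> ?p x \<in> A}"
  ultimately have "(\<integral>\<^sup>+ x. indicator B x * ennreal (sqrt (1 + (\<Sum>i\<in>UNIV. (partial_deriv i \<gamma> x)\<^sup>2))) \<partial>lborel) = 0"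
    using S[OF Ab sub] by (simp only: B_def)
  \<comment> \<open>The density is at least 1 whatever value \<open>partial_deriv\<close> has at
    points where \<gamma> is not differentiable.\<close>
  moreover have "(\<integral>\<^sup>+ x. indicator B x \<partial>lborel) \<le> (\<integral>\<^sup>+ x. indicator B x * ennreal (sqrt (1 + (\<Sum>i\<in>UNIV. (partial_deriv i \<gamma> x)\<^sup>2))) \<partial>lborel)"
  proof (rule nn_integral_mono)
    fix x :: "real^'n"
    have "1 \<le> sqrt (1 + (\<Sum>i\<in>UNIV. (partial_deriv i \<gamma> x)\<^sup>2))" by (simp add: sum_nonneg)
    then have "1 \<le> ennreal (sqrt (1 + (\<Sum>i\<in>UNIV. (partial_deriv i \<gamma> x)\<^sup>2)))"
      by (metis ennreal_1 ennreal_leI)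
    then show "indicator B x \<le> indicator B x * ennreal (sqrt (1 + (\<Sum>i\<in>UNIV. (partial_deriv i \<gamma> x)\<^sup>2)))"
      by (auto simp: indicator_def)
  qed
  moreover have Bb: "B \<in> sets lborel" unfolding B_def by measurable
  ultimately have "emeasure lborel B = 0" by simp
  then have "AE x in lborel. x \<notin> B" using Bb by (intro AE_not_in) (simp add: null_sets_def)
  then show ?thesis
  proof eventually_elim
    case (elim x)
    show ?case
    proof (intro impI, elim conjE)
      assume x: "0 \<le> x \<bullet> e" "x \<bullet> e \<le> 1" "?p x \<in> V"
      have "?p x \<in> frontier \<Omega>"
        using chart_frontier[OF assms(1,4) x(3)] by (simp add: inv inner_add_left ee)
      then have "?p x \<notin> N" using elim x by (auto simp: B_def A_def)
      then show "outer_unit_normal_at \<Omega> (?p x) (\<nu> (?p x))" using N(2) spS by auto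
    qed
  qed
qed

lemma GDERIV_translate_invariant:
  assumes "\<And>x t. \<gamma> (x + t *\<^sub>R e) = \<gamma> x" "GDERIV \<gamma> (x + t *\<^sub>R e) :> d"
  shows "GDERIV \<gamma> x :> d"
proof -
  have "((\<lambda>y. \<gamma> (y + t *\<^sub>R e)) has_derivative (\<lambda>h. h \<bullet> d)) (at x)"
    by (rule has_derivative_compose[where f="\<lambda>y. y + t *\<^sub>R e" and f'="\<lambda>h. h" and g=\<gamma> and g'="\<lambda>h. h \<bullet> d"])
       (use assms(2) in \<open>auto intro!: derivative_eq_intros simp: gderiv_def\<close>)
  then show ?thesis using assms(1) by (simp add: gderiv_def)
qed

lemma GDERIV_partial_deriv:
  assumes "GDERIV f x :> d" shows "partial_deriv i f x = d $ i"
  using frechet_derivative_at[OF assms[unfolded gderiv_def]]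
  by (metis partial_deriv_def inner_axis inner_commute inner_real_def mult.right_neutral mult_1)

text \<open>D is a Borel version of the gradient of \<gamma>. The identity for the normal says that
  density times normal is D - e, which is exactly the boundary factor of
  \<open>graph_gauss\<close>.\<close>

lemma chart_density:
  fixes \<Omega> :: "(real^'n::finite) set"
  assumes "open \<Omega>" "surface_measure \<Omega> S" "outer_unit_normal \<Omega> S \<nu>" "lipschitz_chart \<Omega> e \<gamma> V"
  obtains D :: "'n \<Rightarrow> real^'n \<Rightarrow> real" where "\<And>i. D i \<in> borel_measurable borel"
    "AE x in lborel. 0 \<le> x \<bullet> e \<and> x \<bullet> e \<le> 1 \<and> x + (\<gamma> x - x \<bullet> e) *\<^sub>R e \<in> V \<longrightarrow>
       (\<forall>i. partial_deriv i \<gamma> x = D i x \<and>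
         sqrt (1 + (\<Sum>i\<in>UNIV. (D i x)\<^sup>2)) * \<nu> (x + (\<gamma> x - x \<bullet> e) *\<^sub>R e) $ i = D i x - e $ i \<and>
         (\<lambda>m. (\<gamma> (x - axis i 1 /\<^sub>R real (Suc m)) - \<gamma> x) * real (Suc m)) \<longlonglongrightarrow> - D i x)"
proof
  \<comment> \<open>A limit of Borel functions taken with \<open>lim\<close> is Borel on the whole
    space, whatever its value where the quotients diverge.\<close>
  define D where "D i x = lim (\<lambda>m. (\<gamma> (x + axis i 1 /\<^sub>R real (Suc m)) - \<gamma> x) * real (Suc m))" for i :: 'n and x
  obtain L where L: "L-lipschitz_on UNIV \<gamma>" using assms(4) by (auto simp: lipschitz_chart_def)
  have cont: "continuous_on UNIV \<gamma>" by (rule lipschitz_on_continuous_on[OF L])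
  have [measurable]: "\<gamma> \<in> borel_measurable borel" by (rule borel_measurable_continuous_onI[OF cont])
  show "D i \<in> borel_measurable borel" for i
    unfolding D_def by (rule borel_measurable_lim_metric) measurable
  have inv: "\<And>x t. \<gamma> (x + t *\<^sub>R e) = \<gamma> x" and e: "norm e = 1"
    using assms(4) by (auto simp: lipschitz_chart_def)
  have ee: "e \<bullet> e = 1" using e by (simp add: norm_eq_1)
  let ?p = "\<lambda>x. x + (\<gamma> x - x \<bullet> e) *\<^sub>R e"
  show "AE x in lborel. 0 \<le> x \<bullet> e \<and> x \<bullet> e \<le> 1 \<and> ?p x \<in> V \<longrightarrow>
       (\<forall>i. partial_deriv i \<gamma> x = D i x \<and>
         sqrt (1 + (\<Sum>i\<in>UNIV. (D i x)\<^sup>2)) * \<nu> (?p x) $ i = D i x - e $ i \<and>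
         (\<lambda>m. (\<gamma> (x - axis i 1 /\<^sub>R real (Suc m)) - \<gamma> x) * real (Suc m)) \<longlonglongrightarrow> - D i x)"
    using chart_AE_normal[OF assms]
  proof eventually_elim
    case (elim x)
    show ?case
    proof (intro impI allI)
      fix i assume x: "0 \<le> x \<bullet> e \<and> x \<bullet> e \<le> 1 \<and> ?p x \<in> V"
      define w where "w = \<nu> (?p x)"
      have n: "outer_unit_normal_at \<Omega> (?p x) w" using elim x by (simp add: w_def)
      have g: "\<gamma> (?p x) = ?p x \<bullet> e" by (simp add: inv inner_add_left ee)
      note N = normal_imp_GDERIV[OF assms(1,4) _ g n]
      define a where "a = w \<bullet> e"
      define d where "d = e - w /\<^sub>R a"
      have a: "a < 0" using N(1) x by (simp add: a_def)
      have d: "GDERIV \<gamma> x :> d"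
        using GDERIV_translate_invariant[OF inv] N(2) x by (simp add: d_def a_def)
      have Dd: "D j x = d $ j" for j
        using GDERIV_diff_quot[OF d, of "axis j 1"] unfolding D_def by (simp add: limI inner_axis' )
      have w: "w \<bullet> w = 1" using n by (simp add: outer_unit_normal_at_def norm_eq_1)
      \<comment> \<open>From d = e - w/a with unit vectors e, w and a = w \<bullet> e; hence the
        density is 1/|a| = -1/a.\<close>
      have "d \<bullet> d = (1/a)\<^sup>2 - 1"
        using a by (simp add: d_def inner_diff_left inner_diff_right ee w inner_commute[of e w] a_def[symmetric] power2_eq_square field_simps)
      moreover have "(\<Sum>i\<in>UNIV. (D i x)\<^sup>2) = d \<bullet> d" by (simp add: Dd inner_vec_def power2_eq_square)
      ultimately have "sqrt (1 + (\<Sum>i\<in>UNIV. (D i x)\<^sup>2)) = \<bar>1 / a\<bar>" by (simp only: real_sqrt_abs) simp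
      then have J: "sqrt (1 + (\<Sum>i\<in>UNIV. (D i x)\<^sup>2)) = - 1 / a" using a by simp
      show "partial_deriv i \<gamma> x = D i x \<and>
         sqrt (1 + (\<Sum>i\<in>UNIV. (D i x)\<^sup>2)) * \<nu> (?p x) $ i = D i x - e $ i \<and>
         (\<lambda>m. (\<gamma> (x - axis i 1 /\<^sub>R real (Suc m)) - \<gamma> x) * real (Suc m)) \<longlonglongrightarrow> - D i x"
      proof (intro conjI)
        show "partial_deriv i \<gamma> x = D i x" using GDERIV_partial_deriv[OF d] by (simp add: Dd)
        show "sqrt (1 + (\<Sum>i\<in>UNIV. (D i x)\<^sup>2)) * \<nu> (?p x) $ i = D i x - e $ i"
          unfolding J w_def[symmetric] by (simp add: Dd d_def field_simps)
        show "(\<lambda>m. (\<gamma> (x - axis i 1 /\<^sub>R real (Suc m)) - \<gamma> x) * real (Suc m)) \<longlonglongrightarrow> - D i x"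
          using GDERIV_diff_quot[OF d, of "- axis i 1"] by (simp add: Dd inner_axis')
      qed
    qed
  qed
qed

text \<open>The chart formula for sets says that the part of S on the graph is the image, under the
  map to the graph, of Lebesgue measure on the slab with the density. Equality of these two measures
  gives the formula for integrals.\<close>

lemma chart_surface_integral:
  fixes \<Omega> :: "(real^'n::finite) set"
  assumes "open \<Omega>" "surface_measure \<Omega> S" "lipschitz_chart \<Omega> e \<gamma> V"
    and D: "\<And>i. D i \<in> borel_measurable borel"
    "AE x in lborel. 0 \<le> x \<bullet> e \<and> x \<bullet> e \<le> 1 \<and> x + (\<gamma> x - x \<bullet> e) *\<^sub>R e \<in> V \<longrightarrow>
       (\<forall>i. partial_deriv i \<gamma> x = D i x)"
    and h: "h \<in> borel_measurable borel" "\<And>q. q \<notin> V \<Longrightarrow> h q = (0::real)"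
  shows "(LINT q|S. h q) = (LINT x|lborel. indicat_real {x. 0 \<le> x \<bullet> e \<and> x \<bullet> e \<le> 1} x *
      (sqrt (1 + (\<Sum>i\<in>UNIV. (D i x)\<^sup>2)) * h (x + (\<gamma> x - x \<bullet> e) *\<^sub>R e)))"
proof -
  obtain L where L: "L-lipschitz_on UNIV \<gamma>" using assms(3) by (auto simp: lipschitz_chart_def)
  have cont: "continuous_on UNIV \<gamma>" by (rule lipschitz_on_continuous_on[OF L])
  have [measurable]: "\<gamma> \<in> borel_measurable borel" by (rule borel_measurable_continuous_onI[OF cont])
  note D(1)[measurable] h(1)[measurable]
  have V: "open V" and inv: "\<And>x t. \<gamma> (x + t *\<^sub>R e) = \<gamma> x" and e: "norm e = 1"
    using assms(3) by (auto simp: lipschitz_chart_def)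
  have ee: "e \<bullet> e = 1" using e by (simp add: norm_eq_1)
  have sS[measurable_cong]: "sets S = sets borel" and S0: "emeasure S (- frontier \<Omega>) = 0" and
    S: "\<And>A. A \<in> sets borel \<Longrightarrow> A \<subseteq> frontier \<Omega> \<inter> V \<Longrightarrow> emeasure S A =
          (\<integral>\<^sup>+ x. indicator {x. 0 \<le> x \<bullet> e \<and> x \<bullet> e \<le> 1 \<and> x + (\<gamma> x - x \<bullet> e) *\<^sub>R e \<in> A} x *
                ennreal (sqrt (1 + (\<Sum>i\<in>UNIV. (partial_deriv i \<gamma> x)\<^sup>2))) \<partial>lborel)"
    using assms(2,3) unfolding surface_measure_def by blast+
  define p where "p x = x + (\<gamma> x - x \<bullet> e) *\<^sub>R e" for x
  have pm[measurable]: "p \<in> borel_measurable borel" unfolding p_def by measurable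
  define J where "J x = sqrt (1 + (\<Sum>i\<in>UNIV. (D i x)\<^sup>2))" for x
  have Jm[measurable]: "J \<in> borel_measurable borel" unfolding J_def by measurable
  have J0: "0 \<le> J x" for x unfolding J_def by (simp add: sum_nonneg)
  define F where "F = frontier \<Omega> \<inter> V"
  have Fb[measurable]: "F \<in> sets borel" unfolding F_def using V by (intro sets.Int) (auto simp: frontier_closed borel_closed borel_open)
  define Sl where "Sl = {x. 0 \<le> x \<bullet> e \<and> x \<bullet> e \<le> 1}"
  have Slm[measurable]: "Sl \<in> sets borel" unfolding Sl_def by measurable
  define T where "T x = indicat_real Sl x * indicat_real F (p x)" for x
  have Tm[measurable]: "T \<in> borel_measurable borel" unfolding T_def by measurable
  have pF: "p x \<in> F \<longleftrightarrow> p x \<in> V" for x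
    using chart_frontier[OF assms(1,3), of "p x"] by (auto simp: F_def p_def inv inner_add_left ee)
  have eq: "distr (density lborel (\<lambda>x. ennreal (T x * J x))) borel p = density S (indicator F)"
  proof (rule measure_eqI)
    fix A assume "A \<in> sets (distr (density lborel (\<lambda>x. ennreal (T x * J x))) borel p)"
    then have A[measurable]: "A \<in> sets borel" by simp
    have "emeasure (distr (density lborel (\<lambda>x. ennreal (T x * J x))) borel p) A
       = (\<integral>\<^sup>+ x. ennreal (T x * J x) * indicator (p -` A) x \<partial>lborel)"
      using measurable_sets_borel[OF pm A] by (simp add: emeasure_distr emeasure_density)
    also have "\<dots> = (\<integral>\<^sup>+ x. indicator {x. 0 \<le> x \<bullet> e \<and> x \<bullet> e \<le> 1 \<and> p x \<in> A \<inter> F} x *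
                ennreal (sqrt (1 + (\<Sum>i\<in>UNIV. (partial_deriv i \<gamma> x)\<^sup>2))) \<partial>lborel)"
      using D(2)
    proof (intro nn_integral_cong_AE, eventually_elim)
      case (elim x)
      show ?case
      proof (cases "x \<in> Sl \<and> p x \<in> F \<and> p x \<in> A")
        case True
        then have "\<forall>i. partial_deriv i \<gamma> x = D i x" using elim pF[of x] by (auto simp: Sl_def p_def)
        then show ?thesis using True by (simp add: T_def J_def Sl_def)
      qed (auto simp: T_def Sl_def indicator_def)
    qed
    also have "\<dots> = emeasure S (A \<inter> F)"
    proof -
      have "A \<inter> F \<in> sets borel" by measurable
      moreover have "A \<inter> F \<subseteq> frontier \<Omega> \<inter> V" by (auto simp: F_def)
      ultimately show ?thesis by (simp only: S p_def)
    qed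
    also have "\<dots> = emeasure (density S (indicator F)) A"
    proof -
      have "F \<in> sets S" "A \<in> sets S" using sS by auto
      then show ?thesis by (simp add: emeasure_restricted inf_commute)
    qed
    finally show "emeasure (distr (density lborel (\<lambda>x. ennreal (T x * J x))) borel p) A = emeasure (density S (indicator F)) A" .
  qed (simp add: sS)
  have "(LINT q|S. h q) = (LINT q|S. indicat_real F q *\<^sub>R h q)"
  proof (rule integral_cong_AE)
    have "AE q in S. q \<notin> - frontier \<Omega>"
      using S0 sS by (intro AE_not_in) (auto simp: null_sets_def frontier_closed borel_closed)
    then show "AE q in S. h q = indicat_real F q *\<^sub>R h q"
      by eventually_elim (use h(2) in \<open>auto simp: F_def indicator_def\<close>)
  qed measurable
  also have "\<dots> = (LINT q|density S (indicator F). h q)"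
    by (subst integral_density[where g="indicat_real F", symmetric])
       (auto simp: measurable_cong_sets[OF sS refl] ennreal_indicator intro!: arg_cong[where f="\<lambda>M. integral\<^sup>L M h"] density_cong)
  also have "\<dots> = (LINT x|lborel. (T x * J x) *\<^sub>R h (p x))"
  proof -
    have "integral\<^sup>L (density S (indicator F)) h = (LINT x|density lborel (\<lambda>x. ennreal (T x * J x)). h (p x))"
      unfolding eq[symmetric] by (rule integral_distr) measurable
    also have "\<dots> = (LINT x|lborel. (T x * J x) *\<^sub>R h (p x))"
      by (rule integral_density) (auto simp: T_def J0)
    finally show ?thesis .
  qed
  also have "\<dots> = (LINT x|lborel. indicat_real Sl x * (J x * h (p x)))"
    using pF h(2) by (intro Bochner_Integration.integral_cong refl) (auto simp: T_def indicator_def)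
  finally show ?thesis unfolding J_def p_def Sl_def .
qed

text \<open>For a function supported in one chart, \<open>graph_gauss\<close> supplies the boundary
  factor D - e, \<open>chart_density\<close> turns it into density times normal, and
  \<open>chart_surface_integral\<close> reads the result as an integral over S.\<close>

lemma chart_gauss:
  fixes \<Omega> :: "(real^'n::finite) set"
  assumes "open \<Omega>" "surface_measure \<Omega> S" "outer_unit_normal \<Omega> S \<nu>" "lipschitz_chart \<Omega> e \<gamma> V"
    and \<phi>: "C1_grad \<phi> g" "supp_in \<phi> R" "closed K" "K \<subseteq> V" "\<And>x. x \<notin> K \<Longrightarrow> \<phi> x = 0"
  shows "(LINT x|lborel. indicat_real \<Omega> x * g x $ k) = (LINT q|S. \<phi> q * \<nu> q $ k)"
proof -
  obtain D where D: "\<And>i. D i \<in> borel_measurable borel"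
    "AE x in lborel. 0 \<le> x \<bullet> e \<and> x \<bullet> e \<le> 1 \<and> x + (\<gamma> x - x \<bullet> e) *\<^sub>R e \<in> V \<longrightarrow>
       (\<forall>i. partial_deriv i \<gamma> x = D i x \<and>
         sqrt (1 + (\<Sum>i\<in>UNIV. (D i x)\<^sup>2)) * \<nu> (x + (\<gamma> x - x \<bullet> e) *\<^sub>R e) $ i = D i x - e $ i \<and>
         (\<lambda>m. (\<gamma> (x - axis i 1 /\<^sub>R real (Suc m)) - \<gamma> x) * real (Suc m)) \<longlonglongrightarrow> - D i x)"
    using chart_density[OF assms(1-4)] by blast
  obtain L where L: "L-lipschitz_on UNIV \<gamma>" using assms(4) by (auto simp: lipschitz_chart_def)
  have contg: "continuous_on UNIV \<gamma>" by (rule lipschitz_on_continuous_on[OF L])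
  have [measurable]: "\<gamma> \<in> borel_measurable borel" by (rule borel_measurable_continuous_onI[OF contg])
  have V: "open V" and inv: "\<And>x t. \<gamma> (x + t *\<^sub>R e) = \<gamma> x" and e: "norm e = 1"
    and \<Omega>: "\<Omega> \<inter> V = {x \<in> V. \<gamma> x < x \<bullet> e}"
    using assms(4) by (auto simp: lipschitz_chart_def)
  have sS: "sets S = sets borel" using assms(2) by (simp add: surface_measure_def)
  have [measurable]: "\<nu> \<in> borel_measurable borel" using assms(3) by (simp add: outer_unit_normal_def measurable_cong_sets[OF sS refl])
  have cont: "continuous_on UNIV \<phi>" by (rule C1_grad_continuous[OF \<phi>(1)])
  have [measurable]: "\<phi> \<in> borel_measurable borel" by (rule borel_measurable_continuous_onI[OF cont])
  note D(1)[measurable]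
  have g0: "g x = 0" if "x \<notin> K" for x
  proof -
    have "GDERIV \<phi> x :> 0"
      unfolding gderiv_def
      using has_derivative_transform_within_open[of "\<lambda>_. 0" "\<lambda>_. 0" x UNIV "- K" \<phi>] \<phi>(3,5) that
      by (auto simp: open_Compl)
    moreover have "GDERIV \<phi> x :> g x" using \<phi>(1) by (simp add: C1_grad_def)
    ultimately have "(\<lambda>h. inner h (g x)) = (\<lambda>h. inner h 0)"
      unfolding gderiv_def using has_derivative_unique by blast
    then show ?thesis by (metis inner_eq_zero_iff inner_zero_right)
  qed
  let ?k = "axis k (1::real)"
  have m1: "(\<lambda>x. indicat_real {x. 0 \<le> x \<bullet> e \<and> x \<bullet> e \<le> 1} x * (\<phi> (x + (\<gamma> x - x \<bullet> e) *\<^sub>R e) * (D k x - ?k \<bullet> e))) \<in> borel_measurable lborel"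
    by measurable
  have [measurable]: "(\<lambda>x. sqrt (1 + (\<Sum>i\<in>UNIV. (D i x)\<^sup>2))) \<in> borel_measurable borel" by measurable
  have "(\<lambda>q. \<nu> q \<bullet> ?k) \<in> borel_measurable borel" by measurable
  then have [measurable]: "(\<lambda>q. \<nu> q $ k) \<in> borel_measurable borel" by (simp add: inner_axis)
  have h[measurable]: "(\<lambda>q. \<phi> q * \<nu> q $ k) \<in> borel_measurable borel" by measurable
  have [measurable]: "(\<lambda>x. (\<lambda>q. \<phi> q * \<nu> q $ k) (x + (\<gamma> x - x \<bullet> e) *\<^sub>R e)) \<in> borel_measurable borel"
    by (rule measurable_compose[OF _ h]) measurable
  have m2: "(\<lambda>x. indicat_real {x. 0 \<le> x \<bullet> e \<and> x \<bullet> e \<le> 1} x *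
      (sqrt (1 + (\<Sum>i\<in>UNIV. (D i x)\<^sup>2)) * (\<lambda>q. \<phi> q * \<nu> q $ k) (x + (\<gamma> x - x \<bullet> e) *\<^sub>R e))) \<in> borel_measurable lborel"
    by measurable
  have "(LINT x|lborel. indicat_real \<Omega> x * g x $ k) = (LINT x|lborel. indicat_real {x. \<gamma> x < x \<bullet> e} x * (?k \<bullet> g x))"
  proof (intro Bochner_Integration.integral_cong refl)
    fix x show "indicat_real \<Omega> x * g x $ k = indicat_real {x. \<gamma> x < x \<bullet> e} x * (?k \<bullet> g x)"
    proof (cases "x \<in> V")
      case True
      then have "x \<in> \<Omega> \<longleftrightarrow> \<gamma> x < x \<bullet> e" using \<Omega> by blast
      then show ?thesis by (simp add: indicator_def inner_axis')
    next
      case False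
      then have "g x = 0" using g0 \<phi>(4) by blast
      then show ?thesis by simp
    qed
  qed
  also have "\<dots> = (LINT x|lborel. indicat_real {x. 0 \<le> x \<bullet> e \<and> x \<bullet> e \<le> 1} x *
        (\<phi> (x + (\<gamma> x - x \<bullet> e) *\<^sub>R e) * (D k x - ?k \<bullet> e)))"
  proof (rule graph_gauss[OF \<phi>(1,2) e L inv _ D(1)])
    show "AE x in lborel. 0 \<le> x \<bullet> e \<and> x \<bullet> e \<le> 1 \<and> \<phi> (x + (\<gamma> x - x \<bullet> e) *\<^sub>R e) \<noteq> 0 \<longrightarrow>
        (\<lambda>m. (\<gamma> (x - ?k /\<^sub>R real (Suc m)) - \<gamma> x) * real (Suc m)) \<longlonglongrightarrow> - D k x"
      using D(2) by eventually_elim (use \<phi>(4,5) in blast)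
  qed
  also have "\<dots> = (LINT x|lborel. indicat_real {x. 0 \<le> x \<bullet> e \<and> x \<bullet> e \<le> 1} x *
      (sqrt (1 + (\<Sum>i\<in>UNIV. (D i x)\<^sup>2)) * (\<lambda>q. \<phi> q * \<nu> q $ k) (x + (\<gamma> x - x \<bullet> e) *\<^sub>R e)))"
  proof (rule integral_cong_AE)
    show "AE x in lborel. indicat_real {x. 0 \<le> x \<bullet> e \<and> x \<bullet> e \<le> 1} x *
        (\<phi> (x + (\<gamma> x - x \<bullet> e) *\<^sub>R e) * (D k x - ?k \<bullet> e)) = indicat_real {x. 0 \<le> x \<bullet> e \<and> x \<bullet> e \<le> 1} x *
      (sqrt (1 + (\<Sum>i\<in>UNIV. (D i x)\<^sup>2)) * (\<lambda>q. \<phi> q * \<nu> q $ k) (x + (\<gamma> x - x \<bullet> e) *\<^sub>R e))"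
      using D(2)
    proof eventually_elim
      case (elim x)
      show ?case
      proof (cases "0 \<le> x \<bullet> e \<and> x \<bullet> e \<le> 1 \<and> \<phi> (x + (\<gamma> x - x \<bullet> e) *\<^sub>R e) \<noteq> 0")
        case True
        then have "x + (\<gamma> x - x \<bullet> e) *\<^sub>R e \<in> V" using \<phi>(4,5) by blast
        then have "sqrt (1 + (\<Sum>i\<in>UNIV. (D i x)\<^sup>2)) * \<nu> (x + (\<gamma> x - x \<bullet> e) *\<^sub>R e) $ k = D k x - e $ k"
          using elim True by blast
        then show ?thesis by (simp add: inner_axis' mult.left_commute)
      next
        case False
        then show ?thesis by (cases "0 \<le> x \<bullet> e \<and> x \<bullet> e \<le> 1") simp_all
      qed
    qed
  qed (rule m1 m2)+
  also have "\<dots> = (LINT q|S. \<phi> q * \<nu> q $ k)"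
  proof (rule chart_surface_integral[OF assms(1,2,4) D(1), symmetric])
    show "AE x in lborel. 0 \<le> x \<bullet> e \<and> x \<bullet> e \<le> 1 \<and> x + (\<gamma> x - x \<bullet> e) *\<^sub>R e \<in> V \<longrightarrow> (\<forall>i. partial_deriv i \<gamma> x = D i x)"
      using D(2) by eventually_elim blast
    show "\<phi> q * \<nu> q $ k = 0" if "q \<notin> V" for q using that \<phi>(4,5) by auto
  qed (rule h)
  finally show ?thesis .
qed

text \<open>The partial derivatives of \<gamma> are limits of quotients bounded by L, so the density
  is bounded; and the base points in the slab of a bounded piece of the graph are bounded.\<close>

lemma chart_surface_finite:
  fixes \<Omega> :: "(real^'n::finite) set"
  assumes "open \<Omega>" "surface_measure \<Omega> S" "outer_unit_normal \<Omega> S \<nu>" "lipschitz_chart \<Omega> e \<gamma> V"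
    and A: "A \<in> sets borel" "bounded A" "A \<subseteq> frontier \<Omega> \<inter> V"
  shows "emeasure S A < \<infinity>"
proof -
  obtain D where D: "\<And>i. D i \<in> borel_measurable borel"
    "AE x in lborel. 0 \<le> x \<bullet> e \<and> x \<bullet> e \<le> 1 \<and> x + (\<gamma> x - x \<bullet> e) *\<^sub>R e \<in> V \<longrightarrow>
       (\<forall>i. partial_deriv i \<gamma> x = D i x \<and>
         sqrt (1 + (\<Sum>i\<in>UNIV. (D i x)\<^sup>2)) * \<nu> (x + (\<gamma> x - x \<bullet> e) *\<^sub>R e) $ i = D i x - e $ i \<and>
         (\<lambda>m. (\<gamma> (x - axis i 1 /\<^sub>R real (Suc m)) - \<gamma> x) * real (Suc m)) \<longlonglongrightarrow> - D i x)"
    using chart_density[OF assms(1-4)] by blast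
  obtain L where L: "L-lipschitz_on UNIV \<gamma>" using assms(4) by (auto simp: lipschitz_chart_def)
  have inv: "\<And>x t. \<gamma> (x + t *\<^sub>R e) = \<gamma> x" and e: "norm e = 1"
    using assms(4) by (auto simp: lipschitz_chart_def)
  have ee: "e \<bullet> e = 1" using e by (simp add: norm_eq_1)
  obtain b where b: "\<And>y. y \<in> A \<Longrightarrow> norm y \<le> b" using A(2) by (auto simp: bounded_iff)
  define c where "c = sqrt (1 + real CARD('n) * L\<^sup>2)"
  let ?B = "{x. 0 \<le> x \<bullet> e \<and> x \<bullet> e \<le> 1 \<and> x + (\<gamma> x - x \<bullet> e) *\<^sub>R e \<in> A}"
  have "emeasure S A = (\<integral>\<^sup>+ x. indicator ?B x *
                ennreal (sqrt (1 + (\<Sum>i\<in>UNIV. (partial_deriv i \<gamma> x)\<^sup>2))) \<partial>lborel)"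
    using assms(2,4) A unfolding surface_measure_def by blast
  also have "\<dots> \<le> (\<integral>\<^sup>+ x. ennreal c * indicator (cball (0::real^'n) (2 * b + 1)) x \<partial>lborel)"
  proof (rule nn_integral_mono_AE, rule eventually_mono[OF D(2)])
    fix x assume elim: "0 \<le> x \<bullet> e \<and> x \<bullet> e \<le> 1 \<and> x + (\<gamma> x - x \<bullet> e) *\<^sub>R e \<in> V \<longrightarrow>
       (\<forall>i. partial_deriv i \<gamma> x = D i x \<and>
         sqrt (1 + (\<Sum>i\<in>UNIV. (D i x)\<^sup>2)) * \<nu> (x + (\<gamma> x - x \<bullet> e) *\<^sub>R e) $ i = D i x - e $ i \<and>
         (\<lambda>m. (\<gamma> (x - axis i 1 /\<^sub>R real (Suc m)) - \<gamma> x) * real (Suc m)) \<longlonglongrightarrow> - D i x)"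
    show "indicator ?B x * ennreal (sqrt (1 + (\<Sum>i\<in>UNIV. (partial_deriv i \<gamma> x)\<^sup>2)))
       \<le> ennreal c * indicator (cball 0 (2 * b + 1)) x"
    proof (cases "x \<in> ?B")
      case True
      let ?p = "x + (\<gamma> x - x \<bullet> e) *\<^sub>R e"
      have p: "norm ?p \<le> b" using b True by blast
      have "\<bar>?p \<bullet> e\<bar> \<le> b" using p Cauchy_Schwarz_ineq2[of ?p e] e by simp
      moreover have "?p \<bullet> e = \<gamma> x" by (simp add: inner_add_left ee)
      ultimately have "\<bar>\<gamma> x - x \<bullet> e\<bar> \<le> b + 1" using True by auto
      moreover have "norm x \<le> norm ?p + norm ((\<gamma> x - x \<bullet> e) *\<^sub>R e)" by (metis add_diff_cancel norm_triangle_ineq4)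
      ultimately have x: "norm x \<le> 2 * b + 1" using p e by simp
      have "\<bar>partial_deriv i \<gamma> x\<bar> \<le> L" for i
      proof -
        have "(\<lambda>m. \<bar>(\<gamma> (x - axis i 1 /\<^sub>R real (Suc m)) - \<gamma> x) * real (Suc m)\<bar>) \<longlonglongrightarrow> \<bar>- D i x\<bar>"
          using elim True A(3) by (intro tendsto_rabs) blast
        moreover have "\<bar>(\<gamma> (x - axis i 1 /\<^sub>R real (Suc m)) - \<gamma> x) * real (Suc m)\<bar> \<le> L" for m
        proof -
          let ?d = "\<gamma> (x - axis i 1 /\<^sub>R real (Suc m)) - \<gamma> x"
          have "\<bar>?d\<bar> \<le> L * (1 / real (Suc m))"
            using lipschitz_onD[OF L, of "x - axis i 1 /\<^sub>R real (Suc m)" x]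
            by (simp add: dist_norm inverse_eq_divide del: of_nat_Suc)
          then have "\<bar>?d\<bar> * real (Suc m) \<le> L * (1 / real (Suc m)) * real (Suc m)" by (rule mult_right_mono) simp
          then show ?thesis by (simp add: abs_mult del: of_nat_Suc)
        qed
        ultimately have "\<bar>- D i x\<bar> \<le> L" by (intro LIMSEQ_le_const2) auto
        then show ?thesis using elim True A(3) by auto
      qed
      then have "\<bar>partial_deriv i \<gamma> x\<bar>\<^sup>2 \<le> L\<^sup>2" for i by (rule power_mono) simp
      then have "(partial_deriv i \<gamma> x)\<^sup>2 \<le> L\<^sup>2" for i by (simp only: power2_abs)
      then have "(\<Sum>i\<in>UNIV. (partial_deriv i \<gamma> x)\<^sup>2) \<le> real CARD('n) * L\<^sup>2"
        by (rule sum_bounded_above)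
      then have "ennreal (sqrt (1 + (\<Sum>i\<in>UNIV. (partial_deriv i \<gamma> x)\<^sup>2))) \<le> ennreal c"
        unfolding c_def by (intro ennreal_leI real_sqrt_le_mono) simp
      then show ?thesis using True x by simp
    qed simp
  qed
  also have "\<dots> = ennreal c * emeasure lborel (cball 0 (2 * b + 1) :: (real^'n) set)"
    by (rule nn_integral_cmult_indicator) simp
  also have "\<dots> < \<infinity>"
    using emeasure_lborel_cball_finite[of "0::real^'n" "2*b+1"] by (simp add: ennreal_mult_less_top)
  finally show ?thesis .
qed

section \<open>Finiteness of the surface measure\<close>

text \<open>The radius is doubled inside the chart to leave room for a cut-off that is 1 on the ball
  of radius r and 0 off the ball of radius 2r.\<close>

lemma exterior_chart_ball:
  assumes "exterior_lipschitz_domain \<Omega>" "q \<in> frontier \<Omega>"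
  obtains e \<gamma> V r where "0 < r" "cball q (2 * r) \<subseteq> V" "lipschitz_chart \<Omega> e \<gamma> V"
proof -
  obtain e \<gamma> V where V: "q \<in> V" "lipschitz_chart \<Omega> e \<gamma> V"
    using assms unfolding exterior_lipschitz_domain_def by blast
  then obtain r where "0 < r" "cball q r \<subseteq> V" by (meson lipschitz_chart_def open_contains_cball)
  then show ?thesis using that[of "r/2" V e \<gamma>] V by simp
qed

lemma compact_frontier_exterior:
  assumes "exterior_lipschitz_domain \<Omega>" shows "compact (frontier \<Omega>)"
proof -
  have "frontier \<Omega> \<subseteq> - \<Omega>"
    using assms by (auto simp: exterior_lipschitz_domain_def frontier_def interior_open)
  then show ?thesis using assms by (metis compact_Int_closed exterior_lipschitz_domain_def frontier_closed inf.absorb_iff2)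
qed

lemma surface_finite:
  fixes \<Omega> :: "(real^'n::finite) set"
  assumes dom: "exterior_lipschitz_domain \<Omega>" "surface_measure \<Omega> S" "outer_unit_normal \<Omega> S \<nu>"
  shows "finite_measure S"
proof -
  have op: "open \<Omega>" using dom by (simp add: exterior_lipschitz_domain_def)
  have sS: "sets S = sets borel" and S0: "emeasure S (- frontier \<Omega>) = 0"
    using dom by (auto simp: surface_measure_def)
  have cf: "compact (frontier \<Omega>)" by (rule compact_frontier_exterior[OF dom(1)])
  have "\<forall>q\<in>frontier \<Omega>. \<exists>r>0. emeasure S (frontier \<Omega> \<inter> cball q r) < \<infinity>"
  proof
    fix q assume "q \<in> frontier \<Omega>"
    then obtain e \<gamma> V r where r: "0 < r" "cball q (2 * r) \<subseteq> V" "lipschitz_chart \<Omega> e \<gamma> V"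
      using exterior_chart_ball[OF dom(1)] by metis
    then have "emeasure S (frontier \<Omega> \<inter> cball q (2*r)) < \<infinity>"
      by (intro chart_surface_finite[OF op dom(2,3) r(3)]) (auto simp: frontier_closed borel_closed)
    then show "\<exists>r>0. emeasure S (frontier \<Omega> \<inter> cball q r) < \<infinity>" using r by (intro exI[of _ "2*r"]) auto
  qed
  then obtain r where r: "\<And>q. q \<in> frontier \<Omega> \<Longrightarrow> 0 < r q \<and> emeasure S (frontier \<Omega> \<inter> cball q (r q)) < \<infinity>" by metis
  obtain X where X: "X \<subseteq> frontier \<Omega>" "finite X" "frontier \<Omega> \<subseteq> (\<Union>q\<in>X. ball q (r q))"
    using compactE_image[OF cf, of "frontier \<Omega>" "\<lambda>q. ball q (r q)"] r by force
  have m: "frontier \<Omega> \<inter> cball q (r q) \<in> sets S" for q by (simp add: sS frontier_closed borel_closed)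
  have "emeasure S (frontier \<Omega>) \<le> emeasure S (\<Union>q\<in>X. frontier \<Omega> \<inter> cball q (r q))"
    using X m by (intro emeasure_mono sets.finite_UN) (force simp: subset_iff)+
  also have "\<dots> \<le> (\<Sum>q\<in>X. emeasure S (frontier \<Omega> \<inter> cball q (r q)))"
    using X m by (intro emeasure_subadditive_finite) auto
  also have "\<dots> < \<infinity>" using r X by (auto simp: ennreal_sum_less_top)
  finally have f: "emeasure S (frontier \<Omega>) < \<infinity>" .
  have "emeasure S (frontier \<Omega> \<union> - frontier \<Omega>) \<le> emeasure S (frontier \<Omega>) + emeasure S (- frontier \<Omega>)"
    by (intro emeasure_subadditive) (auto simp: sS frontier_closed borel_closed)
  then have "emeasure S (space S) < \<infinity>"
    using f S0 sets_eq_imp_space_eq[OF sS] by (simp add: le_less_trans)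
  then show ?thesis by (intro finite_measureI) auto
qed

section \<open>Cut-off functions and the passage from charts to the whole boundary\<close>

lemma C1_grad_mult:
  assumes "C1_grad \<phi> g" "C1_grad \<psi> h"
  shows "C1_grad (\<lambda>x. \<phi> x * \<psi> x) (\<lambda>x. \<phi> x *\<^sub>R h x + \<psi> x *\<^sub>R g x)"
  using assms C1_grad_continuous[OF assms(1)] C1_grad_continuous[OF assms(2)]
  unfolding C1_grad_def by (auto intro!: GDERIV_mult continuous_intros)

lemma C1_grad_diff:
  "C1_grad \<phi> g \<Longrightarrow> C1_grad \<psi> h \<Longrightarrow> C1_grad (\<lambda>x. \<phi> x - \<psi> x) (\<lambda>x. g x - h x)"
  unfolding C1_grad_def by (auto intro!: GDERIV_diff continuous_intros)

text \<open>From the second power on, the positive part is continuously differentiable: at 0 the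
  quotient is at most |h| to a positive power. Cut-offs are built from it.\<close>

lemma DERIV_pos_part_power:
  "DERIV (\<lambda>x::real. (max 0 x) ^ Suc (Suc k)) x :> real (Suc (Suc k)) * (max 0 x) ^ Suc k"
proof (cases "x = 0")
  case True
  have "((\<lambda>h::real. (max 0 h) ^ Suc (Suc k) / h) \<longlongrightarrow> 0) (at 0)"
  proof (rule Lim_null_comparison[where g="\<lambda>h. \<bar>h\<bar> ^ Suc k"])
    show "\<forall>\<^sub>F h::real in at 0. norm ((max 0 h) ^ Suc (Suc k) / h) \<le> \<bar>h\<bar> ^ Suc k"
    proof (rule always_eventually, rule allI)
      fix h :: real
      show "norm ((max 0 h) ^ Suc (Suc k) / h) \<le> \<bar>h\<bar> ^ Suc k"
      proof (cases "h > 0")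
        case False
        then have "max 0 h = 0" by simp
        then have "(max 0 h) ^ Suc (Suc k) = 0" by (simp only: power_Suc mult_zero_left)
        then show ?thesis by (simp only: div_0 norm_zero) simp
      qed auto
    qed
    have "((\<lambda>h::real. \<bar>h\<bar> ^ Suc k) \<longlongrightarrow> \<bar>0\<bar> ^ Suc k) (at 0)" by (intro tendsto_intros)
    then show "((\<lambda>h::real. \<bar>h\<bar> ^ Suc k) \<longlongrightarrow> 0) (at 0)" by simp
  qed
  then show ?thesis using True by (simp add: DERIV_def)
next
  case False
  show ?thesis
  proof (cases "x > 0")
    case True
    have "((\<lambda>x. x ^ Suc (Suc k)) has_real_derivative real (Suc (Suc k)) * x ^ Suc k) (at x)"
      using DERIV_pow[of "Suc (Suc k)" x] by (simp only: diff_Suc_Suc diff_zero)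
    then have "((\<lambda>x::real. (max 0 x) ^ Suc (Suc k)) has_real_derivative real (Suc (Suc k)) * x ^ Suc k) (at x)"
      by (rule has_field_derivative_transform_within_open[of _ _ _ "{0<..}"]) (use True in auto)
    then show ?thesis using True by simp
  next
    case neg: False
    have "((\<lambda>x::real. (max 0 x) ^ Suc (Suc k)) has_real_derivative 0) (at x)"
      by (rule has_field_derivative_transform_within_open[of "\<lambda>_. 0" _ _ "{..<0}"]) (use False neg in auto)
    then show ?thesis using neg False by simp
  qed
qed

lemma C1_cutoff:
  fixes q :: "'a::euclidean_space"
  assumes "0 < r"
  obtains ct g where "C1_grad ct g" "\<And>x. x \<in> ball q r \<Longrightarrow> ct x = 1" "\<And>x. x \<notin> cball q (2 * r) \<Longrightarrow> ct x = 0"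
proof -
  \<comment> \<open>p is 1 on u \<le> 0 and 0 on u \<ge> 1. With u = (|x - q|^2 - r^2) / r^2 the
    first covers the ball of radius r and the second everything outside radius sqrt 2 * r, which is
    below 2r.\<close>
  define p where "p u = (max 0 (1 - (max 0 u) ^ Suc (Suc 0))) ^ Suc (Suc 0)" for u :: real
  define p' where "p' u = (2 * max 0 (1 - (max 0 u)\<^sup>2)) * (- (2 * max 0 u))" for u :: real
  have dp: "DERIV p u :> p' u" for u
  proof -
    have 1: "DERIV (\<lambda>u. 1 - (max 0 u) ^ Suc (Suc 0)) u :> - (2 * max 0 u)"
      using DERIV_diff[OF DERIV_const[of 1] DERIV_pos_part_power[of 0 u]] by simp
    from DERIV_chain2[OF DERIV_pos_part_power 1, of 0] show ?thesis
      by (simp add: p_def[abs_def] p'_def power2_eq_square)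
  qed
  have cp': "continuous_on UNIV p'" unfolding p'_def by (intro continuous_intros)
  define u where "u x = ((x - q) \<bullet> (x - q) - r\<^sup>2) * (1 / r\<^sup>2)" for x
  have du: "GDERIV u x :> (2 / r\<^sup>2) *\<^sub>R (x - q)" for x
  proof -
    have "((\<lambda>x. ((x - q) \<bullet> (x - q) - r\<^sup>2) * (1 / r\<^sup>2)) has_derivative (\<lambda>h. ((x - q) \<bullet> h + h \<bullet> (x - q)) * (1 / r\<^sup>2))) (at x)"
      by (rule has_derivative_mult_left) (auto intro!: derivative_eq_intros)
    moreover have "(\<lambda>h. ((x - q) \<bullet> h + h \<bullet> (x - q)) * (1 / r\<^sup>2)) = (\<lambda>h. h \<bullet> ((2 / r\<^sup>2) *\<^sub>R (x - q)))"
      unfolding inner_scaleR_right by (simp add: fun_eq_iff inner_commute[of "x - q"])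
    ultimately show ?thesis by (simp only: gderiv_def u_def[abs_def])
  qed
  have cu: "continuous_on UNIV u" unfolding u_def by (intro continuous_intros)
  show ?thesis
  proof (rule that[of "\<lambda>x. p (u x)" "\<lambda>x. p' (u x) *\<^sub>R ((2 / r\<^sup>2) *\<^sub>R (x - q))"])
    show "C1_grad (\<lambda>x. p (u x)) (\<lambda>x. p' (u x) *\<^sub>R ((2 / r\<^sup>2) *\<^sub>R (x - q)))"
      unfolding C1_grad_def
      by (intro conjI allI GDERIV_DERIV_compose du dp continuous_intros continuous_on_compose2[OF cp' cu]) auto
    have n: "(x - q) \<bullet> (x - q) = (dist q x)\<^sup>2" for x by (metis dist_norm norm_minus_commute power2_norm_eq_inner)
    show "p (u x) = 1" if "x \<in> ball q r" for x
    proof -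
      have "(dist q x)\<^sup>2 \<le> r\<^sup>2" using that by (intro power_mono) auto
      then have "u x \<le> 0" unfolding u_def n by (intro mult_nonpos_nonneg) auto
      then show ?thesis by (simp add: p_def)
    qed
    show "p (u x) = 0" if "x \<notin> cball q (2 * r)" for x
    proof -
      have "(2 * r)\<^sup>2 \<le> (dist q x)\<^sup>2" using that assms by (intro power_mono) auto
      moreover have "2 * r\<^sup>2 \<le> (2 * r)\<^sup>2" by (simp add: power_mult_distrib)
      ultimately have "2 * r\<^sup>2 \<le> (dist q x)\<^sup>2" by linarith
      then have "1 \<le> u x" unfolding u_def n using assms by simp
      then have "1 \<le> (u x)\<^sup>2" by (simp add: one_le_power)
      then show ?thesis using \<open>1 \<le> u x\<close> by (simp add: p_def power2_eq_square)
    qed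
  qed
qed


text \<open>\<phi> vanishes near the frontier, so cutting it off there creates no jump: \<Omega> and
  the union of U with the exterior of \<Omega> are two open sets that cover the space, and the
  product is C1 on each.\<close>

lemma C1_grad_restrict:
  fixes \<phi> :: "'a::euclidean_space \<Rightarrow> real"
  assumes \<phi>: "C1_grad \<phi> g" and op: "open \<Omega>" "open U" and U: "frontier \<Omega> \<subseteq> U" "\<And>x. x \<in> U \<Longrightarrow> \<phi> x = 0"
  shows "C1_grad (\<lambda>x. indicat_real \<Omega> x * \<phi> x) (\<lambda>x. indicat_real \<Omega> x *\<^sub>R g x)"
proof -
  have d: "GDERIV \<phi> x :> g x" for x using \<phi> by (simp add: C1_grad_def)
  have cg: "continuous_on UNIV g" using \<phi> by (auto simp: C1_grad_def)
  have gU: "g x = 0" if "x \<in> U" for x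
  proof -
    have "GDERIV \<phi> x :> 0"
      unfolding gderiv_def
      using has_derivative_transform_within_open[of "\<lambda>_. 0" "\<lambda>_. 0" x UNIV U \<phi>] op U(2) that by auto
    then have "(\<lambda>h. inner h (g x)) = (\<lambda>h. inner h 0)"
      unfolding gderiv_def using has_derivative_unique d[unfolded gderiv_def] by blast
    then show ?thesis by (metis inner_eq_zero_iff inner_zero_right)
  qed
  let ?W = "U \<union> - closure \<Omega>"
  have W: "open ?W" using op by auto
  have cov: "x \<in> \<Omega> \<or> x \<in> ?W" for x
    using U(1) op by (auto simp: frontier_def interior_open)
  have z: "indicat_real \<Omega> x * \<phi> x = 0" "indicat_real \<Omega> x *\<^sub>R g x = 0" if "x \<in> ?W" for x
    using that U(2) gU closure_subset[of \<Omega>] by (auto simp: indicator_def)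
  have "GDERIV (\<lambda>x. indicat_real \<Omega> x * \<phi> x) x :> indicat_real \<Omega> x *\<^sub>R g x" for x
  proof (cases "x \<in> \<Omega>")
    case True
    have "((\<lambda>x. indicat_real \<Omega> x * \<phi> x) has_derivative (\<lambda>h. h \<bullet> g x)) (at x)"
      by (rule has_derivative_transform_within_open[OF d[unfolded gderiv_def] op(1) True]) simp
    then show ?thesis using True by (simp add: gderiv_def)
  next
    case False
    then have x: "x \<in> ?W" using cov by blast
    have "((\<lambda>x. indicat_real \<Omega> x * \<phi> x) has_derivative (\<lambda>h. 0)) (at x)"
      by (rule has_derivative_transform_within_open[of "\<lambda>_. 0" _ _ _ ?W]) (use W x z in auto)
    then show ?thesis unfolding gderiv_def z(2)[OF x] inner_zero_right .
  qed
  moreover have "continuous_on UNIV (\<lambda>x. indicat_real \<Omega> x *\<^sub>R g x)"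
  proof -
    have c1: "continuous_on \<Omega> (\<lambda>x. indicat_real \<Omega> x *\<^sub>R g x)"
      by (rule continuous_on_cong[THEN iffD1, OF refl _ continuous_on_subset[OF cg]]) auto
    have c2: "continuous_on ?W (\<lambda>x. indicat_real \<Omega> x *\<^sub>R g x)"
      by (rule continuous_on_cong[THEN iffD1, OF refl _ continuous_on_const[of _ 0]]) (use z in auto)
    have "continuous_on (\<Omega> \<union> ?W) (\<lambda>x. indicat_real \<Omega> x *\<^sub>R g x)"
      by (rule continuous_on_open_Un[OF op(1) W c1 c2])
    moreover have "\<Omega> \<union> ?W = UNIV" using cov by auto
    ultimately show ?thesis by simp
  qed
  ultimately show ?thesis by (simp add: C1_grad_def)
qed

lemma surface_integrable_normal:
  fixes \<Omega> :: "(real^'n::finite) set"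
  assumes dom: "exterior_lipschitz_domain \<Omega>" "surface_measure \<Omega> S" "outer_unit_normal \<Omega> S \<nu>"
    and "integrable S h"
  shows "integrable S (\<lambda>q. h q * \<nu> q $ k)"
proof (rule Bochner_Integration.integrable_bound[OF assms(4)])
  have sS: "sets S = sets borel" using assms(2) by (simp add: surface_measure_def)
  have [measurable]: "\<nu> \<in> borel_measurable S" using dom by (simp add: outer_unit_normal_def)
  have "(\<lambda>q. \<nu> q \<bullet> axis k 1) \<in> borel_measurable S" by measurable
  then have "(\<lambda>q. \<nu> q $ k) \<in> borel_measurable S" by (simp add: inner_axis)
  then show "(\<lambda>q. h q * \<nu> q $ k) \<in> borel_measurable S" using assms(4) by measurable
  have "AE q in S. outer_unit_normal_at \<Omega> q (\<nu> q)" using dom by (simp add: outer_unit_normal_def)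
  then show "AE q in S. norm (h q * \<nu> q $ k) \<le> norm (h q)"
  proof eventually_elim
    case (elim q)
    then have "\<bar>\<nu> q $ k\<bar> \<le> 1" using component_le_norm_cart[of "\<nu> q" k] by (simp add: outer_unit_normal_at_def)
    then show ?case by (simp add: abs_mult mult_left_le)
  qed
qed

lemma surface_integrable_bounded:
  fixes \<Omega> :: "(real^'n::finite) set"
  assumes dom: "exterior_lipschitz_domain \<Omega>" "surface_measure \<Omega> S" "outer_unit_normal \<Omega> S \<nu>"
    and "continuous_on UNIV h" "\<And>q. \<bar>h q\<bar> \<le> (C::real)"
  shows "integrable S h"
proof -
  interpret finite_measure S by (rule surface_finite[OF dom])
  have sS: "sets S = sets borel" using assms(2) by (simp add: surface_measure_def)
  show ?thesis
    by (rule integrable_const_bound[of _ C])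
       (use assms(4,5) in \<open>auto simp: measurable_cong_sets[OF sS refl] intro: borel_measurable_continuous_onI\<close>)
qed

lemma surface_AE_frontier:
  assumes "surface_measure \<Omega> S" shows "AE q in S. q \<in> frontier \<Omega>"
proof -
  have "AE q in S. q \<notin> - frontier \<Omega>"
    using assms by (intro AE_not_in) (auto simp: surface_measure_def null_sets_def frontier_closed borel_closed)
  then show ?thesis by simp
qed

text \<open>Induction on the chart balls. U is the open set where \<phi> is already known to vanish.
  The cut-off of one ball splits \<phi> into a part supported in its chart, settled by
  \<open>chart_gauss\<close>, and a part vanishing on that ball, which joins U. When no ball is
  left, \<phi> vanishes near the frontier and both sides are 0.\<close>

lemma gauss_cover:
  fixes \<Omega> :: "(real^'n::finite) set"
  assumes dom: "exterior_lipschitz_domain \<Omega>" "surface_measure \<Omega> S" "outer_unit_normal \<Omega> S \<nu>"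
    and X: "finite X" "\<forall>q\<in>X. 0 < r q \<and> (\<exists>e \<gamma> V. cball q (2 * r q) \<subseteq> V \<and> lipschitz_chart \<Omega> e \<gamma> V)"
    and "C1_grad \<phi> g" "supp_in \<phi> R" "open U" "frontier \<Omega> \<subseteq> U \<union> (\<Union>q\<in>X. ball q (r q))" "\<forall>x\<in>U. \<phi> x = 0"
  shows "(LINT x|lborel. indicat_real \<Omega> x * g x $ k) = (LINT q|S. \<phi> q * \<nu> q $ k)"
  using X assms(6-10)
proof (induction X arbitrary: \<phi> g U rule: finite_induct)
  case empty
  have op: "open \<Omega>" using dom by (simp add: exterior_lipschitz_domain_def)
  have "C1_grad (\<lambda>x. indicat_real \<Omega> x * \<phi> x) (\<lambda>x. indicat_real \<Omega> x *\<^sub>R g x)"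
    by (rule C1_grad_restrict[of \<phi> g \<Omega> U]) (use empty op in auto)
  from integral_grad_eq_0[OF this, of R "axis k 1"] empty(3)
  have "(LINT x|lborel. indicat_real \<Omega> x * g x $ k) = 0"
    by (simp add: inner_axis' supp_in_def)
  moreover have "(LINT q|S. \<phi> q * \<nu> q $ k) = 0"
    by (rule integral_eq_zero_AE) (use surface_AE_frontier[OF dom(2)] empty(5,6) in \<open>auto elim!: eventually_mono\<close>)
  ultimately show ?case by simp
next
  case (insert q X)
  have op: "open \<Omega>" using dom by (simp add: exterior_lipschitz_domain_def)
  obtain e \<gamma> V where V: "0 < r q" "cball q (2 * r q) \<subseteq> V" "lipschitz_chart \<Omega> e \<gamma> V"
    using insert.prems(1) by blast
  obtain ct gc where ct: "C1_grad ct gc" "\<And>x. x \<in> ball q (r q) \<Longrightarrow> ct x = 1" "\<And>x. x \<notin> cball q (2 * r q) \<Longrightarrow> ct x = 0"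
    using C1_cutoff[OF V(1), of q] by blast
  define \<phi>1 where "\<phi>1 x = ct x * \<phi> x" for x
  define g1 where "g1 x = ct x *\<^sub>R g x + \<phi> x *\<^sub>R gc x" for x
  have C1: "C1_grad \<phi>1 g1" unfolding \<phi>1_def g1_def by (rule C1_grad_mult[OF ct(1) insert.prems(2)])
  have C2: "C1_grad (\<lambda>x. \<phi> x - \<phi>1 x) (\<lambda>x. g x - g1 x)" by (rule C1_grad_diff[OF insert.prems(2) C1])
  have s1: "supp_in \<phi>1 R" using insert.prems(3) by (simp add: supp_in_def \<phi>1_def)
  have s2: "supp_in (\<lambda>x. \<phi> x - \<phi>1 x) R" using insert.prems(3) by (simp add: supp_in_def \<phi>1_def)
  have e1: "(LINT x|lborel. indicat_real \<Omega> x * g1 x $ k) = (LINT q|S. \<phi>1 q * \<nu> q $ k)"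
    by (rule chart_gauss[OF op dom(2,3) V(3) C1 s1 closed_cball V(2)]) (simp add: \<phi>1_def ct(3))
  have e2: "(LINT x|lborel. indicat_real \<Omega> x * (g x - g1 x) $ k) = (LINT q|S. (\<phi> q - \<phi>1 q) * \<nu> q $ k)"
  proof -
    have h1: "\<forall>z\<in>X. 0 < r z \<and> (\<exists>e \<gamma> V. cball z (2 * r z) \<subseteq> V \<and> lipschitz_chart \<Omega> e \<gamma> V)"
      using insert.prems(1) by simp
    have h2: "open (U \<union> ball q (r q))" using insert.prems(4) by (intro open_Un open_ball)
    have h3: "frontier \<Omega> \<subseteq> (U \<union> ball q (r q)) \<union> (\<Union>q\<in>X. ball q (r q))"
      using insert.prems(5) by (simp add: Un_assoc)
    have h4: "\<forall>x \<in> U \<union> ball q (r q). \<phi> x - \<phi>1 x = 0"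
      using insert.prems(6) ct(2) by (auto simp: \<phi>1_def)
    show ?thesis by (rule insert.IH[OF h1 C2 s2 h2 h3 h4])
  qed
  have i: "integrable lborel (\<lambda>x. indicat_real \<Omega> x * h x $ k)" if p: "C1_grad \<psi> h" "supp_in \<psi> R" for \<psi> and h :: "real^'n \<Rightarrow> real^'n"
  proof -
    obtain C where C': "0 < C" "\<And>x. norm (h x) \<le> C" "\<And>x. \<bar>\<psi> x\<bar> \<le> C" using C1_grad_bounded[OF p] by blast
    note C = C'(2)
    have ch: "continuous_on UNIV h" using p by (simp add: C1_grad_def)
    show ?thesis
    proof (rule integrable_bounded_support[where C=C and R=R])
      have "(\<lambda>x. h x $ k) \<in> borel_measurable borel"
        by (intro borel_measurable_continuous_onI continuous_intros ch)
      then show "(\<lambda>x. indicat_real \<Omega> x * h x $ k) \<in> borel_measurable borel"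
        using op by (intro borel_measurable_times borel_measurable_indicator borel_open)
      show "\<bar>indicat_real \<Omega> x * h x $ k\<bar> \<le> C" for x
      proof -
        have "\<bar>h x $ k\<bar> \<le> C" "0 \<le> C"
          using order_trans[OF component_le_norm_cart C] order_trans[OF norm_ge_zero C] by blast+
        then show ?thesis by (simp add: indicator_def)
      qed
    qed (use C1_grad_supp[OF p] in auto)
  qed
  have j: "integrable S (\<lambda>q. \<psi> q * \<nu> q $ k)" if p: "C1_grad \<psi> h" "supp_in \<psi> R" for \<psi> and h :: "real^'n \<Rightarrow> real^'n"
  proof -
    obtain C where C': "0 < C" "\<And>x. norm (h x) \<le> C" "\<And>x. \<bar>\<psi> x\<bar> \<le> C" using C1_grad_bounded[OF p] by blast
    note C = C'(3)
    show ?thesis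
      by (intro surface_integrable_normal[OF dom] surface_integrable_bounded[OF dom C1_grad_continuous[OF p(1)] C])
  qed
  have "(LINT x|lborel. indicat_real \<Omega> x * g x $ k)
     = (LINT x|lborel. indicat_real \<Omega> x * g1 x $ k + indicat_real \<Omega> x * (g x - g1 x) $ k)"
    by (intro Bochner_Integration.integral_cong refl) (simp add: algebra_simps)
  also have "\<dots> = (LINT q|S. \<phi>1 q * \<nu> q $ k) + (LINT q|S. (\<phi> q - \<phi>1 q) * \<nu> q $ k)"
    by (subst Bochner_Integration.integral_add) (use i[OF C1 s1] i[OF C2 s2] e1 e2 in auto)
  also have "\<dots> = (LINT q|S. \<phi>1 q * \<nu> q $ k + (\<phi> q - \<phi>1 q) * \<nu> q $ k)"
    by (rule Bochner_Integration.integral_add[symmetric]) (use j[OF C1 s1] j[OF C2 s2] in auto)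
  also have "\<dots> = (LINT q|S. \<phi> q * \<nu> q $ k)"
    by (intro Bochner_Integration.integral_cong refl) (simp add: algebra_simps)
  finally show ?case .
qed

theorem gauss_exterior:
  fixes \<Omega> :: "(real^'n::finite) set"
  assumes dom: "exterior_lipschitz_domain \<Omega>" "surface_measure \<Omega> S" "outer_unit_normal \<Omega> S \<nu>"
    and "C1_grad \<phi> g" "supp_in \<phi> R"
  shows "(LINT x|lborel. indicat_real \<Omega> x * g x $ k) = (LINT q|S. \<phi> q * \<nu> q $ k)"
proof -
  have "\<forall>q\<in>frontier \<Omega>. \<exists>r. 0 < r \<and> (\<exists>e \<gamma> V. cball q (2 * r) \<subseteq> V \<and> lipschitz_chart \<Omega> e \<gamma> V)"
    using exterior_chart_ball[OF dom(1)] by metis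
  then obtain r where r: "\<And>q. q \<in> frontier \<Omega> \<Longrightarrow> 0 < r q \<and> (\<exists>e \<gamma> V. cball q (2 * r q) \<subseteq> V \<and> lipschitz_chart \<Omega> e \<gamma> V)"
    by metis
  have cov: "frontier \<Omega> \<subseteq> (\<Union>q\<in>frontier \<Omega>. ball q (r q))"
  proof
    fix q assume q: "q \<in> frontier \<Omega>"
    then have "q \<in> ball q (r q)" using r[OF q] by (simp only: centre_in_ball)
    then show "q \<in> (\<Union>q\<in>frontier \<Omega>. ball q (r q))" using q by (rule UN_I[rotated])
  qed
  obtain X where X: "X \<subseteq> frontier \<Omega>" "finite X" "frontier \<Omega> \<subseteq> (\<Union>q\<in>X. ball q (r q))"
    by (rule compactE_image[OF compact_frontier_exterior[OF dom(1)] _ cov]) (auto intro: that)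
  have h: "\<forall>q\<in>X. 0 < r q \<and> (\<exists>e \<gamma> V. cball q (2 * r q) \<subseteq> V \<and> lipschitz_chart \<Omega> e \<gamma> V)"
    using r X(1) by (meson subsetD)
  have "frontier \<Omega> \<subseteq> {} \<union> (\<Union>q\<in>X. ball q (r q))" using X(3) by simp
  then show ?thesis
    by (rule gauss_cover[OF dom X(2) h assms(4,5) open_empty]) simp
qed

section \<open>Integration by parts for Sobolev functions with traces\<close>

lemma smooth_fun_C1_grad:
  assumes "smooth_fun \<phi>"
  shows "C1_grad \<phi> (\<lambda>x. \<chi> i. partial_deriv i \<phi> x)"
proof -
  have C: "Ck_fun (Suc 0) \<phi>" using assms by (simp add: smooth_fun_def)
  then have d: "\<And>x. \<phi> differentiable (at x)" and c: "\<And>i. continuous_on UNIV (partial_deriv i \<phi>)" by auto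
  have "GDERIV \<phi> x :> (\<chi> i. partial_deriv i \<phi> x)" for x
  proof -
    let ?f = "frechet_derivative \<phi> (at x)"
    have f: "(\<phi> has_derivative ?f) (at x)" using d frechet_derivative_works by blast
    then have l: "linear ?f" by (simp add: has_derivative_linear)
    have "?f h = h \<bullet> (\<chi> i. partial_deriv i \<phi> x)" for h
    proof -
      have "?f h = ?f (\<Sum>i\<in>UNIV. h $ i *\<^sub>R axis i 1)" by (simp add: basis_expansion scalar_mult_eq_scaleR[symmetric])
      also have "\<dots> = (\<Sum>i\<in>UNIV. h $ i *\<^sub>R ?f (axis i 1))" by (simp add: linear_sum[OF l] linear_cmul[OF l])
      finally show ?thesis by (simp add: inner_vec_def partial_deriv_def)
    qed
    then have "?f = (\<lambda>h. h \<bullet> (\<chi> i. partial_deriv i \<phi> x))" by (rule ext)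
    then show ?thesis unfolding gderiv_def using f by metis
  qed
  moreover have "continuous_on UNIV (\<lambda>x. \<chi> i. partial_deriv i \<phi> x)"
    by (intro continuous_on_vec_lambda c)
  ultimately show ?thesis by (simp add: C1_grad_def)
qed

lemma borel_measurable_lebesgue_onI:
  "h \<in> borel_measurable borel \<Longrightarrow> h \<in> borel_measurable (lebesgue_on A)"
  by (intro measurable_restrict_space1 measurable_completion) simp

lemma (in finite_measure) integrable_L2_mult_bounded:
  assumes f: "f \<in> borel_measurable M" "integrable M (\<lambda>x. (f x :: real)\<^sup>2)"
    and b: "b \<in> borel_measurable M" "AE x in M. \<bar>b x\<bar> \<le> C"
  shows "integrable M (\<lambda>x. f x * b x)"
proof (rule Bochner_Integration.integrable_bound)
  show "integrable M (\<lambda>x. C * (1 + (f x)\<^sup>2))" using f(2) by simp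
  show "AE x in M. norm (f x * b x) \<le> norm (C * (1 + (f x)\<^sup>2))"
    using b(2)
  proof eventually_elim
    case (elim x)
    have "\<bar>f x\<bar> \<le> 1 + (f x)\<^sup>2"
    proof -
      have "0 \<le> (\<bar>f x\<bar> - 1)\<^sup>2 + \<bar>f x\<bar>" by simp
      then show ?thesis by (simp add: power2_eq_square algebra_simps)
    qed
    then have "\<bar>b x\<bar> * \<bar>f x\<bar> \<le> C * (1 + (f x)\<^sup>2)" using elim by (intro mult_mono) auto
    moreover have "norm (f x * b x) = \<bar>b x\<bar> * \<bar>f x\<bar>" by (simp add: abs_mult mult.commute)
    ultimately have "norm (f x * b x) \<le> C * (1 + (f x)\<^sup>2)" by simp
    also have "\<dots> \<le> norm (C * (1 + (f x)\<^sup>2))" unfolding real_norm_def by (rule abs_ge_self)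
    finally show ?case .
  qed
qed (use f b in measurable)

text \<open>From |y| \<le> \<eta> + y^2/\<eta> with \<eta> close to the L2 norm of f m: both terms
  then tend to 0, the first because the measure is finite.\<close>

lemma (in finite_measure) L2_limit_imp_L1:
  assumes f: "\<And>m. f m \<in> borel_measurable M" "\<And>m. integrable M (\<lambda>x. (f m x)\<^sup>2)"
    and lim: "(\<lambda>m. LINT x|M. (f m x)\<^sup>2) \<longlonglongrightarrow> (0::real)"
    and b: "b \<in> borel_measurable M" "AE x in M. \<bar>b x\<bar> \<le> C"
  shows "(\<lambda>m. LINT x|M. f m x * b x) \<longlonglongrightarrow> 0"
proof -
  have C0: "\<bar>b x\<bar> \<le> C \<Longrightarrow> 0 \<le> C" for x by linarith
  define B where "B = measure M (space M)"
  have key: "\<bar>y * z\<bar> \<le> \<bar>C\<bar> * (\<eta> + y\<^sup>2 / \<eta>)" if "\<bar>z\<bar> \<le> C" "0 < \<eta>" for y z \<eta> :: real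
  proof -
    have "\<bar>y\<bar> \<le> \<eta> + y\<^sup>2 / \<eta>"
    proof (cases "\<bar>y\<bar> \<le> \<eta>")
      case True then show ?thesis using that(2) by (simp add: add_increasing2)
    next
      case False
      then have "\<eta> * \<bar>y\<bar> \<le> \<bar>y\<bar> * \<bar>y\<bar>" by (intro mult_right_mono) auto
      then have "\<bar>y\<bar> \<le> y\<^sup>2 / \<eta>" using that(2) by (simp add: field_simps power2_eq_square)
      then show ?thesis using that(2) by simp
    qed
    then have "\<bar>z\<bar> * \<bar>y\<bar> \<le> \<bar>C\<bar> * (\<eta> + y\<^sup>2 / \<eta>)" using that by (intro mult_mono) auto
    then show ?thesis by (simp add: abs_mult mult.commute)
  qed
  have int: "integrable M (\<lambda>x. \<bar>C\<bar> * (\<eta> + (f m x)\<^sup>2 / \<eta>))" for \<eta> m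
    using f(2)[of m] by simp
  have i: "integrable M (\<lambda>x. f m x * b x)" for m
    by (rule integrable_L2_mult_bounded[OF f b])
  have bound: "\<bar>LINT x|M. f m x * b x\<bar> \<le> \<bar>C\<bar> * (\<eta> * B + (LINT x|M. (f m x)\<^sup>2) / \<eta>)" if "0 < \<eta>" for \<eta> m
  proof -
    have "\<bar>LINT x|M. f m x * b x\<bar> \<le> (LINT x|M. \<bar>f m x * b x\<bar>)" by (rule integral_abs_bound)
    also have "\<dots> \<le> (LINT x|M. \<bar>C\<bar> * (\<eta> + (f m x)\<^sup>2 / \<eta>))"
      by (rule integral_mono_AE[OF integrable_abs[OF i] int]) (use b(2) key[OF _ that] in \<open>auto elim!: eventually_mono\<close>)
    also have "\<dots> = \<bar>C\<bar> * (\<eta> * B + (LINT x|M. (f m x)\<^sup>2) / \<eta>)"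
      using f(2)[of m] by (simp add: B_def mult.commute)
    finally show ?thesis .
  qed
  define a where "a m = (LINT x|M. (f m x)\<^sup>2)" for m
  have a0: "0 \<le> a m" for m by (simp add: a_def)
  have alim: "a \<longlonglongrightarrow> 0" using lim by (simp add: a_def[abs_def])
  \<comment> \<open>The summand 1/(m+1) keeps \<eta> positive when a m = 0, and a m / \<eta> m \<le>
    sqrt (a m) still holds.\<close>
  define \<eta> where "\<eta> m = sqrt (a m) + inverse (real (Suc m))" for m
  have \<eta>0: "0 < \<eta> m" for m using a0[of m] by (simp add: \<eta>_def add_nonneg_pos)
  have sa: "(\<lambda>m. sqrt (a m)) \<longlonglongrightarrow> 0" using tendsto_real_sqrt[OF alim] by simp
  have "\<eta> \<longlonglongrightarrow> 0" unfolding \<eta>_def[abs_def] using tendsto_add[OF sa LIMSEQ_inverse_real_of_nat] by simp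
  then have lim2: "(\<lambda>m. \<bar>C\<bar> * (\<eta> m * B + sqrt (a m))) \<longlonglongrightarrow> \<bar>C\<bar> * (0 * B + 0)"
    by (intro tendsto_intros sa)
  show "(\<lambda>m. LINT x|M. f m x * b x) \<longlonglongrightarrow> 0"
  proof (rule Lim_null_comparison)
    show "\<forall>\<^sub>F m in sequentially. norm (LINT x|M. f m x * b x) \<le> \<bar>C\<bar> * (\<eta> m * B + sqrt (a m))"
    proof (rule always_eventually, rule allI)
      fix m
      have "a m / \<eta> m \<le> sqrt (a m)"
      proof -
        have "a m = sqrt (a m) * sqrt (a m)" using a0[of m] by simp
        also have "\<dots> \<le> sqrt (a m) * \<eta> m" using a0[of m] by (intro mult_left_mono) (auto simp: \<eta>_def)
        finally show ?thesis using \<eta>0[of m] by (simp add: pos_divide_le_eq)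
      qed
      then have "\<bar>C\<bar> * (\<eta> m * B + a m / \<eta> m) \<le> \<bar>C\<bar> * (\<eta> m * B + sqrt (a m))"
        by (intro mult_left_mono add_left_mono) auto
      then show "norm (LINT x|M. f m x * b x) \<le> \<bar>C\<bar> * (\<eta> m * B + sqrt (a m))"
        using bound[OF \<eta>0[of m], of m] by (simp add: a_def)
    qed
    show "(\<lambda>m. \<bar>C\<bar> * (\<eta> m * B + sqrt (a m))) \<longlonglongrightarrow> 0" using lim2 by simp
  qed
qed

lemma finite_measure_lebesgue_bounded:
  assumes "\<Omega> \<in> sets lebesgue"
  shows "finite_measure (lebesgue_on (\<Omega> \<inter> cball 0 R :: 'a::euclidean_space set))"
proof (rule finite_measureI)
  have "emeasure lebesgue (\<Omega> \<inter> cball 0 R) \<le> emeasure lebesgue (cball (0::'a) R)"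
    using assms by (intro emeasure_mono) auto
  also have "\<dots> < \<infinity>" using emeasure_lborel_cball_finite[of "0::'a" R] by simp
  finally have "emeasure lebesgue (\<Omega> \<inter> cball 0 R) \<noteq> \<infinity>" by simp
  then show "emeasure (lebesgue_on (\<Omega> \<inter> cball 0 R)) (space (lebesgue_on (\<Omega> \<inter> cball 0 R))) \<noteq> \<infinity>"
    using assms by (subst emeasure_restrict_space) (auto simp: space_restrict_space)
qed

lemma L2_loc_cl_lebesgue_on:
  assumes "L2_loc_cl \<Omega> u" "\<Omega> \<in> sets lebesgue"
  shows "u \<in> borel_measurable (lebesgue_on (\<Omega> \<inter> cball 0 R))"
    "integrable (lebesgue_on (\<Omega> \<inter> cball 0 R)) (\<lambda>x. (u x)\<^sup>2)"
proof -
  show "u \<in> borel_measurable (lebesgue_on (\<Omega> \<inter> cball 0 R))"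
    using assms by (auto simp: L2_loc_cl_def intro: measurable_restrict_mono)
  have "set_integrable lebesgue (\<Omega> \<inter> cball 0 R) (\<lambda>x. (u x)\<^sup>2)"
    using assms(1) by (simp add: L2_loc_cl_def)
  then show "integrable (lebesgue_on (\<Omega> \<inter> cball 0 R)) (\<lambda>x. (u x)\<^sup>2)"
    using assms(2) by (subst integrable_restrict_space) (auto simp: set_integrable_def)
qed

lemma supp_set_integral:
  fixes F :: "'a::euclidean_space \<Rightarrow> real"
  assumes "\<And>x. R < norm x \<Longrightarrow> F x = 0" "\<Omega> \<in> sets lebesgue"
  shows "(LINT x:\<Omega>|lebesgue. F x) = (LINT x|lebesgue_on (\<Omega> \<inter> cball 0 R). F x)"
    and "set_integrable lebesgue \<Omega> F \<longleftrightarrow> integrable (lebesgue_on (\<Omega> \<inter> cball 0 R)) F"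
proof -
  have eq: "indicat_real \<Omega> x *\<^sub>R F x = indicat_real (\<Omega> \<inter> cball 0 R) x *\<^sub>R F x" for x
    using assms(1)[of x] by (auto simp: indicator_def)
  show "(LINT x:\<Omega>|lebesgue. F x) = (LINT x|lebesgue_on (\<Omega> \<inter> cball 0 R). F x)"
    unfolding set_lebesgue_integral_def eq using assms(2) by (subst integral_restrict_space) auto
  show "set_integrable lebesgue \<Omega> F \<longleftrightarrow> integrable (lebesgue_on (\<Omega> \<inter> cball 0 R)) F"
    unfolding set_integrable_def eq using assms(2) by (subst integrable_restrict_space) auto
qed

lemma L2_loc_set_integrable:
  fixes u :: "real^'n::finite \<Rightarrow> real"
  assumes "L2_loc_cl \<Omega> u" "\<Omega> \<in> sets lebesgue" "b \<in> borel_measurable borel" "\<And>x. \<bar>b x\<bar> \<le> C" "\<And>x. R < norm x \<Longrightarrow> b x = 0"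
  shows "set_integrable lebesgue \<Omega> (\<lambda>x. u x * b x)"
proof -
  interpret finite_measure "lebesgue_on (\<Omega> \<inter> cball 0 R :: (real^'n) set)"
    by (rule finite_measure_lebesgue_bounded[OF assms(2)])
  have "integrable (lebesgue_on (\<Omega> \<inter> cball 0 R)) (\<lambda>x. u x * b x)"
    by (rule integrable_L2_mult_bounded[where C=C])
       (use assms L2_loc_cl_lebesgue_on[OF assms(1,2)] in \<open>auto intro: borel_measurable_lebesgue_onI\<close>)
  then show ?thesis using assms by (subst supp_set_integral(2)[where R=R]) auto
qed

text \<open>The formula holds for the smooth approximants of u times \<psi>. Since \<psi> and its
  gradient are bounded and vanish outside a fixed ball, L2 convergence of functions, derivatives and
  boundary values on finite measure spaces carries each of the three terms to its limit.\<close>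

theorem gauss_trace:
  fixes \<Omega> :: "(real^'n::finite) set"
  assumes dom: "exterior_lipschitz_domain \<Omega>" "surface_measure \<Omega> S" "outer_unit_normal \<Omega> S \<nu>"
    and tr: "has_trace \<Omega> S u T" and \<psi>: "C1_grad \<psi> g" "supp_in \<psi> R"
  shows "(LINT x:\<Omega>|lebesgue. weak_pderiv \<Omega> k u x * \<psi> x) + (LINT x:\<Omega>|lebesgue. u x * g x $ k)
     = (LINT q|S. T q * \<nu> q $ k * \<psi> q)"
proof -
  have op: "open \<Omega>" using dom by (simp add: exterior_lipschitz_domain_def)
  then have \<Omega>: "\<Omega> \<in> sets lebesgue" by simp
  obtain C where C: "0 < C" "\<And>x. norm (g x) \<le> C" "\<And>x. \<bar>\<psi> x\<bar> \<le> C"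
    using C1_grad_bounded[OF \<psi>] by blast
  have cont: "continuous_on UNIV \<psi>" by (rule C1_grad_continuous[OF \<psi>(1)])
  have contg: "continuous_on UNIV (\<lambda>x. g x $ k)" using \<psi>(1) by (auto simp: C1_grad_def intro: continuous_intros)
  have Cg: "\<bar>g x $ k\<bar> \<le> C" for x using order_trans[OF component_le_norm_cart C(2)] .
  have u: "L2_loc_cl \<Omega> u" "L2_loc_cl \<Omega> (weak_pderiv \<Omega> k u)"
    using tr by (auto simp: has_trace_def H1_loc_cl_def)
  obtain \<phi> where sm: "\<And>m. smooth_fun (\<phi> m)" and
    l1: "\<And>K. compact K \<Longrightarrow> (\<lambda>m. LINT x:\<Omega> \<inter> K|lebesgue. (\<phi> m x - u x)\<^sup>2) \<longlonglongrightarrow> 0" and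
    l2: "\<And>K. compact K \<Longrightarrow> (\<lambda>m. LINT x:\<Omega> \<inter> K|lebesgue. (partial_deriv k (\<phi> m) x - weak_pderiv \<Omega> k u x)\<^sup>2) \<longlonglongrightarrow> 0" and
    l3: "(\<lambda>m. LINT x|S. (\<phi> m x - T x)\<^sup>2) \<longlonglongrightarrow> 0"
    using tr unfolding has_trace_def by blast
  have T: "T \<in> borel_measurable S" "integrable S (\<lambda>x. (T x)\<^sup>2)" using tr by (auto simp: has_trace_def)
  have sS: "sets S = sets borel" using dom(2) by (simp add: surface_measure_def)
  interpret S: finite_measure S by (rule surface_finite[OF dom])
  let ?M = "lebesgue_on (\<Omega> \<inter> cball 0 R) :: (real^'n) measure"
  interpret M: finite_measure ?M by (rule finite_measure_lebesgue_bounded[OF \<Omega>])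
  note sq = L2_loc_cl_lebesgue_on[OF _ \<Omega>, where R=R]
  have cM: "h \<in> borel_measurable ?M" if "continuous_on UNIV h" for h :: "real^'n \<Rightarrow> real"
    using borel_measurable_continuous_onI[OF that]
    by (rule borel_measurable_lebesgue_onI)
  have bM: "integrable ?M (\<lambda>x. (h x)\<^sup>2)" if h: "continuous_on UNIV h" for h :: "real^'n \<Rightarrow> real"
  proof -
    have "compact (h ` cball 0 R)" by (intro compact_continuous_image continuous_on_subset[OF h]) auto
    then obtain B where B: "\<And>x. x \<in> cball 0 R \<Longrightarrow> \<bar>h x\<bar> \<le> B"
      by (force dest!: compact_imp_bounded simp: bounded_iff)
    have "AE x in ?M. norm ((h x)\<^sup>2) \<le> B\<^sup>2"
    proof (rule AE_I2)
      fix x assume "x \<in> space ?M"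
      then have "\<bar>h x\<bar> \<le> B" using B by (simp add: space_restrict_space)
      then have "\<bar>h x\<bar>\<^sup>2 \<le> B\<^sup>2" by (rule power_mono) simp
      then show "norm ((h x)\<^sup>2) \<le> B\<^sup>2" by simp
    qed
    then show ?thesis using cM[OF h] by (intro M.integrable_const_bound[of _ "B\<^sup>2"]) auto
  qed
  have diff2: "integrable N (\<lambda>x. (a x - b x)\<^sup>2)"
    if "integrable N (\<lambda>x. (a x)\<^sup>2)" "integrable N (\<lambda>x. (b x)\<^sup>2)" "a \<in> borel_measurable N" "b \<in> borel_measurable N"
    for N :: "(real^'n) measure" and a b :: "real^'n \<Rightarrow> real"
  proof (rule Bochner_Integration.integrable_bound[where f="\<lambda>x. 2 * (a x)\<^sup>2 + 2 * (b x)\<^sup>2"])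
    show "AE x in N. norm ((a x - b x)\<^sup>2) \<le> norm (2 * (a x)\<^sup>2 + 2 * (b x)\<^sup>2)"
    proof (rule AE_I2)
      fix x
      have "0 \<le> (a x + b x)\<^sup>2" by simp
      then have "(a x - b x)\<^sup>2 \<le> 2 * (a x)\<^sup>2 + 2 * (b x)\<^sup>2"
        by (simp add: power2_eq_square algebra_simps)
      then show "norm ((a x - b x)\<^sup>2) \<le> norm (2 * (a x)\<^sup>2 + 2 * (b x)\<^sup>2)"
        by (metis abs_ge_self abs_power2 order_trans real_norm_def)
    qed
  qed (use that in auto)
  have c\<phi>: "continuous_on UNIV (\<phi> m)" for m by (rule C1_grad_continuous[OF smooth_fun_C1_grad[OF sm]])
  have cd\<phi>: "continuous_on UNIV (partial_deriv k (\<phi> m))" for m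
  proof -
    have "Ck_fun (Suc 0) (\<phi> m)" using sm[of m] by (simp add: smooth_fun_def)
    then show ?thesis by simp
  qed
  have rs: "(LINT x:\<Omega> \<inter> cball 0 R|lebesgue. F x) = (LINT x|?M. F x)" for F :: "real^'n \<Rightarrow> real"
    unfolding set_lebesgue_integral_def using \<Omega> by (subst integral_restrict_space) auto
  have f1: "(\<lambda>x. \<phi> m x - u x) \<in> borel_measurable ?M" "integrable ?M (\<lambda>x. (\<phi> m x - u x)\<^sup>2)" for m
    using sq[OF u(1)] cM[OF c\<phi>[of m]] bM[OF c\<phi>[of m]] by (auto intro: diff2)
  have f2: "(\<lambda>x. partial_deriv k (\<phi> m) x - weak_pderiv \<Omega> k u x) \<in> borel_measurable ?M"
    "integrable ?M (\<lambda>x. (partial_deriv k (\<phi> m) x - weak_pderiv \<Omega> k u x)\<^sup>2)" for m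
    using sq[OF u(2)] cM[OF cd\<phi>[of m]] bM[OF cd\<phi>[of m]] by (auto intro: diff2)
  have b1: "(\<lambda>x. g x $ k) \<in> borel_measurable ?M" "AE x in ?M. \<bar>g x $ k\<bar> \<le> C" using cM[OF contg] Cg by auto
  have b2: "\<psi> \<in> borel_measurable ?M" "AE x in ?M. \<bar>\<psi> x\<bar> \<le> C" using cM[OF cont] C(3) by auto
  have A1: "(\<lambda>m. LINT x|?M. (\<phi> m x - u x) * g x $ k) \<longlonglongrightarrow> 0"
    by (rule M.L2_limit_imp_L1[OF f1 l1[of "cball 0 R", unfolded rs] b1]) simp
  have A1i: "integrable ?M (\<lambda>x. (\<phi> m x - u x) * g x $ k)" for m
    by (rule M.integrable_L2_mult_bounded[OF f1 b1])
  have A2: "(\<lambda>m. LINT x|?M. (partial_deriv k (\<phi> m) x - weak_pderiv \<Omega> k u x) * \<psi> x) \<longlonglongrightarrow> 0"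
    by (rule M.L2_limit_imp_L1[OF f2 l2[of "cball 0 R", unfolded rs] b2]) simp
  have A2i: "integrable ?M (\<lambda>x. (partial_deriv k (\<phi> m) x - weak_pderiv \<Omega> k u x) * \<psi> x)" for m
    by (rule M.integrable_L2_mult_bounded[OF f2 b2])
  have \<nu>1: "AE q in S. \<bar>\<nu> q $ k * \<psi> q\<bar> \<le> C"
  proof -
    have "AE q in S. outer_unit_normal_at \<Omega> q (\<nu> q)" using dom by (simp add: outer_unit_normal_def)
    then show ?thesis
    proof eventually_elim
      case (elim q)
      then have "\<bar>\<nu> q $ k\<bar> \<le> 1" using component_le_norm_cart[of "\<nu> q" k] by (simp add: outer_unit_normal_at_def)
      then have "\<bar>\<nu> q $ k\<bar> * \<bar>\<psi> q\<bar> \<le> 1 * C" using C(3) by (intro mult_mono) auto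
      then show ?case by (simp add: abs_mult)
    qed
  qed
  have \<nu>m: "(\<lambda>q. \<nu> q $ k) \<in> borel_measurable S"
  proof -
    have [measurable]: "\<nu> \<in> borel_measurable S" using dom by (simp add: outer_unit_normal_def)
    have "(\<lambda>q. \<nu> q \<bullet> axis k 1) \<in> borel_measurable S" by measurable
    then show ?thesis by (simp add: inner_axis)
  qed
  have mS: "h \<in> borel_measurable S" if "continuous_on UNIV h" for h :: "real^'n \<Rightarrow> real"
    using borel_measurable_continuous_onI[OF that] by (simp add: measurable_cong_sets[OF sS refl])
  have iS: "integrable S (\<lambda>q. (\<phi> m q)\<^sup>2)" for m
  proof -
    have "compact (\<phi> m ` frontier \<Omega>)"
      by (intro compact_continuous_image continuous_on_subset[OF c\<phi>] compact_frontier_exterior[OF dom(1)]) auto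
    then obtain B where B: "\<And>x. x \<in> frontier \<Omega> \<Longrightarrow> \<bar>\<phi> m x\<bar> \<le> B"
      by (force dest!: compact_imp_bounded simp: bounded_iff)
    have "AE q in S. norm ((\<phi> m q)\<^sup>2) \<le> B\<^sup>2"
      using surface_AE_frontier[OF dom(2)]
    proof eventually_elim
      case (elim q)
      have "\<bar>\<phi> m q\<bar>\<^sup>2 \<le> B\<^sup>2" using B[OF elim] by (rule power_mono) simp
      then show ?case by simp
    qed
    then show ?thesis using mS[OF c\<phi>[of m]] by (intro S.integrable_const_bound[of _ "B\<^sup>2"]) auto
  qed
  have f3: "(\<lambda>x. \<phi> m x - T x) \<in> borel_measurable S" "integrable S (\<lambda>x. (\<phi> m x - T x)\<^sup>2)" for m
    using T mS[OF c\<phi>[of m]] iS[of m] by (auto intro: diff2)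
  have b3: "(\<lambda>q. \<nu> q $ k * \<psi> q) \<in> borel_measurable S" using \<nu>m mS[OF cont] by measurable
  have A3: "(\<lambda>m. LINT q|S. (\<phi> m q - T q) * (\<nu> q $ k * \<psi> q)) \<longlonglongrightarrow> 0"
    by (rule S.L2_limit_imp_L1[OF f3 l3 b3 \<nu>1])
  have A3i: "integrable S (\<lambda>q. (\<phi> m q - T q) * (\<nu> q $ k * \<psi> q))" for m
    by (rule S.integrable_L2_mult_bounded[OF f3 b3 \<nu>1])
  have gm: "(LINT x|?M. partial_deriv k (\<phi> m) x * \<psi> x + \<phi> m x * g x $ k) = (LINT q|S. \<phi> m q * (\<nu> q $ k * \<psi> q))" for m
  proof -
    have "(LINT x|lborel. indicat_real \<Omega> x * (\<phi> m x *\<^sub>R g x + \<psi> x *\<^sub>R (\<chi> i. partial_deriv i (\<phi> m) x)) $ k)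
      = (LINT q|S. (\<phi> m q * \<psi> q) * \<nu> q $ k)"
      by (rule gauss_exterior[OF dom C1_grad_mult[OF smooth_fun_C1_grad[OF sm] \<psi>(1)], where R=R])
         (use \<psi>(2) in \<open>simp add: supp_in_def\<close>)
    moreover have "(LINT x|lborel. indicat_real \<Omega> x * (\<phi> m x *\<^sub>R g x + \<psi> x *\<^sub>R (\<chi> i. partial_deriv i (\<phi> m) x)) $ k)
       = (LINT x:\<Omega>|lebesgue. partial_deriv k (\<phi> m) x * \<psi> x + \<phi> m x * g x $ k)"
    proof -
      have "(\<lambda>x. partial_deriv k (\<phi> m) x * \<psi> x + \<phi> m x * g x $ k) \<in> borel_measurable borel"
        by (intro borel_measurable_continuous_onI continuous_intros cd\<phi> cont c\<phi> contg)
      then have "(\<lambda>x. indicat_real \<Omega> x *\<^sub>R (partial_deriv k (\<phi> m) x * \<psi> x + \<phi> m x * g x $ k)) \<in> borel_measurable lborel"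
        using op by (intro borel_measurable_scaleR borel_measurable_indicator) auto
      from integral_completion[OF this] show ?thesis
        by (simp add: set_lebesgue_integral_def algebra_simps)
    qed
    moreover have "(LINT x:\<Omega>|lebesgue. partial_deriv k (\<phi> m) x * \<psi> x + \<phi> m x * g x $ k)
       = (LINT x|?M. partial_deriv k (\<phi> m) x * \<psi> x + \<phi> m x * g x $ k)"
      using \<psi>(2) C1_grad_supp[OF \<psi>] \<Omega> by (intro supp_set_integral) (auto simp: supp_in_def)
    ultimately show ?thesis by (simp add: mult_ac)
  qed
  have U1: "integrable ?M (\<lambda>x. weak_pderiv \<Omega> k u x * \<psi> x)" "integrable ?M (\<lambda>x. u x * g x $ k)"
    by (rule M.integrable_L2_mult_bounded[OF sq[OF u(2)] b2]) (rule M.integrable_L2_mult_bounded[OF sq[OF u(1)] b1])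
  have U2: "integrable S (\<lambda>q. T q * (\<nu> q $ k * \<psi> q))"
    by (rule S.integrable_L2_mult_bounded[OF T b3 \<nu>1])
  have "(LINT x|?M. weak_pderiv \<Omega> k u x * \<psi> x) + (LINT x|?M. u x * g x $ k) = (LINT q|S. T q * (\<nu> q $ k * \<psi> q))"
  proof -
    let ?L = "(LINT x|?M. weak_pderiv \<Omega> k u x * \<psi> x) + (LINT x|?M. u x * g x $ k)"
    have e: "(LINT x|?M. partial_deriv k (\<phi> m) x * \<psi> x + \<phi> m x * g x $ k)
       = (LINT x|?M. (partial_deriv k (\<phi> m) x - weak_pderiv \<Omega> k u x) * \<psi> x) + (LINT x|?M. (\<phi> m x - u x) * g x $ k) + ?L" for m
    proof -
      have "(LINT x|?M. partial_deriv k (\<phi> m) x * \<psi> x + \<phi> m x * g x $ k)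
        = (LINT x|?M. ((partial_deriv k (\<phi> m) x - weak_pderiv \<Omega> k u x) * \<psi> x + (\<phi> m x - u x) * g x $ k)
            + (weak_pderiv \<Omega> k u x * \<psi> x + u x * g x $ k))"
        by (intro Bochner_Integration.integral_cong refl) (simp add: algebra_simps)
      then show ?thesis
        by (simp only: Bochner_Integration.integral_add[OF Bochner_Integration.integrable_add[OF A2i A1i] Bochner_Integration.integrable_add[OF U1]]
          Bochner_Integration.integral_add[OF A2i A1i] Bochner_Integration.integral_add[OF U1])
    qed
    have e': "(LINT q|S. \<phi> m q * (\<nu> q $ k * \<psi> q)) = (LINT q|S. (\<phi> m q - T q) * (\<nu> q $ k * \<psi> q)) + (LINT q|S. T q * (\<nu> q $ k * \<psi> q))" for m
      by (subst Bochner_Integration.integral_add[OF A3i U2, symmetric]) (simp add: algebra_simps)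
    have "(\<lambda>m. LINT q|S. \<phi> m q * (\<nu> q $ k * \<psi> q)) \<longlonglongrightarrow> 0 + (LINT q|S. T q * (\<nu> q $ k * \<psi> q))"
      unfolding e' by (intro tendsto_intros A3)
    moreover have "(\<lambda>m. LINT q|S. \<phi> m q * (\<nu> q $ k * \<psi> q)) \<longlonglongrightarrow> 0 + 0 + ?L"
      unfolding gm[symmetric] e by (intro tendsto_intros A1 A2)
    ultimately show ?thesis using LIMSEQ_unique by fastforce
  qed
  moreover have "(LINT x:\<Omega>|lebesgue. weak_pderiv \<Omega> k u x * \<psi> x) = (LINT x|?M. weak_pderiv \<Omega> k u x * \<psi> x)"
    "(LINT x:\<Omega>|lebesgue. u x * g x $ k) = (LINT x|?M. u x * g x $ k)"
    using \<psi>(2) C1_grad_supp[OF \<psi>] \<Omega> by (intro supp_set_integral; auto simp: supp_in_def)+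
  ultimately show ?thesis by (simp add: mult.assoc)
qed

section \<open>Radial kernels\<close>

definition dlt :: "'n \<Rightarrow> 'n \<Rightarrow> real" where "dlt i j = (if i = j then 1 else 0)"

lemma dlt_same [simp]: "dlt i i = 1" by (simp add: dlt_def)

lemma dlt_commute: "dlt i j = dlt j i" by (simp add: dlt_def)

lemma dlt_sum [simp]: "(\<Sum>k\<in>(UNIV::'n::finite set). dlt i k * f k) = f i"
proof -
  have "(\<Sum>k\<in>(UNIV::'n set). dlt i k * f k) = (\<Sum>k\<in>UNIV. if i = k then f k else 0)"
    by (intro sum.cong) (auto simp: dlt_def)
  then show ?thesis by simp
qed

lemma axis_nth_dlt: "axis i 1 $ k = dlt i k" by (simp add: axis_def dlt_def)

text \<open>With \<open>\<Psi> z = \<theta> (z \<bullet> z)\<close>, the functions below are the tensor \<open>\<partial>\<^sub>i\<partial>\<^sub>j\<Psi> - \<delta>\<^sub>i\<^sub>j \<Delta>\<Psi>\<close>, the derivative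
  \<open>\<partial>\<^sub>i (- \<Delta>\<Psi>)\<close> and \<open>\<Delta>\<^sup>2\<Psi>\<close>, with their derivatives, written in terms of \<open>F0 = \<theta>'\<close> and its
  derivatives \<open>F1\<close>, \<open>F2\<close>, \<open>F3\<close>.\<close>

definition kphi :: "(real \<Rightarrow> real) \<Rightarrow> (real \<Rightarrow> real) \<Rightarrow> 'n \<Rightarrow> 'n \<Rightarrow> real^'n::finite \<Rightarrow> real" where
  "kphi F0 F1 i j z = 4 * z $ i * z $ j * F1 (z \<bullet> z)
     + dlt i j * ((2 - 2 * real CARD('n)) * F0 (z \<bullet> z) - 4 * (z \<bullet> z) * F1 (z \<bullet> z))"

definition dphi :: "(real \<Rightarrow> real) \<Rightarrow> (real \<Rightarrow> real) \<Rightarrow> 'n \<Rightarrow> 'n \<Rightarrow> 'n \<Rightarrow> real^'n::finite \<Rightarrow> real" where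
  "dphi F1 F2 i j k z = 4 * (dlt i k * z $ j + dlt j k * z $ i) * F1 (z \<bullet> z)
     + 8 * z $ i * z $ j * z $ k * F2 (z \<bullet> z)
     - dlt i j * z $ k * (4 * (real CARD('n) + 1) * F1 (z \<bullet> z) + 8 * (z \<bullet> z) * F2 (z \<bullet> z))"

definition ddphi :: "(real \<Rightarrow> real) \<Rightarrow> (real \<Rightarrow> real) \<Rightarrow> (real \<Rightarrow> real) \<Rightarrow> 'n \<Rightarrow> 'n \<Rightarrow> 'n \<Rightarrow> 'n \<Rightarrow> real^'n::finite \<Rightarrow> real" where
  "ddphi F1 F2 F3 i j k l z =
     4 * (dlt i k * dlt j l + dlt j k * dlt i l) * F1 (z \<bullet> z)
     + 8 * (dlt i k * z $ j + dlt j k * z $ i) * z $ l * F2 (z \<bullet> z)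
     + 8 * (dlt i l * z $ j * z $ k + dlt j l * z $ i * z $ k + dlt k l * z $ i * z $ j) * F2 (z \<bullet> z)
     + 16 * z $ i * z $ j * z $ k * z $ l * F3 (z \<bullet> z)
     - dlt i j * dlt k l * (4 * (real CARD('n) + 1) * F1 (z \<bullet> z) + 8 * (z \<bullet> z) * F2 (z \<bullet> z))
     - dlt i j * z $ k * z $ l * (8 * (real CARD('n) + 3) * F2 (z \<bullet> z) + 16 * (z \<bullet> z) * F3 (z \<bullet> z))"

definition kQ :: "(real \<Rightarrow> real) \<Rightarrow> (real \<Rightarrow> real) \<Rightarrow> 'n \<Rightarrow> real^'n::finite \<Rightarrow> real" where
  "kQ F1 F2 i z = - 2 * z $ i * ((4 + 2 * real CARD('n)) * F1 (z \<bullet> z) + 4 * (z \<bullet> z) * F2 (z \<bullet> z))"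

definition dQ :: "(real \<Rightarrow> real) \<Rightarrow> (real \<Rightarrow> real) \<Rightarrow> (real \<Rightarrow> real) \<Rightarrow> 'n \<Rightarrow> 'n \<Rightarrow> real^'n::finite \<Rightarrow> real" where
  "dQ F1 F2 F3 i l z = - 2 * dlt i l * ((4 + 2 * real CARD('n)) * F1 (z \<bullet> z) + 4 * (z \<bullet> z) * F2 (z \<bullet> z))
     - 4 * z $ i * z $ l * ((8 + 2 * real CARD('n)) * F2 (z \<bullet> z) + 4 * (z \<bullet> z) * F3 (z \<bullet> z))"

definition kK :: "(real \<Rightarrow> real) \<Rightarrow> (real \<Rightarrow> real) \<Rightarrow> (real \<Rightarrow> real) \<Rightarrow> real^'n::finite \<Rightarrow> real" where
  "kK F1 F2 F3 z = 4 * real CARD('n) * (real CARD('n) + 2) * F1 (z \<bullet> z)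
     + 16 * (real CARD('n) + 2) * (z \<bullet> z) * F2 (z \<bullet> z) + 16 * (z \<bullet> z)\<^sup>2 * F3 (z \<bullet> z)"

text \<open>In terms of \<Psi> this is the cancellation of the i-th derivative of \<Delta>\<Psi>
  with itself. It is what removes the pressure from the Green identity.\<close>

lemma dphi_div: "(\<Sum>j\<in>UNIV. dphi F1 F2 i j j z) = 0"
proof -
  let ?n = "real CARD('a)"
  let ?F1 = "F1 (z \<bullet> z)" and ?F2 = "F2 (z \<bullet> z)"
  have "dphi F1 F2 i j j z = dlt i j * (z $ j * (4 * ?F1 - (4 * (?n + 1) * ?F1 + 8 * (z \<bullet> z) * ?F2)))
     + 4 * z $ i * ?F1 + 8 * z $ i * ?F2 * (z $ j * z $ j)" for j
    by (simp add: dphi_def algebra_simps)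
  then have "(\<Sum>j\<in>UNIV. dphi F1 F2 i j j z) = z $ i * (4 * ?F1 - (4 * (?n + 1) * ?F1 + 8 * (z \<bullet> z) * ?F2))
     + ?n * (4 * z $ i * ?F1) + 8 * z $ i * ?F2 * (z \<bullet> z)"
    by (simp add: sum.distrib sum_distrib_left[symmetric] inner_vec_def)
  then show ?thesis by (simp add: algebra_simps)
qed

text \<open>In terms of \<Psi>: minus the Laplacian of the tensor is the identity matrix times the
  bi-Laplacian of \<Psi>, plus the j-th derivative of the kernel pressure \<open>kQ\<close>.\<close>

lemma ddphi_laplace:
  "- (\<Sum>k\<in>UNIV. ddphi F1 F2 F3 i j k k z) = dlt i j * kK F1 F2 F3 z + dQ F1 F2 F3 i j z"
proof -
  let ?n = "real CARD('a)" and ?t = "z \<bullet> z"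
  let ?F1 = "F1 ?t" and ?F2 = "F2 ?t" and ?F3 = "F3 ?t"
  have "ddphi F1 F2 F3 i j k k z = dlt i k * (8 * dlt j k * ?F1 + 16 * z $ j * z $ k * ?F2)
     + dlt j k * (16 * z $ i * z $ k * ?F2) 
     + (8 * z $ i * z $ j * ?F2 - dlt i j * (4 * (?n + 1) * ?F1 + 8 * ?t * ?F2))
     + (16 * z $ i * z $ j * ?F3 - dlt i j * (8 * (?n + 3) * ?F2 + 16 * ?t * ?F3)) * (z $ k * z $ k)" for k
    by (simp add: ddphi_def algebra_simps)
  then have "(\<Sum>k\<in>UNIV. ddphi F1 F2 F3 i j k k z) = 8 * dlt j i * ?F1 + 16 * z $ j * z $ i * ?F2
     + 16 * z $ i * z $ j * ?F2
     + ?n * (8 * z $ i * z $ j * ?F2 - dlt i j * (4 * (?n + 1) * ?F1 + 8 * ?t * ?F2))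
     + (16 * z $ i * z $ j * ?F3 - dlt i j * (8 * (?n + 3) * ?F2 + 16 * ?t * ?F3)) * ?t"
    by (simp only: sum.distrib sum_distrib_left[symmetric] inner_vec_def dlt_sum inner_real_def sum_constant)
  then show ?thesis unfolding kK_def dQ_def dlt_commute[of j i] by (simp add: power2_eq_square algebra_simps)
qed

lemma GDERIV_nth: "GDERIV (\<lambda>z. z $ i) z :> axis i 1"
  unfolding gderiv_def by (simp add: inner_axis bounded_linear_imp_has_derivative bounded_linear_vec_nth)

lemma GDERIV_radial:
  assumes "DERIV F (z \<bullet> z) :> F'"
  shows "GDERIV (\<lambda>z. F (z \<bullet> z)) z :> F' *\<^sub>R (2 *\<^sub>R z)"
proof (rule GDERIV_DERIV_compose[where f="\<lambda>z. z \<bullet> z", OF _ assms])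
  show "GDERIV (\<lambda>z. z \<bullet> z) z :> 2 *\<^sub>R z"
    unfolding gderiv_def by (auto intro!: derivative_eq_intros simp: inner_commute)
qed

lemma GDERIV_sq: "GDERIV (\<lambda>z. z \<bullet> z) z :> 2 *\<^sub>R z"
  unfolding gderiv_def by (auto intro!: derivative_eq_intros simp: inner_commute)

lemma GDERIV_kphi:
  assumes "DERIV F0 (z \<bullet> z) :> F1 (z \<bullet> z)" "DERIV F1 (z \<bullet> z) :> F2 (z \<bullet> z)"
  shows "GDERIV (kphi F0 F1 i j) z :> (\<chi> k. dphi F1 F2 i j k z)"
  unfolding kphi_def[abs_def]
  by (rule GDERIV_subst, (rule GDERIV_add GDERIV_diff GDERIV_mult GDERIV_const GDERIV_nth GDERIV_sq GDERIV_radial assms)+)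
     (simp add: vec_eq_iff dphi_def axis_nth_dlt algebra_simps)

lemma GDERIV_dphi:
  assumes "DERIV F1 (z \<bullet> z) :> F2 (z \<bullet> z)" "DERIV F2 (z \<bullet> z) :> F3 (z \<bullet> z)"
  shows "GDERIV (dphi F1 F2 i j k) z :> (\<chi> l. ddphi F1 F2 F3 i j k l z)"
  unfolding dphi_def[abs_def]
  by (rule GDERIV_subst, (rule GDERIV_add GDERIV_diff GDERIV_mult GDERIV_const GDERIV_nth GDERIV_sq GDERIV_radial assms)+)
     (simp add: vec_eq_iff ddphi_def axis_nth_dlt algebra_simps)

lemma GDERIV_kQ:
  assumes "DERIV F1 (z \<bullet> z) :> F2 (z \<bullet> z)" "DERIV F2 (z \<bullet> z) :> F3 (z \<bullet> z)"
  shows "GDERIV (kQ F1 F2 i) z :> (\<chi> l. dQ F1 F2 F3 i l z)"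
  unfolding kQ_def[abs_def]
  by (rule GDERIV_subst, (rule GDERIV_add GDERIV_diff GDERIV_mult GDERIV_const GDERIV_nth GDERIV_sq GDERIV_radial assms)+)
     (simp add: vec_eq_iff dQ_def axis_nth_dlt algebra_simps)

text \<open>Profiles that vanish for large arguments and are regular at \<open>0\<close>, with the size of the singular
  profile \<open>F1 t = B t\<^bsup>-d/2\<^esup>\<close>. The constant \<open>B\<close> is the only quantity that enters the estimates, so they are
  uniform in the regularisation.\<close>

definition kchain :: "real \<Rightarrow> real \<Rightarrow> (real \<Rightarrow> real) \<Rightarrow> (real \<Rightarrow> real) \<Rightarrow> (real \<Rightarrow> real) \<Rightarrow> (real \<Rightarrow> real) \<Rightarrow> bool" where
  "kchain d B F0 F1 F2 F3 \<longleftrightarrow>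
     (\<forall>t\<ge>0. DERIV F0 t :> F1 t \<and> DERIV F1 t :> F2 t \<and> DERIV F2 t :> F3 t) \<and> continuous_on {0..} F3 \<and>
     (\<forall>t>0. \<bar>F1 t\<bar> \<le> B * t powr (- d / 2) \<and> \<bar>F2 t\<bar> \<le> B * t powr (- d / 2 - 1) \<and> \<bar>F3 t\<bar> \<le> B * t powr (- d / 2 - 2)) \<and>
     (\<exists>T. \<forall>t\<ge>T. F0 t = 0 \<and> F1 t = 0 \<and> F2 t = 0)"

lemma kchain_C1:
  assumes "kchain d B F0 F1 F2 F3"
  shows "C1_grad (kphi F0 F1 i j) (\<lambda>z::real^'n. \<chi> k. dphi F1 F2 i j k z)"
    "C1_grad (dphi F1 F2 i j k) (\<lambda>z::real^'n. \<chi> l. ddphi F1 F2 F3 i j k l z)"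
    "C1_grad (kQ F1 F2 i) (\<lambda>z::real^'n. \<chi> l. dQ F1 F2 F3 i l z)"
proof -
  have D: "DERIV F0 t :> F1 t" "DERIV F1 t :> F2 t" "DERIV F2 t :> F3 t" if "0 \<le> t" for t
    using assms that by (auto simp: kchain_def)
  have c3: "continuous_on {0..} F3" using assms by (simp add: kchain_def)
  have c1: "continuous_on {0..} F1" and c2: "continuous_on {0..} F2"
    using D by (auto intro!: continuous_at_imp_continuous_on DERIV_isCont)
  have r: "continuous_on UNIV (\<lambda>z::real^'n. F (z \<bullet> z))" if "continuous_on {0..} F" for F :: "real \<Rightarrow> real"
    by (rule continuous_on_compose2[OF that]) (auto intro!: continuous_intros)
  note r = r[OF c1] r[OF c2] r[OF c3]
  show "C1_grad (kphi F0 F1 i j) (\<lambda>z::real^'n. \<chi> k. dphi F1 F2 i j k z)"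
    unfolding C1_grad_def dphi_def
    by (intro conjI allI GDERIV_kphi[unfolded dphi_def] D inner_ge_zero continuous_on_vec_lambda continuous_intros r)
  show "C1_grad (dphi F1 F2 i j k) (\<lambda>z::real^'n. \<chi> l. ddphi F1 F2 F3 i j k l z)"
    unfolding C1_grad_def ddphi_def
    by (intro conjI allI GDERIV_dphi[unfolded ddphi_def] D inner_ge_zero continuous_on_vec_lambda continuous_intros r)
  show "C1_grad (kQ F1 F2 i) (\<lambda>z::real^'n. \<chi> l. dQ F1 F2 F3 i l z)"
    unfolding C1_grad_def dQ_def
    by (intro conjI allI GDERIV_kQ[unfolded dQ_def] D inner_ge_zero continuous_on_vec_lambda continuous_intros r)
qed

lemma kchain_B_nonneg: "kchain d B F0 F1 F2 F3 \<Longrightarrow> 0 \<le> B"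
proof -
  assume "kchain d B F0 F1 F2 F3"
  then have "\<bar>F1 1\<bar> \<le> B * 1 powr (- d / 2)" unfolding kchain_def by (metis zero_less_one)
  then show ?thesis by simp
qed

section \<open>Size of the kernels and of their differences\<close>

lemma inner_powr_half: "z \<noteq> 0 \<Longrightarrow> (z \<bullet> z) powr (- d / 2) = norm z powr (- d)"
  by (simp add: power2_norm_eq_inner[symmetric] powr_power[symmetric] powr_powr flip: powr_numeral)

text \<open>Weighted with the matching power of z \<bullet> z, the three profiles have the same
  homogeneity -d, so that one quantity bounds all monomials of the kernels.\<close>

lemma kchain_bounds:
  assumes "kchain d B F0 F1 F2 F3" "z \<noteq> 0"
  shows "\<bar>F1 (z \<bullet> z)\<bar> \<le> B * norm z powr (- d)"
    "\<bar>(z \<bullet> z) * F2 (z \<bullet> z)\<bar> \<le> B * norm z powr (- d)"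
    "\<bar>(z \<bullet> z)\<^sup>2 * F3 (z \<bullet> z)\<bar> \<le> B * norm z powr (- d)"
proof -
  have t: "0 < z \<bullet> z" using assms(2) by simp
  note p = inner_powr_half[OF assms(2), of d]
  have F: "\<bar>F1 (z \<bullet> z)\<bar> \<le> B * (z \<bullet> z) powr (- d / 2)" "\<bar>F2 (z \<bullet> z)\<bar> \<le> B * (z \<bullet> z) powr (- d / 2 - 1)"
    "\<bar>F3 (z \<bullet> z)\<bar> \<le> B * (z \<bullet> z) powr (- d / 2 - 2)"
    using assms(1) t unfolding kchain_def by blast+
  show "\<bar>F1 (z \<bullet> z)\<bar> \<le> B * norm z powr (- d)" using F(1) p by simp
  have "(z \<bullet> z) * \<bar>F2 (z \<bullet> z)\<bar> \<le> (z \<bullet> z) * (B * (z \<bullet> z) powr (- d / 2 - 1))"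
    using F(2) t by (intro mult_left_mono) auto
  also have "\<dots> = B * (z \<bullet> z) powr (- d / 2)"
    using t by (simp add: powr_diff)
  finally show "\<bar>(z \<bullet> z) * F2 (z \<bullet> z)\<bar> \<le> B * norm z powr (- d)" using p by (simp add: abs_mult)
  have "(z \<bullet> z)\<^sup>2 * \<bar>F3 (z \<bullet> z)\<bar> \<le> (z \<bullet> z)\<^sup>2 * (B * (z \<bullet> z) powr (- d / 2 - 2))"
    using F(3) t by (intro mult_left_mono) auto
  also have "\<dots> = B * (z \<bullet> z) powr (- d / 2)"
    using t by (simp add: powr_diff)
  finally show "\<bar>(z \<bullet> z)\<^sup>2 * F3 (z \<bullet> z)\<bar> \<le> B * norm z powr (- d)" using p by (simp add: abs_mult)
qed

lemma abs_mult_le1: "\<bar>a\<bar> \<le> 1 \<Longrightarrow> \<bar>b\<bar> \<le> P \<Longrightarrow> \<bar>a * b\<bar> \<le> (P::real)"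
  using mult_mono[of "\<bar>a\<bar>" 1 "\<bar>b\<bar>" P] by (simp add: abs_mult)

lemma abs_dlt: "\<bar>dlt i j\<bar> \<le> 1" by (simp add: dlt_def)

text \<open>With z = r u and |u i| \<le> 1 each kernel is a power of r times a sum of monomials,
  each of size at most P = B * r powr (-n), up to a factor n in some. The constants are the sums of
  the absolute values of the coefficients.\<close>

lemma kernel_bounds:
  fixes z :: "real^'n::finite"
  assumes "kchain (real CARD('n)) B F0 F1 F2 F3" "z \<noteq> 0"
  shows "\<bar>dphi F1 F2 i j k z\<bar> \<le> (4 * real CARD('n) + 28) * (B * norm z powr (1 - real CARD('n)))"
    "\<bar>ddphi F1 F2 F3 i j k l z\<bar> \<le> (12 * real CARD('n) + 116) * (B * norm z powr (- real CARD('n)))"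
    "\<bar>dQ F1 F2 F3 i l z\<bar> \<le> (12 * real CARD('n) + 64) * (B * norm z powr (- real CARD('n)))"
proof -
  let ?n = "real CARD('n)"
  define r where "r = norm z"
  have r: "0 < r" using assms(2) by (simp add: r_def)
  define P where "P = B * r powr (- ?n)"
  define u where "u i = z $ i / r" for i
  have z: "z $ i = r * u i" for i using r by (simp add: u_def)
  have u1: "\<bar>u i\<bar> \<le> 1" for i using r component_le_norm_cart[of z i] by (simp add: u_def r_def)
  have zz: "z \<bullet> z = r\<^sup>2" by (simp add: r_def power2_norm_eq_inner)
  define f1 where "f1 = F1 (z \<bullet> z)"
  define f2 where "f2 = (z \<bullet> z) * F2 (z \<bullet> z)"
  define f3 where "f3 = (z \<bullet> z)\<^sup>2 * F3 (z \<bullet> z)"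
  have b: "\<bar>f1\<bar> \<le> P" "\<bar>f2\<bar> \<le> P" "\<bar>f3\<bar> \<le> P"
    using kchain_bounds[OF assms] by (auto simp: f1_def f2_def f3_def P_def r_def)
  have F2: "F2 (z \<bullet> z) = f2 / r\<^sup>2" and F3: "F3 (z \<bullet> z) = f3 / (r\<^sup>2)\<^sup>2"
    using r by (simp_all add: f2_def f3_def zz)
  have nb: "\<bar>?n * w\<bar> \<le> ?n * P" if "\<bar>w\<bar> \<le> P" for w using that by (simp add: abs_mult)
  note le1 = abs_mult_le1[OF abs_dlt] abs_mult_le1[OF u1] u1 b abs_dlt
  have "dphi F1 F2 i j k z = r * (4 * (dlt i k * (u j * f1)) + 4 * (dlt j k * (u i * f1)) + 8 * (u i * (u j * (u k * f2)))
      - 4 * (?n * (dlt i j * (u k * f1))) - 4 * (dlt i j * (u k * f1)) - 8 * (dlt i j * (u k * f2)))"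
    unfolding dphi_def F2 z f1_def[symmetric] unfolding zz using r by (simp add: field_simps power2_eq_square)
  moreover have "\<bar>4 * (dlt i k * (u j * f1)) + 4 * (dlt j k * (u i * f1)) + 8 * (u i * (u j * (u k * f2)))
      - 4 * (?n * (dlt i j * (u k * f1))) - 4 * (dlt i j * (u k * f1)) - 8 * (dlt i j * (u k * f2))\<bar> \<le> (4 * ?n + 28) * P"
  proof -
    have L: "\<bar>dlt i k * (u j * f1)\<bar> \<le> P" "\<bar>dlt j k * (u i * f1)\<bar> \<le> P" "\<bar>u i * (u j * (u k * f2))\<bar> \<le> P"
       "\<bar>?n * (dlt i j * (u k * f1))\<bar> \<le> ?n * P" "\<bar>dlt i j * (u k * f1)\<bar> \<le> P" "\<bar>dlt i j * (u k * f2)\<bar> \<le> P"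
      by (intro le1 nb)+
    show ?thesis using L[THEN abs_le_D1] L[THEN abs_le_D2] unfolding distrib_right by (intro abs_leI; linarith)
  qed
  ultimately have "\<bar>dphi F1 F2 i j k z\<bar> \<le> r * ((4 * ?n + 28) * P)" using r by (simp add: abs_mult)
  also have "r * ((4 * ?n + 28) * P) = (4 * ?n + 28) * (B * r powr (1 - ?n))"
  proof -
    have "r * r powr (- ?n) = r powr (1 - ?n)" using r by (simp add: powr_diff powr_minus_divide)
    then show ?thesis unfolding P_def by (metis mult.assoc mult.left_commute)
  qed
  finally show "\<bar>dphi F1 F2 i j k z\<bar> \<le> (4 * ?n + 28) * (B * norm z powr (1 - ?n))" by (simp only: r_def)
  have e: "ddphi F1 F2 F3 i j k l z = 4 * (dlt i k * (dlt j l * f1)) + 4 * (dlt j k * (dlt i l * f1))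
      + 8 * (dlt i k * (u j * (u l * f2))) + 8 * (dlt j k * (u i * (u l * f2)))
      + 8 * (dlt i l * (u j * (u k * f2))) + 8 * (dlt j l * (u i * (u k * f2))) + 8 * (dlt k l * (u i * (u j * f2)))
      + 16 * (u i * (u j * (u k * (u l * f3))))
      - 4 * (?n * (dlt i j * (dlt k l * f1))) - 4 * (dlt i j * (dlt k l * f1)) - 8 * (dlt i j * (dlt k l * f2))
      - 8 * (?n * (dlt i j * (u k * (u l * f2)))) - 24 * (dlt i j * (u k * (u l * f2))) - 16 * (dlt i j * (u k * (u l * f3)))"
    unfolding ddphi_def F2 F3 z f1_def[symmetric] unfolding zz using r by (simp add: field_simps power2_eq_square)
  have L: "\<bar>dlt i k * (dlt j l * f1)\<bar> \<le> P" "\<bar>dlt j k * (dlt i l * f1)\<bar> \<le> P"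
      "\<bar>dlt i k * (u j * (u l * f2))\<bar> \<le> P" "\<bar>dlt j k * (u i * (u l * f2))\<bar> \<le> P"
      "\<bar>dlt i l * (u j * (u k * f2))\<bar> \<le> P" "\<bar>dlt j l * (u i * (u k * f2))\<bar> \<le> P" "\<bar>dlt k l * (u i * (u j * f2))\<bar> \<le> P"
      "\<bar>u i * (u j * (u k * (u l * f3)))\<bar> \<le> P"
      "\<bar>?n * (dlt i j * (dlt k l * f1))\<bar> \<le> ?n * P" "\<bar>dlt i j * (dlt k l * f1)\<bar> \<le> P" "\<bar>dlt i j * (dlt k l * f2)\<bar> \<le> P"
      "\<bar>?n * (dlt i j * (u k * (u l * f2)))\<bar> \<le> ?n * P" "\<bar>dlt i j * (u k * (u l * f2))\<bar> \<le> P" "\<bar>dlt i j * (u k * (u l * f3))\<bar> \<le> P"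
    by (intro le1 nb)+
  have "\<bar>ddphi F1 F2 F3 i j k l z\<bar> \<le> (12 * ?n + 116) * P"
    unfolding e using L[THEN abs_le_D1] L[THEN abs_le_D2] unfolding distrib_right by (intro abs_leI; linarith)
  then show "\<bar>ddphi F1 F2 F3 i j k l z\<bar> \<le> (12 * ?n + 116) * (B * norm z powr (- ?n))" by (simp only: P_def r_def)
  have e: "dQ F1 F2 F3 i l z = - 8 * (dlt i l * f1) - 4 * (?n * (dlt i l * f1)) - 8 * (dlt i l * f2)
      - 32 * (u i * (u l * f2)) - 8 * (?n * (u i * (u l * f2))) - 16 * (u i * (u l * f3))"
    unfolding dQ_def F2 F3 z f1_def[symmetric] unfolding zz using r by (simp add: field_simps power2_eq_square)
  have L: "\<bar>dlt i l * f1\<bar> \<le> P" "\<bar>?n * (dlt i l * f1)\<bar> \<le> ?n * P" "\<bar>dlt i l * f2\<bar> \<le> P"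
      "\<bar>u i * (u l * f2)\<bar> \<le> P" "\<bar>?n * (u i * (u l * f2))\<bar> \<le> ?n * P" "\<bar>u i * (u l * f3)\<bar> \<le> P"
    by (intro le1 nb)+
  have "\<bar>dQ F1 F2 F3 i l z\<bar> \<le> (12 * ?n + 64) * P"
    unfolding e using L[THEN abs_le_D1] L[THEN abs_le_D2] unfolding distrib_right by (intro abs_leI; linarith)
  then show "\<bar>dQ F1 F2 F3 i l z\<bar> \<le> (12 * ?n + 64) * (B * norm z powr (- ?n))" by (simp only: P_def r_def)
qed

lemma norm_vec_le:
  fixes f :: "'n::finite \<Rightarrow> real"
  assumes "\<And>k. \<bar>f k\<bar> \<le> M"
  shows "norm (\<chi> k. f k) \<le> real CARD('n) * M"
proof -
  have "norm (\<chi> k. f k) \<le> (\<Sum>k\<in>UNIV. \<bar>f k\<bar>)" using norm_le_l1_cart[of "\<chi> k. f k"] by simp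
  also have "\<dots> \<le> real CARD('n) * M" using assms by (intro sum_bounded_above)
  finally show ?thesis .
qed

lemma GDERIV_segment_bound:
  fixes f :: "'a::euclidean_space \<Rightarrow> real"
  assumes "\<And>x. x \<in> closed_segment a b \<Longrightarrow> GDERIV f x :> g x" "\<And>x. x \<in> closed_segment a b \<Longrightarrow> norm (g x) \<le> M"
  shows "\<bar>f a - f b\<bar> \<le> M * norm (a - b)"
proof -
  have "norm (f a - f b) \<le> M * norm (a - b)"
  proof (rule differentiable_bound[where S="closed_segment a b" and f'="\<lambda>x h. h \<bullet> g x"])
    show "onorm (\<lambda>h. h \<bullet> g x) \<le> M" if "x \<in> closed_segment a b" for x
    proof (rule onorm_le)
      show "norm (h \<bullet> g x) \<le> M * norm h" for h
        using Cauchy_Schwarz_ineq2[of h "g x"] mult_right_mono[OF assms(2)[OF that], of "norm h"]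
        by (simp add: mult.commute)
    qed
    show "(f has_derivative (\<lambda>h. h \<bullet> g x)) (at x within closed_segment a b)" if "x \<in> closed_segment a b" for x
      using assms(1)[OF that] by (simp add: gderiv_def has_derivative_at_withinI)
  qed auto
  then show ?thesis by simp
qed

lemma closed_segment_norm_ge:
  assumes "w \<in> closed_segment a b" shows "norm a - norm (a - b) \<le> norm w"
proof -
  have "norm (w - a) \<le> norm (b - a)" using segment_bound(1)[OF assms] .
  then show ?thesis using norm_triangle_ineq3[of a w] by (simp add: norm_minus_commute)
qed

lemma powr_half_bound:
  fixes r s b :: real
  assumes "0 < r" "r / 2 \<le> s" "0 \<le> b" shows "s powr (- b) \<le> 2 powr b * r powr (- b)"
proof -
  have "s powr (- b) \<le> (r / 2) powr (- b)" using assms by (intro powr_mono2') auto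
  also have "\<dots> = 2 powr b * r powr (- b)" using assms by (simp add: powr_divide powr_minus_divide)
  finally show ?thesis .
qed

text \<open>A single constant that dominates every numerical constant of the kernel estimates, as
  listed in \<open>kconst_ge\<close>.\<close>

definition kconst :: "real \<Rightarrow> real" where
  "kconst d = d * d * (12 * d + 116) * 2 powr d + 4 * d + 64"

lemma kconst_ge:
  assumes "2 \<le> d"
  shows "d * (4 * d + 28) * 2 powr (d - 1) \<le> kconst d" "d * (12 * d + 116) * 2 powr d \<le> kconst d"
    "4 * d + 64 \<le> kconst d" "d * (12 * d + 64) * 2 powr d \<le> kconst d" "0 < kconst d"
    "d * (d * (12 * d + 116) * 2 powr d) \<le> kconst d"
proof -
  have p: "2 powr (d - 1) \<le> 2 powr d" "0 < (2::real) powr d" by auto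
  have "0 \<le> d * d * (12 * d + 116) * 2 powr d" using assms by simp
  then show a: "4 * d + 64 \<le> kconst d" by (simp add: kconst_def)
  then show "0 < kconst d" using assms by linarith
  have 1: "x * 2 powr d \<le> kconst d" if "x \<le> d * d * (12 * d + 116)" for x
  proof -
    have "x * 2 powr d \<le> d * d * (12 * d + 116) * 2 powr d" using that by (intro mult_right_mono) auto
    then show ?thesis unfolding kconst_def using assms by linarith
  qed
  have dd: "1 * d \<le> d * d" using assms by (intro mult_right_mono) auto
  have "d * (12 * d + 116) \<le> d * d * (12 * d + 116)" using dd assms by (intro mult_right_mono) auto
  moreover have "d * (12 * d + 64) \<le> d * (12 * d + 116)" "d * (4 * d + 28) \<le> d * (12 * d + 116)"
    using assms by (intro mult_left_mono; simp)+
  ultimately have S: "d * (12 * d + 116) * 2 powr d \<le> kconst d" "d * (12 * d + 64) * 2 powr d \<le> kconst d"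
    "d * (d * (12 * d + 116) * 2 powr d) \<le> kconst d"
    "d * (4 * d + 28) * 2 powr d \<le> kconst d"
    using 1[of "d * (12 * d + 116)"] 1[of "d * (12 * d + 64)"] 1[of "d * d * (12 * d + 116)"] 1[of "d * (4 * d + 28)"]
    by (auto simp: mult.assoc)
  show "d * (12 * d + 116) * 2 powr d \<le> kconst d" "d * (12 * d + 64) * 2 powr d \<le> kconst d"
    "d * (d * (12 * d + 116) * 2 powr d) \<le> kconst d" by (fact S)+
  have "d * (4 * d + 28) * 2 powr (d - 1) \<le> d * (4 * d + 28) * 2 powr d"
    using assms p by (intro mult_left_mono) auto
  then show "d * (4 * d + 28) * 2 powr (d - 1) \<le> kconst d" using S(4) by linarith
qed

text \<open>If z and z0 are close, the segment between them stays outside radius r0/2 and the mean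
  value theorem applies. If they are far apart, the segment may meet the singularity; then r0 \<le>
  2 |z - z0|, and the terms with F1 are estimated one by one. F0 is logarithmic in dimension two, so
  only its radial increments are estimated.\<close>

lemma kphi_diff:
  fixes z z0 :: "real^'n::finite"
  assumes K: "kchain (real CARD('n)) B F0 F1 F2 F3" and d: "CARD('n) \<ge> 2"
    and r0: "0 < r0" "r0 \<le> norm z" "r0 \<le> norm z0"
  shows "\<bar>kphi F0 F1 i j z - kphi F0 F1 i j z0\<bar>
    \<le> kconst (real CARD('n)) * B * (norm (z - z0) * r0 powr (1 - real CARD('n)))"
proof -
  let ?n = "real CARD('n)"
  have n2: "2 \<le> ?n" using d by simp
  have B: "0 \<le> B" by (rule kchain_B_nonneg[OF K])
  show ?thesis
  proof (cases "norm (z - z0) < r0 / 2")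
    case True
    have "\<bar>kphi F0 F1 i j z - kphi F0 F1 i j z0\<bar> \<le> (?n * ((4 * ?n + 28) * (B * (2 powr (?n - 1) * r0 powr (1 - ?n))))) * norm (z - z0)"
    proof (rule GDERIV_segment_bound)
      fix w assume w: "w \<in> closed_segment z z0"
      show "GDERIV (kphi F0 F1 i j) w :> (\<chi> k. dphi F1 F2 i j k w)"
        using kchain_C1(1)[OF K, where i=i and j=j] unfolding C1_grad_def by blast
      have nw: "r0 / 2 \<le> norm w" using closed_segment_norm_ge[OF w] r0 True by linarith
      then have "w \<noteq> 0" using r0 by auto
      have "norm w powr (1 - ?n) \<le> 2 powr (?n - 1) * r0 powr (1 - ?n)"
        using powr_half_bound[OF r0(1) nw, of "?n - 1"] n2 by simp
      then have "(4 * ?n + 28) * (B * norm w powr (1 - ?n)) \<le> (4 * ?n + 28) * (B * (2 powr (?n - 1) * r0 powr (1 - ?n)))"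
        using B by (intro mult_left_mono) auto
      then show "norm (\<chi> k. dphi F1 F2 i j k w) \<le> ?n * ((4 * ?n + 28) * (B * (2 powr (?n - 1) * r0 powr (1 - ?n))))"
        using kernel_bounds(1)[OF K \<open>w \<noteq> 0\<close>] by (intro norm_vec_le) (rule order_trans)
    qed
    also have "\<dots> = (?n * (4 * ?n + 28) * 2 powr (?n - 1)) * (B * (norm (z - z0) * r0 powr (1 - ?n)))" by (simp add: mult_ac)
    also have "\<dots> \<le> kconst ?n * (B * (norm (z - z0) * r0 powr (1 - ?n)))"
      using B by (intro mult_right_mono kconst_ge(1)[OF n2]) auto
    finally show ?thesis by (simp add: mult.assoc)
  next
    case False
    let ?X = "B * (norm (z - z0) * r0 powr (1 - ?n))"
    \<comment> \<open>The left side is B * norm w powr (2 - n), at most B * r0 * r0 powr (1 - n),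
      and one factor r0 is exchanged for 2 |z - z0|.\<close>
    have P: "B * (norm w)\<^sup>2 * norm w powr (- ?n) \<le> 2 * ?X" if "r0 \<le> norm w" for w :: "real^'n"
    proof -
      have "(norm w)\<^sup>2 * norm w powr (- ?n) = norm w powr (2 - ?n)"
        using that r0 by (simp add: powr_diff powr_minus_divide)
      also have "\<dots> \<le> r0 powr (2 - ?n)" using that r0 n2 by (intro powr_mono2') auto
      also have "\<dots> = r0 * r0 powr (1 - ?n)" using r0 by (simp add: powr_diff power2_eq_square)
      also have "\<dots> \<le> (2 * norm (z - z0)) * r0 powr (1 - ?n)" using False by (intro mult_right_mono) auto
      finally have "B * ((norm w)\<^sup>2 * norm w powr (- ?n)) \<le> B * ((2 * norm (z - z0)) * r0 powr (1 - ?n))"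
        using B by (rule mult_left_mono)
      then show ?thesis by (simp add: mult_ac)
    qed
    have F1: "\<bar>w $ i * w $ j * F1 (w \<bullet> w)\<bar> \<le> 2 * ?X" "\<bar>(w \<bullet> w) * F1 (w \<bullet> w)\<bar> \<le> 2 * ?X" if w: "r0 \<le> norm w" for w :: "real^'n"
    proof -
      have "w \<noteq> 0" using w r0 by auto
      then have f: "\<bar>F1 (w \<bullet> w)\<bar> \<le> B * norm w powr (- ?n)" by (rule kchain_bounds(1)[OF K])
      have "\<bar>w $ i\<bar> * \<bar>w $ j\<bar> \<le> norm w * norm w" by (intro mult_mono component_le_norm_cart) auto
      then have "\<bar>w $ i * w $ j\<bar> * \<bar>F1 (w \<bullet> w)\<bar> \<le> (norm w)\<^sup>2 * (B * norm w powr (- ?n))"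
        using f by (intro mult_mono) (auto simp: abs_mult power2_eq_square)
      then show "\<bar>w $ i * w $ j * F1 (w \<bullet> w)\<bar> \<le> 2 * ?X" using P[OF w] by (simp add: abs_mult mult_ac)
      have "(norm w)\<^sup>2 * \<bar>F1 (w \<bullet> w)\<bar> \<le> (norm w)\<^sup>2 * (B * norm w powr (- ?n))" using f by (intro mult_left_mono) auto
      then show "\<bar>(w \<bullet> w) * F1 (w \<bullet> w)\<bar> \<le> 2 * ?X" using P[OF w] by (simp add: abs_mult power2_norm_eq_inner mult_ac)
    qed
    \<comment> \<open>F0 depends only on the norm, so the mean value theorem is applied along the
      radius, from norm z to norm z0, where the argument never drops below r0.\<close>
    have F0: "\<bar>F0 (z \<bullet> z) - F0 (z0 \<bullet> z0)\<bar> \<le> 2 * ?X"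
    proof -
      have der: "((\<lambda>\<rho>. F0 (\<rho>\<^sup>2)) has_real_derivative F1 (\<rho>\<^sup>2) * (2 * \<rho>)) (at \<rho>)" for \<rho>
      proof -
        have "DERIV F0 (\<rho>\<^sup>2) :> F1 (\<rho>\<^sup>2)" using K by (simp add: kchain_def)
        then show ?thesis by (rule DERIV_chain2) (auto intro!: derivative_eq_intros)
      qed
      have "norm (F0 ((norm z)\<^sup>2) - F0 ((norm z0)\<^sup>2)) \<le> (2 * (B * r0 powr (1 - ?n))) * norm (norm z - norm z0)"
      proof (rule field_differentiable_bound[where S="{r0..}" and f'="\<lambda>\<rho>. F1 (\<rho>\<^sup>2) * (2 * \<rho>)"])
        fix \<rho> assume "\<rho> \<in> {r0..}"
        then have \<rho>: "r0 \<le> \<rho>" "0 < \<rho>" using r0 by auto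
        have "\<bar>F1 (\<rho>\<^sup>2)\<bar> \<le> B * (\<rho>\<^sup>2) powr (- ?n / 2)" using K \<rho> by (simp add: kchain_def)
        also have "(\<rho>\<^sup>2) powr (- ?n / 2) = \<rho> powr (- ?n)" using \<rho> by (simp add: powr_powr flip: powr_numeral)
        finally have "\<bar>F1 (\<rho>\<^sup>2)\<bar> * \<rho> \<le> B * \<rho> powr (- ?n) * \<rho>" using \<rho> by (intro mult_right_mono) auto
        also have "\<dots> = B * \<rho> powr (1 - ?n)" using \<rho> by (simp add: powr_diff powr_minus_divide)
        also have "\<dots> \<le> B * r0 powr (1 - ?n)" using \<rho> r0 n2 B by (intro mult_left_mono powr_mono2') auto
        finally show "norm (F1 (\<rho>\<^sup>2) * (2 * \<rho>)) \<le> 2 * (B * r0 powr (1 - ?n))" using \<rho> by (simp add: abs_mult)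
        show "((\<lambda>\<rho>. F0 (\<rho>\<^sup>2)) has_real_derivative F1 (\<rho>\<^sup>2) * (2 * \<rho>)) (at \<rho> within {r0..})"
          using der by (rule has_field_derivative_at_within)
      qed (use r0 in auto)
      also have "\<dots> \<le> (2 * (B * r0 powr (1 - ?n))) * norm (z - z0)"
        using B norm_triangle_ineq3[of z z0] by (intro mult_left_mono) auto
      finally show ?thesis by (simp add: power2_norm_eq_inner mult_ac)
    qed
    have dl: "\<bar>dlt i j * x\<bar> \<le> y" if "\<bar>x\<bar> \<le> y" for x y by (rule abs_mult_le1[OF abs_dlt that])
    have "kphi F0 F1 i j z - kphi F0 F1 i j z0 = 4 * (z $ i * z $ j * F1 (z \<bullet> z)) - 4 * (z0 $ i * z0 $ j * F1 (z0 \<bullet> z0))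
       + dlt i j * ((2 - 2 * ?n) * (F0 (z \<bullet> z) - F0 (z0 \<bullet> z0)) - 4 * ((z \<bullet> z) * F1 (z \<bullet> z)) + 4 * ((z0 \<bullet> z0) * F1 (z0 \<bullet> z0)))"
      by (simp add: kphi_def algebra_simps)
    moreover have "\<bar>dlt i j * ((2 - 2 * ?n) * (F0 (z \<bullet> z) - F0 (z0 \<bullet> z0)) - 4 * ((z \<bullet> z) * F1 (z \<bullet> z)) + 4 * ((z0 \<bullet> z0) * F1 (z0 \<bullet> z0)))\<bar>
       \<le> 4 * (?n * ?X) + 12 * ?X"
    proof (rule dl)
      have "\<bar>(2 - 2 * ?n) * (F0 (z \<bullet> z) - F0 (z0 \<bullet> z0))\<bar> \<le> (2 * ?n - 2) * (2 * ?X)"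
        unfolding abs_mult using n2 F0 by (intro mult_mono) auto
      then show "\<bar>(2 - 2 * ?n) * (F0 (z \<bullet> z) - F0 (z0 \<bullet> z0)) - 4 * ((z \<bullet> z) * F1 (z \<bullet> z)) + 4 * ((z0 \<bullet> z0) * F1 (z0 \<bullet> z0))\<bar>
         \<le> 4 * (?n * ?X) + 12 * ?X"
        using F1(2)[OF r0(2)] F1(2)[OF r0(3)] unfolding left_diff_distrib by linarith
    qed
    ultimately have "\<bar>kphi F0 F1 i j z - kphi F0 F1 i j z0\<bar> \<le> 4 * (?n * ?X) + 28 * ?X"
      using F1(1)[OF r0(2)] F1(1)[OF r0(3)] by linarith
    also have "\<dots> \<le> (4 * ?n + 64) * ?X" using B by (simp add: algebra_simps)
    also have "\<dots> \<le> kconst ?n * ?X" using B by (intro mult_right_mono kconst_ge(3)[OF n2]) auto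
    finally show ?thesis by (simp add: mult.assoc)
  qed
qed

section \<open>The Green identity\<close>

lemma set_integral_lebesgue_on:
  fixes F :: "'a::euclidean_space \<Rightarrow> real"
  assumes "\<Omega> \<in> sets lebesgue"
  shows "(LINT x:\<Omega>|lebesgue. F x) = (LINT x|lebesgue_on \<Omega>. F x)"
    and "set_integrable lebesgue \<Omega> F \<longleftrightarrow> integrable (lebesgue_on \<Omega>) F"
  unfolding set_lebesgue_integral_def set_integrable_def
  using assms by (auto simp: integral_restrict_space integrable_restrict_space)

locale stokes_exterior =
  fixes \<Omega> :: "(real^'n::finite) set"
    and S :: "(real^'n) measure"
    and \<nu> :: "real^'n \<Rightarrow> real^'n"
    and v f :: "real^'n \<Rightarrow> real^'n"
    and p :: "real^'n \<Rightarrow> real"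
    and vb :: "real^'n \<Rightarrow> real^'n"
    and Gb :: "real^'n \<Rightarrow> real^'n^'n"
    and pb :: "real^'n \<Rightarrow> real"
    and a :: real
  assumes dim: "CARD('n) \<ge> 2"
    and dom: "exterior_lipschitz_domain \<Omega>" and zero: "0 \<notin> closure \<Omega>"
    and surf: "surface_measure \<Omega> S"
    and normal: "outer_unit_normal \<Omega> S \<nu>"
    and v_reg: "\<And>i. H2_loc_cl \<Omega> (\<lambda>x. v x $ i)"
    and p_reg: "H1_loc_cl \<Omega> p"
    and v_trace: "\<And>i. has_trace \<Omega> S (\<lambda>x. v x $ i) (\<lambda>x. vb x $ i)"
    and grad_v_trace: "\<And>i l. has_trace \<Omega> S (weak_pderiv \<Omega> l (\<lambda>x. v x $ i)) (\<lambda>x. Gb x $ i $ l)"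
    and p_trace: "has_trace \<Omega> S p pb"
    and momentum: "\<And>i. AE x in lebesgue_on \<Omega>.
        - (\<Sum>k\<in>UNIV. weak_pderiv \<Omega> k (weak_pderiv \<Omega> k (\<lambda>x. v x $ i)) x) + weak_pderiv \<Omega> i p x
        = f x $ i"
    and divfree: "AE x in lebesgue_on \<Omega>. (\<Sum>i\<in>UNIV. weak_pderiv \<Omega> i (\<lambda>x. v x $ i) x) = 0"
    and a: "a > real CARD('n) + 1"
    and f_decay: "\<exists>C. AE x in lebesgue_on \<Omega>. norm (f x) \<le> C * japanese x powr (- a)"
    and net_force: "\<And>j. (LINT y:\<Omega>|lebesgue. f y $ j)
        + (LINT y|S. (\<Sum>l\<in>UNIV. \<nu> y $ l * Gb y $ j $ l) - pb y * \<nu> y $ j) = 0"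
    and v_decay: "\<And>\<epsilon>. \<epsilon> > 0 \<Longrightarrow>
        \<exists>R. AE x in lebesgue_on \<Omega>. norm x \<ge> R \<longrightarrow> norm (v x) \<le> \<epsilon>"
begin

abbreviation "M \<equiv> lebesgue_on \<Omega>"

lemma op: "open \<Omega>" using dom by (simp add: exterior_lipschitz_domain_def)

lemma \<Omega>_sets: "\<Omega> \<in> sets lebesgue" using op by simp

lemma sets_S: "sets S = sets borel" using surf by (simp add: surface_measure_def)

lemma finite_S: "finite_measure S" by (rule surface_finite[OF dom surf normal])

lemma integrable_L2_M:
  assumes "L2_loc_cl \<Omega> u" "C1_grad b g" "supp_in b R"
  shows "integrable M (\<lambda>y. u y * b y)"
proof -
  obtain C where C: "0 < C" "\<And>x. norm (g x) \<le> C" "\<And>x. \<bar>b x\<bar> \<le> C"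
    using C1_grad_bounded[OF assms(2,3)] by blast
  have "set_integrable lebesgue \<Omega> (\<lambda>x. u x * b x)"
    by (rule L2_loc_set_integrable[OF assms(1) \<Omega>_sets _ C(3)])
       (use assms(3) borel_measurable_continuous_onI[OF C1_grad_continuous[OF assms(2)]] in \<open>auto simp: supp_in_def\<close>)
  then show ?thesis by (simp add: set_integral_lebesgue_on(2)[OF \<Omega>_sets])
qed

lemma integrable_L2_M_grad:
  assumes "L2_loc_cl \<Omega> u" "C1_grad b g" "supp_in b R"
  shows "integrable M (\<lambda>y. u y * g y $ k)"
proof -
  obtain C where C: "0 < C" "\<And>x. norm (g x) \<le> C" "\<And>x. \<bar>b x\<bar> \<le> C"
    using C1_grad_bounded[OF assms(2,3)] by blast
  have "continuous_on UNIV (\<lambda>x. g x $ k)" using assms(2) by (auto simp: C1_grad_def intro: continuous_intros)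
  then have "set_integrable lebesgue \<Omega> (\<lambda>x. u x * g x $ k)"
    by (intro L2_loc_set_integrable[OF assms(1) \<Omega>_sets _ order_trans[OF component_le_norm_cart C(2)], where R=R])
       (use C1_grad_supp[OF assms(2,3)] in \<open>auto intro: borel_measurable_continuous_onI\<close>)
  then show ?thesis by (simp add: set_integral_lebesgue_on(2)[OF \<Omega>_sets])
qed

lemma gauss_M:
  assumes "has_trace \<Omega> S u T" "C1_grad \<psi> g" "supp_in \<psi> R"
  shows "(LINT x|M. weak_pderiv \<Omega> k u x * \<psi> x) + (LINT x|M. u x * g x $ k) = (LINT q|S. T q * \<nu> q $ k * \<psi> q)"
  using gauss_trace[OF dom surf normal assms] by (simp add: set_integral_lebesgue_on(1)[OF \<Omega>_sets])

lemma L2_v: "L2_loc_cl \<Omega> (\<lambda>x. v x $ i)"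
  and L2_dv: "L2_loc_cl \<Omega> (weak_pderiv \<Omega> k (\<lambda>x. v x $ i))"
  and L2_ddv: "L2_loc_cl \<Omega> (weak_pderiv \<Omega> l (weak_pderiv \<Omega> k (\<lambda>x. v x $ i)))"
  and L2_p: "L2_loc_cl \<Omega> p" and L2_dp: "L2_loc_cl \<Omega> (weak_pderiv \<Omega> k p)"
  using v_reg[of i] p_reg by (auto simp: H2_loc_cl_def H1_loc_cl_def)

text \<open>On \<Omega> the momentum equation gives f almost everywhere as a combination of
  measurable weak derivatives.\<close>

lemma f_measurable: "(\<lambda>x. f x $ i) \<in> borel_measurable M"
proof -
  let ?g = "\<lambda>x. - (\<Sum>k\<in>UNIV. weak_pderiv \<Omega> k (weak_pderiv \<Omega> k (\<lambda>x. v x $ i)) x) + weak_pderiv \<Omega> i p x"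
  have "?g \<in> borel_measurable M"
    using L2_ddv L2_dp unfolding L2_loc_cl_def by (intro borel_measurable_add borel_measurable_uminus borel_measurable_sum) auto
  then have "(\<lambda>x. if x \<in> \<Omega> then ?g x else 0) \<in> borel_measurable lebesgue"
    by (simp only: borel_measurable_if[OF \<Omega>_sets])
  moreover have "AE x in lebesgue. (if x \<in> \<Omega> then ?g x else 0) = (if x \<in> \<Omega> then f x $ i else 0)"
    using momentum[of i] \<Omega>_sets by (simp add: AE_restrict_space_iff)
  ultimately have "(\<lambda>x. if x \<in> \<Omega> then f x $ i else 0) \<in> borel_measurable lebesgue"
    by (rule borel_measurable_AE)
  then show ?thesis by (simp only: borel_measurable_if[OF \<Omega>_sets])
qed

text \<open>The j-th component of \<nu>\<cdot>\<nabla>v - p\<nu>, the boundary density in the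
  balance of forces.\<close>

definition gb :: "'n \<Rightarrow> real^'n \<Rightarrow> real" where
  "gb j q = (\<Sum>l\<in>UNIV. \<nu> q $ l * Gb q $ j $ l) - pb q * \<nu> q $ j"

text \<open>The force in the \<open>j\<close>-th momentum equation together with the boundary stress, as a functional of
  the test function. It annihilates constants because the net force vanishes.\<close>

definition Lfun :: "'n \<Rightarrow> (real^'n \<Rightarrow> real) \<Rightarrow> real" where
  "Lfun j \<psi> = (LINT y|M. f y $ j * \<psi> y) + (LINT q|S. gb j q * \<psi> q)"

lemma trace_integrable:
  assumes "has_trace \<Omega> S u T"
  shows "integrable S T"
proof -
  interpret finite_measure S by (rule finite_S)
  have "integrable S (\<lambda>q. T q * 1)"
    by (rule integrable_L2_mult_bounded[where C=1]) (use assms in \<open>auto simp: has_trace_def\<close>)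
  then show ?thesis by simp
qed

text \<open>S is carried by the compact frontier, on which every continuous h is bounded; this
  covers the coordinate functions as well as the kernels.\<close>

lemma integrable_mult_cont_S:
  assumes "integrable S T" "continuous_on UNIV (h :: real^'n \<Rightarrow> real)"
  shows "integrable S (\<lambda>q. T q * h q)"
proof -
  have "compact (h ` frontier \<Omega>)"
    by (intro compact_continuous_image continuous_on_subset[OF assms(2)] compact_frontier_exterior[OF dom]) auto
  then obtain B where B: "\<And>x. x \<in> frontier \<Omega> \<Longrightarrow> \<bar>h x\<bar> \<le> B"
    by (force dest!: compact_imp_bounded simp: bounded_iff)
  have [measurable]: "h \<in> borel_measurable S"
    using borel_measurable_continuous_onI[OF assms(2)] by (simp add: measurable_cong_sets[OF sets_S refl])
  show ?thesis
  proof (rule Bochner_Integration.integrable_bound[of _ "\<lambda>q. B * T q"])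
    show "integrable S (\<lambda>q. B * T q)" using assms(1) by simp
    show "(\<lambda>q. T q * h q) \<in> borel_measurable S" using assms(1) by measurable
    show "AE q in S. norm (T q * h q) \<le> norm (B * T q)"
      using surface_AE_frontier[OF surf]
    proof eventually_elim
      case (elim q)
      then have "\<bar>h q\<bar> \<le> \<bar>B\<bar>" using B[of q] by linarith
      then show ?case using mult_left_mono[of "\<bar>h q\<bar>" "\<bar>B\<bar>" "\<bar>T q\<bar>"] by (simp add: abs_mult mult.commute)
    qed
  qed
qed

lemma integrable_S_normal: "integrable S T \<Longrightarrow> integrable S (\<lambda>q. T q * \<nu> q $ k)"
  by (rule surface_integrable_normal[OF dom surf normal])

lemma integrable_vb: "integrable S (\<lambda>q. vb q $ j)" by (rule trace_integrable[OF v_trace])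

lemma integrable_Gb: "integrable S (\<lambda>q. Gb q $ j $ l)" by (rule trace_integrable[OF grad_v_trace])

lemma integrable_pb: "integrable S pb" by (rule trace_integrable[OF p_trace])

lemma integrable_gb: "integrable S (gb j)"
proof -
  have "integrable S (\<lambda>q. (\<Sum>l\<in>UNIV. Gb q $ j $ l * \<nu> q $ l) - pb q * \<nu> q $ j)"
    by (intro Bochner_Integration.integrable_diff Bochner_Integration.integrable_sum integrable_S_normal integrable_Gb integrable_pb)
  then show ?thesis by (simp add: gb_def[abs_def] mult.commute)
qed

text \<open>The j-th momentum equation is tested with \<phi> j, v is integrated by parts twice and p
  once, and the results are summed over j. The volume term of p carries the divergence of \<phi> and
  vanishes by \<open>div\<close>. By \<open>lap\<close> the volume term of v splits into K paired
  with the i-th component and a gradient of Q; a further integration by parts moves the latter to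
  div v = 0 and leaves the flux of v weighted with Q.\<close>

lemma green_identity:
  fixes \<phi> :: "'n \<Rightarrow> real^'n \<Rightarrow> real" and d :: "'n \<Rightarrow> 'n \<Rightarrow> real^'n \<Rightarrow> real"
  assumes \<phi>: "\<And>j. C1_grad (\<phi> j) (\<lambda>y. \<chi> k. d j k y)" "\<And>j. supp_in (\<phi> j) R"
    and d: "\<And>j k. C1_grad (d j k) (\<lambda>y. \<chi> l. dd j k l y)"
    and Q: "C1_grad Q (\<lambda>y. \<chi> l. dQ' l y)" "supp_in Q R"
    and div: "\<And>y. (\<Sum>j\<in>UNIV. d j j y) = 0"
    and lap: "\<And>j y. - (\<Sum>k\<in>UNIV. dd j k k y) = dlt i j * K y + dQ' j y"
  shows "(LINT y|M. v y $ i * K y) + (LINT q|S. (vb q \<bullet> \<nu> q) * Q q)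
    = (\<Sum>j\<in>UNIV. Lfun j (\<phi> j)) - (\<Sum>j\<in>UNIV. \<Sum>k\<in>UNIV. LINT q|S. vb q $ j * \<nu> q $ k * d j k q)"
proof -
  let ?W = "\<lambda>j k. weak_pderiv \<Omega> k (\<lambda>x. v x $ j)"
  let ?WW = "\<lambda>j k. weak_pderiv \<Omega> k (weak_pderiv \<Omega> k (\<lambda>x. v x $ j))"
  have ds: "supp_in (d j k) R" for j k
    using C1_grad_supp[OF \<phi>(1) \<phi>(2)] by (auto simp: supp_in_def vec_eq_iff)
  have g1: "(LINT y|M. ?WW j k y * \<phi> j y) + (LINT y|M. ?W j k y * d j k y) = (LINT q|S. Gb q $ j $ k * \<nu> q $ k * \<phi> j q)" for j k
    using gauss_M[OF grad_v_trace[where i=j and l=k] \<phi>(1)[of j] \<phi>(2)[of j], where k=k] by simp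
  have g2: "(LINT y|M. ?W j k y * d j k y) + (LINT y|M. v y $ j * dd j k k y) = (LINT q|S. vb q $ j * \<nu> q $ k * d j k q)" for j k
    using gauss_M[OF v_trace[of j] d[of j k] ds[of j k], where k=k] by simp
  have g3: "(LINT y|M. weak_pderiv \<Omega> j p y * \<phi> j y) + (LINT y|M. p y * d j j y) = (LINT q|S. pb q * \<nu> q $ j * \<phi> j q)" for j
    using gauss_M[OF p_trace \<phi>(1)[of j] \<phi>(2)[of j], where k=j] by simp
  have g4: "(LINT y|M. ?W j j y * Q y) + (LINT y|M. v y $ j * dQ' j y) = (LINT q|S. vb q $ j * \<nu> q $ j * Q q)" for j
    using gauss_M[OF v_trace[of j] Q, where k=j] by simp
  have iWW: "integrable M (\<lambda>y. ?WW j k y * \<phi> j y)" for j k by (rule integrable_L2_M[OF L2_ddv \<phi>(1,2)])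
  have idp: "integrable M (\<lambda>y. weak_pderiv \<Omega> j p y * \<phi> j y)" for j by (rule integrable_L2_M[OF L2_dp \<phi>(1,2)])
  have ipd: "integrable M (\<lambda>y. p y * d j j y)" for j by (rule integrable_L2_M[OF L2_p d ds])
  have idd: "integrable M (\<lambda>y. v y $ j * dd j k l y)" for j k l using integrable_L2_M_grad[OF L2_v[of j] d[of j k] ds[of j k], where k=l] by simp
  have idQ: "integrable M (\<lambda>y. v y $ j * dQ' l y)" for j l using integrable_L2_M_grad[OF L2_v[of j] Q, where k=l] by simp
  have iWQ: "integrable M (\<lambda>y. ?W j j y * Q y)" for j by (rule integrable_L2_M[OF L2_dv Q])
  have c\<phi>: "continuous_on UNIV (\<phi> j)" for j by (rule C1_grad_continuous[OF \<phi>(1)])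
  have cQ: "continuous_on UNIV Q" by (rule C1_grad_continuous[OF Q(1)])
  have iG: "integrable S (\<lambda>q. Gb q $ j $ k * \<nu> q $ k * \<phi> j q)" for j k
    by (intro integrable_mult_cont_S integrable_S_normal integrable_Gb c\<phi>)
  have ip: "integrable S (\<lambda>q. pb q * \<nu> q $ j * \<phi> j q)" for j
    by (intro integrable_mult_cont_S integrable_S_normal integrable_pb c\<phi>)
  have iv: "integrable S (\<lambda>q. vb q $ j * \<nu> q $ j * Q q)" for j
    by (intro integrable_mult_cont_S integrable_S_normal integrable_vb cQ)
  have fj: "(LINT y|M. f y $ j * \<phi> j y) = - (\<Sum>k\<in>UNIV. LINT y|M. ?WW j k y * \<phi> j y) + (LINT y|M. weak_pderiv \<Omega> j p y * \<phi> j y)" for j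
  proof -
    have "(LINT y|M. f y $ j * \<phi> j y) = (LINT y|M. - (\<Sum>k\<in>UNIV. ?WW j k y * \<phi> j y) + weak_pderiv \<Omega> j p y * \<phi> j y)"
    proof (rule integral_cong_AE)
      show "AE y in M. f y $ j * \<phi> j y = - (\<Sum>k\<in>UNIV. ?WW j k y * \<phi> j y) + weak_pderiv \<Omega> j p y * \<phi> j y"
        using momentum[of j]
      proof eventually_elim
        case (elim y)
        show ?case unfolding elim[symmetric] sum_distrib_right[symmetric] distrib_right mult_minus_left ..
      qed
      show "(\<lambda>y. f y $ j * \<phi> j y) \<in> borel_measurable M"
        using f_measurable[of j] borel_measurable_lebesgue_onI[OF borel_measurable_continuous_onI[OF c\<phi>]] by (intro borel_measurable_times)
      show "(\<lambda>y. - (\<Sum>k\<in>UNIV. ?WW j k y * \<phi> j y) + weak_pderiv \<Omega> j p y * \<phi> j y) \<in> borel_measurable M"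
        by (intro borel_measurable_integrable Bochner_Integration.integrable_add integrable_minus Bochner_Integration.integrable_sum iWW idp)
    qed
    also have "\<dots> = - (LINT y|M. (\<Sum>k\<in>UNIV. ?WW j k y * \<phi> j y)) + (LINT y|M. weak_pderiv \<Omega> j p y * \<phi> j y)"
      by (subst Bochner_Integration.integral_add) (simp_all add: iWW idp)
    also have "(LINT y|M. (\<Sum>k\<in>UNIV. ?WW j k y * \<phi> j y)) = (\<Sum>k\<in>UNIV. LINT y|M. ?WW j k y * \<phi> j y)"
      by (rule Bochner_Integration.integral_sum) (rule iWW)
    finally show ?thesis .
  qed
  have gj: "(LINT q|S. gb j q * \<phi> j q) = (\<Sum>k\<in>UNIV. LINT q|S. Gb q $ j $ k * \<nu> q $ k * \<phi> j q) - (LINT q|S. pb q * \<nu> q $ j * \<phi> j q)" for j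
  proof -
    have "(LINT q|S. gb j q * \<phi> j q) = (LINT q|S. (\<Sum>k\<in>UNIV. Gb q $ j $ k * \<nu> q $ k * \<phi> j q) - pb q * \<nu> q $ j * \<phi> j q)"
      by (intro Bochner_Integration.integral_cong refl) (simp add: gb_def left_diff_distrib sum_distrib_right mult.commute[of "\<nu> _ $ _"])
    also have "\<dots> = (LINT q|S. (\<Sum>k\<in>UNIV. Gb q $ j $ k * \<nu> q $ k * \<phi> j q)) - (LINT q|S. pb q * \<nu> q $ j * \<phi> j q)"
      by (intro Bochner_Integration.integral_diff Bochner_Integration.integrable_sum iG ip)
    also have "(LINT q|S. (\<Sum>k\<in>UNIV. Gb q $ j $ k * \<nu> q $ k * \<phi> j q)) = (\<Sum>k\<in>UNIV. LINT q|S. Gb q $ j $ k * \<nu> q $ k * \<phi> j q)"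
      by (rule Bochner_Integration.integral_sum) (rule iG)
    finally show ?thesis .
  qed
  have Lj: "Lfun j (\<phi> j) - (\<Sum>k\<in>UNIV. LINT q|S. vb q $ j * \<nu> q $ k * d j k q)
     = - (\<Sum>k\<in>UNIV. LINT y|M. v y $ j * dd j k k y) - (LINT y|M. p y * d j j y)" for j
  proof -
    have "(\<Sum>k\<in>UNIV. (LINT y|M. ?WW j k y * \<phi> j y)) = (\<Sum>k\<in>UNIV. (LINT q|S. Gb q $ j $ k * \<nu> q $ k * \<phi> j q)
       - (LINT q|S. vb q $ j * \<nu> q $ k * d j k q) + (LINT y|M. v y $ j * dd j k k y))"
    proof (rule sum.cong[OF refl])
      fix k show "(LINT y|M. ?WW j k y * \<phi> j y) = (LINT q|S. Gb q $ j $ k * \<nu> q $ k * \<phi> j q)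
       - (LINT q|S. vb q $ j * \<nu> q $ k * d j k q) + (LINT y|M. v y $ j * dd j k k y)"
        using g1[of k j] g2[of k j] by linarith
    qed
    then show ?thesis unfolding Lfun_def fj gj using g3[of j] by (simp add: sum.distrib sum_subtractf)
  qed
  have pz: "(\<Sum>j\<in>UNIV. LINT y|M. p y * d j j y) = 0"
  proof -
    have "(\<Sum>j\<in>UNIV. LINT y|M. p y * d j j y) = (LINT y|M. (\<Sum>j\<in>UNIV. p y * d j j y))"
      by (rule Bochner_Integration.integral_sum[symmetric]) (rule ipd)
    then show ?thesis by (simp add: sum_distrib_left[symmetric] div)
  qed
  have vj: "- (\<Sum>k\<in>UNIV. LINT y|M. v y $ j * dd j k k y) = dlt i j * (LINT y|M. v y $ i * K y) + (LINT y|M. v y $ j * dQ' j y)" for j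
  proof -
    \<comment> \<open>Nothing is known of K itself; the integrability of v times K is read off from
      \<open>lap\<close> with j = i.\<close>
    have iK: "integrable M (\<lambda>y. v y $ i * K y)"
    proof -
      have "integrable M (\<lambda>y. - (\<Sum>k\<in>UNIV. v y $ i * dd i k k y) - v y $ i * dQ' i y)"
        by (intro Bochner_Integration.integrable_diff integrable_minus Bochner_Integration.integrable_sum idd idQ)
      moreover have "- (\<Sum>k\<in>UNIV. v y $ i * dd i k k y) - v y $ i * dQ' i y = v y $ i * K y" for y
      proof -
        have "- (\<Sum>k\<in>UNIV. v y $ i * dd i k k y) - v y $ i * dQ' i y = v y $ i * (- (\<Sum>k\<in>UNIV. dd i k k y) - dQ' i y)"
          by (simp add: sum_distrib_left[symmetric] right_diff_distrib)
        also have "- (\<Sum>k\<in>UNIV. dd i k k y) - dQ' i y = K y" using lap[of i y] by simp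
        finally show ?thesis .
      qed
      ultimately show ?thesis by simp
    qed
    have "- (\<Sum>k\<in>UNIV. LINT y|M. v y $ j * dd j k k y) = - (LINT y|M. (\<Sum>k\<in>UNIV. v y $ j * dd j k k y))"
      by (subst Bochner_Integration.integral_sum) (auto simp: idd)
    also have "\<dots> = (LINT y|M. - (\<Sum>k\<in>UNIV. v y $ j * dd j k k y))" by simp
    also have "\<dots> = (LINT y|M. dlt i j * (v y $ i * K y) + v y $ j * dQ' j y)"
    proof (intro Bochner_Integration.integral_cong refl)
      fix y
      have "- (\<Sum>k\<in>UNIV. v y $ j * dd j k k y) = v y $ j * (dlt i j * K y + dQ' j y)"
        unfolding lap[of j y, symmetric] by (simp add: sum_distrib_left[symmetric])
      also have "\<dots> = dlt i j * (v y $ i * K y) + v y $ j * dQ' j y" by (simp add: dlt_def algebra_simps)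
      finally show "- (\<Sum>k\<in>UNIV. v y $ j * dd j k k y) = dlt i j * (v y $ i * K y) + v y $ j * dQ' j y" .
    qed
    also have "\<dots> = dlt i j * (LINT y|M. v y $ i * K y) + (LINT y|M. v y $ j * dQ' j y)"
      by (subst Bochner_Integration.integral_add) (auto simp: iK idQ)
    finally show ?thesis .
  qed
  have Qs: "(\<Sum>j\<in>UNIV. LINT y|M. v y $ j * dQ' j y) = (LINT q|S. (vb q \<bullet> \<nu> q) * Q q)"
  proof -
    have "(\<Sum>j\<in>UNIV. LINT y|M. ?W j j y * Q y) = (LINT y|M. (\<Sum>j\<in>UNIV. ?W j j y * Q y))"
      by (rule Bochner_Integration.integral_sum[symmetric]) (rule iWQ)
    also have "\<dots> = 0"
    proof (rule integral_eq_zero_AE)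
      show "AE y in M. (\<Sum>j\<in>UNIV. ?W j j y * Q y) = 0"
        using divfree by eventually_elim (simp add: sum_distrib_right[symmetric])
    qed
    finally have z: "(\<Sum>j\<in>UNIV. LINT y|M. ?W j j y * Q y) = 0" .
    have "(\<Sum>j\<in>UNIV. LINT y|M. v y $ j * dQ' j y) = (\<Sum>j\<in>UNIV. (LINT q|S. vb q $ j * \<nu> q $ j * Q q) - (LINT y|M. ?W j j y * Q y))"
      by (intro sum.cong refl) (use g4 in \<open>simp add: algebra_simps\<close>)
    also have "\<dots> = (\<Sum>j\<in>UNIV. (LINT q|S. vb q $ j * \<nu> q $ j * Q q))" by (simp add: sum_subtractf z)
    also have "\<dots> = (LINT q|S. (\<Sum>j\<in>UNIV. vb q $ j * \<nu> q $ j * Q q))"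
      by (rule Bochner_Integration.integral_sum[symmetric]) (rule iv)
    finally show ?thesis by (simp add: inner_vec_def sum_distrib_right)
  qed
  have "(\<Sum>j\<in>UNIV. Lfun j (\<phi> j)) - (\<Sum>j\<in>UNIV. \<Sum>k\<in>UNIV. LINT q|S. vb q $ j * \<nu> q $ k * d j k q)
    = (\<Sum>j\<in>UNIV. dlt i j * (LINT y|M. v y $ i * K y) + (LINT y|M. v y $ j * dQ' j y) - (LINT y|M. p y * d j j y))"
    unfolding sum_subtractf[symmetric] Lj vj ..
  also have "\<dots> = (LINT y|M. v y $ i * K y) + (LINT q|S. (vb q \<bullet> \<nu> q) * Q q)"
    by (simp only: sum_subtractf sum.distrib dlt_sum Qs pz diff_zero)
  finally show ?thesis by simp
qed

end

section \<open>Expansion at infinity\<close>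

lemma dphi_minus: "dphi F1 F2 i j k (- z) = - dphi F1 F2 i j k z"
  by (simp add: dphi_def algebra_simps)

lemma kQ_minus: "kQ F1 F2 i (- z) = - kQ F1 F2 i z"
  by (simp add: kQ_def algebra_simps)

lemma GDERIV_translate: "GDERIV f (y - x) :> g \<Longrightarrow> GDERIV (\<lambda>y. f (y - x)) y :> g"
  unfolding gderiv_def
  by (rule has_derivative_compose[where f="\<lambda>y. y - x" and f'="\<lambda>h. h" and g=f]) (auto intro!: derivative_eq_intros)

lemma C1_grad_translate:
  assumes "C1_grad \<phi> g" shows "C1_grad (\<lambda>y. \<phi> (y - x)) (\<lambda>y. g (y - x))"
  using assms unfolding C1_grad_def
  by (auto intro!: GDERIV_translate continuous_on_compose2[of UNIV g] continuous_intros)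

definition taylor_rem ::
  "(real \<Rightarrow> real) \<Rightarrow> (real \<Rightarrow> real) \<Rightarrow> (real \<Rightarrow> real) \<Rightarrow> real^'n \<Rightarrow> 'n \<Rightarrow> 'n \<Rightarrow> real^'n::finite \<Rightarrow> real" where
  "taylor_rem F0 F1 F2 x i j y =
     kphi F0 F1 i j (y - x) - kphi F0 F1 i j (- x) - (\<Sum>k\<in>UNIV. y $ k * dphi F1 F2 i j k (- x))"

context
  fixes B :: real and F0 F1 F2 F3 :: "real \<Rightarrow> real" and x :: "real^'n::finite"
  assumes K: "kchain (real CARD('n)) B F0 F1 F2 F3" and d: "CARD('n) \<ge> 2" and x: "x \<noteq> 0"
begin

text \<open>For |y| \<le> |x|/2 the segment from -x to y - x keeps distance |x|/2 from the
  singularity, so the gradient of D on it has the size it has at x up to the factor 2 powr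
  n.\<close>

lemma near_bound:
  fixes D :: "real^'n \<Rightarrow> real"
  assumes D: "C1_grad D (\<lambda>z. \<chi> l. g l z)" and y: "norm y \<le> norm x / 2"
    and g: "\<And>l z. z \<noteq> 0 \<Longrightarrow> \<bar>g l z\<bar> \<le> c * (B * norm z powr (- real CARD('n)))" and c: "0 \<le> c"
  shows "\<bar>D (y - x) - D (- x)\<bar>
    \<le> (real CARD('n) * c * 2 powr real CARD('n)) * (B * (norm x powr (- real CARD('n)) * norm y))"
proof -
  let ?n = "real CARD('n)"
  have B: "0 \<le> B" by (rule kchain_B_nonneg[OF K])
  have nx: "0 < norm x" using x by simp
  have "\<bar>D (y - x) - D (- x)\<bar> \<le> (?n * (c * (B * (2 powr ?n * norm x powr (- ?n))))) * norm (y - x - (- x))"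
  proof (rule GDERIV_segment_bound)
    fix w assume w: "w \<in> closed_segment (y - x) (- x)"
    show "GDERIV D w :> (\<chi> l. g l w)" using D by (simp add: C1_grad_def)
    have "w \<in> closed_segment (- x) (y - x)" using w by (simp add: closed_segment_commute)
    from closed_segment_norm_ge[OF this] y have nw: "norm x / 2 \<le> norm w" by simp
    then have "w \<noteq> 0" using nx by auto
    have "norm w powr (- ?n) \<le> 2 powr ?n * norm x powr (- ?n)" by (rule powr_half_bound[OF nx nw]) simp
    then have "c * (B * norm w powr (- ?n)) \<le> c * (B * (2 powr ?n * norm x powr (- ?n)))"
      using B c by (intro mult_left_mono) auto
    then show "norm (\<chi> l. g l w) \<le> ?n * (c * (B * (2 powr ?n * norm x powr (- ?n))))"
      using g[OF \<open>w \<noteq> 0\<close>] by (intro norm_vec_le) (rule order_trans)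
  qed
  then show ?thesis by (simp add: mult_ac)
qed

text \<open>The factor n in the second bound is spent on \<open>norm_vec_le\<close>, when the
  components are collected into a gradient in \<open>taylor_rem_near\<close>.\<close>

lemma dphi_near:
  assumes y: "norm y \<le> norm x / 2"
  shows "\<bar>dphi F1 F2 i j k (y - x) - dphi F1 F2 i j k (- x)\<bar>
    \<le> kconst (real CARD('n)) * (B * (norm x powr (- real CARD('n)) * norm y))"
    and "real CARD('n) * \<bar>dphi F1 F2 i j k (y - x) - dphi F1 F2 i j k (- x)\<bar>
    \<le> kconst (real CARD('n)) * (B * (norm x powr (- real CARD('n)) * norm y))"
    and "\<bar>kQ F1 F2 i (y - x) - kQ F1 F2 i (- x)\<bar>
    \<le> kconst (real CARD('n)) * (B * (norm x powr (- real CARD('n)) * norm y))"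
proof -
  let ?n = "real CARD('n)"
  let ?Y = "B * (norm x powr (- ?n) * norm y)"
  have n2: "2 \<le> ?n" using d by simp
  have Y: "0 \<le> ?Y" using kchain_B_nonneg[OF K] by simp
  have 1: "\<bar>dphi F1 F2 i j k (y - x) - dphi F1 F2 i j k (- x)\<bar> \<le> (?n * (12 * ?n + 116) * 2 powr ?n) * ?Y"
    by (rule near_bound[OF kchain_C1(2)[OF K] y kernel_bounds(2)[OF K]]) auto
  also have "\<dots> \<le> kconst ?n * ?Y" by (intro mult_right_mono kconst_ge(2)[OF n2] Y)
  finally show "\<bar>dphi F1 F2 i j k (y - x) - dphi F1 F2 i j k (- x)\<bar> \<le> kconst ?n * ?Y" .
  have "?n * \<bar>dphi F1 F2 i j k (y - x) - dphi F1 F2 i j k (- x)\<bar> \<le> ?n * ((?n * (12 * ?n + 116) * 2 powr ?n) * ?Y)"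
    using 1 by (intro mult_left_mono) auto
  also have "\<dots> = (?n * (?n * (12 * ?n + 116) * 2 powr ?n)) * ?Y" by (simp add: mult.assoc)
  also have "\<dots> \<le> kconst ?n * ?Y" by (intro mult_right_mono kconst_ge(6)[OF n2] Y)
  finally show "?n * \<bar>dphi F1 F2 i j k (y - x) - dphi F1 F2 i j k (- x)\<bar> \<le> kconst ?n * ?Y" .
  have "\<bar>kQ F1 F2 i (y - x) - kQ F1 F2 i (- x)\<bar> \<le> (?n * (12 * ?n + 64) * 2 powr ?n) * ?Y"
    by (rule near_bound[OF kchain_C1(3)[OF K] y kernel_bounds(3)[OF K]]) auto
  also have "\<dots> \<le> kconst ?n * ?Y" by (intro mult_right_mono kconst_ge(4)[OF n2] Y)
  finally show "\<bar>kQ F1 F2 i (y - x) - kQ F1 F2 i (- x)\<bar> \<le> kconst ?n * ?Y" .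
qed

text \<open>The gradient of the remainder in y is dphi at y - x minus dphi at -x. By
  \<open>dphi_near\<close> it is at most linear in |y|, so the mean value theorem from 0 to y yields
  |y|^2.\<close>

lemma taylor_rem_near:
  assumes y: "norm y \<le> norm x / 2"
  shows "\<bar>taylor_rem F0 F1 F2 x i j y\<bar> \<le> kconst (real CARD('n)) * (B * (norm x powr (- real CARD('n)) * (norm y)\<^sup>2))"
proof -
  let ?n = "real CARD('n)"
  let ?c = "kconst ?n * (B * (norm x powr (- ?n) * norm y))"
  let ?f = "\<lambda>y. kphi F0 F1 i j (y - x) - (\<Sum>k\<in>UNIV. y $ k * dphi F1 F2 i j k (- x))"
  have n2: "2 \<le> ?n" using d by simp
  have B: "0 \<le> B" by (rule kchain_B_nonneg[OF K])
  have "\<bar>?f y - ?f 0\<bar> \<le> ?c * norm (y - 0)"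
  proof (rule GDERIV_segment_bound)
    fix w assume w: "w \<in> closed_segment y 0"
    have nw: "norm w \<le> norm y" using segment_bound(1)[of w 0 y] w by (simp add: closed_segment_commute)
    have "GDERIV (\<lambda>y::real^'n. \<Sum>k\<in>UNIV. y $ k * dphi F1 F2 i j k (- x)) w :> (\<chi> k. dphi F1 F2 i j k (- x))"
    proof -
      have "(\<Sum>k\<in>UNIV. y $ k * dphi F1 F2 i j k (- x)) = y \<bullet> (\<chi> k. dphi F1 F2 i j k (- x))" for y :: "real^'n"
        by (simp add: inner_vec_def)
      then show ?thesis unfolding gderiv_def by (simp add: bounded_linear_imp_has_derivative bounded_linear_inner_left)
    qed
    moreover have "GDERIV (\<lambda>y. kphi F0 F1 i j (y - x)) w :> (\<chi> k. dphi F1 F2 i j k (w - x))"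
      using C1_grad_translate[OF kchain_C1(1)[OF K], where i1=i and j1=j] by (simp add: C1_grad_def)
    ultimately show "GDERIV ?f w :> (\<chi> k. dphi F1 F2 i j k (w - x)) - (\<chi> k. dphi F1 F2 i j k (- x))"
      by (intro GDERIV_diff)
    have "\<bar>dphi F1 F2 i j k (w - x) - dphi F1 F2 i j k (- x)\<bar> \<le> ?c / ?n" for k
    proof -
      have "?n * \<bar>dphi F1 F2 i j k (w - x) - dphi F1 F2 i j k (- x)\<bar> \<le> kconst ?n * (B * (norm x powr (- ?n) * norm w))"
        by (rule dphi_near(2)) (use nw y in linarith)
      also have "\<dots> \<le> ?c" using nw B kconst_ge(5)[OF n2] by (intro mult_left_mono) auto
      finally show ?thesis using n2 by (simp add: field_simps)
    qed
    then have "norm (\<chi> k. dphi F1 F2 i j k (w - x) - dphi F1 F2 i j k (- x)) \<le> ?n * (?c / ?n)"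
      by (rule norm_vec_le)
    moreover have "(\<chi> k. dphi F1 F2 i j k (w - x)) - (\<chi> k. dphi F1 F2 i j k (- x)) = (\<chi> k. dphi F1 F2 i j k (w - x) - dphi F1 F2 i j k (- x))"
      by (simp add: vec_eq_iff)
    ultimately show "norm ((\<chi> k. dphi F1 F2 i j k (w - x)) - (\<chi> k. dphi F1 F2 i j k (- x))) \<le> ?c" by simp
  qed
  moreover have "?f y - ?f 0 = taylor_rem F0 F1 F2 x i j y" by (simp add: taylor_rem_def)
  ultimately show ?thesis by (simp add: power2_eq_square mult_ac)
qed

text \<open>Far from the origin the increment of the kernel and the linear Taylor term are bounded
  separately. The singularity at y = x contributes only within distance |x|/2 of x, which is what
  the indicator records.\<close>

lemma taylor_rem_far:
  assumes y: "norm x / 2 \<le> norm y" "y \<noteq> x"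
  shows "\<bar>taylor_rem F0 F1 F2 x i j y\<bar> \<le> kconst (real CARD('n)) * B * (2 powr real CARD('n) + 1) *
     (norm y * norm x powr (1 - real CARD('n))
      + norm y * (indicat_real (ball x (norm x / 2)) y * norm (y - x) powr (1 - real CARD('n))))"
proof -
  let ?n = "real CARD('n)" and ?k = "kconst (real CARD('n))"
  have n2: "2 \<le> ?n" using d by simp
  have B: "0 \<le> B" by (rule kchain_B_nonneg[OF K])
  have nx: "0 < norm x" using x by simp
  have k0: "0 < ?k" by (rule kconst_ge(5)[OF n2])
  have p1: "1 \<le> 2 powr ?n" by (rule ge_one_powr_ge_zero) auto
  let ?I = "indicat_real (ball x (norm x / 2)) y * norm (y - x) powr (1 - ?n)"
  have kp: "\<bar>kphi F0 F1 i j (y - x) - kphi F0 F1 i j (- x)\<bar> \<le> ?k * B * (norm y * (2 powr ?n * norm x powr (1 - ?n) + ?I))"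
  \<comment> \<open>Close to x, \<open>kphi_diff\<close> is used with r0 = |y - x|; away from x,
    with r0 = |x|/2.\<close>
  proof (cases "dist x y < norm x / 2")
    case True
    have "\<bar>kphi F0 F1 i j (y - x) - kphi F0 F1 i j (- x)\<bar> \<le> ?k * B * (norm (y - x - (- x)) * norm (y - x) powr (1 - ?n))"
    proof (rule kphi_diff[OF K d])
      show "0 < norm (y - x)" using y by simp
      have "norm (y - x) < norm x / 2" using True by (simp add: dist_norm norm_minus_commute)
      then show "norm (y - x) \<le> norm (- x)" using nx unfolding norm_minus_cancel by linarith
    qed simp
    also have "\<dots> \<le> ?k * B * (norm y * (2 powr ?n * norm x powr (1 - ?n) + ?I))"
      using True B k0 by (intro mult_left_mono mult_nonneg_nonneg) (auto intro!: mult_left_mono)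
    finally show ?thesis .
  next
    case False
    have "\<bar>kphi F0 F1 i j (y - x) - kphi F0 F1 i j (- x)\<bar> \<le> ?k * B * (norm (y - x - (- x)) * (norm x / 2) powr (1 - ?n))"
      by (rule kphi_diff[OF K d]) (use False nx in \<open>auto simp: dist_norm norm_minus_commute\<close>)
    also have "\<dots> \<le> ?k * B * (norm y * (2 powr ?n * norm x powr (1 - ?n) + ?I))"
    proof -
      have "(norm x / 2) powr (1 - ?n) \<le> 2 powr (?n - 1) * norm x powr (1 - ?n)"
        using powr_half_bound[OF nx, of "norm x / 2" "?n - 1"] n2 by simp
      also have "\<dots> \<le> 2 powr ?n * norm x powr (1 - ?n)" by (intro mult_right_mono) auto
      finally have "(norm x / 2) powr (1 - ?n) \<le> 2 powr ?n * norm x powr (1 - ?n) + ?I" by (simp add: add_increasing2)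
      then show ?thesis using B k0 by (intro mult_left_mono mult_nonneg_nonneg) (auto intro!: mult_left_mono)
    qed
    finally show ?thesis .
  qed
  have "\<bar>\<Sum>k\<in>UNIV. y $ k * dphi F1 F2 i j k (- x)\<bar> \<le> (\<Sum>k\<in>(UNIV::'n set). norm y * ((4 * ?n + 28) * (B * norm x powr (1 - ?n))))"
  proof (rule order_trans[OF sum_abs], rule sum_mono)
    fix k
    have "\<bar>dphi F1 F2 i j k (- x)\<bar> \<le> (4 * ?n + 28) * (B * norm (- x) powr (1 - ?n))"
      by (rule kernel_bounds(1)[OF K]) (use x in simp)
    then show "\<bar>y $ k * dphi F1 F2 i j k (- x)\<bar> \<le> norm y * ((4 * ?n + 28) * (B * norm x powr (1 - ?n)))"
      unfolding abs_mult by (intro mult_mono component_le_norm_cart) auto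
  qed
  also have "\<dots> = (?n * (4 * ?n + 28)) * (B * (norm y * norm x powr (1 - ?n)))" by (simp add: mult_ac)
  also have "\<dots> \<le> ?k * (B * (norm y * norm x powr (1 - ?n)))"
  proof (rule mult_right_mono)
    have "?n * (4 * ?n + 28) * 1 \<le> ?n * (4 * ?n + 28) * 2 powr (?n - 1)"
      using n2 by (intro mult_left_mono ge_one_powr_ge_zero) auto
    then show "?n * (4 * ?n + 28) \<le> ?k" using kconst_ge(1)[OF n2] by linarith
  qed (use B in auto)
  finally have s: "\<bar>\<Sum>k\<in>UNIV. y $ k * dphi F1 F2 i j k (- x)\<bar> \<le> ?k * B * (norm y * norm x powr (1 - ?n))" by (simp add: mult.assoc)
  have "\<bar>taylor_rem F0 F1 F2 x i j y\<bar> \<le> ?k * B * (norm y * (2 powr ?n * norm x powr (1 - ?n) + ?I)) + ?k * B * (norm y * norm x powr (1 - ?n))"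
    using kp s unfolding taylor_rem_def by linarith
  also have "\<dots> = ?k * B * ((2 powr ?n + 1) * (norm y * norm x powr (1 - ?n)) + 1 * (norm y * ?I))" by (simp add: algebra_simps)
  also have "\<dots> \<le> ?k * B * ((2 powr ?n + 1) * (norm y * norm x powr (1 - ?n)) + (2 powr ?n + 1) * (norm y * ?I))"
    using B k0 p1 by (intro mult_left_mono add_left_mono mult_right_mono) auto
  finally show ?thesis by (simp add: algebra_simps)
qed

end

section \<open>Radial integrals and the size of the remainder\<close>

definition sphere_area :: "nat \<Rightarrow> real" where "sphere_area n = real n * unit_ball_vol (real n)"

lemma sphere_area_pos: "0 < n \<Longrightarrow> 0 < sphere_area n" by (simp add: sphere_area_def)

text \<open>Polar coordinates for radial functions: the two measures agree on the half-lines below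
  r, where the left one gives the volume of a ball, and half-lines generate the Borel sets.\<close>

lemma distr_norm_lborel:
  "distr (lborel :: 'a::euclidean_space measure) borel norm =
   density lborel (\<lambda>r. ennreal (sphere_area DIM('a) * r ^ (DIM('a) - 1)) * indicator {0..} r)"
proof (rule measure_eqI_generator_eq[where E="range (atMost :: real \<Rightarrow> real set)" and \<Omega>=UNIV and A="\<lambda>i. {..real i}"])
  let ?n = "DIM('a)"
  have eq: "emeasure (distr (lborel :: 'a measure) borel norm) {..r} = ennreal (if 0 \<le> r then unit_ball_vol ?n * r ^ ?n else 0)" for r
  proof -
    have "norm -` {..r} = (cball 0 r :: 'a set)" by auto
    then have "emeasure (distr (lborel :: 'a measure) borel norm) {..r} = emeasure lborel (cball (0::'a) r)"
      by (simp add: emeasure_distr)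
    then show ?thesis by (auto simp: emeasure_cball)
  qed
  show "emeasure (distr (lborel :: 'a measure) borel norm) X =
    emeasure (density lborel (\<lambda>r. ennreal (sphere_area ?n * r ^ (?n - 1)) * indicator {0..} r)) X" if X: "X \<in> range atMost" for X
  proof -
    obtain r where r: "X = {..r}" using X by auto
    have "emeasure (density lborel (\<lambda>r. ennreal (sphere_area ?n * r ^ (?n - 1)) * indicator {0..} r)) X
      = (\<integral>\<^sup>+ s. ennreal (sphere_area ?n * s ^ (?n - 1)) * indicator {0..r} s \<partial>lborel)"
      unfolding r by (subst emeasure_density) (auto intro!: nn_integral_cong simp: indicator_def)
    also have "\<dots> = ennreal (if 0 \<le> r then unit_ball_vol ?n * r ^ ?n else 0)"
    proof (cases "0 \<le> r")
      case True
      have "(\<integral>\<^sup>+ s. ennreal (sphere_area ?n * s ^ (?n - 1)) * indicator {0..r} s \<partial>lborel)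
        = ennreal (unit_ball_vol ?n * r ^ ?n - unit_ball_vol ?n * 0 ^ ?n)"
        by (rule nn_integral_FTC_Icc) (use True in \<open>auto intro!: derivative_eq_intros simp: sphere_area_def\<close>)
      then show ?thesis using True by simp
    qed simp
    finally show ?thesis by (simp only: eq r)
  qed
  show "Int_stable (range (atMost :: real \<Rightarrow> real set))"
    unfolding Int_stable_def by (auto simp: min_def)
  show "(\<Union>i. {..real i}) = UNIV" by (auto intro: real_arch_simple)
  show "emeasure (distr (lborel :: 'a measure) borel norm) {..real i} \<noteq> \<infinity>" for i by (simp add: eq)
qed (auto simp: borel_eq_atMost)

lemma nn_integral_radial:
  fixes g :: "real \<Rightarrow> real"
  assumes g: "g \<in> borel_measurable borel" "\<And>r. 0 \<le> r \<Longrightarrow> 0 \<le> g r"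
  shows "(\<integral>\<^sup>+ x. ennreal (g (norm (x::'a::euclidean_space))) \<partial>lborel)
     = (\<integral>\<^sup>+ r. ennreal (sphere_area DIM('a) * (g r * r ^ (DIM('a) - 1))) * indicator {0..} r \<partial>lborel)"
proof -
  have "(\<integral>\<^sup>+ x. ennreal (g (norm x)) \<partial>(lborel :: 'a measure)) = (\<integral>\<^sup>+ r. ennreal (g r) \<partial>distr (lborel :: 'a measure) borel norm)"
    using g by (subst nn_integral_distr) auto
  also have "\<dots> = (\<integral>\<^sup>+ r. (ennreal (sphere_area DIM('a) * r ^ (DIM('a) - 1)) * indicator {0..} r) * ennreal (g r) \<partial>lborel)"
    unfolding distr_norm_lborel using g by (subst nn_integral_density) auto
  also have "\<dots> = (\<integral>\<^sup>+ r. ennreal (sphere_area DIM('a) * (g r * r ^ (DIM('a) - 1))) * indicator {0..} r \<partial>lborel)"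
    using sphere_area_pos[of "DIM('a)"] g(2)
    by (intro nn_integral_cong) (auto simp: indicator_def ennreal_mult[symmetric] mult_ac)
  finally show ?thesis .
qed

text \<open>The antiderivative of (1 + s) powr (-b) that vanishes at 0; the exponent b = 1 gives the
  logarithm.\<close>

definition Lam :: "real \<Rightarrow> real \<Rightarrow> real" where
  "Lam b r = (if b = 1 then ln (1 + r) else ((1 + r) powr (1 - b) - 1) / (1 - b))"

lemma Lam_deriv: "0 \<le> s \<Longrightarrow> DERIV (Lam b) s :> (1 + s) powr (- b)"
proof (cases "b = 1")
  assume s: "0 \<le> s"
  case True
  then show ?thesis using s unfolding Lam_def[abs_def]
    by (auto intro!: derivative_eq_intros simp: powr_minus_divide)
next
  assume s: "0 \<le> s"
  case False
  have "((\<lambda>s. (1 + s) powr (1 - b)) has_real_derivative ((1 - b) * (1 + s) powr (1 - b - 1)) * (0 + 1)) (at s)"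
    using s by (intro DERIV_chain2[OF has_real_derivative_powr] DERIV_add DERIV_const DERIV_ident) auto
  then have "((\<lambda>s. ((1 + s) powr (1 - b) - 1) / (1 - b)) has_real_derivative (((1 - b) * (1 + s) powr (1 - b - 1)) * (0 + 1) - 0) / (1 - b)) (at s)"
    by (intro DERIV_cdivide DERIV_diff DERIV_const)
  then show ?thesis using False by (simp add: Lam_def[abs_def])
qed

context
  fixes n :: nat
  assumes n: "n = DIM('a::euclidean_space)"
begin

lemma radial_powr_tail:
  assumes r: "0 < r" and b: "real n < b"
  shows "(\<integral>\<^sup>+ y. ennreal (norm y powr (- b) * indicat_real {r..} (norm y)) \<partial>(lborel :: 'a measure))
     = ennreal (sphere_area n / (b - real n) * r powr (real n - b))"
proof -
  let ?A = "sphere_area n"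
  have A: "0 < ?A" by (simp add: n sphere_area_pos)
  have "(\<integral>\<^sup>+ y. ennreal (norm y powr (- b) * indicat_real {r..} (norm y)) \<partial>(lborel :: 'a measure))
    = (\<integral>\<^sup>+ s. ennreal (?A * ((s powr (- b) * indicat_real {r..} s) * s ^ (n - 1))) * indicator {0..} s \<partial>lborel)"
    unfolding n by (rule nn_integral_radial) auto
  also have "\<dots> = (\<integral>\<^sup>+ s. ennreal (?A * s powr (real n - 1 - b)) * indicator {r..} s \<partial>lborel)"
  proof (intro nn_integral_cong)
    fix s :: real
    show "ennreal (?A * ((s powr (- b) * indicat_real {r..} s) * s ^ (n - 1))) * indicator {0..} s
       = ennreal (?A * s powr (real n - 1 - b)) * indicator {r..} s"
    proof (cases "r \<le> s")
      case True
      then have s: "0 < s" using r by simp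
      have "s ^ (n - 1) = s powr (real n - 1)" using s n by (simp add: powr_realpow[symmetric] of_nat_diff Suc_leI)
      then have "s powr (- b) * s ^ (n - 1) = s powr (real n - 1 - b)" using s by (simp add: powr_add[symmetric])
      then show ?thesis using True s by simp
    qed (auto simp: indicator_def)
  qed
  also have "\<dots> = ennreal (0 - (- (?A / (b - real n) * r powr (real n - b))))"
  proof (rule nn_integral_FTC_atLeast[where F="\<lambda>s. - (?A / (b - real n) * s powr (real n - b))"])
    fix s assume "r \<le> s"
    then have "0 < s" using r by simp
    then show "((\<lambda>s. - (?A / (b - real n) * s powr (real n - b))) has_real_derivative ?A * s powr (real n - 1 - b)) (at s)"
    proof -
      have "((\<lambda>s. - (?A / (b - real n) * s powr (real n - b))) has_real_derivative - (?A / (b - real n) * ((real n - b) * s powr (real n - b - 1)))) (at s)"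
        using \<open>0 < s\<close> by (intro DERIV_minus DERIV_cmult has_real_derivative_powr)
      moreover have "- (?A / (b - real n) * ((real n - b) * s powr (real n - b - 1))) = ?A * s powr (real n - 1 - b)"
      proof -
        have "real n - b - 1 = real n - 1 - b" by simp
        then show ?thesis using b by (simp add: field_simps)
      qed
      ultimately show ?thesis by simp
    qed
  next
    have "((\<lambda>s. s powr (- (b - real n))) \<longlongrightarrow> 0) at_top"
      using b by (intro tendsto_neg_powr filterlim_ident) auto
    then have "((\<lambda>s. - (?A / (b - real n) * s powr (- (b - real n)))) \<longlongrightarrow> - (?A / (b - real n) * 0)) at_top"
      by (intro tendsto_intros)
    then show "((\<lambda>s. - (?A / (b - real n) * s powr (real n - b))) \<longlongrightarrow> 0) at_top" by simp
  qed (use A in auto)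
  finally show ?thesis by simp
qed

lemma radial_powr_near:
  assumes r: "0 \<le> r"
  shows "(\<integral>\<^sup>+ y. ennreal (norm y powr (1 - real n) * indicat_real {..r} (norm y)) \<partial>(lborel :: 'a measure)) \<le> ennreal (sphere_area n * r)"
proof -
  let ?A = "sphere_area n"
  have A: "0 < ?A" by (simp add: n sphere_area_pos)
  have "(\<integral>\<^sup>+ y. ennreal (norm y powr (1 - real n) * indicat_real {..r} (norm y)) \<partial>(lborel :: 'a measure))
    = (\<integral>\<^sup>+ s. ennreal (?A * ((s powr (1 - real n) * indicat_real {..r} s) * s ^ (n - 1))) * indicator {0..} s \<partial>lborel)"
    unfolding n by (rule nn_integral_radial) auto
  also have "\<dots> \<le> (\<integral>\<^sup>+ s. ennreal ?A * indicator {0..r} s \<partial>lborel)"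
  proof (intro nn_integral_mono)
    fix s :: real
    show "ennreal (?A * ((s powr (1 - real n) * indicat_real {..r} s) * s ^ (n - 1))) * indicator {0..} s
       \<le> ennreal ?A * indicator {0..r} s"
    proof (cases "0 < s \<and> s \<le> r")
      case True
      have "s ^ (n - 1) = s powr (real n - 1)" using True n by (simp add: powr_realpow[symmetric] of_nat_diff Suc_leI)
      then have "s powr (1 - real n) * s ^ (n - 1) = 1" using True by (simp add: powr_add[symmetric])
      then show ?thesis using True by simp
    qed (auto simp: indicator_def)
  qed
  also have "\<dots> = ennreal ?A * ennreal r" using r by (simp add: nn_integral_cmult_indicator)
  also have "\<dots> = ennreal (?A * r)" using A r by (simp add: ennreal_mult)
  finally show ?thesis .
qed

text \<open>The second moment of the weight on a ball: in polar coordinates the integrand is at most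
  (1 + s) powr (n + 1 - a), whose antiderivative is \<open>Lam\<close> with exponent a - n -
  1.\<close>

lemma radial_moment:
  assumes r: "0 \<le> r" and a: "real n + 1 - a = - b" "0 \<le> a"
  shows "(\<integral>\<^sup>+ y. ennreal ((norm y)\<^sup>2 * (1 + norm y) powr (- a) * indicat_real {..r} (norm y)) \<partial>(lborel :: 'a measure))
     \<le> ennreal (sphere_area n * Lam b r)"
proof -
  let ?A = "sphere_area n"
  have A: "0 < ?A" by (simp add: n sphere_area_pos)
  have "(\<integral>\<^sup>+ y. ennreal ((norm y)\<^sup>2 * (1 + norm y) powr (- a) * indicat_real {..r} (norm y)) \<partial>(lborel :: 'a measure))
    = (\<integral>\<^sup>+ s. ennreal (?A * ((s\<^sup>2 * (1 + s) powr (- a) * indicat_real {..r} s) * s ^ (n - 1))) * indicator {0..} s \<partial>lborel)"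
    unfolding n by (rule nn_integral_radial) auto
  also have "\<dots> \<le> (\<integral>\<^sup>+ s. ennreal (?A * (1 + s) powr (- b)) * indicator {0..r} s \<partial>lborel)"
  proof (intro nn_integral_mono)
    fix s :: real
    show "ennreal (?A * ((s\<^sup>2 * (1 + s) powr (- a) * indicat_real {..r} s) * s ^ (n - 1))) * indicator {0..} s
       \<le> ennreal (?A * (1 + s) powr (- b)) * indicator {0..r} s"
    proof (cases "0 \<le> s \<and> s \<le> r")
      case True
      have "s\<^sup>2 * s ^ (n - 1) \<le> (1 + s)\<^sup>2 * (1 + s) ^ (n - 1)" using True by (intro mult_mono power_mono) auto
      also have "\<dots> = (1 + s) powr (real n + 1)"
      proof -
        have "(1 + s)\<^sup>2 = (1 + s) powr 2" using True by (simp add: powr_numeral)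
        moreover have "(1 + s) ^ (n - 1) = (1 + s) powr (real n - 1)"
          using True n by (simp add: powr_realpow[symmetric] of_nat_diff Suc_leI)
        ultimately show ?thesis by (simp add: powr_add[symmetric] add.commute)
      qed
      finally have "s\<^sup>2 * s ^ (n - 1) * (1 + s) powr (- a) \<le> (1 + s) powr (real n + 1) * (1 + s) powr (- a)"
        by (rule mult_right_mono) simp
      also have "\<dots> = (1 + s) powr (- b)" using a by (simp add: powr_add[symmetric])
      finally have "?A * (s\<^sup>2 * s ^ (n - 1) * (1 + s) powr (- a)) \<le> ?A * (1 + s) powr (- b)" using A by simp
      then show ?thesis using True by (simp add: mult_ac ennreal_leI)
    qed (auto simp: indicator_def)
  qed
  also have "\<dots> = ennreal (?A * Lam b r - ?A * Lam b 0)"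
    by (rule nn_integral_FTC_Icc) (use A r in \<open>auto intro!: derivative_eq_intros Lam_deriv\<close>)
  also have "\<dots> = ennreal (?A * Lam b r)" by (simp add: Lam_def)
  finally show ?thesis .
qed

lemma radial_integrable:
  assumes b: "real n < b"
  shows "(\<integral>\<^sup>+ y. ennreal ((1 + norm y) powr (- b)) \<partial>(lborel :: 'a measure)) < \<infinity>"
proof -
  have b0: "0 \<le> b" using b by linarith
  have "(\<integral>\<^sup>+ y. ennreal ((1 + norm y) powr (- b)) \<partial>(lborel :: 'a measure))
    \<le> (\<integral>\<^sup>+ y. indicator (cball 0 1) y + ennreal (norm y powr (- b) * indicat_real {1..} (norm y)) \<partial>(lborel :: 'a measure))"
  proof (intro nn_integral_mono)
    fix y :: 'a
    show "ennreal ((1 + norm y) powr (- b)) \<le> indicator (cball 0 1) y + ennreal (norm y powr (- b) * indicat_real {1..} (norm y))"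
    proof (cases "norm y \<le> 1")
      case True
      have "(1 + norm y) powr (- b) \<le> 1 powr (- b)" using b0 by (intro powr_mono2') auto
      then have "(1 + norm y) powr (- b) \<le> 1" by simp
      then have "ennreal ((1 + norm y) powr (- b)) \<le> 1" by (simp add: ennreal_le_1)
      then show ?thesis using True by (simp add: add_increasing2)
    next
      case False
      have "(1 + norm y) powr (- b) \<le> norm y powr (- b)" using False b by (intro powr_mono2') auto
      then show ?thesis using False by (simp add: ennreal_leI)
    qed
  qed
  also have "\<dots> = emeasure lborel (cball (0::'a) 1) + (\<integral>\<^sup>+ y. ennreal (norm y powr (- b) * indicat_real {1..} (norm y)) \<partial>(lborel :: 'a measure))"
    by (subst nn_integral_add) (auto intro!: borel_measurable_indicator)
  also have "\<dots> < \<infinity>" using emeasure_lborel_cball_finite[of "0::'a" 1] by (simp add: radial_powr_tail[OF zero_less_one b])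
  finally show ?thesis .
qed

end

lemma Lam_nonneg: "0 \<le> r \<Longrightarrow> 0 \<le> Lam b r"
proof -
  assume r: "0 \<le> r"
  have "Lam b 0 \<le> Lam b r"
  proof (rule DERIV_nonneg_imp_nondecreasing[OF r])
    show "\<exists>y. (Lam b has_real_derivative y) (at s) \<and> 0 \<le> y" if "0 \<le> s" "s \<le> r" for s
      using Lam_deriv[OF that(1)] by (intro exI[of _ "(1 + s) powr (- b)"]) auto
  qed
  moreover have "Lam b 0 = 0" by (simp add: Lam_def)
  ultimately show ?thesis by simp
qed

text \<open>The three regimes \<open>a > d + 2\<close>, \<open>a = d + 2\<close> and \<open>a < d + 2\<close> of the remainder all come from
  the first moment of the force over the ball of radius \<open>r / 2\<close>.\<close>

lemma Lam_remainder:
  fixes d a r :: real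
  assumes a: "a > d + 1" and r: "2 \<le> r"
  shows "r powr (- d) * Lam (a - d - 1) (r / 2)
    \<le> (1 + 1 / \<bar>a - d - 2\<bar>) * (r powr (- min d (a - 2)) * (1 + (if a = d + 2 then ln r else 0)))"
proof -
  define b where "b = a - d - 1"
  consider "b = 1" | "b > 1" | "b < 1" by linarith
  then show ?thesis
  proof cases
    case 1
    then have ad: "a = d + 2" by (simp add: b_def)
    \<comment> \<open>Here a = d + 2, so 1 / |a - d - 2| is division by zero, with value 0, and the
      stated constant is 1. The comparison 1 + r/2 \<le> r is where r \<ge> 2 enters.\<close>
    have "ln (1 + r / 2) \<le> ln r" using r by (intro ln_mono) auto
    also have "\<dots> \<le> 1 + ln r" by simp
    finally have "r powr (- d) * ln (1 + r / 2) \<le> r powr (- d) * (1 + ln r)" by (intro mult_left_mono) auto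
    then show ?thesis using ad by (simp add: Lam_def)
  next
    case 2
    have m: "min d (a - 2) = d" using 2 by (simp add: b_def)
    have ne: "a \<noteq> d + 2" using 2 by (simp add: b_def)
    have L: "Lam b (r / 2) = (1 - (1 + r / 2) powr (1 - b)) / (b - 1)" using 2 by (simp add: Lam_def divide_simps) (simp add: algebra_simps)?
    also have "\<dots> \<le> 1 / (b - 1)" using 2 by (intro divide_right_mono) auto
    also have "\<dots> \<le> 1 + 1 / \<bar>b - 1\<bar>" using 2 by simp
    finally have "r powr (- d) * Lam b (r / 2) \<le> r powr (- d) * (1 + 1 / \<bar>b - 1\<bar>)" by (intro mult_left_mono) auto
    then show ?thesis using m ne by (simp add: b_def mult.commute)
  next
    case 3
    have m: "min d (a - 2) = a - 2" using 3 by (simp add: b_def)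
    have ne: "a \<noteq> d + 2" using 3 by (simp add: b_def)
    have "Lam b (r / 2) = ((1 + r / 2) powr (1 - b) - 1) / (1 - b)" using 3 by (simp add: Lam_def)
    also have "\<dots> \<le> (1 + r / 2) powr (1 - b) / (1 - b)" using 3 by (intro divide_right_mono) auto
    also have "\<dots> \<le> r powr (1 - b) / (1 - b)" using 3 r by (intro divide_right_mono powr_mono2) auto
    finally have "r powr (- d) * Lam b (r / 2) \<le> r powr (- d) * (r powr (1 - b) / (1 - b))" by (intro mult_left_mono) auto
    also have "\<dots> = r powr (- (a - 2)) * (1 / (1 - b))"
    proof -
      have "r powr (- d) * r powr (1 - b) = r powr (- (a - 2))" using r by (simp add: powr_add[symmetric] b_def)
      then show ?thesis by simp
    qed
    also have "\<dots> \<le> r powr (- (a - 2)) * (1 + 1 / \<bar>b - 1\<bar>)" using 3 by (intro mult_left_mono) auto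
    finally show ?thesis using m ne by (simp add: b_def mult.commute)
  qed
qed

text \<open>For norm x \<ge> 2 the bracket \<open>japanese x\<close> lies between norm x and 2 *
  norm x, so bounds in terms of the norm convert with a fixed power of 2.\<close>

lemma remainder_bound_ge:
  fixes x :: "real^'n::finite"
  assumes a: "a > real CARD('n) + 1" and x: "2 \<le> norm x"
  shows "norm x powr (- min (real CARD('n)) (a - 2)) * (1 + (if a = real CARD('n) + 2 then ln (norm x) else 0))
    \<le> 2 powr min (real CARD('n)) (a - 2) * remainder_bound a x"
proof -
  let ?m = "min (real CARD('n)) (a - 2)" and ?r = "norm x"
  have n: "1 \<le> real CARD('n)" by (simp add: Suc_leI)
  have "0 \<le> a - 2" using a n by linarith
  then have m: "0 \<le> ?m" by simp
  have j1: "japanese x \<le> 2 * ?r"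
  proof -
    have "1 \<le> ?r\<^sup>2" using x by (simp add: one_le_power)
    then have "2 + ?r\<^sup>2 \<le> (2 * ?r)\<^sup>2" by (simp add: power_mult_distrib)
    then show ?thesis unfolding japanese_def using x by (intro real_le_lsqrt) auto
  qed
  have j2: "?r \<le> japanese x" unfolding japanese_def by (intro real_le_rsqrt) auto
  have "2 powr (- ?m) * ?r powr (- ?m) = (2 * ?r) powr (- ?m)" by (simp add: powr_mult)
  also have "\<dots> \<le> japanese x powr (- ?m)" using j1 j2 x m by (intro powr_mono2') auto
  finally have 1: "2 powr ?m * (2 powr (- ?m) * ?r powr (- ?m)) \<le> 2 powr ?m * japanese x powr (- ?m)"
    by (intro mult_left_mono) auto
  have 2: "2 powr ?m * (2 powr (- ?m) * ?r powr (- ?m)) = ?r powr (- ?m)" by (simp add: powr_minus)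
  have "ln ?r \<le> ln (japanese x)" using j2 x by (intro ln_mono) auto
  then have 3: "1 + (if a = real CARD('n) + 2 then ln ?r else 0) \<le> 1 + (if a = real CARD('n) + 2 then ln (japanese x) else 0)"
    by simp
  have "0 \<le> ln ?r" using x by simp
  then have "?r powr (- ?m) * (1 + (if a = real CARD('n) + 2 then ln ?r else 0))
    \<le> (2 powr ?m * japanese x powr (- ?m)) * (1 + (if a = real CARD('n) + 2 then ln (japanese x) else 0))"
    using 1 2 3 by (intro mult_mono) auto
  then show ?thesis by (simp add: remainder_bound_def mult.assoc)
qed

section \<open>Moments of the force\<close>

context stokes_exterior
begin

lemma n2: "2 \<le> real CARD('n)" using dim by simp

lemma f_bound: obtains Cf where "0 \<le> Cf" "AE y in M. norm (f y) \<le> Cf * (1 + norm y) powr (- a)"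
proof -
  obtain C where C: "AE x in M. norm (f x) \<le> C * japanese x powr (- a)" using f_decay by blast
  have j: "japanese x powr (- a) \<le> sqrt 2 powr a * (1 + norm x) powr (- a)" for x :: "real^'n"
  proof -
    \<comment> \<open>This is the inequality (1 + |x|)^2 \<le> 2(2 + |x|^2), which compares the two
      weights.\<close>
    have "0 \<le> (norm x - 1)\<^sup>2 + 2" by simp
    then have "((1 + norm x) / sqrt 2)\<^sup>2 \<le> 2 + (norm x)\<^sup>2" by (simp add: power2_eq_square field_simps)
    then have "(1 + norm x) / sqrt 2 \<le> japanese x" unfolding japanese_def by (rule real_le_rsqrt)
    moreover have "0 \<le> a" using a n2 by linarith
    ultimately have "japanese x powr (- a) \<le> ((1 + norm x) / sqrt 2) powr (- a)"
      by (intro powr_mono2') (auto simp: add_pos_nonneg)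
    also have "\<dots> = sqrt 2 powr a * (1 + norm x) powr (- a)"
      by (simp add: powr_divide powr_minus_divide)
    finally show ?thesis .
  qed
  show ?thesis
  proof (rule that[of "\<bar>C\<bar> * sqrt 2 powr a"])
    show "AE y in M. norm (f y) \<le> \<bar>C\<bar> * sqrt 2 powr a * (1 + norm y) powr (- a)"
      using C
    proof eventually_elim
      case (elim y)
      have "C * japanese y powr (- a) \<le> \<bar>C\<bar> * (sqrt 2 powr a * (1 + norm y) powr (- a))"
        by (intro mult_mono j) auto
      then show ?case using elim by (simp add: mult.assoc)
    qed
  qed simp
qed

text \<open>Every integral of f against a kernel is reduced to a Lebesgue integral over the whole
  space of the decay weight times that kernel, which the radial formulas can evaluate.\<close>

lemma f_moment_bound:
  fixes h :: "real^'n \<Rightarrow> real"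
  assumes Cf: "0 \<le> Cf" "AE y in M. norm (f y) \<le> Cf * (1 + norm y) powr (- a)"
    and h: "h \<in> borel_measurable borel" and c: "0 \<le> c"
    and le: "(\<integral>\<^sup>+ y. ennreal ((1 + norm y) powr (- a) * \<bar>h y\<bar>) \<partial>lborel) \<le> ennreal c"
  shows "integrable M (\<lambda>y. f y $ j * h y)" "\<bar>LINT y|M. f y $ j * h y\<bar> \<le> Cf * c"
proof -
  have m: "(\<lambda>y. f y $ j * h y) \<in> borel_measurable M"
    using f_measurable[of j] borel_measurable_lebesgue_onI[OF h] by (intro borel_measurable_times)
  have "(\<integral>\<^sup>+ y. ennreal (norm (f y $ j * h y)) \<partial>M) \<le> (\<integral>\<^sup>+ y. ennreal Cf * ennreal ((1 + norm y) powr (- a) * \<bar>h y\<bar>) \<partial>M)"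
  proof (rule nn_integral_mono_AE, rule eventually_mono[OF Cf(2)])
    fix y assume y: "norm (f y) \<le> Cf * (1 + norm y) powr (- a)"
    have "\<bar>f y $ j\<bar> \<le> Cf * (1 + norm y) powr (- a)" using component_le_norm_cart[of "f y" j] y by linarith
    then have "\<bar>f y $ j\<bar> * \<bar>h y\<bar> \<le> Cf * (1 + norm y) powr (- a) * \<bar>h y\<bar>" by (intro mult_right_mono) auto
    then show "ennreal (norm (f y $ j * h y)) \<le> ennreal Cf * ennreal ((1 + norm y) powr (- a) * \<bar>h y\<bar>)"
      using Cf(1) by (simp add: ennreal_mult[symmetric] abs_mult mult.assoc ennreal_leI)
  qed
  also have "\<dots> \<le> (\<integral>\<^sup>+ y. ennreal Cf * ennreal ((1 + norm y) powr (- a) * \<bar>h y\<bar>) \<partial>lebesgue)"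
    using \<Omega>_sets by (subst nn_integral_restrict_space) (auto intro!: nn_integral_mono simp: indicator_def)
  also have "\<dots> = (\<integral>\<^sup>+ y. ennreal Cf * ennreal ((1 + norm y) powr (- a) * \<bar>h y\<bar>) \<partial>lborel)"
    using h by (intro nn_integral_completion) measurable
  also have "\<dots> = ennreal Cf * (\<integral>\<^sup>+ y. ennreal ((1 + norm y) powr (- a) * \<bar>h y\<bar>) \<partial>lborel)"
    using h by (intro nn_integral_cmult) measurable
  also have "\<dots> \<le> ennreal Cf * ennreal c" by (intro mult_left_mono le) auto
  also have "\<dots> = ennreal (Cf * c)" using Cf(1) c by (simp add: ennreal_mult)
  finally have N: "(\<integral>\<^sup>+ y. ennreal (norm (f y $ j * h y)) \<partial>M) \<le> ennreal (Cf * c)" .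
  show I: "integrable M (\<lambda>y. f y $ j * h y)"
    by (rule integrableI_bounded[OF m]) (use N in \<open>simp add: le_less_trans\<close>)
  have "ennreal (norm (LINT y|M. f y $ j * h y)) \<le> ennreal (Cf * c)"
    using integral_norm_bound_ennreal[OF I] N by (rule order_trans)
  then show "\<bar>LINT y|M. f y $ j * h y\<bar> \<le> Cf * c" using Cf(1) c by (simp add: ennreal_le_iff)
qed

text \<open>Against a function of linear growth the weight becomes (1 + |y|) powr (1 - a), which is
  integrable because a - 1 > n.\<close>

lemma f_integrable_linear:
  fixes h :: "real^'n \<Rightarrow> real"
  assumes h: "h \<in> borel_measurable borel" "\<And>y. \<bar>h y\<bar> \<le> c * (1 + norm y)"
  shows "integrable M (\<lambda>y. f y $ j * h y)"
proof -
  obtain Cf where Cf: "0 \<le> Cf" "AE y in M. norm (f y) \<le> Cf * (1 + norm y) powr (- a)" using f_bound by blast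
  have c: "0 \<le> c" using order_trans[OF abs_ge_zero h(2)[of 0]] by simp
  have lt: "(\<integral>\<^sup>+ y. ennreal ((1 + norm y) powr (- (a - 1))) \<partial>(lborel :: (real^'n) measure)) < \<infinity>"
    by (rule radial_integrable[where n="DIM(real^'n)"]) (use a in auto)
  have "(\<integral>\<^sup>+ y. ennreal ((1 + norm y) powr (- a) * \<bar>h y\<bar>) \<partial>lborel)
     \<le> (\<integral>\<^sup>+ y. ennreal c * ennreal ((1 + norm y) powr (- (a - 1))) \<partial>(lborel :: (real^'n) measure))"
  proof (rule nn_integral_mono)
    fix y :: "real^'n"
    have "(1 + norm y) powr (- a) * \<bar>h y\<bar> \<le> (1 + norm y) powr (- a) * (c * (1 + norm y))"
      by (intro mult_left_mono h) auto
    also have "\<dots> = c * (1 + norm y) powr (- (a - 1))"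
      by (simp add: powr_diff powr_minus_divide add_pos_nonneg)
    finally show "ennreal ((1 + norm y) powr (- a) * \<bar>h y\<bar>) \<le> ennreal c * ennreal ((1 + norm y) powr (- (a - 1)))"
      using c by (simp add: ennreal_mult[symmetric] ennreal_leI)
  qed
  also have "\<dots> = ennreal c * (\<integral>\<^sup>+ y. ennreal ((1 + norm y) powr (- (a - 1))) \<partial>(lborel :: (real^'n) measure))"
    by (intro nn_integral_cmult) measurable
  also have "\<dots> < \<infinity>" using lt by (simp add: ennreal_mult_less_top)
  finally have fin: "(\<integral>\<^sup>+ y. ennreal ((1 + norm y) powr (- a) * \<bar>h y\<bar>) \<partial>lborel) < \<infinity>" .
  define X where "X = (\<integral>\<^sup>+ y. ennreal ((1 + norm y) powr (- a) * \<bar>h y\<bar>) \<partial>lborel)"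
  have "X \<le> ennreal (enn2real X)" using fin unfolding X_def by simp
  then show ?thesis unfolding X_def by (rule f_moment_bound(1)[OF Cf h(1) enn2real_nonneg])
qed

lemma S_bound:
  assumes "integrable S T" "continuous_on UNIV (h :: real^'n \<Rightarrow> real)" "\<And>q. q \<in> frontier \<Omega> \<Longrightarrow> \<bar>h q\<bar> \<le> c"
  shows "\<bar>LINT q|S. T q * h q\<bar> \<le> c * (LINT q|S. \<bar>T q\<bar>)"
proof -
  have "\<bar>LINT q|S. T q * h q\<bar> \<le> (LINT q|S. \<bar>T q * h q\<bar>)" by (rule integral_abs_bound)
  also have "\<dots> \<le> (LINT q|S. c * \<bar>T q\<bar>)"
  proof (rule integral_mono_AE)
    show "integrable S (\<lambda>q. \<bar>T q * h q\<bar>)" using integrable_mult_cont_S[OF assms(1,2)] by simp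
    show "integrable S (\<lambda>q. c * \<bar>T q\<bar>)" using assms(1) by simp
    show "AE q in S. \<bar>T q * h q\<bar> \<le> c * \<bar>T q\<bar>"
      using surface_AE_frontier[OF surf]
    proof eventually_elim
      case (elim q)
      show ?case using mult_right_mono[OF assms(3)[OF elim], of "\<bar>T q\<bar>"] by (simp add: abs_mult mult.commute)
    qed
  qed
  finally show ?thesis by simp
qed

text \<open>The matrix of first moments before normalisation. \<open>coeff_b_Bm\<close> shows that
  the coefficients of the theorem differ from it by a multiple of the identity matrix.\<close>

definition Bm :: "'n \<Rightarrow> 'n \<Rightarrow> real" where
  "Bm j k = (LINT q|S. vb q $ j * \<nu> q $ k) - Lfun j (\<lambda>y. y $ k)"

lemma Lfun_1: "Lfun j (\<lambda>_. 1) = 0"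
  using net_force[of j] by (simp add: Lfun_def gb_def set_integral_lebesgue_on(1)[OF \<Omega>_sets])

lemma Lfun_add:
  assumes "integrable M (\<lambda>y. f y $ j * h1 y)" "integrable M (\<lambda>y. f y $ j * h2 y)"
    "integrable S (\<lambda>q. gb j q * h1 q)" "integrable S (\<lambda>q. gb j q * h2 q)"
  shows "Lfun j (\<lambda>y. h1 y + h2 y) = Lfun j h1 + Lfun j h2"
  using assms by (simp add: Lfun_def distrib_left)

lemma Lfun_cmult: "Lfun j (\<lambda>y. c * h y) = c * Lfun j h"
  by (simp add: Lfun_def mult.left_commute distrib_left)

lemma f_nth_integrable: "integrable M (\<lambda>y. f y $ j * y $ k)"
  by (rule f_integrable_linear[where c=1])
     (use component_le_norm_cart in \<open>auto intro!: borel_measurable_continuous_onI continuous_intros order_trans[OF component_le_norm_cart]\<close>)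

text \<open>The constant c0 drops out because the net force is zero, so of a first order expansion
  only the first moments survive.\<close>

lemma Lfun_linear:
  "Lfun j (\<lambda>y. c0 + (\<Sum>k\<in>UNIV. y $ k * c k)) = (\<Sum>k\<in>UNIV. Lfun j (\<lambda>y. y $ k) * c k)"
  and linear_integrable: "integrable M (\<lambda>y. f y $ j * (c0 + (\<Sum>k\<in>UNIV. y $ k * c k)))"
    "integrable S (\<lambda>q. gb j q * (c0 + (\<Sum>k\<in>UNIV. q $ k * c k)))"
proof -
  have i1: "integrable M (\<lambda>y. f y $ j * c0)" by (rule f_integrable_linear[where c="\<bar>c0\<bar>"]) (auto simp: mult_le_cancel_left1)
  have i2: "integrable M (\<lambda>y. f y $ j * (\<Sum>k\<in>UNIV. y $ k * c k))"
    by (simp add: sum_distrib_left mult.assoc[symmetric] f_nth_integrable)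
  have j0: "integrable S (\<lambda>q. gb j q * q $ k)" for k
    by (intro integrable_mult_cont_S integrable_gb continuous_intros)
  have j1: "integrable S (\<lambda>q. gb j q * c0)" by (simp add: integrable_gb)
  have j2: "integrable S (\<lambda>q. gb j q * (\<Sum>k\<in>UNIV. q $ k * c k))"
    by (simp add: sum_distrib_left mult.assoc[symmetric] j0)
  have "Lfun j (\<lambda>y. c0 + (\<Sum>k\<in>UNIV. y $ k * c k)) = Lfun j (\<lambda>_. c0) + Lfun j (\<lambda>y. \<Sum>k\<in>UNIV. y $ k * c k)"
    by (rule Lfun_add[OF i1 i2 j1 j2])
  also have "Lfun j (\<lambda>_. c0) = 0" using Lfun_cmult[of j c0 "\<lambda>_. 1"] by (simp add: Lfun_1)
  also have "Lfun j (\<lambda>y. \<Sum>k\<in>UNIV. y $ k * c k) = (\<Sum>k\<in>UNIV. Lfun j (\<lambda>y. y $ k) * c k)"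
    by (simp add: Lfun_def sum_distrib_left mult.assoc[symmetric] f_nth_integrable j0 Bochner_Integration.integral_sum sum.distrib distrib_right)
  finally show "Lfun j (\<lambda>y. c0 + (\<Sum>k\<in>UNIV. y $ k * c k)) = (\<Sum>k\<in>UNIV. Lfun j (\<lambda>y. y $ k) * c k)" by simp
  show "integrable M (\<lambda>y. f y $ j * (c0 + (\<Sum>k\<in>UNIV. y $ k * c k)))"
    using i1 i2 by (simp add: distrib_left)
  show "integrable S (\<lambda>q. gb j q * (c0 + (\<Sum>k\<in>UNIV. q $ k * c k)))"
    using j1 j2 by (simp add: distrib_left)
qed

end

lemma lborel_nn_integral_translate:
  fixes f :: "'a::euclidean_space \<Rightarrow> ennreal"
  assumes [measurable]: "f \<in> borel_measurable borel"
  shows "(\<integral>\<^sup>+ x. f (x - c) \<partial>lborel) = (\<integral>\<^sup>+ x. f x \<partial>lborel)"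
proof -
  have "(\<integral>\<^sup>+ x. f x \<partial>lborel) = (\<integral>\<^sup>+ x. f x \<partial>distr lborel borel ((+) (- c)))" by (simp only: lborel_distr_plus)
  also have "\<dots> = (\<integral>\<^sup>+ x. f (- c + x) \<partial>lborel)" by (rule nn_integral_distr) measurable
  finally show ?thesis by simp
qed

text \<open>The three summands belong to the inner ball |y| \<le> |x|/2, to the tail |y| \<ge> |x|/2
  and to the ball around the singularity y = x; the last factor converts powers of |x| into
  \<open>remainder_bound\<close>.\<close>

definition theta_const :: "real \<Rightarrow> nat \<Rightarrow> real" where
  "theta_const a n = kconst (real n) * (2 powr real n + 1) * sphere_area n *
     ((1 + 1 / \<bar>a - real n - 2\<bar>) + 2 powr (a - 1 - real n) / (a - 1 - real n) + 2 powr (a - 2)) * 2 powr min (real n) (a - 2)"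

lemma theta_const_nonneg: "2 \<le> n \<Longrightarrow> a > real n + 1 \<Longrightarrow> 0 \<le> theta_const a n"
  using kconst_ge(5)[of "real n"] sphere_area_pos[of n]
  by (auto simp: theta_const_def intro!: mult_nonneg_nonneg add_nonneg_nonneg divide_nonneg_pos)

text \<open>On the inner ball the quadratic bound of the remainder meets the second moment of the
  weight, which creates the three regimes of the remainder. The two outer pieces are each of order
  |x| powr (2 - a).\<close>

lemma taylor_rem_moment:
  fixes x :: "real^'n::finite"
  assumes K: "kchain (real CARD('n)) B F0 F1 F2 F3" and d: "CARD('n) \<ge> 2" and x: "2 \<le> norm x"
    and a: "a > real CARD('n) + 1"
  shows "(\<integral>\<^sup>+ y. ennreal ((1 + norm y) powr (- a) * \<bar>taylor_rem F0 F1 F2 x i j y\<bar>) \<partial>lborel)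
    \<le> ennreal (theta_const a CARD('n) * B * remainder_bound a x)"
proof -
  let ?n = "real CARD('n)" and ?A = "sphere_area CARD('n)"
  define r where "r = norm x"
  have r: "2 \<le> r" "0 < r" using x by (auto simp: r_def)
  have x0: "x \<noteq> 0" using r by (auto simp: r_def)
  have n2: "2 \<le> ?n" using d by simp
  have B: "0 \<le> B" by (rule kchain_B_nonneg[OF K])
  have A: "0 < ?A" by (rule sphere_area_pos) simp
  define P where "P = kconst ?n * B * (2 powr ?n + 1)"
  have P: "0 \<le> P" using kconst_ge(5)[OF n2] B by (simp add: P_def)
  have kP: "kconst ?n * B \<le> P"
  proof -
    have "kconst ?n * B * 1 \<le> kconst ?n * B * (2 powr ?n + 1)"
      using kconst_ge(5)[OF n2] B by (intro mult_left_mono) auto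
    then show ?thesis by (simp add: P_def)
  qed
  \<comment> \<open>G1 is the integrand on the inner ball, G2 the tail, and G3, translated to x, the
    local singularity of the kernel.\<close>
  define G1 where "G1 y = (norm y)\<^sup>2 * (1 + norm y) powr (- a) * indicat_real {..r/2} (norm y)" for y :: "real^'n"
  define G2 where "G2 y = norm y powr (- (a - 1)) * indicat_real {r/2..} (norm y)" for y :: "real^'n"
  define G3 where "G3 y = norm y powr (1 - ?n) * indicat_real {..r/2} (norm y)" for y :: "real^'n"
  have [measurable]: "G1 \<in> borel_measurable borel" "G2 \<in> borel_measurable borel" "G3 \<in> borel_measurable borel"
    unfolding G1_def[abs_def] G2_def[abs_def] G3_def[abs_def] by measurable
  have G0: "0 \<le> G1 y" "0 \<le> G2 y" "0 \<le> G3 y" for y by (simp_all add: G1_def G2_def G3_def)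
  define k1 where "k1 = P * r powr (- ?n)"
  define k2 where "k2 = P * r powr (1 - ?n)"
  define k3 where "k3 = P * (r/2) powr (1 - a)"
  have k: "0 \<le> k1" "0 \<le> k2" "0 \<le> k3" using P by (simp_all add: k1_def k2_def k3_def)
  have pw: "(1 + norm y) powr (- a) * \<bar>taylor_rem F0 F1 F2 x i j y\<bar> \<le> k1 * G1 y + (k2 * G2 y + k3 * G3 (y - x))"
    if y: "y \<noteq> x" for y
  proof (cases "norm y \<le> r / 2")
    case True
    have "\<bar>taylor_rem F0 F1 F2 x i j y\<bar> \<le> kconst ?n * (B * (norm x powr (- ?n) * (norm y)\<^sup>2))"
      by (rule taylor_rem_near[OF K d x0]) (use True in \<open>simp add: r_def\<close>)
    also have "\<dots> = (kconst ?n * B) * (r powr (- ?n) * (norm y)\<^sup>2)" by (simp add: r_def)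
    also have "\<dots> \<le> P * (r powr (- ?n) * (norm y)\<^sup>2)" by (intro mult_right_mono kP) auto
    finally have "(1 + norm y) powr (- a) * \<bar>taylor_rem F0 F1 F2 x i j y\<bar> \<le> (1 + norm y) powr (- a) * (P * (r powr (- ?n) * (norm y)\<^sup>2))"
      by (intro mult_left_mono) auto
    also have "\<dots> = k1 * G1 y" using True by (simp add: k1_def G1_def)
    finally show ?thesis using k G0 by (simp add: add_increasing2)
  next
    case False
    then have ny: "r / 2 \<le> norm y" "0 < norm y" using r by auto
    define I where "I = indicat_real (ball x (norm x / 2)) y * norm (y - x) powr (1 - ?n)"
    have I: "0 \<le> I" "I \<le> G3 (y - x)" by (auto simp: I_def G3_def indicator_def r_def dist_norm norm_minus_commute)
    have "\<bar>taylor_rem F0 F1 F2 x i j y\<bar> \<le> P * (norm y * r powr (1 - ?n) + norm y * I)"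
      using taylor_rem_far[OF K d x0, of y i j] ny y by (simp add: r_def P_def I_def)
    then have "(1 + norm y) powr (- a) * \<bar>taylor_rem F0 F1 F2 x i j y\<bar> \<le> (1 + norm y) powr (- a) * (P * (norm y * r powr (1 - ?n) + norm y * I))"
      by (intro mult_left_mono) auto
    also have "\<dots> = ((1 + norm y) powr (- a) * norm y) * (P * (r powr (1 - ?n) + I))" by (simp add: algebra_simps)
    also have "\<dots> \<le> norm y powr (- (a - 1)) * (P * (r powr (1 - ?n) + I))"
    proof (rule mult_right_mono)
      have "(1 + norm y) powr (- a) \<le> norm y powr (- a)" using ny a n2 by (intro powr_mono2') auto
      then have "(1 + norm y) powr (- a) * norm y \<le> norm y powr (- a) * norm y" by (rule mult_right_mono) simp
      also have "\<dots> = norm y powr (- (a - 1))" using ny by (simp add: powr_diff powr_minus_divide)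
      finally show "(1 + norm y) powr (- a) * norm y \<le> norm y powr (- (a - 1))" .
    qed (use P I in auto)
    also have "\<dots> = k2 * G2 y + P * (norm y powr (- (a - 1)) * I)" using ny by (simp add: k2_def G2_def algebra_simps)
    also have "\<dots> \<le> k2 * G2 y + P * ((r/2) powr (1 - a) * G3 (y - x))"
    proof (intro add_left_mono mult_left_mono P mult_mono I)
      have "norm y powr (- (a - 1)) \<le> (r/2) powr (- (a - 1))" using ny r a n2 by (intro powr_mono2') auto
      then show "norm y powr (- (a - 1)) \<le> (r/2) powr (1 - a)" by simp
    qed auto
    also have "\<dots> = k2 * G2 y + k3 * G3 (y - x)" by (simp add: k3_def)
    finally show ?thesis using k G0 by (simp add: add_increasing)
  qed
  have a1: "?n < a - 1" using a by simp
  have cd: "CARD('n) = DIM(real^'n)" by simp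
  have "(\<integral>\<^sup>+ y. ennreal ((1 + norm y) powr (- a) * \<bar>taylor_rem F0 F1 F2 x i j y\<bar>) \<partial>lborel)
    \<le> (\<integral>\<^sup>+ y. ennreal k1 * ennreal (G1 y) + (ennreal k2 * ennreal (G2 y) + ennreal k3 * ennreal (G3 (y - x))) \<partial>lborel)"
  \<comment> \<open>\<open>taylor_rem_far\<close> excludes the point y = x, which is a null
    set.\<close>
  proof (rule nn_integral_mono_AE, rule eventually_mono[OF AE_lborel_singleton[of x]])
    fix y assume "y \<noteq> x"
    from pw[OF this] show "ennreal ((1 + norm y) powr (- a) * \<bar>taylor_rem F0 F1 F2 x i j y\<bar>)
      \<le> ennreal k1 * ennreal (G1 y) + (ennreal k2 * ennreal (G2 y) + ennreal k3 * ennreal (G3 (y - x)))"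
      using k G0 by (simp add: ennreal_mult[symmetric] ennreal_plus[symmetric] ennreal_leI del: ennreal_plus)
  qed
  also have "\<dots> = ennreal k1 * (\<integral>\<^sup>+ y. ennreal (G1 y) \<partial>lborel) + (ennreal k2 * (\<integral>\<^sup>+ y. ennreal (G2 y) \<partial>lborel)
      + ennreal k3 * (\<integral>\<^sup>+ y. ennreal (G3 (y - x)) \<partial>lborel))"
    by (simp add: nn_integral_add nn_integral_cmult)
  also have "(\<integral>\<^sup>+ y. ennreal (G3 (y - x)) \<partial>lborel) = (\<integral>\<^sup>+ y. ennreal (G3 y) \<partial>lborel)"
    by (rule lborel_nn_integral_translate) measurable
  also have "ennreal k1 * (\<integral>\<^sup>+ y. ennreal (G1 y) \<partial>lborel) + (ennreal k2 * (\<integral>\<^sup>+ y. ennreal (G2 y) \<partial>lborel)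
      + ennreal k3 * (\<integral>\<^sup>+ y. ennreal (G3 y) \<partial>lborel))
    \<le> ennreal k1 * ennreal (?A * Lam (a - ?n - 1) (r/2)) + (ennreal k2 * ennreal (?A / (a - 1 - ?n) * (r/2) powr (?n - (a - 1)))
      + ennreal k3 * ennreal (?A * (r/2)))"
  proof (intro add_mono mult_left_mono)
    show "(\<integral>\<^sup>+ y. ennreal (G1 y) \<partial>lborel) \<le> ennreal (?A * Lam (a - ?n - 1) (r/2))"
      unfolding G1_def by (rule radial_moment[OF cd]) (use r a n2 in auto)
    show "(\<integral>\<^sup>+ y. ennreal (G2 y) \<partial>lborel) \<le> ennreal (?A / (a - 1 - ?n) * (r/2) powr (?n - (a - 1)))"
      unfolding G2_def by (subst radial_powr_tail[OF cd]) (use r a1 in auto)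
    show "(\<integral>\<^sup>+ y. ennreal (G3 y) \<partial>lborel) \<le> ennreal (?A * (r/2))"
      unfolding G3_def by (rule radial_powr_near[OF cd]) (use r in auto)
  qed auto
  also have "\<dots> = ennreal (k1 * (?A * Lam (a - ?n - 1) (r/2)) + (k2 * (?A / (a - 1 - ?n) * (r/2) powr (?n - (a - 1))) + k3 * (?A * (r/2))))"
    using k A r a1 Lam_nonneg[of "r/2" "a - ?n - 1"] by (simp add: ennreal_mult[symmetric] ennreal_plus[symmetric] del: ennreal_plus)
  also have "\<dots> \<le> ennreal (theta_const a CARD('n) * B * remainder_bound a x)"
  proof (rule ennreal_leI)
    let ?m = "min ?n (a - 2)"
    define R where "R = r powr (- ?m) * (1 + (if a = ?n + 2 then ln r else 0))"
    have R2: "r powr (2 - a) \<le> R"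
    proof -
      have "r powr (2 - a) \<le> r powr (- ?m)" using r by (intro powr_mono) auto
      also have "\<dots> \<le> R" using r by (simp add: R_def mult_le_cancel_left1)
      finally show ?thesis .
    qed
    have t1: "r powr (- ?n) * Lam (a - ?n - 1) (r/2) \<le> (1 + 1 / \<bar>a - ?n - 2\<bar>) * R"
      unfolding R_def by (rule Lam_remainder[OF a r(1)])
    have t2: "r powr (1 - ?n) * (r/2) powr (?n - (a - 1)) \<le> 2 powr (a - 1 - ?n) * R"
    proof -
      have "r powr (1 - ?n) * (r/2) powr (?n - (a - 1)) = (r powr (1 - ?n) * r powr (?n - (a - 1))) / 2 powr (?n - (a - 1))"
        using r by (simp add: powr_divide)
      also have "r powr (1 - ?n) * r powr (?n - (a - 1)) = r powr (2 - a)" by (simp add: powr_add[symmetric])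
      also have "r powr (2 - a) / 2 powr (?n - (a - 1)) = 2 powr (a - 1 - ?n) * r powr (2 - a)"
        using powr_minus_divide[of 2 "?n - (a - 1)"] by simp
      finally show ?thesis using mult_left_mono[OF R2, of "2 powr (a - 1 - ?n)"] by simp
    qed
    have t3: "(r/2) powr (1 - a) * (r/2) \<le> 2 powr (a - 2) * R"
    proof -
      have "(r/2) powr (1 - a) * (r/2) = (r/2) powr (2 - a)" using r by (simp add: powr_diff power2_eq_square)
      also have "\<dots> = r powr (2 - a) / 2 powr (2 - a)" using r by (simp add: powr_divide)
      also have "\<dots> = 2 powr (a - 2) * r powr (2 - a)" using powr_minus_divide[of 2 "2 - a"] by simp
      finally show ?thesis using mult_left_mono[OF R2, of "2 powr (a - 2)"] by simp
    qed
    have PA: "0 \<le> P * ?A" using P A by simp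
    have "k1 * (?A * Lam (a - ?n - 1) (r/2)) + (k2 * (?A / (a - 1 - ?n) * (r/2) powr (?n - (a - 1))) + k3 * (?A * (r/2)))
      = P * ?A * (r powr (- ?n) * Lam (a - ?n - 1) (r/2) + (r powr (1 - ?n) * (r/2) powr (?n - (a - 1)) / (a - 1 - ?n) + (r/2) powr (1 - a) * (r/2)))"
      by (simp add: k1_def k2_def k3_def algebra_simps)
    also have "\<dots> \<le> P * ?A * ((1 + 1 / \<bar>a - ?n - 2\<bar>) * R + (2 powr (a - 1 - ?n) * R / (a - 1 - ?n) + 2 powr (a - 2) * R))"
      using a1 by (intro mult_left_mono add_mono divide_right_mono t1 t2 t3 PA) auto
    also have "\<dots> = P * ?A * ((1 + 1 / \<bar>a - ?n - 2\<bar>) + 2 powr (a - 1 - ?n) / (a - 1 - ?n) + 2 powr (a - 2)) * R"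
      by (simp add: algebra_simps)
    also have "\<dots> \<le> P * ?A * ((1 + 1 / \<bar>a - ?n - 2\<bar>) + 2 powr (a - 1 - ?n) / (a - 1 - ?n) + 2 powr (a - 2)) * (2 powr ?m * remainder_bound a x)"
      unfolding R_def r_def using P A a1 by (intro mult_left_mono remainder_bound_ge[OF a x] mult_nonneg_nonneg add_nonneg_nonneg) auto
    also have "\<dots> = theta_const a CARD('n) * B * remainder_bound a x"
      by (simp add: theta_const_def P_def mult_ac)
    finally show "k1 * (?A * Lam (a - ?n - 1) (r/2)) + (k2 * (?A / (a - 1 - ?n) * (r/2) powr (?n - (a - 1))) + k3 * (?A * (r/2)))
      \<le> theta_const a CARD('n) * B * remainder_bound a x" .
  qed
  finally show ?thesis .
qed


text \<open>Second order boundary errors are of size |x| powr (-n); since min n (a - 2) \<le> n they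
  are absorbed by the remainder.\<close>

lemma powr_dim_remainder:
  fixes x :: "real^'n::finite"
  assumes a: "a > real CARD('n) + 1" and x: "2 \<le> norm x"
  shows "norm x powr (- real CARD('n)) \<le> 2 powr min (real CARD('n)) (a - 2) * remainder_bound a x"
proof -
  let ?m = "min (real CARD('n)) (a - 2)"
  have "norm x powr (- real CARD('n)) \<le> norm x powr (- ?m)" using x by (intro powr_mono) auto
  also have "\<dots> \<le> norm x powr (- ?m) * (1 + (if a = real CARD('n) + 2 then ln (norm x) else 0))"
    using x by (simp add: mult_le_cancel_left1)
  also have "\<dots> \<le> 2 powr ?m * remainder_bound a x" by (rule remainder_bound_ge[OF a x])
  finally show ?thesis .
qed

section \<open>The estimate for regularised kernels\<close>

context stokes_exterior
begin

lemma kernel_green: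
  fixes x :: "real^'n"
  assumes K: "kchain (real CARD('n)) B F0 F1 F2 F3"
  shows "(LINT y|M. v y $ i * kK F1 F2 F3 (y - x)) + (LINT q|S. (vb q \<bullet> \<nu> q) * kQ F1 F2 i (q - x))
    = (\<Sum>j\<in>UNIV. Lfun j (\<lambda>y. kphi F0 F1 i j (y - x)))
      - (\<Sum>j\<in>UNIV. \<Sum>k\<in>UNIV. LINT q|S. vb q $ j * \<nu> q $ k * dphi F1 F2 i j k (q - x))"
proof -
  obtain T where T: "\<And>t. T \<le> t \<Longrightarrow> F0 t = 0 \<and> F1 t = 0 \<and> F2 t = 0" using K unfolding kchain_def by blast
  \<comment> \<open>Beyond this radius |y - x| \<ge> |T| + 1 \<ge> 1, so its square exceeds T and
    all three profiles vanish.\<close>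
  have z: "F0 ((y - x) \<bullet> (y - x)) = 0 \<and> F1 ((y - x) \<bullet> (y - x)) = 0 \<and> F2 ((y - x) \<bullet> (y - x)) = 0"
    if y: "norm x + \<bar>T\<bar> + 1 < norm y" for y
  proof (rule T)
    have "\<bar>T\<bar> + 1 \<le> norm (y - x)" using y norm_triangle_ineq2[of y x] by linarith
    then have "(\<bar>T\<bar> + 1) * 1 \<le> norm (y - x) * norm (y - x)" by (intro mult_mono) auto
    then show "T \<le> (y - x) \<bullet> (y - x)" by (simp add: power2_norm_eq_inner[symmetric] power2_eq_square)
  qed
  show ?thesis
  proof (rule green_identity[where R="norm x + \<bar>T\<bar> + 1"])
    show "C1_grad (\<lambda>y. kphi F0 F1 i j (y - x)) (\<lambda>y. \<chi> k. dphi F1 F2 i j k (y - x))" for j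
      by (rule C1_grad_translate[OF kchain_C1(1)[OF K]])
    show "C1_grad (\<lambda>y. dphi F1 F2 i j k (y - x)) (\<lambda>y. \<chi> l. ddphi F1 F2 F3 i j k l (y - x))" for j k
      by (rule C1_grad_translate[OF kchain_C1(2)[OF K]])
    show "C1_grad (\<lambda>y. kQ F1 F2 i (y - x)) (\<lambda>y. \<chi> l. dQ F1 F2 F3 i l (y - x))"
      by (rule C1_grad_translate[OF kchain_C1(3)[OF K]])
    show "supp_in (\<lambda>y. kphi F0 F1 i j (y - x)) (norm x + \<bar>T\<bar> + 1)" for j
      using z by (simp add: supp_in_def kphi_def)
    show "supp_in (\<lambda>y. kQ F1 F2 i (y - x)) (norm x + \<bar>T\<bar> + 1)"
      using z by (simp add: supp_in_def kQ_def)
    show "(\<Sum>j\<in>UNIV. dphi F1 F2 i j j (y - x)) = 0" for y by (rule dphi_div)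
    show "- (\<Sum>k\<in>UNIV. ddphi F1 F2 F3 i j k k (y - x)) = dlt i j * kK F1 F2 F3 (y - x) + dQ F1 F2 F3 i j (y - x)" for j y
      by (rule ddphi_laplace)
  qed
qed

text \<open>C and R0 are fixed before the profiles are chosen, and a chain of profiles enters only
  through B. This uniformity allows the regularisation to be removed later.\<close>

lemma main_estimate:
  obtains C R0 where "0 \<le> C"
    "\<And>F0 F1 F2 F3 B x i. kchain (real CARD('n)) B F0 F1 F2 F3 \<Longrightarrow> R0 \<le> norm x \<Longrightarrow>
      \<bar>(LINT y|M. v y $ i * kK F1 F2 F3 (y - x)) - (coeff_b0 S \<nu> vb * kQ F1 F2 i x
        + (\<Sum>j\<in>UNIV. \<Sum>k\<in>UNIV. dphi F1 F2 i j k x * Bm j k))\<bar> \<le> C * B * remainder_bound a x"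
proof -
  let ?n = "real CARD('n)"
  obtain Cf where Cf: "0 \<le> Cf" "AE y in M. norm (f y) \<le> Cf * (1 + norm y) powr (- a)" using f_bound by blast
  obtain \<rho> where \<rho>: "0 < \<rho>" "\<And>q. q \<in> frontier \<Omega> \<Longrightarrow> norm q \<le> \<rho>"
    using compact_imp_bounded[OF compact_frontier_exterior[OF dom]] by (auto simp: bounded_pos)
  define D0 where "D0 = (2::real) powr min ?n (a - 2)"
  define k where "k = kconst ?n"
  have k0: "0 < k" unfolding k_def by (rule kconst_ge(5)[OF n2])
  have D0: "0 < D0" by (simp add: D0_def)
  define I1 where "I1 = (LINT q|S. \<bar>vb q \<bullet> \<nu> q\<bar>)"
  define J where "J j = (LINT q|S. \<bar>gb j q\<bar>)" for j
  define I where "I j l = (LINT q|S. \<bar>vb q $ j * \<nu> q $ l\<bar>)" for j l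
  have nn: "0 \<le> I1" "0 \<le> J j" "0 \<le> I j l" for j l by (simp_all add: I1_def J_def I_def)
  define \<Theta> where "\<Theta> = theta_const a CARD('n)"
  have \<Theta>: "0 \<le> \<Theta>" unfolding \<Theta>_def using dim a by (intro theta_const_nonneg) auto
  define C where "C = k * D0 * \<rho> * I1 + (\<Sum>j\<in>UNIV. Cf * \<Theta> + k * D0 * \<rho>\<^sup>2 * J j) + (\<Sum>j\<in>UNIV. \<Sum>l\<in>UNIV. k * D0 * \<rho> * I j l)"
  have ivn: "integrable S (\<lambda>q. vb q $ j * \<nu> q $ l)" for j l by (rule integrable_S_normal[OF integrable_vb])
  have ivb: "integrable S (\<lambda>q. vb q \<bullet> \<nu> q)" unfolding inner_vec_def using ivn by simp
  show ?thesis
  \<comment> \<open>\<rho> bounds the boundary, so norm x \<ge> 2\<rho> puts all boundary points in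
    the range |q| \<le> |x|/2 of the expansions around -x.\<close>
  proof (rule that[of C "max 2 (2 * \<rho>)"])
    show "0 \<le> C" unfolding C_def using k0 D0 \<rho> nn \<Theta> Cf
      by (intro add_nonneg_nonneg sum_nonneg mult_nonneg_nonneg) auto
    fix F0 F1 F2 F3 :: "real \<Rightarrow> real" and B and x :: "real^'n" and i :: 'n
    assume K: "kchain ?n B F0 F1 F2 F3" and xR: "max 2 (2 * \<rho>) \<le> norm x"
    have x2: "2 \<le> norm x" and x\<rho>: "\<rho> \<le> norm x / 2" and x0: "x \<noteq> 0" using xR by auto
    have B: "0 \<le> B" by (rule kchain_B_nonneg[OF K])
    define R where "R = remainder_bound a x"
    have xn: "norm x powr (- ?n) \<le> D0 * R" unfolding D0_def R_def by (rule powr_dim_remainder[OF a x2])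
    then have R0: "0 \<le> R" using D0 by (smt (verit) powr_ge_zero zero_le_mult_iff)
    have near: "norm q \<le> norm x / 2" if "q \<in> frontier \<Omega>" for q using \<rho>(2)[OF that] x\<rho> by linarith
    have kb: "k * (B * (norm x powr (- ?n) * t)) \<le> (k * D0 * s) * (B * R)" if "0 \<le> t" "t \<le> s" for t s
    proof -
      have "k * (B * (norm x powr (- ?n) * t)) \<le> k * (B * ((D0 * R) * s))"
        using k0 B xn that D0 R0 by (intro mult_left_mono mult_mono) auto
      then show ?thesis by (simp add: mult_ac)
    qed
    \<comment> \<open>The three errors of the expansion: of the flux term, of force and boundary
      stress, and of the boundary velocity. The first and last are of first order in q, against
      kernels one degree more singular; E2 is the second order remainder.\<close>
    define E1 where "E1 = (LINT q|S. (vb q \<bullet> \<nu> q) * (kQ F1 F2 i (q - x) - kQ F1 F2 i (- x)))"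
    define E2 where "E2 j = Lfun j (taylor_rem F0 F1 F2 x i j)" for j
    define E3 where "E3 j l = (LINT q|S. vb q $ j * \<nu> q $ l * (dphi F1 F2 i j l (q - x) - dphi F1 F2 i j l (- x)))" for j l
    have cQ: "continuous_on UNIV (\<lambda>y. kQ F1 F2 i (y - x))"
      by (rule C1_grad_continuous[OF C1_grad_translate[OF kchain_C1(3)[OF K]]])
    have cd: "continuous_on UNIV (\<lambda>y. dphi F1 F2 i j l (y - x))" for j l
      by (rule C1_grad_continuous[OF C1_grad_translate[OF kchain_C1(2)[OF K]]])
    have cp: "continuous_on UNIV (\<lambda>y. kphi F0 F1 i j (y - x))" for j
      by (rule C1_grad_continuous[OF C1_grad_translate[OF kchain_C1(1)[OF K]]])
    have ct: "continuous_on UNIV (taylor_rem F0 F1 F2 x i j)" for j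
      unfolding taylor_rem_def[abs_def] by (intro continuous_intros cp)
    have b1: "\<bar>E1\<bar> \<le> (k * D0 * \<rho>) * (B * R) * I1"
      unfolding E1_def I1_def
    proof (rule S_bound[OF ivb])
      fix q assume q: "q \<in> frontier \<Omega>"
      show "\<bar>kQ F1 F2 i (q - x) - kQ F1 F2 i (- x)\<bar> \<le> (k * D0 * \<rho>) * (B * R)"
        using dphi_near(3)[OF K dim x0 near[OF q], of i] kb[OF norm_ge_zero \<rho>(2)[OF q]] unfolding k_def by linarith
    qed (intro continuous_intros cQ)
    have b3: "\<bar>E3 j l\<bar> \<le> (k * D0 * \<rho>) * (B * R) * I j l" for j l
      unfolding E3_def I_def
    proof (rule S_bound[OF ivn])
      fix q assume q: "q \<in> frontier \<Omega>"
      show "\<bar>dphi F1 F2 i j l (q - x) - dphi F1 F2 i j l (- x)\<bar> \<le> (k * D0 * \<rho>) * (B * R)"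
        using dphi_near(1)[OF K dim x0 near[OF q], of i j l] kb[OF norm_ge_zero \<rho>(2)[OF q]] unfolding k_def by linarith
    qed (intro continuous_intros cd)
    have tm: "(\<integral>\<^sup>+ y. ennreal ((1 + norm y) powr (- a) * \<bar>taylor_rem F0 F1 F2 x i j y\<bar>) \<partial>lborel) \<le> ennreal (\<Theta> * B * R)" for j
      unfolding \<Theta>_def R_def by (rule taylor_rem_moment[OF K dim x2 a])
    have tb: "taylor_rem F0 F1 F2 x i j \<in> borel_measurable borel" for j
      by (rule borel_measurable_continuous_onI[OF ct])
    have tR: "0 \<le> \<Theta> * B * R" using \<Theta> B R0 by simp
    note fm = f_moment_bound[OF Cf tb tR tm]
    have b2: "\<bar>E2 j\<bar> \<le> (Cf * \<Theta> + k * D0 * \<rho>\<^sup>2 * J j) * (B * R)" for j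
    proof -
      have "\<bar>LINT q|S. gb j q * taylor_rem F0 F1 F2 x i j q\<bar> \<le> (k * D0 * \<rho>\<^sup>2) * (B * R) * J j"
        unfolding J_def
      proof (rule S_bound[OF integrable_gb ct])
        fix q assume q: "q \<in> frontier \<Omega>"
        have "(norm q)\<^sup>2 \<le> \<rho>\<^sup>2" using \<rho>(2)[OF q] by (intro power_mono) auto
        then show "\<bar>taylor_rem F0 F1 F2 x i j q\<bar> \<le> (k * D0 * \<rho>\<^sup>2) * (B * R)"
          using taylor_rem_near[OF K dim x0 near[OF q], of i j] kb[of "(norm q)\<^sup>2" "\<rho>\<^sup>2"] unfolding k_def by fastforce
      qed
      then have "\<bar>E2 j\<bar> \<le> Cf * (\<Theta> * B * R) + (k * D0 * \<rho>\<^sup>2) * (B * R) * J j"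
        unfolding E2_def Lfun_def using fm(2)[of j j] by linarith
      then show ?thesis by (simp add: algebra_simps)
    qed
    \<comment> \<open>The affine part of the kernel is evaluated by \<open>Lfun_linear\<close>; the
      sign comes from dphi being odd.\<close>
    have L: "Lfun j (\<lambda>y. kphi F0 F1 i j (y - x)) = E2 j - (\<Sum>l\<in>UNIV. Lfun j (\<lambda>y. y $ l) * dphi F1 F2 i j l x)" for j
    proof -
      have "(\<lambda>y. kphi F0 F1 i j (y - x)) = (\<lambda>y. taylor_rem F0 F1 F2 x i j y + (kphi F0 F1 i j (- x) + (\<Sum>l\<in>UNIV. y $ l * dphi F1 F2 i j l (- x))))"
        by (simp add: fun_eq_iff taylor_rem_def)
      then have "Lfun j (\<lambda>y. kphi F0 F1 i j (y - x)) = Lfun j (taylor_rem F0 F1 F2 x i j)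
         + Lfun j (\<lambda>y. kphi F0 F1 i j (- x) + (\<Sum>l\<in>UNIV. y $ l * dphi F1 F2 i j l (- x)))"
        by (simp only:) (rule Lfun_add[OF fm(1) linear_integrable(1) integrable_mult_cont_S[OF integrable_gb ct] linear_integrable(2)])
      then show ?thesis unfolding Lfun_linear by (simp add: E2_def dphi_minus sum_negf)
    qed
    have V: "(LINT q|S. vb q $ j * \<nu> q $ l * dphi F1 F2 i j l (q - x)) = E3 j l - (LINT q|S. vb q $ j * \<nu> q $ l) * dphi F1 F2 i j l x" for j l
    proof -
      have "E3 j l = (LINT q|S. vb q $ j * \<nu> q $ l * dphi F1 F2 i j l (q - x) - vb q $ j * \<nu> q $ l * dphi F1 F2 i j l (- x))"
        unfolding E3_def by (intro Bochner_Integration.integral_cong refl) (simp add: right_diff_distrib)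
      also have "\<dots> = (LINT q|S. vb q $ j * \<nu> q $ l * dphi F1 F2 i j l (q - x)) - (LINT q|S. vb q $ j * \<nu> q $ l * dphi F1 F2 i j l (- x))"
        by (rule Bochner_Integration.integral_diff[OF integrable_mult_cont_S[OF ivn cd]]) (simp add: ivn)
      finally show ?thesis by (simp add: dphi_minus)
    qed
    have Qe: "(LINT q|S. (vb q \<bullet> \<nu> q) * kQ F1 F2 i (q - x)) = E1 - coeff_b0 S \<nu> vb * kQ F1 F2 i x"
    proof -
      have "E1 = (LINT q|S. (vb q \<bullet> \<nu> q) * kQ F1 F2 i (q - x) - (vb q \<bullet> \<nu> q) * kQ F1 F2 i (- x))"
        unfolding E1_def by (intro Bochner_Integration.integral_cong refl) (simp add: right_diff_distrib)
      also have "\<dots> = (LINT q|S. (vb q \<bullet> \<nu> q) * kQ F1 F2 i (q - x)) - (LINT q|S. (vb q \<bullet> \<nu> q) * kQ F1 F2 i (- x))"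
        by (rule Bochner_Integration.integral_diff[OF integrable_mult_cont_S[OF ivb cQ]]) (simp add: ivb)
      finally show ?thesis by (simp add: kQ_minus coeff_b0_def)
    qed
    have "(LINT y|M. v y $ i * kK F1 F2 F3 (y - x)) - (coeff_b0 S \<nu> vb * kQ F1 F2 i x
        + (\<Sum>j\<in>UNIV. \<Sum>l\<in>UNIV. dphi F1 F2 i j l x * Bm j l))
      = - E1 + (\<Sum>j\<in>UNIV. E2 j) - (\<Sum>j\<in>UNIV. \<Sum>l\<in>UNIV. E3 j l)"
      using kernel_green[OF K, of i x] unfolding Qe L V
      by (simp add: sum_subtractf Bm_def right_diff_distrib mult.commute)
    also have "\<bar>\<dots>\<bar> \<le> (k * D0 * \<rho>) * (B * R) * I1 + (\<Sum>j\<in>UNIV. (Cf * \<Theta> + k * D0 * \<rho>\<^sup>2 * J j) * (B * R))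
       + (\<Sum>j\<in>UNIV. \<Sum>l\<in>UNIV. (k * D0 * \<rho>) * (B * R) * I j l)"
    proof -
      have "\<bar>\<Sum>j\<in>UNIV. E2 j\<bar> \<le> (\<Sum>j\<in>UNIV. (Cf * \<Theta> + k * D0 * \<rho>\<^sup>2 * J j) * (B * R))"
        by (rule order_trans[OF sum_abs sum_mono[OF b2]])
      moreover have "\<bar>\<Sum>j\<in>UNIV. \<Sum>l\<in>UNIV. E3 j l\<bar> \<le> (\<Sum>j\<in>UNIV. \<Sum>l\<in>UNIV. (k * D0 * \<rho>) * (B * R) * I j l)"
        by (rule order_trans[OF sum_abs sum_mono[OF order_trans[OF sum_abs sum_mono[OF b3]]]])
      ultimately show ?thesis using b1 by linarith
    qed
    also have "\<dots> = C * B * R"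
    proof -
      have "C * (B * R) = (k * D0 * \<rho>) * (B * R) * I1 + (\<Sum>j\<in>UNIV. (Cf * \<Theta> + k * D0 * \<rho>\<^sup>2 * J j) * (B * R))
         + (\<Sum>j\<in>UNIV. \<Sum>l\<in>UNIV. (k * D0 * \<rho>) * (B * R) * I j l)"
        unfolding C_def distrib_right sum_distrib_right by (simp add: mult_ac)
      then show ?thesis by (simp add: mult.assoc)
    qed
    finally show "\<bar>(LINT y|M. v y $ i * kK F1 F2 F3 (y - x)) - (coeff_b0 S \<nu> vb * kQ F1 F2 i x
        + (\<Sum>j\<in>UNIV. \<Sum>l\<in>UNIV. dphi F1 F2 i j l x * Bm j l))\<bar> \<le> C * B * remainder_bound a x"
      by (simp add: R_def)
  qed
qed

end

section \<open>Removal of the regularisation\<close>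

lemma lborel_distr_uminus_euclidean: "distr lborel borel uminus = (lborel :: 'a::euclidean_space measure)"
proof -
  have "(\<lambda>x::'a. 0 + (\<Sum>j\<in>Basis. (- 1 * (x \<bullet> j)) *\<^sub>R j)) = uminus"
    by (simp add: fun_eq_iff sum_negf euclidean_representation)
  with lborel_affine_euclidean[of "\<lambda>_::'a. - 1" 0] show ?thesis by (simp add: density_1)
qed

text \<open>By Fubini the kernel is moved from u to the indicator of the box. The smoothed
  indicators \<open>b m\<close> lie between 0 and 1 and converge off the frontier of the box, a null
  set, because the mass of the kernels concentrates at 0; |u| dominates.\<close>

lemma approx_identity_cbox:
  fixes u :: "'a::euclidean_space \<Rightarrow> real" and k :: "nat \<Rightarrow> 'a \<Rightarrow> real"
  assumes u: "integrable lborel u" and um: "u \<in> borel_measurable borel"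
    and k: "\<And>m. integrable lborel (k m)" "\<And>m. k m \<in> borel_measurable borel" "\<And>m z. 0 \<le> k m z" "\<And>m. (LINT z|lborel. k m z) = 1"
    and conc: "\<And>\<delta>. 0 < \<delta> \<Longrightarrow> (\<lambda>m. LINT z|lborel. k m z * indicat_real {\<delta>..} (norm z)) \<longlonglongrightarrow> 0"
  shows "(\<lambda>m. LINT x|lborel. indicat_real (cbox p q) x * (LINT y|lborel. u y * k m (y - x)))
      \<longlonglongrightarrow> (LINT x|lborel. indicat_real (cbox p q) x * u x)"
    and "integrable lborel (\<lambda>x. indicat_real (cbox p q) x * (LINT y|lborel. u y * k m (y - x)))"
proof -
  let ?Q = "cbox p q"
  note [measurable] = um k(2)
  define b where "b m y = (LINT x|lborel. indicat_real ?Q x * k m (y - x))" for m y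
  have reflect: "(LINT x|lborel. f (y - x)) = (LINT z|lborel. f z)" if "f \<in> borel_measurable borel" for f :: "'a \<Rightarrow> real" and y
  proof -
    have "(LINT z|lborel. f (y + z)) = (LINT z|distr lborel borel uminus. f (y + z))"
      by (simp only: lborel_distr_uminus_euclidean)
    also have "\<dots> = (LINT z|lborel. f (y - z))" using that by (subst integral_distr) auto
    finally show ?thesis using lborel_integral_translate[of f y] by (simp add: add.commute)
  qed
  have reflect_i: "integrable lborel (\<lambda>x. f (y - x))" if "integrable lborel f" for f :: "'a \<Rightarrow> real" and y
  proof -
    have 1: "integrable lborel (\<lambda>x. f (x + y))" by (rule lborel_integrable_translate[OF that])
    have "integrable (distr lborel borel uminus) (\<lambda>x. f (x + y))" using 1 by (simp only: lborel_distr_uminus_euclidean)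
    then show ?thesis using that by (subst (asm) integrable_distr_eq) (auto simp: add.commute)
  qed
  have bi: "integrable lborel (\<lambda>x. indicat_real ?Q x * k m (y - x))" for m y
    by (rule Bochner_Integration.integrable_bound[OF reflect_i[OF k(1)[of m]], of _ y])
       (auto simp: indicator_def k(3))
  have b0: "0 \<le> b m y" for m y unfolding b_def by (rule Bochner_Integration.integral_nonneg) (simp add: k(3))
  have b1: "b m y \<le> 1" for m y
  proof -
    have "b m y \<le> (LINT x|lborel. k m (y - x))"
      unfolding b_def by (rule integral_mono[OF bi reflect_i[OF k(1)]]) (auto simp: indicator_def k(3))
    then show ?thesis using reflect[OF k(2)] k(4) by simp
  qed
  have bm: "b m \<in> borel_measurable borel" for m unfolding b_def by measurable
  let ?F = "\<lambda>m y x. indicat_real ?Q x * (u y * k m (y - x))"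
  have FI: "integrable (lborel \<Otimes>\<^sub>M lborel) (case_prod (?F m))" for m
  proof (rule lborel_pair.Fubini_integrable)
    show "case_prod (?F m) \<in> borel_measurable (lborel \<Otimes>\<^sub>M lborel)" by measurable
    have e: "(LINT x|lborel. norm (case_prod (?F m) (y, x))) = \<bar>u y\<bar> * b m y" for y
    proof -
      have "(LINT x|lborel. norm (case_prod (?F m) (y, x))) = (LINT x|lborel. \<bar>u y\<bar> * (indicat_real ?Q x * k m (y - x)))"
        by (intro Bochner_Integration.integral_cong refl) (simp add: abs_mult k(3))
      then show ?thesis by (simp add: b_def)
    qed
    show "integrable lborel (\<lambda>y. LINT x|lborel. norm (case_prod (?F m) (y, x)))"
      unfolding e
    proof (rule Bochner_Integration.integrable_bound[OF u])
      show "AE y in lborel. norm (\<bar>u y\<bar> * b m y) \<le> norm (u y)"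
        using b0 b1 by (intro AE_I2) (simp add: abs_mult mult_left_le)
    qed (use bm in measurable)
    show "AE y in lborel. integrable lborel (\<lambda>x. case_prod (?F m) (y, x))"
    proof (rule AE_I2)
      fix y
      have "integrable lborel (\<lambda>x. u y * (indicat_real ?Q x * k m (y - x)))" using bi by simp
      then show "integrable lborel (\<lambda>x. case_prod (?F m) (y, x))" by (simp add: mult.left_commute)
    qed
  qed
  have int: "(LINT x|lborel. indicat_real ?Q x * (LINT y|lborel. u y * k m (y - x))) = (LINT y|lborel. u y * b m y)" for m
  proof -
    have "(LINT x|lborel. indicat_real ?Q x * (LINT y|lborel. u y * k m (y - x))) = (LINT x|lborel. LINT y|lborel. ?F m y x)" by simp
    also have "\<dots> = (LINT y|lborel. LINT x|lborel. ?F m y x)" by (rule lborel_pair.Fubini_integral[OF FI])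
    also have "\<dots> = (LINT y|lborel. u y * b m y)"
      by (intro Bochner_Integration.integral_cong refl) (simp add: b_def mult.left_commute)
    finally show ?thesis .
  qed
  have "integrable lborel (\<lambda>x. LINT y|lborel. ?F m y x)" for m
    using lborel_pair.integrable_snd[OF FI] by simp
  then show "integrable lborel (\<lambda>x. indicat_real ?Q x * (LINT y|lborel. u y * k m (y - x)))" for m by simp
  have "(\<lambda>m. LINT y|lborel. u y * b m y) \<longlonglongrightarrow> (LINT y|lborel. u y * indicat_real ?Q y)"
  proof (rule integral_dominated_convergence[where w="\<lambda>y. \<bar>u y\<bar>"])
    have "negligible (frontier ?Q)" by (rule negligible_convex_frontier) simp
    then have "AE y in lebesgue. y \<notin> frontier ?Q" by (simp add: negligible_iff_null_sets AE_not_in)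
    then have "AE y in lborel. y \<notin> frontier ?Q" by (simp add: AE_completion_iff)
    then show "AE y in lborel. (\<lambda>m. u y * b m y) \<longlonglongrightarrow> u y * indicat_real ?Q y"
    proof eventually_elim
      case (elim y)
      have "(\<lambda>m. b m y) \<longlonglongrightarrow> indicat_real ?Q y"
      proof (cases "y \<in> ?Q")
        case True
        then have "y \<in> interior ?Q" using elim by (simp add: frontier_def)
        then obtain \<delta> where \<delta>: "0 < \<delta>" "ball y \<delta> \<subseteq> ?Q" unfolding mem_interior by blast
        have "1 - b m y \<le> (LINT z|lborel. k m z * indicat_real {\<delta>..} (norm z))" for m
        proof -
          have i: "integrable lborel (\<lambda>z. k m z * indicat_real {\<delta>..} (norm z))"
            by (rule Bochner_Integration.integrable_bound[OF k(1)[of m]]) (auto simp: indicator_def)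
          have "1 - b m y = (LINT x|lborel. k m (y - x) - indicat_real ?Q x * k m (y - x))"
            unfolding b_def using Bochner_Integration.integral_diff[OF reflect_i[OF k(1)] bi] reflect[OF k(2)] k(4) by simp
          also have "\<dots> \<le> (LINT x|lborel. (\<lambda>z. k m z * indicat_real {\<delta>..} (norm z)) (y - x))"
          proof (rule integral_mono[OF Bochner_Integration.integrable_diff[OF reflect_i[OF k(1)] bi] reflect_i[OF i]])
            fix x
            show "k m (y - x) - indicat_real ?Q x * k m (y - x) \<le> k m (y - x) * indicat_real {\<delta>..} (norm (y - x))"
              using \<delta>(2) k(3)[of m "y - x"] by (auto simp: indicator_def dist_norm subset_iff)
          qed
          also have "\<dots> = (LINT z|lborel. k m z * indicat_real {\<delta>..} (norm z))" by (rule reflect) measurable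
          finally show ?thesis .
        qed
        then have "(\<lambda>m. 1 - b m y) \<longlonglongrightarrow> 0"
          by (intro Lim_null_comparison[OF _ conc[OF \<delta>(1)]] always_eventually) (use b1 in auto)
        then have "(\<lambda>m. 1 - (1 - b m y)) \<longlonglongrightarrow> 1 - 0" by (intro tendsto_diff tendsto_const)
        then show ?thesis using True by simp
      next
        case False
        then have "open (- ?Q)" "y \<in> - ?Q" by (auto intro: open_Compl)
        then obtain \<delta> where \<delta>: "0 < \<delta>" "ball y \<delta> \<subseteq> - ?Q" by (meson openE)
        have "b m y \<le> (LINT z|lborel. k m z * indicat_real {\<delta>..} (norm z))" for m
        proof -
          have i: "integrable lborel (\<lambda>z. k m z * indicat_real {\<delta>..} (norm z))"
            by (rule Bochner_Integration.integrable_bound[OF k(1)[of m]]) (auto simp: indicator_def)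
          have "b m y \<le> (LINT x|lborel. (\<lambda>z. k m z * indicat_real {\<delta>..} (norm z)) (y - x))"
            unfolding b_def
          proof (rule integral_mono[OF bi reflect_i[OF i]])
            fix x
            show "indicat_real ?Q x * k m (y - x) \<le> k m (y - x) * indicat_real {\<delta>..} (norm (y - x))"
              using \<delta>(2) k(3)[of m "y - x"] by (auto simp: indicator_def dist_norm subset_iff)
          qed
          also have "\<dots> = (LINT z|lborel. k m z * indicat_real {\<delta>..} (norm z))" by (rule reflect) measurable
          finally show ?thesis .
        qed
        then have "(\<lambda>m. b m y) \<longlonglongrightarrow> 0"
          by (intro Lim_null_comparison[OF _ conc[OF \<delta>(1)]] always_eventually) (use b0 in auto)
        then show ?thesis using False by simp
      qed
      then show ?case by (intro tendsto_mult tendsto_const)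
    qed
    show "AE y in lborel. norm (u y * b m y) \<le> \<bar>u y\<bar>" for m
      using b0 b1 by (intro AE_I2) (simp add: abs_mult mult_left_le)
  qed (use u bm in auto)
  then show "(\<lambda>m. LINT x|lborel. indicat_real ?Q x * (LINT y|lborel. u y * k m (y - x)))
      \<longlonglongrightarrow> (LINT x|lborel. indicat_real ?Q x * u x)"
    unfolding int by (simp add: mult.commute)
qed

text \<open>Lebesgue differentiation over cubes with corner x: at almost every point of W both
  averages converge to the value there, and the inequality of the averages is preserved.\<close>

lemma AE_le_of_cbox_integrals:
  fixes F G :: "'a::euclidean_space \<Rightarrow> real"
  assumes F: "integrable lborel F" and G: "integrable lborel G" and W: "open W"
    and le: "\<And>p q. cbox p q \<subseteq> W \<Longrightarrow> \<bar>LINT x|lborel. indicat_real (cbox p q) x * F x\<bar> \<le> (LINT x|lborel. indicat_real (cbox p q) x * G x)"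
  shows "AE x in lebesgue. x \<in> W \<longrightarrow> \<bar>F x\<bar> \<le> G x"
proof -
  have si: "set_integrable lborel (cbox p q) H" if "integrable lborel H" for H :: "'a \<Rightarrow> real" and p q
    unfolding set_integrable_def using that by (intro integrable_mult_indicator) auto
  have io: "H integrable_on cbox p q" if "integrable lborel H" for H :: "'a \<Rightarrow> real" and p q
    using set_borel_integral_eq_integral(1)[OF si[OF that]] .
  have eq: "integral (cbox p q) H = (LINT x|lborel. indicat_real (cbox p q) x * H x)" if "integrable lborel H" for H :: "'a \<Rightarrow> real" and p q
    using set_borel_integral_eq_integral(2)[OF si[OF that]] by (simp add: set_lebesgue_integral_def)
  obtain N1 where N1: "negligible N1" "\<And>x e. \<lbrakk>x \<notin> N1; 0 < e\<rbrakk> \<Longrightarrow>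
               \<exists>d>0. \<forall>h. 0 < h \<and> h < d \<longrightarrow> norm(integral (cbox x (x + h *\<^sub>R One)) F /\<^sub>R h ^ DIM('a) - F x) < e"
    using integrable_ccontinuous_explicit[of F] io[OF F] by blast
  obtain N2 where N2: "negligible N2" "\<And>x e. \<lbrakk>x \<notin> N2; 0 < e\<rbrakk> \<Longrightarrow>
               \<exists>d>0. \<forall>h. 0 < h \<and> h < d \<longrightarrow> norm(integral (cbox x (x + h *\<^sub>R One)) G /\<^sub>R h ^ DIM('a) - G x) < e"
    using integrable_ccontinuous_explicit[of G] io[OF G] by blast
  have main: "\<bar>F x\<bar> \<le> G x" if x: "x \<in> W" "x \<notin> N1" "x \<notin> N2" for x
  proof (rule field_le_epsilon)
    fix e :: real assume e: "0 < e"
    obtain r where r: "0 < r" "ball x r \<subseteq> W" using W x(1) by (meson openE)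
    obtain d1 where d1: "d1 > 0" "\<And>h. 0 < h \<Longrightarrow> h < d1 \<Longrightarrow> norm(integral (cbox x (x + h *\<^sub>R One)) F /\<^sub>R h ^ DIM('a) - F x) < e/2"
      using N1(2)[OF x(2), of "e/2"] e by auto
    obtain d2 where d2: "d2 > 0" "\<And>h. 0 < h \<Longrightarrow> h < d2 \<Longrightarrow> norm(integral (cbox x (x + h *\<^sub>R One)) G /\<^sub>R h ^ DIM('a) - G x) < e/2"
      using N2(2)[OF x(3), of "e/2"] e by auto
    \<comment> \<open>Small enough for both averages to be within e/2, and for the cube, whose
      points are within DIM('a) * h of x, to stay inside the ball in W.\<close>
    define h where "h = min (min d1 d2) (r / real DIM('a)) / 2"
    have h: "0 < h" "h < d1" "h < d2" "h * real DIM('a) < r"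
    proof -
      have m: "0 < min (min d1 d2) (r / real DIM('a))" using r d1(1) d2(1) by simp
      then show h0: "0 < h" by (simp only: h_def half_gt_zero_iff)
      have "t / 2 < t" if "0 < t" for t :: real using that by simp
      from this[OF m] have "h < min (min d1 d2) (r / real DIM('a))" by (simp only: h_def)
      then show "h < d1" "h < d2" by simp_all
      have "h < r / real DIM('a)" using \<open>h < min (min d1 d2) (r / real DIM('a))\<close> by simp
      then show "h * real DIM('a) < r" by (simp add: field_simps)
    qed
    have sub: "cbox x (x + h *\<^sub>R One) \<subseteq> W"
    proof -
      have "y \<in> ball x r" if y: "y \<in> cbox x (x + h *\<^sub>R One)" for y
      proof -
        have "\<bar>(y - x) \<bullet> i\<bar> \<le> h" if "i \<in> Basis" for i
          using y that by (auto simp: mem_box inner_diff_left inner_add_left)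
        then have "(\<Sum>i\<in>Basis. \<bar>(y - x) \<bullet> i\<bar>) \<le> real DIM('a) * h" by (intro sum_bounded_above)
        then have "norm (y - x) < r" using norm_le_l1[of "y - x"] h(4) by (simp add: mult.commute)
        then show ?thesis by (simp add: dist_norm norm_minus_commute)
      qed
      then show ?thesis using r(2) by blast
    qed
    let ?I = "\<lambda>H. integral (cbox x (x + h *\<^sub>R One)) H /\<^sub>R h ^ DIM('a)"
    have "\<bar>?I F\<bar> \<le> ?I G"
      using le[OF sub] h(1) by (simp add: eq[OF F] eq[OF G] abs_mult mult_left_mono)
    then show "\<bar>F x\<bar> \<le> G x + e"
      using d1(2)[OF h(1,2)] d2(2)[OF h(1,3)] by (simp only: real_norm_def)
  qed
  have "AE x in lebesgue. x \<notin> N1" "AE x in lebesgue. x \<notin> N2"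
    using N1(1) N2(1) by (auto simp: negligible_iff_null_sets intro: AE_not_in)
  then show ?thesis by eventually_elim (use main in blast)
qed

section \<open>Truncated and regularised profiles\<close>

text \<open>At the junction the quotient of the truncated function is dominated by that of g, which
  tends to g' \<sigma> = 0.\<close>

lemma DERIV_cutoff:
  fixes g g' :: "real \<Rightarrow> real"
  assumes g: "DERIV g s :> g' s" and z: "g \<sigma> = 0" "g' \<sigma> = 0"
  shows "DERIV (\<lambda>s. if s < \<sigma> then g s else 0) s :> (if s < \<sigma> then g' s else 0)"
proof -
  consider "s < \<sigma>" | "s > \<sigma>" | "s = \<sigma>" by linarith
  then show ?thesis
  proof cases
    case 1
    have "((\<lambda>s. if s < \<sigma> then g s else 0) has_real_derivative g' s) (at s)"
      by (rule has_field_derivative_transform_within_open[OF g, of "{..<\<sigma>}"]) (use 1 in auto)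
    then show ?thesis using 1 by simp
  next
    case 2
    have "((\<lambda>s. if s < \<sigma> then g s else 0) has_real_derivative 0) (at s)"
      by (rule has_field_derivative_transform_within_open[of "\<lambda>_. 0" _ _ "{\<sigma><..}"]) (use 2 in auto)
    then show ?thesis using 2 by simp
  next
    case 3
    have l: "((\<lambda>h. (g (\<sigma> + h) - g \<sigma>) / h) \<longlongrightarrow> 0) (at 0)" using g 3 z by (simp add: DERIV_def)
    have "((\<lambda>h. ((if \<sigma> + h < \<sigma> then g (\<sigma> + h) else 0) - (if \<sigma> < \<sigma> then g \<sigma> else 0)) / h) \<longlongrightarrow> 0) (at 0)"
    proof (rule Lim_null_comparison)
      show "((\<lambda>h. \<bar>(g (\<sigma> + h) - g \<sigma>) / h\<bar>) \<longlongrightarrow> 0) (at 0)" using tendsto_rabs_zero[OF l] .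
    qed (auto intro!: always_eventually simp: z)
    then show ?thesis using 3 by (simp add: DERIV_def)
  qed
qed

text \<open>The antiderivative of the singular profile s powr (-d/2), a logarithm for d = 2. By
  \<open>fund_E_P0\<close> it is E, as a function of the squared norm, up to a constant
  factor.\<close>

definition P0 :: "real \<Rightarrow> real \<Rightarrow> real" where
  "P0 d s = (if d = 2 then ln s else s powr (1 - d/2) / (1 - d/2))"

definition P1 :: "real \<Rightarrow> real \<Rightarrow> real" where "P1 d s = s powr (- d/2)"

definition P2 :: "real \<Rightarrow> real \<Rightarrow> real" where "P2 d s = - (d/2) * s powr (- d/2 - 1)"

definition P3 :: "real \<Rightarrow> real \<Rightarrow> real" where "P3 d s = (d/2) * (d/2 + 1) * s powr (- d/2 - 2)"

lemma P_deriv: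
  assumes "0 < s"
  shows "DERIV (P0 d) s :> P1 d s" "DERIV (P1 d) s :> P2 d s" "DERIV (P2 d) s :> P3 d s"
proof -
  show "DERIV (P0 d) s :> P1 d s"
  proof (cases "d = 2")
    case True
    have "P0 d = ln" by (simp add: fun_eq_iff P0_def True)
    then show ?thesis using assms DERIV_ln_divide[OF assms] by (simp add: P1_def True powr_minus_divide)
  next
    case False
    have "DERIV (\<lambda>s. s powr (1 - d/2) / (1 - d/2)) s :> ((1 - d/2) * s powr (1 - d/2 - 1)) / (1 - d/2)"
      by (intro DERIV_cdivide has_real_derivative_powr assms)
    moreover have "P0 d = (\<lambda>s. s powr (1 - d/2) / (1 - d/2))" by (simp add: fun_eq_iff P0_def False)
    ultimately show ?thesis using False by (simp add: P1_def)
  qed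
  have "DERIV (\<lambda>s. s powr (- d/2)) s :> (- d/2) * s powr (- d/2 - 1)" by (rule has_real_derivative_powr[OF assms])
  then show "DERIV (P1 d) s :> P2 d s" by (simp add: P1_def[abs_def] P2_def)
  have "DERIV (\<lambda>s. - (d/2) * s powr (- d/2 - 1)) s :> - (d/2) * ((- d/2 - 1) * s powr (- d/2 - 1 - 1))"
    by (intro DERIV_cmult has_real_derivative_powr assms)
  moreover have "- (d/2) * ((- d/2 - 1) * s powr (- d/2 - 1 - 1)) = P3 d s" by (simp add: P3_def algebra_simps)
  ultimately show "DERIV (P2 d) s :> P3 d s" by (simp add: P2_def[abs_def])
qed

text \<open>Third order Taylor expansion of \<open>P0\<close> at \<open>\<sigma>\<close> and its derivatives: subtracting it makes the
  truncated functions \<open>H0\<close>, \<open>H1\<close>, \<open>H2\<close>, \<open>H3\<close> continuous at \<open>\<sigma>\<close>.\<close>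

definition q0 :: "real \<Rightarrow> real \<Rightarrow> real \<Rightarrow> real" where
  "q0 d \<sigma> s = P0 d \<sigma> + P1 d \<sigma> * (s - \<sigma>) + P2 d \<sigma> * ((s - \<sigma>)\<^sup>2 / 2) + P3 d \<sigma> * ((s - \<sigma>)^3 / 6)"

definition q1 :: "real \<Rightarrow> real \<Rightarrow> real \<Rightarrow> real" where
  "q1 d \<sigma> s = P1 d \<sigma> + P2 d \<sigma> * (s - \<sigma>) + P3 d \<sigma> * ((s - \<sigma>)\<^sup>2 / 2)"

definition q2 :: "real \<Rightarrow> real \<Rightarrow> real \<Rightarrow> real" where
  "q2 d \<sigma> s = P2 d \<sigma> + P3 d \<sigma> * (s - \<sigma>)"

definition H0 :: "real \<Rightarrow> real \<Rightarrow> real \<Rightarrow> real \<Rightarrow> real" where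
  "H0 c d \<sigma> s = (if s < \<sigma> then c * (P0 d s - q0 d \<sigma> s) else 0)"

definition H1 :: "real \<Rightarrow> real \<Rightarrow> real \<Rightarrow> real \<Rightarrow> real" where
  "H1 c d \<sigma> s = (if s < \<sigma> then c * (P1 d s - q1 d \<sigma> s) else 0)"

definition H2 :: "real \<Rightarrow> real \<Rightarrow> real \<Rightarrow> real \<Rightarrow> real" where
  "H2 c d \<sigma> s = (if s < \<sigma> then c * (P2 d s - q2 d \<sigma> s) else 0)"

definition H3 :: "real \<Rightarrow> real \<Rightarrow> real \<Rightarrow> real \<Rightarrow> real" where
  "H3 c d \<sigma> s = (if s < \<sigma> then c * (P3 d s - P3 d \<sigma>) else 0)"

lemma H_deriv:
  assumes s: "0 < s"
  shows "DERIV (H0 c d \<sigma>) s :> H1 c d \<sigma> s" "DERIV (H1 c d \<sigma>) s :> H2 c d \<sigma> s" "DERIV (H2 c d \<sigma>) s :> H3 c d \<sigma> s"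
proof -
  have q: "DERIV (q0 d \<sigma>) s :> q1 d \<sigma> s" "DERIV (q1 d \<sigma>) s :> q2 d \<sigma> s" "DERIV (q2 d \<sigma>) s :> P3 d \<sigma>"
    unfolding q0_def[abs_def] q1_def[abs_def] q2_def[abs_def]
    by (auto intro!: derivative_eq_intros simp: power2_eq_square field_simps)
  have z: "q0 d \<sigma> \<sigma> = P0 d \<sigma>" "q1 d \<sigma> \<sigma> = P1 d \<sigma>" "q2 d \<sigma> \<sigma> = P2 d \<sigma>" by (simp_all add: q0_def q1_def q2_def)
  show "DERIV (H0 c d \<sigma>) s :> H1 c d \<sigma> s"
    unfolding H0_def[abs_def] H1_def by (intro DERIV_cutoff DERIV_cmult DERIV_diff P_deriv[OF s] q) (auto simp: z)
  show "DERIV (H1 c d \<sigma>) s :> H2 c d \<sigma> s"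
    unfolding H1_def[abs_def] H2_def by (intro DERIV_cutoff DERIV_cmult DERIV_diff P_deriv[OF s] q) (auto simp: z)
  show "DERIV (H2 c d \<sigma>) s :> H3 c d \<sigma> s"
    unfolding H2_def[abs_def] H3_def by (intro DERIV_cutoff DERIV_cmult DERIV_diff P_deriv[OF s] q) (auto simp: z)
qed

definition qconst :: "real \<Rightarrow> real" where "qconst d = 2 + 2 * d + d\<^sup>2"

text \<open>With r = (\<sigma> - s)/\<sigma> between 0 and 1, the Taylor polynomial is \<sigma> powr
  (-d/2) times a polynomial in r with coefficients depending only on d; each derivative costs one
  factor 1/\<sigma>.\<close>

lemma q_bounds:
  assumes d: "0 \<le> d" and s: "0 < s" "s \<le> \<sigma>"
  shows "\<bar>q1 d \<sigma> s\<bar> \<le> (1 + d + d\<^sup>2) * \<sigma> powr (- d/2)"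
    "\<sigma> * \<bar>q2 d \<sigma> s\<bar> \<le> (d + d\<^sup>2) * \<sigma> powr (- d/2)" "\<sigma>\<^sup>2 * \<bar>P3 d \<sigma>\<bar> \<le> (d + d\<^sup>2) * \<sigma> powr (- d/2)"
proof -
  have \<sigma>: "0 < \<sigma>" using s by simp
  define p where "p = \<sigma> powr (- d/2)"
  have p: "0 < p" using \<sigma> by (simp add: p_def)
  define r where "r = (\<sigma> - s) / \<sigma>"
  have r: "0 \<le> r" "r \<le> 1" using s \<sigma> by (auto simp: r_def field_simps)
  have sr: "s - \<sigma> = - (\<sigma> * r)" using \<sigma> by (simp add: r_def)
  have e2: "P2 d \<sigma> * \<sigma> = - (d/2) * p" and e3: "P3 d \<sigma> * \<sigma>\<^sup>2 = (d/2) * (d/2 + 1) * p"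
    using \<sigma> by (simp_all add: P2_def P3_def p_def powr_diff)
  have "q1 d \<sigma> s = p + (d/2) * p * r + (d/2) * (d/2 + 1) * p * (r\<^sup>2 / 2)"
  proof -
    have "q1 d \<sigma> s = P1 d \<sigma> - (P2 d \<sigma> * \<sigma>) * r + (P3 d \<sigma> * \<sigma>\<^sup>2) * (r\<^sup>2 / 2)"
      by (simp add: q1_def sr power_mult_distrib)
    then show ?thesis by (simp add: e2 e3 P1_def p_def)
  qed
  moreover have "(d/2) * p * r \<le> (d/2) * p * 1" using d p r by (intro mult_left_mono) auto
  moreover have "(d/2) * (d/2 + 1) * p * (r\<^sup>2 / 2) \<le> (d/2) * (d/2 + 1) * p * 1"
    using d p r power_le_one[of r 2] by (intro mult_left_mono) auto
  moreover have "0 \<le> (d/2) * p * r" "0 \<le> (d/2) * (d/2 + 1) * p * (r\<^sup>2 / 2)" using d p r by auto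
  ultimately have "\<bar>q1 d \<sigma> s\<bar> \<le> p + (d/2) * p + (d/2) * (d/2 + 1) * p" using p by linarith
  also have "\<dots> \<le> (1 + d + d\<^sup>2) * p" using d p by (simp add: power2_eq_square algebra_simps)
  finally show "\<bar>q1 d \<sigma> s\<bar> \<le> (1 + d + d\<^sup>2) * \<sigma> powr (- d/2)" by (simp only: p_def)
  have "\<sigma> * q2 d \<sigma> s = - ((d/2) * p + (d/2) * (d/2 + 1) * p * r)"
  proof -
    have "\<sigma> * q2 d \<sigma> s = P2 d \<sigma> * \<sigma> - (P3 d \<sigma> * \<sigma>\<^sup>2) * r" by (simp add: q2_def sr power2_eq_square algebra_simps)
    then show ?thesis by (simp add: e2 e3)
  qed
  moreover have "(d/2) * (d/2 + 1) * p * r \<le> (d/2) * (d/2 + 1) * p * 1" using d p r by (intro mult_left_mono) auto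
  moreover have "0 \<le> (d/2) * (d/2 + 1) * p * r" using d p r by auto
  ultimately have "\<bar>\<sigma> * q2 d \<sigma> s\<bar> \<le> (d/2) * p + (d/2) * (d/2 + 1) * p" using mult_nonneg_nonneg[of "d/2" p] d p by linarith
  also have "\<dots> \<le> (d + d\<^sup>2) * p" using d p by (simp add: power2_eq_square algebra_simps)
  finally show "\<sigma> * \<bar>q2 d \<sigma> s\<bar> \<le> (d + d\<^sup>2) * \<sigma> powr (- d/2)" using \<sigma> by (simp add: abs_mult p_def)
  have "\<sigma>\<^sup>2 * \<bar>P3 d \<sigma>\<bar> = (d/2) * (d/2 + 1) * p" using e3 d by (simp add: P3_def abs_mult mult.commute)
  also have "\<dots> \<le> (d + d\<^sup>2) * p" 
  proof -
    have "0 \<le> d * p" "0 \<le> d * (d * p)" using d p by auto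
    then show ?thesis unfolding power2_eq_square by (simp add: algebra_simps)
  qed
  finally show "\<sigma>\<^sup>2 * \<bar>P3 d \<sigma>\<bar> \<le> (d + d\<^sup>2) * \<sigma> powr (- d/2)" by (simp only: p_def)
qed

text \<open>For s < \<sigma> the negative powers of \<sigma> from \<open>q_bounds\<close> are below
  those of s, so the truncated profiles obey the bounds of the singular ones uniformly in
  \<sigma>.\<close>

lemma H_bounds:
  assumes c: "0 \<le> c" and d: "0 \<le> d" and s: "0 < s"
  shows "\<bar>H1 c d \<sigma> s\<bar> \<le> c * (2 * qconst d) * s powr (- d/2)"
    "\<bar>H2 c d \<sigma> s\<bar> \<le> c * (2 * qconst d) * s powr (- d/2 - 1)"
    "\<bar>H3 c d \<sigma> s\<bar> \<le> c * (2 * qconst d) * s powr (- d/2 - 2)"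
proof -
  have k: "1 + (1 + d + d\<^sup>2) \<le> 2 * qconst d" "d/2 + (d + d\<^sup>2) \<le> 2 * qconst d" "(d/2) * (d/2 + 1) + (d + d\<^sup>2) \<le> 2 * qconst d" "0 \<le> qconst d"
  proof -
    show "1 + (1 + d + d\<^sup>2) \<le> 2 * qconst d" "d/2 + (d + d\<^sup>2) \<le> 2 * qconst d" "0 \<le> qconst d"
      using d by (auto simp: qconst_def power2_eq_square algebra_simps)
    have "2 * qconst d - ((d/2) * (d/2 + 1) + (d + d\<^sup>2)) = 4 + 5/2 * d + 3/4 * d\<^sup>2"
      by (simp add: qconst_def power2_eq_square algebra_simps)
    moreover have "0 \<le> 4 + 5/2 * d + 3/4 * d\<^sup>2" using d by simp
    ultimately show "(d/2) * (d/2 + 1) + (d + d\<^sup>2) \<le> 2 * qconst d" by (metis diff_ge_0_iff_ge)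
  qed
  have main: "\<bar>c * (P - q)\<bar> \<le> c * (2 * qconst d) * X"
    if "\<bar>P\<bar> \<le> k1 * X" "\<bar>q\<bar> \<le> k2 * X" "k1 + k2 \<le> 2 * qconst d" "0 \<le> X" for P q k1 k2 X :: real
  proof -
    have "\<bar>P - q\<bar> \<le> (k1 + k2) * X" using that unfolding distrib_right by linarith
    also have "\<dots> \<le> 2 * qconst d * X" using that by (intro mult_right_mono) auto
    finally have "c * \<bar>P - q\<bar> \<le> c * (2 * qconst d * X)" using c by (rule mult_left_mono)
    then show ?thesis using c by (simp add: abs_mult mult.assoc)
  qed
  note q = q_bounds[OF d s, of \<sigma>]
  have mono: "\<sigma> powr (- d/2 - j) \<le> s powr (- d/2 - j)" if "s < \<sigma>" "0 \<le> j" for j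
    by (rule powr_mono2') (use that d s in auto)
  show "\<bar>H1 c d \<sigma> s\<bar> \<le> c * (2 * qconst d) * s powr (- d/2)"
  proof (cases "s < \<sigma>")
    case True
    have "\<bar>q1 d \<sigma> s\<bar> \<le> (1 + d + d\<^sup>2) * s powr (- d/2)"
      using q(1) True mono[OF True, of 0] d by (auto intro!: order_trans[OF q(1)] mult_left_mono)
    then show ?thesis unfolding H1_def using True k by (simp add: main[where ?k1.0=1 and ?k2.0="1 + d + d\<^sup>2"] P1_def)
  qed (use c k in \<open>simp add: H1_def\<close>)
  show "\<bar>H2 c d \<sigma> s\<bar> \<le> c * (2 * qconst d) * s powr (- d/2 - 1)"
  proof (cases "s < \<sigma>")
    case True
    have \<sigma>: "0 < \<sigma>" using True s by simp
    have "\<sigma> * \<bar>q2 d \<sigma> s\<bar> \<le> (d + d\<^sup>2) * \<sigma> powr (- d/2)" using q(2) True by simp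
    also have "\<dots> = \<sigma> * ((d + d\<^sup>2) * \<sigma> powr (- d/2 - 1))" using \<sigma> by (simp add: powr_diff)
    finally have "\<bar>q2 d \<sigma> s\<bar> \<le> (d + d\<^sup>2) * \<sigma> powr (- d/2 - 1)" using \<sigma> by simp
    also have "\<dots> \<le> (d + d\<^sup>2) * s powr (- d/2 - 1)" using mono[OF True, of 1] d by (intro mult_left_mono) auto
    finally have "\<bar>q2 d \<sigma> s\<bar> \<le> (d + d\<^sup>2) * s powr (- d/2 - 1)" .
    moreover have "\<bar>P2 d s\<bar> \<le> (d/2) * s powr (- d/2 - 1)" using d by (simp add: P2_def abs_mult)
    ultimately have "\<bar>c * (P2 d s - q2 d \<sigma> s)\<bar> \<le> c * (2 * qconst d) * s powr (- d/2 - 1)"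
      using k(2) by (intro main[where ?k1.0="d/2" and ?k2.0="d + d\<^sup>2"]) auto
    then show ?thesis using True by (simp add: H2_def)
  qed (use c k in \<open>simp add: H2_def\<close>)
  show "\<bar>H3 c d \<sigma> s\<bar> \<le> c * (2 * qconst d) * s powr (- d/2 - 2)"
  proof (cases "s < \<sigma>")
    case True
    have \<sigma>: "0 < \<sigma>" using True s by simp
    have "\<sigma>\<^sup>2 * \<bar>P3 d \<sigma>\<bar> \<le> (d + d\<^sup>2) * \<sigma> powr (- d/2)" using q(3) True by simp
    also have "\<dots> = \<sigma>\<^sup>2 * ((d + d\<^sup>2) * \<sigma> powr (- d/2 - 2))" using \<sigma> by (simp add: powr_diff)
    finally have "\<bar>P3 d \<sigma>\<bar> \<le> (d + d\<^sup>2) * \<sigma> powr (- d/2 - 2)" using \<sigma> by simp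
    also have "\<dots> \<le> (d + d\<^sup>2) * s powr (- d/2 - 2)" using mono[OF True, of 2] d by (intro mult_left_mono) auto
    finally have "\<bar>P3 d \<sigma>\<bar> \<le> (d + d\<^sup>2) * s powr (- d/2 - 2)" .
    moreover have "\<bar>P3 d s\<bar> \<le> (d/2) * (d/2 + 1) * s powr (- d/2 - 2)" using d by (simp add: P3_def abs_mult)
    ultimately have "\<bar>c * (P3 d s - P3 d \<sigma>)\<bar> \<le> c * (2 * qconst d) * s powr (- d/2 - 2)"
      using k(3) by (intro main[where ?k1.0="(d/2) * (d/2 + 1)" and ?k2.0="d + d\<^sup>2"]) auto
    then show ?thesis using True by (simp add: H3_def)
  qed (use c k in \<open>simp add: H3_def\<close>)
qed

text \<open>The shift t + e moves the singularity to t = -e, outside the range of z \<bullet> z, and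
  only decreases the bounds. The constant depends neither on e nor on \<sigma>.\<close>

lemma kchain_H:
  assumes c: "0 \<le> c" and d: "0 \<le> d" and e: "0 < e" and \<sigma>: "0 < \<sigma>"
  shows "kchain d (c * (2 * qconst d)) (\<lambda>t. H0 c d \<sigma> (t + e)) (\<lambda>t. H1 c d \<sigma> (t + e)) (\<lambda>t. H2 c d \<sigma> (t + e)) (\<lambda>t. H3 c d \<sigma> (t + e))"
  unfolding kchain_def
proof (intro conjI allI impI)
  have sh: "DERIV (\<lambda>t. F (t + e)) t :> F' (t + e)" if "DERIV F (t + e) :> F' (t + e)" for F F' :: "real \<Rightarrow> real" and t
    using that by (simp add: DERIV_shift)
  fix t :: real
  assume t: "0 \<le> t"
  then have "0 < t + e" using e by simp
  note D = H_deriv[OF this]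
  show "((\<lambda>t. H0 c d \<sigma> (t + e)) has_real_derivative H1 c d \<sigma> (t + e)) (at t)" by (rule sh[where F="H0 c d \<sigma>" and F'="H1 c d \<sigma>", OF D(1)])
  show "((\<lambda>t. H1 c d \<sigma> (t + e)) has_real_derivative H2 c d \<sigma> (t + e)) (at t)" by (rule sh[where F="H1 c d \<sigma>" and F'="H2 c d \<sigma>", OF D(2)])
  show "((\<lambda>t. H2 c d \<sigma> (t + e)) has_real_derivative H3 c d \<sigma> (t + e)) (at t)" by (rule sh[where F="H2 c d \<sigma>" and F'="H3 c d \<sigma>", OF D(3)])
next
  \<comment> \<open>Written with \<open>min\<close>, the truncated third derivative is visibly
    continuous across \<sigma>.\<close>
  have "H3 c d \<sigma> s = c * (P3 d (min s \<sigma>) - P3 d \<sigma>)" for s by (simp add: H3_def min_def)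
  moreover have "continuous_on {0..} (\<lambda>t. c * (P3 d (min (t + e) \<sigma>) - P3 d \<sigma>))"
    unfolding P3_def by (intro continuous_intros) (use e \<sigma> in \<open>auto simp: min_def\<close>)
  ultimately show "continuous_on {0..} (\<lambda>t. H3 c d \<sigma> (t + e))" by simp
next
  fix t :: real assume t: "0 < t"
  then have s: "0 < t + e" using e by simp
  have q: "0 \<le> c * (2 * qconst d)" using c d by (simp add: qconst_def)
  have mono: "(t + e) powr (- d/2 - j) \<le> t powr (- d/2 - j)" if "0 \<le> j" for j
    by (rule powr_mono2') (use that d t e in auto)
  show "\<bar>H1 c d \<sigma> (t + e)\<bar> \<le> c * (2 * qconst d) * t powr (- d/2)"
    by (rule order_trans[OF H_bounds(1)[OF c d s]], rule mult_left_mono[OF _ q]) (use mono[of 0] in simp)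
  show "\<bar>H2 c d \<sigma> (t + e)\<bar> \<le> c * (2 * qconst d) * t powr (- d/2 - 1)"
    by (rule order_trans[OF H_bounds(2)[OF c d s]], rule mult_left_mono[OF _ q]) (use mono[of 1] in simp)
  show "\<bar>H3 c d \<sigma> (t + e)\<bar> \<le> c * (2 * qconst d) * t powr (- d/2 - 2)"
    by (rule order_trans[OF H_bounds(3)[OF c d s]], rule mult_left_mono[OF _ q]) (use mono[of 2] in simp)
next
  show "\<exists>T. \<forall>t\<ge>T. H0 c d \<sigma> (t + e) = 0 \<and> H1 c d \<sigma> (t + e) = 0 \<and> H2 c d \<sigma> (t + e) = 0"
    using e by (intro exI[of _ \<sigma>]) (auto simp: H0_def H1_def H2_def)
qed

section \<open>The regularised bi-Laplacian as an approximate identity\<close>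

lemma omega_unit_ball_vol: "0 < n \<Longrightarrow> omega n = unit_ball_vol (real n)"
proof -
  assume n: "0 < n"
  then have G: "Gamma (real n / 2 + 1) = real n / 2 * Gamma (real n / 2)"
    by (intro Gamma_plus1) (auto elim!: nonpos_Ints_cases)
  show ?thesis unfolding omega_def unit_ball_vol_def G using n by simp
qed

lemma omega_pos: "0 < n \<Longrightarrow> 0 < omega n"
  by (simp add: omega_unit_ball_vol)

lemma sphere_area_omega: "0 < n \<Longrightarrow> sphere_area n = real n * omega n"
  by (simp add: sphere_area_def omega_unit_ball_vol)

text \<open>The factor of \<open>x\<^sub>i x\<^sub>j / |x|\<^sup>n\<close> in the Lorentz tensor, divided by four.\<close>

definition kc :: "nat \<Rightarrow> real" where "kc n = 1 / (8 * real n * omega n)"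

text \<open>\<open>\<Delta>\<^sup>2\<Psi>\<close> for the profile \<open>F0 t = kc n * P0 n (t + e)\<close>, which is regularised but not truncated.\<close>

definition keps :: "real \<Rightarrow> 'a::euclidean_space \<Rightarrow> real" where
  "keps e z = (real DIM('a) + 2) / (2 * omega DIM('a)) * e\<^sup>2 * (z \<bullet> z + e) powr (- real DIM('a) / 2 - 2)"

text \<open>The first summand comes from the subtracted Taylor polynomial inside the truncation, the
  second from the values of \<open>keps\<close> outside of it.\<close>

definition Kerr :: "nat \<Rightarrow> real" where
  "Kerr n = kc n * ((4 * real n * (real n + 2) + 16 * (real n + 2) + 16) * (1 + real n + (real n)\<^sup>2)) + (real n + 2) / (2 * omega n)"

lemma kc_pos: "0 < n \<Longrightarrow> 0 < kc n" by (simp add: kc_def omega_pos)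

lemma Kerr_nonneg: "0 < n \<Longrightarrow> 0 \<le> Kerr n"
  using kc_pos[of n] omega_pos[of n] by (simp add: Kerr_def)

lemma kK_cutoff_zero:
  "\<sigma> \<le> z \<bullet> z + e \<Longrightarrow> kK (\<lambda>t. H1 c d \<sigma> (t + e)) (\<lambda>t. H2 c d \<sigma> (t + e)) (\<lambda>t. H3 c d \<sigma> (t + e)) z = 0"
  by (simp add: kK_def H1_def H2_def H3_def)

text \<open>Inside the truncation the difference is the contribution of the Taylor polynomial, where
  t \<le> \<sigma> balances the factors 1/\<sigma> of its derivatives; outside, \<open>kK\<close> is
  0 and \<open>keps\<close> is itself of this size.\<close>

lemma kK_approx:
  fixes z :: "real^'n::finite"
  assumes e: "0 < e" "e \<le> 1" and \<sigma>: "1 \<le> \<sigma>"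
  defines "d \<equiv> real CARD('n)" and "c \<equiv> kc CARD('n)"
  shows "\<bar>kK (\<lambda>t. H1 c d \<sigma> (t + e)) (\<lambda>t. H2 c d \<sigma> (t + e)) (\<lambda>t. H3 c d \<sigma> (t + e)) z - keps e z\<bar> \<le> Kerr CARD('n) * \<sigma> powr (- d/2)"
proof (cases "z \<bullet> z + e < \<sigma>")
  case True
  define t where "t = z \<bullet> z"
  define s where "s = t + e"
  have t: "0 \<le> t" "t \<le> s" "s < \<sigma>" "0 < s" using e True by (auto simp: t_def s_def add_nonneg_pos)
  have d0: "0 \<le> d" by (simp add: d_def)
  have c: "0 < c" unfolding c_def by (rule kc_pos) simp
  define X where "X = s powr (- d/2 - 2)"
  have P1: "P1 d s = s\<^sup>2 * X" and P2: "P2 d s = - (d/2) * s * X" and P3: "P3 d s = (d/2) * (d/2 + 1) * X"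
    using t by (simp_all add: P1_def P2_def P3_def X_def powr_diff power2_eq_square)
  \<comment> \<open>The three coefficients complete the square s^2 - 2ts + t^2 = (s - t)^2, which is
    e^2. At e = 0 the bi-Laplacian vanishes away from the origin.\<close>
  have "4 * d * (d + 2) * (c * P1 d s) + 16 * (d + 2) * t * (c * P2 d s) + 16 * t\<^sup>2 * (c * P3 d s)
    = 4 * c * d * (d + 2) * X * (s - t)\<^sup>2"
    unfolding P1 P2 P3 by (simp add: power2_eq_square field_simps)
  also have "\<dots> = keps e z"
    using omega_pos[of "CARD('n)"] unfolding s_def X_def c_def kc_def keps_def t_def d_def by simp
  finally have main: "4 * d * (d + 2) * (c * P1 d s) + 16 * (d + 2) * t * (c * P2 d s) + 16 * t\<^sup>2 * (c * P3 d s) = keps e z" .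
  have "kK (\<lambda>t. H1 c d \<sigma> (t + e)) (\<lambda>t. H2 c d \<sigma> (t + e)) (\<lambda>t. H3 c d \<sigma> (t + e)) z
    = 4 * d * (d + 2) * (c * (P1 d s - q1 d \<sigma> s)) + 16 * (d + 2) * t * (c * (P2 d s - q2 d \<sigma> s)) + 16 * t\<^sup>2 * (c * (P3 d s - P3 d \<sigma>))"
    using True by (simp add: kK_def H1_def H2_def H3_def d_def t_def s_def)
  then have diff: "kK (\<lambda>t. H1 c d \<sigma> (t + e)) (\<lambda>t. H2 c d \<sigma> (t + e)) (\<lambda>t. H3 c d \<sigma> (t + e)) z - keps e z
    = - (c * (4 * d * (d + 2) * q1 d \<sigma> s + 16 * (d + 2) * (t * q2 d \<sigma> s) + 16 * (t\<^sup>2 * P3 d \<sigma>)))"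
    unfolding main[symmetric] by (simp add: algebra_simps)
  define Y where "Y = (1 + d + d\<^sup>2) * \<sigma> powr (- d/2)"
  note q = q_bounds[OF d0 t(4) less_imp_le[OF t(3)]]
  have dY: "(d + d\<^sup>2) * \<sigma> powr (- d/2) \<le> Y" unfolding Y_def by (intro mult_right_mono) auto
  have b1: "\<bar>q1 d \<sigma> s\<bar> \<le> Y" using q(1) by (simp add: Y_def)
  have b2: "\<bar>t * q2 d \<sigma> s\<bar> \<le> Y"
  proof -
    have "\<bar>t * q2 d \<sigma> s\<bar> \<le> \<sigma> * \<bar>q2 d \<sigma> s\<bar>" using t by (simp add: abs_mult mult_right_mono)
    then show ?thesis using q(2) dY by linarith
  qed
  have b3: "\<bar>t\<^sup>2 * P3 d \<sigma>\<bar> \<le> Y"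
  proof -
    have "t\<^sup>2 \<le> \<sigma>\<^sup>2" using t by (intro power_mono) auto
    then have "\<bar>t\<^sup>2 * P3 d \<sigma>\<bar> \<le> \<sigma>\<^sup>2 * \<bar>P3 d \<sigma>\<bar>" by (simp add: abs_mult mult_right_mono)
    then show ?thesis using q(3) dY by linarith
  qed
  have "\<bar>4 * d * (d + 2) * q1 d \<sigma> s + 16 * (d + 2) * (t * q2 d \<sigma> s) + 16 * (t\<^sup>2 * P3 d \<sigma>)\<bar>
     \<le> 4 * d * (d + 2) * Y + 16 * (d + 2) * Y + 16 * Y"
  proof -
    have "\<bar>4 * d * (d + 2) * q1 d \<sigma> s\<bar> \<le> 4 * d * (d + 2) * Y" using b1 d0 by (simp add: abs_mult mult_left_mono)
    moreover have "\<bar>16 * (d + 2) * (t * q2 d \<sigma> s)\<bar> \<le> 16 * (d + 2) * Y" 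
      unfolding abs_mult[of "16 * (d + 2)"] using b2 d0 by (simp add: mult_left_mono)
    ultimately show ?thesis using b3 by linarith
  qed
  then have "c * \<bar>4 * d * (d + 2) * q1 d \<sigma> s + 16 * (d + 2) * (t * q2 d \<sigma> s) + 16 * (t\<^sup>2 * P3 d \<sigma>)\<bar>
     \<le> c * (4 * d * (d + 2) * Y + 16 * (d + 2) * Y + 16 * Y)" using c by (intro mult_left_mono) auto
  also have "\<dots> = c * ((4 * d * (d + 2) + 16 * (d + 2) + 16) * (1 + d + d\<^sup>2)) * \<sigma> powr (- d/2)"
    unfolding Y_def by (simp add: algebra_simps)
  also have "\<dots> \<le> Kerr CARD('n) * \<sigma> powr (- d/2)"
    unfolding Kerr_def c_def d_def using omega_pos[of "CARD('n)"] by (intro mult_right_mono) auto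
  finally show ?thesis unfolding diff using c by (simp add: abs_mult)
next
  case False
  have d0: "0 \<le> d" by (simp add: d_def)
  have w: "0 < omega CARD('n)" by (rule omega_pos) simp
  have "(z \<bullet> z + e) powr (- d / 2 - 2) \<le> \<sigma> powr (- d / 2 - 2)" using False \<sigma> d0 by (intro powr_mono2') auto
  also have "\<dots> \<le> \<sigma> powr (- d / 2)" using \<sigma> by (intro powr_mono) auto
  finally have 1: "(z \<bullet> z + e) powr (- d / 2 - 2) \<le> \<sigma> powr (- d / 2)" .
  have 2: "e\<^sup>2 \<le> 1" using e by (intro power_le_one) auto
  have "e\<^sup>2 * (z \<bullet> z + e) powr (- d / 2 - 2) \<le> 1 * \<sigma> powr (- d / 2)" using 1 2 by (intro mult_mono) auto
  then have "(d + 2) / (2 * omega CARD('n)) * (e\<^sup>2 * (z \<bullet> z + e) powr (- d / 2 - 2)) \<le> (d + 2) / (2 * omega CARD('n)) * (1 * \<sigma> powr (- d / 2))"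
    using w d0 by (intro mult_left_mono) auto
  then have "keps e z \<le> (d + 2) / (2 * omega CARD('n)) * \<sigma> powr (- d / 2)" by (simp add: keps_def d_def mult.assoc)
  also have "\<dots> \<le> Kerr CARD('n) * \<sigma> powr (- d / 2)"
    unfolding Kerr_def d_def using kc_pos[of "CARD('n)"] by (intro mult_right_mono) auto
  finally have "keps e z \<le> Kerr CARD('n) * \<sigma> powr (- d / 2)" .
  moreover have "0 \<le> keps e z" using w by (simp add: keps_def)
  ultimately show ?thesis using kK_cutoff_zero[of \<sigma> z e c d] False by simp
qed

lemma keps_nonneg: "0 \<le> keps e z"
  using omega_pos[of "DIM('a::euclidean_space)"] by (simp add: keps_def)

lemma keps_measurable [measurable]: "keps e \<in> borel_measurable borel"
  unfolding keps_def[abs_def] by measurable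

lemma keps_decay:
  fixes z :: "'a::euclidean_space"
  assumes "0 < e" "z \<noteq> 0"
  shows "keps e z \<le> (real DIM('a) + 2) / (2 * omega DIM('a)) * e\<^sup>2 * norm z powr (- (real DIM('a) + 4))"
proof -
  have z: "0 < z \<bullet> z" using assms by simp
  have "(z \<bullet> z + e) powr (- real DIM('a) / 2 - 2) \<le> (z \<bullet> z) powr (- real DIM('a) / 2 - 2)"
    using z assms by (intro powr_mono2') auto
  also have "\<dots> = (z \<bullet> z) powr (- (real DIM('a) + 4) / 2)" by (simp add: field_simps)
  also have "\<dots> = norm z powr (- (real DIM('a) + 4))" by (rule inner_powr_half[OF assms(2)])
  finally show ?thesis unfolding keps_def using omega_pos[of "DIM('a)"] by (intro mult_left_mono) auto
qed

text \<open>The radial integrand has an explicit antiderivative that runs from 0 at r = 0 to 1 at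
  infinity. That this mass is 1 fixes the constant \<open>kc\<close>.\<close>

lemma keps_nn_integral:
  assumes e: "0 < e"
  shows "(\<integral>\<^sup>+ z. ennreal (keps e z) \<partial>(lborel :: 'a::euclidean_space measure)) = 1"
proof -
  let ?n = "DIM('a)" and ?d = "real DIM('a)"
  have n: "0 < ?n" by simp
  have w: "0 < omega ?n" by (rule omega_pos[OF n])
  define g where "g r = (?d + 2) / (2 * omega ?n) * e\<^sup>2 * (r\<^sup>2 + e) powr (- ?d / 2 - 2)" for r
  \<comment> \<open>With u = r^2 / (r^2 + e) this is (d+2)/2 * u powr (d/2) - d/2 * u powr (d/2 +
    1), and u tends to 1.\<close>
  define F where "F r = (?d + 2) / 2 * (r ^ ?n * (r\<^sup>2 + e) powr (- ?d / 2)) - ?d / 2 * (r ^ (?n + 2) * (r\<^sup>2 + e) powr (- ?d / 2 - 1))" for r :: real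
  have s: "0 < r\<^sup>2 + e" for r using e by (simp add: add_nonneg_pos)
  have "(\<integral>\<^sup>+ z. ennreal (keps e z) \<partial>(lborel :: 'a measure)) = (\<integral>\<^sup>+ z. ennreal (g (norm z)) \<partial>(lborel :: 'a measure))"
    by (simp add: keps_def g_def power2_norm_eq_inner)
  also have "\<dots> = (\<integral>\<^sup>+ r. ennreal (sphere_area ?n * (g r * r ^ (?n - 1))) * indicator {0..} r \<partial>lborel)"
    by (rule nn_integral_radial) (use w in \<open>auto simp: g_def[abs_def]\<close>)
  also have "\<dots> = ennreal (1 - F 0)"
  proof (rule nn_integral_FTC_atLeast)
    show "(\<lambda>r. sphere_area ?n * (g r * r ^ (?n - 1))) \<in> borel_measurable borel" unfolding g_def[abs_def] by measurable
    show "0 \<le> sphere_area ?n * (g r * r ^ (?n - 1))" if "0 \<le> r" for r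
      using that w sphere_area_pos[OF n] by (simp add: g_def)
    show "(F \<longlongrightarrow> 1) at_top"
    proof -
      have l: "((\<lambda>r::real. r\<^sup>2 / (r\<^sup>2 + e)) \<longlongrightarrow> 1) at_top"
      proof -
        have "((\<lambda>r::real. 1 - e / (r\<^sup>2 + e)) \<longlongrightarrow> 1 - 0) at_top"
        proof (intro tendsto_diff tendsto_const tendsto_divide_0[OF tendsto_const])
          have "filterlim (\<lambda>r::real. r\<^sup>2 + e) at_top at_top"
            unfolding add.commute[of _ e]
            by (intro filterlim_tendsto_add_at_top[OF tendsto_const] filterlim_pow_at_top filterlim_ident) simp
          then show "filterlim (\<lambda>r::real. r\<^sup>2 + e) at_infinity at_top" by (rule filterlim_at_top_imp_at_infinity)
        qed
        moreover have "1 - e / (r\<^sup>2 + e) = r\<^sup>2 / (r\<^sup>2 + e)" for r using s[of r] by (simp add: field_simps)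
        ultimately show ?thesis by simp
      qed
      have F_eq: "F r = (?d + 2) / 2 * (r\<^sup>2 / (r\<^sup>2 + e)) powr (?d / 2) - ?d / 2 * (r\<^sup>2 / (r\<^sup>2 + e)) powr (?d / 2 + 1)" if "0 < r" for r
      proof -
        have q: "0 < r\<^sup>2" using that by simp
        have "(r\<^sup>2) powr (?d / 2) = (r powr 2) powr (?d / 2)" using that by simp
        also have "\<dots> = r powr ?d" unfolding powr_powr by simp
        also have "\<dots> = r ^ ?n" using that by (rule powr_realpow)
        finally have 1: "r ^ ?n = (r\<^sup>2) powr (?d / 2)" by (rule sym)
        have 2: "r ^ (?n + 2) = (r\<^sup>2) powr (?d / 2 + 1)"
          unfolding power_add 1 powr_add using q by simp
        have 3: "- (?d / 2) - 1 = - (?d / 2 + 1)" "- ?d / 2 = - (?d / 2)" by simp_all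
        have 4: "(r\<^sup>2) powr b * (r\<^sup>2 + e) powr (- b) = (r\<^sup>2 / (r\<^sup>2 + e)) powr b" for b
          using q s[of r] by (simp add: powr_minus_divide powr_divide)
        show ?thesis unfolding F_def 1 2 3 4 ..
      qed
      have "((\<lambda>r. (?d + 2) / 2 * (r\<^sup>2 / (r\<^sup>2 + e)) powr (?d / 2) - ?d / 2 * (r\<^sup>2 / (r\<^sup>2 + e)) powr (?d / 2 + 1)) \<longlongrightarrow>
          (?d + 2) / 2 * 1 powr (?d / 2) - ?d / 2 * 1 powr (?d / 2 + 1)) at_top"
        by (intro tendsto_intros l) auto
      moreover have "(?d + 2) / 2 * 1 powr (?d / 2) - ?d / 2 * 1 powr (?d / 2 + 1) = 1" by (simp add: field_simps)
      moreover have "\<forall>\<^sub>F r in at_top. (?d + 2) / 2 * (r\<^sup>2 / (r\<^sup>2 + e)) powr (?d / 2) - ?d / 2 * (r\<^sup>2 / (r\<^sup>2 + e)) powr (?d / 2 + 1) = F r"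
        using eventually_gt_at_top[of "0::real"] by eventually_elim (simp add: F_eq)
      ultimately show ?thesis by (simp add: tendsto_cong[symmetric])
    qed
    show "(F has_real_derivative sphere_area ?n * (g r * r ^ (?n - 1))) (at r)" if r: "0 \<le> r" for r
    proof -
      let ?s = "r\<^sup>2 + e"
      define X where "X = ?s powr (- ?d / 2 - 2)"
      have X1: "?s powr (- ?d / 2) = ?s\<^sup>2 * X" and X2: "?s powr (- ?d / 2 - 1) = ?s * X"
        using s[of r] by (simp_all add: X_def powr_diff power2_eq_square)
      have ds: "((\<lambda>r. r\<^sup>2 + e) has_real_derivative 2 * r) (at r)" by (auto intro!: derivative_eq_intros)
      have dp: "((\<lambda>r. (r\<^sup>2 + e) powr q) has_real_derivative q * ?s powr (q - 1) * (2 * r)) (at r)" for q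
        by (rule DERIV_chain2[OF has_real_derivative_powr[OF s] ds])
      have r1: "r ^ ?n = r * r ^ (?n - 1)" using n by (metis power_Suc Suc_pred')
      have "(F has_real_derivative (?d + 2) / 2 * ((?d * r ^ (?n - 1)) * ?s powr (- ?d / 2) + (- ?d / 2 * ?s powr (- ?d / 2 - 1) * (2 * r)) * r ^ ?n)
        - ?d / 2 * ((real (?n + 2) * r ^ (?n + 2 - 1)) * ?s powr (- ?d / 2 - 1) + ((- ?d / 2 - 1) * ?s powr (- ?d / 2 - 1 - 1) * (2 * r)) * r ^ (?n + 2))) (at r)"
        unfolding F_def[abs_def] using DERIV_pow[of ?n r] DERIV_pow[of "?n + 2" r]
        by (intro DERIV_diff DERIV_cmult DERIV_mult dp) auto
      moreover have "(?d + 2) / 2 * ((?d * r ^ (?n - 1)) * ?s powr (- ?d / 2) + (- ?d / 2 * ?s powr (- ?d / 2 - 1) * (2 * r)) * r ^ ?n)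
        - ?d / 2 * ((real (?n + 2) * r ^ (?n + 2 - 1)) * ?s powr (- ?d / 2 - 1) + ((- ?d / 2 - 1) * ?s powr (- ?d / 2 - 1 - 1) * (2 * r)) * r ^ (?n + 2))
        = ?d * (?d + 2) / 2 * (r ^ (?n - 1) * X * (?s - r\<^sup>2)\<^sup>2)"
      proof -
        have "- ?d / 2 - 1 - 1 = - ?d / 2 - 2" by simp
        then have X3: "?s powr (- ?d / 2 - 1 - 1) = X" unfolding X_def by (rule arg_cong)
        have "?n + 2 - 1 = Suc (Suc (?n - 1))" "?n + 2 = Suc (Suc (Suc (?n - 1)))" using n by simp_all
        then have r2: "r ^ (?n + 2 - 1) = r\<^sup>2 * r ^ (?n - 1)" "r ^ (?n + 2) = r\<^sup>2 * r * r ^ (?n - 1)"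
          by (simp_all only: power_Suc power2_eq_square mult.assoc)
        show ?thesis unfolding X1 X2 X3 r1 r2 by (simp add: power2_eq_square field_simps)
      qed
      moreover have "?d * (?d + 2) / 2 * (r ^ (?n - 1) * X * (?s - r\<^sup>2)\<^sup>2) = sphere_area ?n * (g r * r ^ (?n - 1))"
        using w by (simp add: g_def X_def sphere_area_omega[OF n])
      ultimately show ?thesis by (simp only:)
    qed
  qed
  also have "F 0 = 0" using n by (simp add: F_def)
  finally show ?thesis by simp
qed

lemma keps_integral:
  assumes e: "0 < e"
  shows "integrable lborel (keps e :: 'a::euclidean_space \<Rightarrow> real)" "(LINT z|lborel. keps e (z::'a)) = 1"
proof -
  show i: "integrable lborel (keps e :: 'a \<Rightarrow> real)"
    by (rule integrableI_nonneg) (auto simp: keps_nonneg keps_nn_integral[OF e])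
  have "ennreal (LINT z|lborel. keps e (z::'a)) = 1"
    using nn_integral_eq_integral[OF i] keps_nn_integral[OF e, where 'a='a] by (simp add: keps_nonneg)
  then show "(LINT z|lborel. keps e (z::'a)) = 1"
    by (metis enn2real_1 enn2real_ennreal Bochner_Integration.integral_nonneg keps_nonneg)
qed

text \<open>Off the ball of radius \<delta> the kernel is below e^2 |z| powr (-n-4), hence its mass
  there tends to 0 with e.\<close>

lemma keps_tail:
  assumes e: "0 < e" and \<delta>: "0 < \<delta>"
  shows "(LINT z|lborel. keps e (z::'a::euclidean_space) * indicat_real {\<delta>..} (norm z))
     \<le> (real DIM('a) + 2) / (2 * omega DIM('a)) * e\<^sup>2 * (sphere_area DIM('a) / 4 * \<delta> powr (- 4))"
proof -
  let ?d = "real DIM('a)"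
  define k where "k = (?d + 2) / (2 * omega DIM('a)) * e\<^sup>2"
  have k: "0 \<le> k" using omega_pos[of "DIM('a)"] by (simp add: k_def)
  have "ennreal (LINT z|lborel. keps e (z::'a) * indicat_real {\<delta>..} (norm z)) = (\<integral>\<^sup>+ z. ennreal (keps e z * indicat_real {\<delta>..} (norm z)) \<partial>(lborel :: 'a measure))"
  proof (rule nn_integral_eq_integral[symmetric])
    show "integrable lborel (\<lambda>z::'a. keps e z * indicat_real {\<delta>..} (norm z))"
      by (rule Bochner_Integration.integrable_bound[OF keps_integral(1)[OF e]]) (auto simp: indicator_def)
  qed (simp add: keps_nonneg)
  also have "\<dots> \<le> (\<integral>\<^sup>+ z. ennreal k * ennreal (norm z powr (- (?d + 4)) * indicat_real {\<delta>..} (norm z)) \<partial>(lborel :: 'a measure))"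
  proof (rule nn_integral_mono)
    fix z :: 'a
    show "ennreal (keps e z * indicat_real {\<delta>..} (norm z)) \<le> ennreal k * ennreal (norm z powr (- (?d + 4)) * indicat_real {\<delta>..} (norm z))"
    proof (cases "\<delta> \<le> norm z")
      case True
      then have "z \<noteq> 0" using \<delta> by auto
      from keps_decay[OF e this] have "keps e z \<le> k * norm z powr (- (?d + 4))" by (simp only: k_def)
      then have "ennreal (keps e z) \<le> ennreal (k * norm z powr (- (?d + 4)))" by (rule ennreal_leI)
      then show ?thesis using True by (simp add: ennreal_mult[OF k powr_ge_zero])
    qed simp
  qed
  also have "\<dots> = ennreal k * (\<integral>\<^sup>+ z. ennreal (norm z powr (- (?d + 4)) * indicat_real {\<delta>..} (norm z)) \<partial>(lborel :: 'a measure))"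
    by (rule nn_integral_cmult) measurable
  also have "\<dots> = ennreal k * ennreal (sphere_area DIM('a) / 4 * \<delta> powr (- 4))"
    by (subst radial_powr_tail[OF refl \<delta>]) auto
  also have "\<dots> = ennreal (k * (sphere_area DIM('a) / 4 * \<delta> powr (- 4)))"
    using sphere_area_pos[of "DIM('a)"] by (intro ennreal_mult[symmetric] k) simp
  finally have "ennreal (LINT z|lborel. keps e (z::'a) * indicat_real {\<delta>..} (norm z)) \<le> ennreal (k * (sphere_area DIM('a) / 4 * \<delta> powr (- 4)))" .
  moreover have "0 \<le> k * (sphere_area DIM('a) / 4 * \<delta> powr (- 4))" using k sphere_area_pos[of "DIM('a)"] by simp
  ultimately show ?thesis unfolding k_def by (metis ennreal_le_iff)
qed

section \<open>Identification of the singular kernels\<close>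

lemma norm_power_powr: "x \<noteq> 0 \<Longrightarrow> 1 / norm x ^ n = (x \<bullet> x) powr (- real n / 2)"
  using inner_powr_half[of x "real n"] by (simp add: powr_minus_divide powr_realpow)

lemma fund_E_P0: "CARD('n) \<ge> 2 \<Longrightarrow> fund_E x = - 4 * kc CARD('n) * P0 (real CARD('n)) (x \<bullet> x)" for x :: "real^'n::finite"
proof -
  assume n: "CARD('n) \<ge> 2"
  show ?thesis
  proof (cases "x = 0")
    \<comment> \<open>Both sides are 0 by the values of \<open>ln\<close> and \<open>powr\<close> at
      0, so the formula is an equality of functions.\<close>
    case True
    then show ?thesis by (simp add: fund_E_def P0_def)
  next
    case False
    show ?thesis
    proof (cases "CARD('n) = 2")
      case True
      have "ln (x \<bullet> x) = 2 * ln (norm x)"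
        using False by (simp add: power2_norm_eq_inner[symmetric] ln_realpow)
      moreover have "omega 2 = pi" unfolding omega_def by simp
      ultimately show ?thesis unfolding fund_E_def P0_def kc_def True by simp
    next
      case F: False
      have "(x \<bullet> x) powr (1 - real CARD('n) / 2) = (norm x powr 2) powr (1 - real CARD('n) / 2)"
        using False by (simp add: power2_norm_eq_inner)
      also have "\<dots> = norm x powr (2 - real CARD('n))" unfolding powr_powr by (rule arg_cong) simp
      finally have e: "(x \<bullet> x) powr (1 - real CARD('n) / 2) = norm x powr (2 - real CARD('n))" .
      have "real CARD('n) \<noteq> 2" "1 - real CARD('n) / 2 \<noteq> 0" "0 < omega CARD('n)"
        using F omega_pos[of "CARD('n)"] by auto
      then have c: "1 / (real CARD('n) * (real CARD('n) - 2) * omega CARD('n)) = - 4 * kc CARD('n) / (1 - real CARD('n) / 2)"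
        unfolding kc_def by (simp add: divide_simps)
      have "fund_E x = 1 / (real CARD('n) * (real CARD('n) - 2) * omega CARD('n)) * norm x powr (2 - real CARD('n))"
        using F by (simp only: fund_E_def if_False)
      also have "\<dots> = - 4 * kc CARD('n) * (norm x powr (2 - real CARD('n)) / (1 - real CARD('n) / 2))"
        unfolding c by simp
      also have "norm x powr (2 - real CARD('n)) / (1 - real CARD('n) / 2) = P0 (real CARD('n)) (x \<bullet> x)"
        using F unfolding P0_def e by simp
      finally show ?thesis .
    qed
  qed
qed

lemma grad_E_nth:
  fixes x :: "real^'n::finite"
  assumes n: "CARD('n) \<ge> 2" and x: "x \<noteq> 0"
  shows "grad_E x $ i = - 8 * kc CARD('n) * P1 (real CARD('n)) (x \<bullet> x) * x $ i"
proof -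
  have "GDERIV (\<lambda>x::real^'n. - 4 * kc CARD('n) * P0 (real CARD('n)) (x \<bullet> x)) x :> (- 4 * kc CARD('n) * P1 (real CARD('n)) (x \<bullet> x)) *\<^sub>R (2 *\<^sub>R x)"
    by (rule GDERIV_radial[where F="\<lambda>t. - 4 * kc CARD('n) * P0 (real CARD('n)) t"]) (intro DERIV_cmult P_deriv(1), use x in simp)
  moreover have "fund_E = (\<lambda>x::real^'n. - 4 * kc CARD('n) * P0 (real CARD('n)) (x \<bullet> x))"
    using fund_E_P0[OF n] by (intro ext) 
  ultimately have "GDERIV fund_E x :> (- 4 * kc CARD('n) * P1 (real CARD('n)) (x \<bullet> x)) *\<^sub>R (2 *\<^sub>R x)" by simp
  then show ?thesis by (simp add: grad_E_def GDERIV_partial_deriv)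
qed

lemma grad_E_eq:
  fixes x :: "real^'n::finite"
  assumes n: "CARD('n) \<ge> 2" and x: "x \<noteq> 0"
  shows "grad_E x = - (1 / (real CARD('n) * omega CARD('n) * norm x ^ CARD('n))) *\<^sub>R x"
  unfolding vec_eq_iff
proof
  fix i
  have "grad_E x $ i = - 8 * kc CARD('n) * (1 / norm x ^ CARD('n)) * x $ i"
    unfolding grad_E_nth[OF n x] P1_def norm_power_powr[OF x] ..
  then show "grad_E x $ i = (- (1 / (real CARD('n) * omega CARD('n) * norm x ^ CARD('n))) *\<^sub>R x) $ i"
    by (simp add: kc_def)
qed

text \<open>The pressure that accompanies the singular kernel is the gradient of E: by homogeneity t
  * P2 is a multiple of P1, which leaves only one term.\<close>

lemma grad_E_kQ:
  fixes x :: "real^'n::finite"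
  assumes n: "CARD('n) \<ge> 2" and x: "x \<noteq> 0"
  shows "grad_E x $ i = kQ (\<lambda>t. kc CARD('n) * P1 (real CARD('n)) t) (\<lambda>t. kc CARD('n) * P2 (real CARD('n)) t) i x"
proof -
  have "(x \<bullet> x) * P2 (real CARD('n)) (x \<bullet> x) = - (real CARD('n) / 2) * P1 (real CARD('n)) (x \<bullet> x)"
    using x by (simp add: P1_def P2_def powr_diff)
  then have e: "4 * kc CARD('n) * ((x \<bullet> x) * P2 (real CARD('n)) (x \<bullet> x)) = - 2 * real CARD('n) * kc CARD('n) * P1 (real CARD('n)) (x \<bullet> x)"
    by (simp only:) simp
  have "kQ (\<lambda>t. kc CARD('n) * P1 (real CARD('n)) t) (\<lambda>t. kc CARD('n) * P2 (real CARD('n)) t) i x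
    = - 2 * x $ i * ((4 + 2 * real CARD('n)) * (kc CARD('n) * P1 (real CARD('n)) (x \<bullet> x)) + 4 * kc CARD('n) * ((x \<bullet> x) * P2 (real CARD('n)) (x \<bullet> x)))"
    by (simp add: kQ_def mult_ac)
  then show ?thesis unfolding grad_E_nth[OF n x] e by (simp add: algebra_simps)
qed

text \<open>By homogeneity t * P1 is a multiple of P0, except in dimension two, where it is the
  constant 1 while P0 is a logarithm. The additive constant left there disappears in
  \<open>Phi\<close>.\<close>

lemma lorentz_U_kphi:
  fixes x :: "real^'n::finite"
  assumes n: "CARD('n) \<ge> 2" and x: "x \<noteq> 0"
  shows "lorentz_U i j x = kphi (\<lambda>t. kc CARD('n) * P0 (real CARD('n)) t) (\<lambda>t. kc CARD('n) * P1 (real CARD('n)) t) i j x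
     + dlt i j * (if CARD('n) = 2 then 4 * kc CARD('n) else 0)"
proof -
  let ?n = "real CARD('n)" and ?c = "kc CARD('n)" and ?t = "x \<bullet> x"
  have t: "0 < ?t" using x by simp
  have A: "1 / (2 * ?n * omega CARD('n)) * (x $ i * x $ j / norm x ^ CARD('n)) = 4 * x $ i * x $ j * (?c * P1 ?n ?t)"
    unfolding P1_def norm_power_powr[OF x, symmetric] kc_def by simp
  have T: "4 * ?t * (?c * P1 ?n ?t) = (4 - 2 * ?n) * (?c * P0 ?n ?t) + (if CARD('n) = 2 then 4 * ?c else 0)"
  proof (cases "CARD('n) = 2")
    case True
    then show ?thesis using t by (simp add: P1_def powr_minus_divide)
  next
    case False
    then have "1 - ?n / 2 \<noteq> 0" "?n \<noteq> 2" by auto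
    moreover have "?t * P1 ?n ?t = ?t powr (1 - ?n / 2)" using t by (simp add: P1_def powr_diff powr_minus_divide)
    ultimately have "?t * P1 ?n ?t = (1 - ?n / 2) * P0 ?n ?t" by (simp add: P0_def)
    then have "4 * ?c * (?t * P1 ?n ?t) = 4 * ?c * ((1 - ?n / 2) * P0 ?n ?t)" by simp
    then show ?thesis using False by (simp add: algebra_simps)
  qed
  have B: "1/2 * (if i = j then 1 else 0) * fund_E x = dlt i j * (- 2 * (?c * P0 ?n ?t))"
    unfolding fund_E_P0[OF n] by (simp add: dlt_def)
  show ?thesis unfolding lorentz_U_def A B kphi_def T by (simp add: algebra_simps)
qed

lemma Phi_dphi:
  fixes x :: "real^'n::finite"
  assumes n: "CARD('n) \<ge> 2" and x: "x \<noteq> 0"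
  shows "Phi j k i x = dphi (\<lambda>t. kc CARD('n) * P1 (real CARD('n)) t) (\<lambda>t. kc CARD('n) * P2 (real CARD('n)) t) i j k x"
proof -
  let ?F0 = "\<lambda>t. kc CARD('n) * P0 (real CARD('n)) t" and ?F1 = "\<lambda>t. kc CARD('n) * P1 (real CARD('n)) t" and ?F2 = "\<lambda>t. kc CARD('n) * P2 (real CARD('n)) t"
  define K where "K = dlt i j * (if CARD('n) = 2 then 4 * kc CARD('n) else 0)"
  let ?d = "\<chi> k. dphi ?F1 ?F2 i j k x"
  have t: "0 < x \<bullet> x" using x by simp
  have "GDERIV (\<lambda>x. kphi ?F0 ?F1 i j x + K) x :> ?d + 0"
    by (intro GDERIV_add GDERIV_const GDERIV_kphi DERIV_cmult P_deriv t)
  then have "((\<lambda>x. kphi ?F0 ?F1 i j x + K) has_derivative (\<lambda>h. h \<bullet> ?d)) (at x)" by (simp add: gderiv_def)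
  then have "(lorentz_U i j has_derivative (\<lambda>h. h \<bullet> ?d)) (at x)"
    by (rule has_derivative_transform_within_open[of _ _ _ _ "- {0}"]) (use x lorentz_U_kphi[OF n] in \<open>auto simp: K_def\<close>)
  then have "GDERIV (lorentz_U i j) x :> ?d" by (simp add: gderiv_def)
  then show ?thesis unfolding Phi_def by (simp add: GDERIV_partial_deriv)
qed

section \<open>The joint limit of regularisation and truncation\<close>

text \<open>The regularisation 1/(m+1) and the truncation at m+1 are removed together; the Taylor
  part is at most \<open>Z m\<close>. The leading terms are built from \<open>kQ\<close> and
  \<open>dphi\<close>, so they contain only these two profiles.\<close>

lemma H_limits:
  fixes c d t :: real
  assumes c: "0 \<le> c" and d: "0 < d" and t: "0 < t"
  shows "(\<lambda>m. H1 c d (real (Suc m)) (t + inverse (real (Suc m)))) \<longlonglongrightarrow> c * P1 d t"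
    "(\<lambda>m. H2 c d (real (Suc m)) (t + inverse (real (Suc m)))) \<longlonglongrightarrow> c * P2 d t"
proof -
  have e: "(\<lambda>m. t + inverse (real (Suc m))) \<longlonglongrightarrow> t" using tendsto_add[OF tendsto_const LIMSEQ_inverse_real_of_nat, of t] by simp
  have l: "(\<lambda>m. c * P1 d (t + inverse (real (Suc m)))) \<longlonglongrightarrow> c * P1 d t"
    "(\<lambda>m. c * P2 d (t + inverse (real (Suc m)))) \<longlonglongrightarrow> c * P2 d t"
    unfolding P1_def P2_def using t by (intro tendsto_intros e; simp)+
  define Z where "Z m = c * ((1 + d + d\<^sup>2) * real (Suc m) powr (- d/2))" for m
  have Z: "Z \<longlonglongrightarrow> 0"
  proof -
    have "filterlim (\<lambda>m. real (Suc m)) at_top sequentially" by (rule filterlim_compose[OF filterlim_real_sequentially filterlim_Suc])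
    then have "(\<lambda>m. real (Suc m) powr (- d/2)) \<longlonglongrightarrow> 0" by (intro tendsto_neg_powr) (use d in auto)
    then show ?thesis unfolding Z_def by (intro tendsto_mult_right_zero)
  qed
  have ev: "\<forall>\<^sub>F m in sequentially. t + inverse (real (Suc m)) < real (Suc m)"
  proof -
    obtain N where N: "t + 1 < real N" using reals_Archimedean2 by blast
    have "t + inverse (real (Suc m)) < real (Suc m)" if "N \<le> m" for m
    proof -
      have "inverse (real (Suc m)) \<le> 1" by (simp add: field_simps)
      then show ?thesis using N that by linarith
    qed
    then show ?thesis unfolding eventually_sequentially by blast
  qed
  have p: "0 < t + inverse (real (Suc m))" for m using t by (simp add: add_pos_pos)
  have "(\<lambda>m. H1 c d (real (Suc m)) (t + inverse (real (Suc m))) - c * P1 d (t + inverse (real (Suc m)))) \<longlonglongrightarrow> 0"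
  proof (rule Lim_null_comparison[OF _ Z])
    show "\<forall>\<^sub>F m in sequentially. norm (H1 c d (real (Suc m)) (t + inverse (real (Suc m))) - c * P1 d (t + inverse (real (Suc m)))) \<le> Z m"
      using ev
    proof eventually_elim
      case (elim m)
      have "\<bar>q1 d (real (Suc m)) (t + inverse (real (Suc m)))\<bar> \<le> (1 + d + d\<^sup>2) * real (Suc m) powr (- d/2)"
        using d p elim by (intro q_bounds(1)) auto
      then have "c * \<bar>q1 d (real (Suc m)) (t + inverse (real (Suc m)))\<bar> \<le> Z m" unfolding Z_def by (rule mult_left_mono[OF _ c])
      moreover have "H1 c d (real (Suc m)) (t + inverse (real (Suc m))) - c * P1 d (t + inverse (real (Suc m)))
        = - (c * q1 d (real (Suc m)) (t + inverse (real (Suc m))))" 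
        unfolding H1_def if_P[OF elim] by (simp only: right_diff_distrib)
      ultimately show ?case using c by (simp only: real_norm_def abs_minus_cancel abs_mult abs_of_nonneg)
    qed
  qed
  from tendsto_add[OF this l(1)] show "(\<lambda>m. H1 c d (real (Suc m)) (t + inverse (real (Suc m)))) \<longlonglongrightarrow> c * P1 d t" by simp
  have "(\<lambda>m. H2 c d (real (Suc m)) (t + inverse (real (Suc m))) - c * P2 d (t + inverse (real (Suc m)))) \<longlonglongrightarrow> 0"
  proof (rule Lim_null_comparison[OF _ Z])
    show "\<forall>\<^sub>F m in sequentially. norm (H2 c d (real (Suc m)) (t + inverse (real (Suc m))) - c * P2 d (t + inverse (real (Suc m)))) \<le> Z m"
      using ev
    proof eventually_elim
      case (elim m)
      let ?q = "q2 d (real (Suc m)) (t + inverse (real (Suc m)))"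
      have "1 * \<bar>?q\<bar> \<le> real (Suc m) * \<bar>?q\<bar>" by (intro mult_right_mono) auto
      also have "\<dots> \<le> (d + d\<^sup>2) * real (Suc m) powr (- d/2)"
        using d p elim by (intro q_bounds(2)) auto
      also have "\<dots> \<le> (1 + d + d\<^sup>2) * real (Suc m) powr (- d/2)" by (intro mult_right_mono) auto
      finally have "c * \<bar>?q\<bar> \<le> Z m" unfolding Z_def using c by (intro mult_left_mono) auto
      moreover have "H2 c d (real (Suc m)) (t + inverse (real (Suc m))) - c * P2 d (t + inverse (real (Suc m))) = - (c * ?q)" 
        unfolding H2_def if_P[OF elim] by (simp only: right_diff_distrib)
      ultimately show ?case using c by (simp only: real_norm_def abs_minus_cancel abs_mult abs_of_nonneg)
    qed
  qed
  from tendsto_add[OF this l(2)] show "(\<lambda>m. H2 c d (real (Suc m)) (t + inverse (real (Suc m)))) \<longlonglongrightarrow> c * P2 d t" by simp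
qed

text \<open>Outside a large fixed ball |u| is at most a small constant, whose mean is small; the
  fixed ball contributes a constant divided by s powr n.\<close>

lemma ball_mean_tendsto_0:
  fixes u :: "'a::euclidean_space \<Rightarrow> real"
  assumes loc: "\<And>R. integrable lborel (\<lambda>y. indicat_real (cball 0 R) y * u y)"
    and decay: "\<And>\<epsilon>. 0 < \<epsilon> \<Longrightarrow> \<exists>R. AE y in lborel. R \<le> norm y \<longrightarrow> \<bar>u y\<bar> \<le> \<epsilon>" and b: "0 \<le> b"
  shows "((\<lambda>s. s powr (- real DIM('a)) * (LINT y|lborel. indicat_real (cball 0 (b + s)) y * \<bar>u y\<bar>)) \<longlongrightarrow> 0) at_top"
proof (rule tendstoI)
  fix \<epsilon> :: real
  assume \<epsilon>: "0 < \<epsilon>"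
  define U where "U r = (LINT y|lborel. indicat_real (cball 0 r) y * \<bar>u y\<bar>)" for r
  have Ui: "integrable lborel (\<lambda>y. indicat_real (cball 0 r) y * \<bar>u y\<bar>)" for r
    using integrable_abs[OF loc[of r]] by (simp add: abs_mult)
  have U0: "0 \<le> U r" for r unfolding U_def by (rule Bochner_Integration.integral_nonneg) simp
  define V where "V = unit_ball_vol (real DIM('a)) * (b + 1) ^ DIM('a)"
  have V: "0 < V" using b by (simp add: V_def)
  define \<epsilon>' where "\<epsilon>' = \<epsilon> / (2 * V)"
  have \<epsilon>': "0 < \<epsilon>'" using \<epsilon> V by (simp add: \<epsilon>'_def)
  obtain R where R: "AE y in lborel. R \<le> norm y \<longrightarrow> \<bar>u y\<bar> \<le> \<epsilon>'" using decay[OF \<epsilon>'] by blast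
  have main: "s powr (- real DIM('a)) * U (b + s) \<le> s powr (- real DIM('a)) * U R + \<epsilon> / 2" if s: "1 \<le> s" for s
  proof -
    have ci: "integrable lborel (indicat_real (cball (0::'a) r))" for r
      by (intro integrable_real_indicator emeasure_lborel_cball_finite) simp
    have "U (b + s) \<le> (LINT y|lborel. indicat_real (cball 0 R) y * \<bar>u y\<bar> + \<epsilon>' * indicat_real (cball 0 (b + s)) (y::'a))"
      unfolding U_def
    proof (rule integral_mono_AE)
      show "integrable lborel (\<lambda>y. indicat_real (cball 0 R) y * \<bar>u y\<bar> + \<epsilon>' * indicat_real (cball 0 (b + s)) (y::'a))"
        by (intro Bochner_Integration.integrable_add Ui integrable_mult_right ci)
      show "AE y in lborel. indicat_real (cball 0 (b + s)) y * \<bar>u y\<bar> \<le> indicat_real (cball 0 R) y * \<bar>u y\<bar> + \<epsilon>' * indicat_real (cball 0 (b + s)) y"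
        using R by eventually_elim (use \<epsilon>' in \<open>auto simp: indicator_def\<close>)
    qed (rule Ui)
    also have "\<dots> = U R + \<epsilon>' * measure lborel (cball (0::'a) (b + s))"
      unfolding U_def using Ui ci by (subst Bochner_Integration.integral_add) auto
    also have "measure lborel (cball (0::'a) (b + s)) \<le> V * s ^ DIM('a)"
    proof -
      have "b * 1 \<le> b * s" using b s by (intro mult_left_mono) auto
      then have "b + s \<le> (b + 1) * s" by (simp add: distrib_right)
      then have "(b + s) ^ DIM('a) \<le> ((b + 1) * s) ^ DIM('a)" using b s by (intro power_mono) auto
      then show ?thesis using b s by (simp add: content_cball V_def power_mult_distrib mult.assoc mult_left_mono)
    qed
    finally have "U (b + s) \<le> U R + \<epsilon>' * (V * s ^ DIM('a))" using \<epsilon>' by simp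
    then have "s powr (- real DIM('a)) * U (b + s) \<le> s powr (- real DIM('a)) * (U R + \<epsilon>' * (V * s ^ DIM('a)))"
      by (intro mult_left_mono) auto
    also have "\<dots> = s powr (- real DIM('a)) * U R + \<epsilon>' * V"
      using s by (simp add: powr_minus powr_realpow distrib_left)
    also have "\<epsilon>' * V = \<epsilon> / 2" using V by (simp add: \<epsilon>'_def)
    finally show ?thesis .
  qed
  have "((\<lambda>s. s powr (- real DIM('a)) * U R) \<longlongrightarrow> 0 * U R) at_top"
    by (intro tendsto_mult tendsto_const tendsto_neg_powr filterlim_ident) auto
  then have "\<forall>\<^sub>F s in at_top. s powr (- real DIM('a)) * U R < \<epsilon> / 2"
    by (rule order_tendstoD) (use \<epsilon> in simp)
  then have "\<forall>\<^sub>F s in at_top. dist (s powr (- real DIM('a)) * U (b + s)) 0 < \<epsilon>"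
    using eventually_ge_at_top[of 1]
  proof eventually_elim
    case (elim s)
    have "0 \<le> s powr (- real DIM('a)) * U (b + s)" using U0 by simp
    then show ?case using main[OF elim(2)] elim(1) by (simp only: dist_real_def diff_zero abs_of_nonneg)
  qed
  then show "\<forall>\<^sub>F s in at_top. dist (s powr (- real DIM('a)) * (LINT y|lborel. indicat_real (cball 0 (b + s)) y * \<bar>u y\<bar>)) 0 < \<epsilon>"
    by (simp only: U_def)
qed

text \<open>The bi-Laplacian of the profile truncated at m+1 and regularised with 1/(m+1); one index
  drives both limits.\<close>

definition Kcut :: "nat \<Rightarrow> real^'n::finite \<Rightarrow> real" where
  "Kcut m = kK (\<lambda>t. H1 (kc CARD('n)) (real CARD('n)) (real (Suc m)) (t + inverse (real (Suc m))))
     (\<lambda>t. H2 (kc CARD('n)) (real CARD('n)) (real (Suc m)) (t + inverse (real (Suc m))))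
     (\<lambda>t. H3 (kc CARD('n)) (real CARD('n)) (real (Suc m)) (t + inverse (real (Suc m))))"

lemma Kcut_measurable [measurable]: "Kcut m \<in> borel_measurable borel"
  unfolding Kcut_def kK_def[abs_def] H1_def H2_def H3_def P1_def P2_def P3_def q1_def q2_def by measurable

lemma Kcut_approx: "\<bar>Kcut m z - keps (inverse (real (Suc m))) z\<bar> \<le> Kerr CARD('n) * real (Suc m) powr (- real CARD('n) / 2)"
  for z :: "real^'n::finite"
  unfolding Kcut_def by (rule kK_approx) (auto simp: field_simps)

lemma Kcut_zero: "real (Suc m) \<le> z \<bullet> z \<Longrightarrow> Kcut m z = 0"
  unfolding Kcut_def by (rule kK_cutoff_zero) (rule add_increasing2, auto)

lemma keps_le:
  assumes "0 < e"
  shows "keps e (z::'a::euclidean_space) \<le> (real DIM('a) + 2) / (2 * omega DIM('a)) * e\<^sup>2 * e powr (- real DIM('a) / 2 - 2)"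
  unfolding keps_def using omega_pos[of "DIM('a)"] assms by (intro mult_left_mono powr_mono2') auto

lemma integrable_bounded_mult:
  fixes f g :: "'a \<Rightarrow> real"
  assumes "integrable M f" "g \<in> borel_measurable M" "\<And>x. \<bar>g x\<bar> \<le> C"
  shows "integrable M (\<lambda>x. f x * g x)"
proof (rule Bochner_Integration.integrable_bound[of _ "\<lambda>x. C * f x"])
  show "integrable M (\<lambda>x. C * f x)" using assms(1) by simp
  show "(\<lambda>x. f x * g x) \<in> borel_measurable M" using assms(1,2) by measurable
  show "AE x in M. norm (f x * g x) \<le> norm (C * f x)"
  proof (rule AE_I2)
    fix x
    have "\<bar>g x\<bar> \<le> \<bar>C\<bar>" using assms(3)[of x] by linarith
    then show "norm (f x * g x) \<le> norm (C * f x)"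
      using mult_right_mono[of "\<bar>g x\<bar>" "\<bar>C\<bar>" "\<bar>f x\<bar>"] by (simp add: abs_mult mult.commute)
  qed
qed

lemma Kcut_bounded: "\<exists>C. \<forall>z::real^'n::finite. \<bar>Kcut m z\<bar> \<le> C"
proof -
  have e: "0 < inverse (real (Suc m))" by simp
  show ?thesis
  proof (intro exI allI)
    fix z :: "real^'n"
    show "\<bar>Kcut m z\<bar> \<le> Kerr CARD('n) * real (Suc m) powr (- real CARD('n) / 2) +
      (real DIM(real^'n) + 2) / (2 * omega DIM(real^'n)) * (inverse (real (Suc m)))\<^sup>2 * inverse (real (Suc m)) powr (- real DIM(real^'n) / 2 - 2)"
      using Kcut_approx[of m z] keps_le[OF e, of z] keps_nonneg[of "inverse (real (Suc m))" z] by linarith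
  qed
qed

lemma Kcut_integrable:
  fixes u :: "real^'n::finite \<Rightarrow> real"
  assumes loc: "\<And>R. integrable lborel (\<lambda>y. indicat_real (cball 0 R) y * u y)"
  shows "integrable lborel (\<lambda>y. u y * Kcut m (y - x))"
proof -
  obtain C where C: "\<And>z::real^'n. \<bar>Kcut m z\<bar> \<le> C" using Kcut_bounded by blast
  let ?R = "norm x + real (Suc m)"
  have "integrable lborel (\<lambda>y. (indicat_real (cball 0 ?R) y * u y) * Kcut m (y - x))"
    by (rule integrable_bounded_mult[OF loc _ C]) simp
  moreover have "(indicat_real (cball 0 ?R) y * u y) * Kcut m (y - x) = u y * Kcut m (y - x)" for y
  proof (cases "norm y \<le> ?R")
    case False
    then have n: "real (Suc m) \<le> norm (y - x)" using norm_triangle_sub[of y x] by linarith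
    have "real (Suc m) * 1 \<le> norm (y - x) * norm (y - x)" by (rule mult_mono) (use n in auto)
    then have "real (Suc m) \<le> (y - x) \<bullet> (y - x)" by (simp add: power2_norm_eq_inner[symmetric] power2_eq_square)
    then show ?thesis by (simp add: Kcut_zero)
  qed simp
  ultimately show ?thesis by (simp only:)
qed

text \<open>Up to distance s = sqrt(m+1) from x the kernels differ by at most a constant times s
  powr (-n), which turns the error into a mean of |u| over a ball. What remains is
  \<open>keps\<close> outside the ball of radius 2\<rho> + 1, where |u| \<le> 1 and its tail is
  small. The bound is uniform in norm x \<le> \<rho>.\<close>

lemma Kcut_limit_error:
  fixes u :: "real^'n::finite \<Rightarrow> real"
  assumes loc: "\<And>R. integrable lborel (\<lambda>y. indicat_real (cball 0 R) y * u y)"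
    and decay: "\<And>\<epsilon>. 0 < \<epsilon> \<Longrightarrow> \<exists>R. AE y in lborel. R \<le> norm y \<longrightarrow> \<bar>u y\<bar> \<le> \<epsilon>"
    and \<rho>: "0 \<le> \<rho>" "AE y in lborel. \<rho> \<le> norm y \<longrightarrow> \<bar>u y\<bar> \<le> 1"
  obtains \<eta> where "\<eta> \<longlonglongrightarrow> 0"
    "\<And>m x. norm x \<le> \<rho> \<Longrightarrow> \<bar>(LINT y|lborel. u y * Kcut m (y - x))
        - (LINT y|lborel. (indicat_real (cball 0 (2 * \<rho> + 1)) y * u y) * keps (inverse (real (Suc m))) (y - x))\<bar> \<le> \<eta> m"
proof -
  let ?n = "real CARD('n)"
  let ?u = "\<lambda>y. indicat_real (cball 0 (2 * \<rho> + 1)) y * u y"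
  \<comment> \<open>For norm x \<le> \<rho> every y with norm y > b has |y - x| \<ge> 1 and |u y|
    \<le> 1.\<close>
  define b where "b = 2 * \<rho> + 1"
  define W where "W s = s powr (- ?n) * (LINT y|lborel. indicat_real (cball 0 (b + s)) y * \<bar>u y\<bar>)" for s
  define c where "c = (?n + 2) / (2 * omega CARD('n)) * (sphere_area CARD('n) / 4)"
  define \<eta> where "\<eta> m = Kerr CARD('n) * W (sqrt (real (Suc m))) + c * (inverse (real (Suc m)))\<^sup>2" for m
  have lim: "\<eta> \<longlonglongrightarrow> 0"
  proof -
    have s: "filterlim (\<lambda>m. sqrt (real (Suc m))) at_top sequentially"
      by (rule filterlim_compose[OF sqrt_at_top filterlim_compose[OF filterlim_real_sequentially filterlim_Suc]])
    have "(W \<longlongrightarrow> 0) at_top"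
      using ball_mean_tendsto_0[OF loc decay, of b] \<rho> by (simp add: W_def[abs_def] b_def)
    from filterlim_compose[OF this s] have "(\<lambda>m. Kerr CARD('n) * W (sqrt (real (Suc m)))) \<longlonglongrightarrow> 0"
      by (rule tendsto_mult_right_zero)
    moreover have "(\<lambda>m. c * (inverse (real (Suc m)))\<^sup>2) \<longlonglongrightarrow> 0"
      using tendsto_power[OF LIMSEQ_inverse_real_of_nat, of 2] by (intro tendsto_mult_right_zero) simp
    ultimately show ?thesis unfolding \<eta>_def using tendsto_add_zero by blast
  qed
  have bound: "\<bar>(LINT y|lborel. u y * Kcut m (y - x)) - (LINT y|lborel. ?u y * keps (inverse (real (Suc m))) (y - x))\<bar> \<le> \<eta> m"
    if x: "norm x \<le> \<rho>" for m x
  proof -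
    define e where "e = inverse (real (Suc m))"
    define s where "s = sqrt (real (Suc m))"
    have e: "0 < e" by (simp add: e_def)
    have s0: "0 < s" and s2: "s\<^sup>2 = real (Suc m)" by (simp_all add: s_def)
    define B where "B = Kerr CARD('n) * s powr (- ?n)"
    have B: "0 \<le> B" by (simp add: B_def Kerr_nonneg)
    have sp: "real (Suc m) powr (- ?n / 2) = s powr (- ?n)"
    proof -
      have "real (Suc m) powr (- ?n / 2) = (s powr 2) powr (- ?n / 2)" using s0 s2 by simp
      also have "\<dots> = s powr (- ?n)" unfolding powr_powr by simp
      finally show ?thesis .
    qed
    have ap: "\<bar>Kcut m z - keps e z\<bar> \<le> B" for z :: "real^'n"
      using Kcut_approx[of m z] unfolding sp B_def e_def .
    have i1: "integrable lborel (\<lambda>y. u y * Kcut m (y - x))" by (rule Kcut_integrable[OF loc])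
    have i2: "integrable lborel (\<lambda>y. ?u y * keps e (y - x))"
    proof (rule integrable_bounded_mult[OF loc])
      show "(\<lambda>y. keps e (y - x)) \<in> borel_measurable lborel" by simp
      show "\<bar>keps e (y - x)\<bar> \<le> (real DIM(real^'n) + 2) / (2 * omega DIM(real^'n)) * e\<^sup>2 * e powr (- real DIM(real^'n) / 2 - 2)" for y
        using keps_le[OF e, of "y - x"] keps_nonneg[of e "y - x"] by (simp only: abs_of_nonneg)
    qed
    have i3: "integrable lborel (\<lambda>y. B * (indicat_real (cball 0 (b + s)) y * \<bar>u y\<bar>))"
      using integrable_abs[OF loc[of "b + s"]] by (simp add: abs_mult)
    have i4': "integrable lborel (\<lambda>z::real^'n. keps e z * indicat_real {1..} (norm z))"
      by (rule integrable_bounded_mult[OF keps_integral(1)[OF e], where C=1]) (auto simp: indicator_def)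
    have i4: "integrable lborel (\<lambda>y. keps e (y - x) * indicat_real {1..} (norm (y - x)))"
      using lborel_integrable_translate[OF i4', of "- x"] by simp
    have pw: "AE y in lborel. norm (u y * Kcut m (y - x) - ?u y * keps e (y - x))
        \<le> B * (indicat_real (cball 0 (b + s)) y * \<bar>u y\<bar>) + keps e (y - x) * indicat_real {1..} (norm (y - x))"
      using \<rho>(2)
    proof eventually_elim
      case (elim y)
      note ap = ap[of "y - x"]
      note k0 = keps_nonneg[of e "y - x"]
      show ?case
      proof (cases "norm y \<le> b")
        case True
        have "u y * Kcut m (y - x) - ?u y * keps e (y - x) = u y * (Kcut m (y - x) - keps e (y - x))"
          using True by (simp add: b_def algebra_simps)
        then have "norm (u y * Kcut m (y - x) - ?u y * keps e (y - x)) = \<bar>Kcut m (y - x) - keps e (y - x)\<bar> * \<bar>u y\<bar>"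
          by (simp add: abs_mult)
        also have "\<dots> \<le> B * \<bar>u y\<bar>" by (rule mult_right_mono[OF ap]) simp
        also have "\<dots> = B * (indicat_real (cball 0 (b + s)) y * \<bar>u y\<bar>)" using True s0 by simp
        also have "\<dots> \<le> B * (indicat_real (cball 0 (b + s)) y * \<bar>u y\<bar>) + keps e (y - x) * indicat_real {1..} (norm (y - x))"
          using k0 by simp
        finally show ?thesis .
      next
        case False
        then have yb: "b < norm y" by simp
        have far: "1 \<le> norm (y - x)" using yb x \<rho>(1) norm_triangle_sub[of y x] unfolding b_def by linarith
        have u1: "\<bar>u y\<bar> \<le> 1" using elim yb \<rho>(1) by (simp add: b_def)
        have eq: "norm (u y * Kcut m (y - x) - ?u y * keps e (y - x)) = \<bar>u y\<bar> * \<bar>Kcut m (y - x)\<bar>"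
          using yb by (simp add: b_def abs_mult)
        show ?thesis
        proof (cases "norm (y - x) < s")
          case True
          then have yc: "norm y \<le> b + s" using x norm_triangle_sub[of y x] \<rho>(1) unfolding b_def by linarith
          have "\<bar>u y\<bar> * \<bar>Kcut m (y - x)\<bar> \<le> \<bar>u y\<bar> * (B + keps e (y - x))"
            using ap k0 by (intro mult_left_mono) linarith+
          also have "\<dots> = B * \<bar>u y\<bar> + \<bar>u y\<bar> * keps e (y - x)" by (simp add: algebra_simps)
          also have "\<dots> \<le> B * \<bar>u y\<bar> + 1 * keps e (y - x)" using u1 k0 by (intro add_left_mono mult_right_mono)
          finally show ?thesis unfolding eq using yc far by simp
        next
          case False
          then have "s\<^sup>2 \<le> (norm (y - x))\<^sup>2" using s0 by (intro power_mono) auto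
          then have "Kcut m (y - x) = 0" using s2 by (intro Kcut_zero) (simp add: power2_norm_eq_inner)
          then show ?thesis unfolding eq using k0 B by simp
        qed
      qed
    qed
    have "\<bar>(LINT y|lborel. u y * Kcut m (y - x)) - (LINT y|lborel. ?u y * keps e (y - x))\<bar>
      = norm (LINT y|lborel. u y * Kcut m (y - x) - ?u y * keps e (y - x))"
      using i1 i2 by (subst Bochner_Integration.integral_diff) auto
    also have "\<dots> \<le> (LINT y|lborel. norm (u y * Kcut m (y - x) - ?u y * keps e (y - x)))" by (rule integral_norm_bound)
    also have "\<dots> \<le> (LINT y|lborel. B * (indicat_real (cball 0 (b + s)) y * \<bar>u y\<bar>) + keps e (y - x) * indicat_real {1..} (norm (y - x)))"
      by (rule integral_mono_AE[OF _ _ pw]) (intro integrable_norm Bochner_Integration.integrable_diff i1 i2, intro Bochner_Integration.integrable_add i3 i4)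
    also have "\<dots> = B * (LINT y|lborel. indicat_real (cball 0 (b + s)) y * \<bar>u y\<bar>) + (LINT y|lborel. keps e (y - x) * indicat_real {1..} (norm (y - x)))"
      using i3 i4 by (subst Bochner_Integration.integral_add) auto
    also have "(LINT y|lborel. keps e (y - x) * indicat_real {1..} (norm (y - x))) = (LINT z::real^'n|lborel. keps e z * indicat_real {1..} (norm z))"
      using lborel_integral_translate[of "\<lambda>z::real^'n. keps e z * indicat_real {1..} (norm z)" "- x"] by simp
    also have "\<dots> \<le> c * e\<^sup>2"
      using keps_tail[OF e, of 1, where 'a="real^'n"] by (simp add: c_def mult_ac)
    finally show ?thesis unfolding \<eta>_def W_def B_def e_def[symmetric] s_def[symmetric] by (simp add: mult.assoc)
  qed
  show ?thesis by (rule that[OF lim bound])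
qed

text \<open>The estimate is integrated over boxes, where the smoothed u converges to u and A m
  converges boundedly; the limiting inequality for boxes gives the pointwise one almost everywhere.
  Bounded annuli keep the error of the truncation uniform, and countably many of them exhaust the
  exterior.\<close>

lemma kernel_limit_bound:
  fixes u A' G :: "real^'n::finite \<Rightarrow> real" and A :: "nat \<Rightarrow> real^'n \<Rightarrow> real"
  assumes um: "u \<in> borel_measurable borel"
    and loc: "\<And>R. integrable lborel (\<lambda>y. indicat_real (cball 0 R) y * u y)"
    and decay: "\<And>\<epsilon>. 0 < \<epsilon> \<Longrightarrow> \<exists>R. AE y in lborel. R \<le> norm y \<longrightarrow> \<bar>u y\<bar> \<le> \<epsilon>"
    and est: "\<And>m x. R0 \<le> norm x \<Longrightarrow> \<bar>(LINT y|lborel. u y * Kcut m (y - x)) - A m x\<bar> \<le> G x"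
    and Am: "\<And>m. A m \<in> borel_measurable borel" and Gm: "G \<in> borel_measurable borel"
    and lim: "\<And>x. R0 \<le> norm x \<Longrightarrow> (\<lambda>m. A m x) \<longlonglongrightarrow> A' x"
    and bd: "\<And>m x. R0 \<le> norm x \<Longrightarrow> \<bar>A m x\<bar> \<le> D" "\<And>x. R0 \<le> norm x \<Longrightarrow> \<bar>G x\<bar> \<le> D"
  shows "AE x in lebesgue. R0 < norm x \<longrightarrow> \<bar>u x - A' x\<bar> \<le> G x"
proof -
  note [measurable] = um Am Gm
  obtain R1 where R1: "AE y in lborel. R1 \<le> norm y \<longrightarrow> \<bar>u y\<bar> \<le> 1" using decay[of 1] by auto
  \<comment> \<open>A Borel version of A', which is known only as a pointwise limit outside the ball
    of radius R0.\<close>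
  define B where "B x = indicat_real {x. R0 \<le> norm x} x * A' x" for x
  have B_lim: "(\<lambda>m. indicat_real {x. R0 \<le> norm x} x * A m x) \<longlonglongrightarrow> B x" for x
    using lim[of x] by (auto simp: B_def indicator_def)
  have [measurable]: "B \<in> borel_measurable borel"
    by (rule borel_measurable_LIMSEQ_real[OF B_lim]) measurable
  have B_eq: "B x = A' x" if "R0 \<le> norm x" for x using that by (simp add: B_def)
  have B_bd: "\<bar>B x\<bar> \<le> D" if "R0 \<le> norm x" for x
    unfolding B_eq[OF that] by (rule LIMSEQ_le_const2[OF tendsto_rabs[OF lim[OF that]]]) (use bd(1)[OF that] in auto)
  have conc: "(\<lambda>m. LINT z::real^'n|lborel. keps (inverse (real (Suc m))) z * indicat_real {\<delta>..} (norm z)) \<longlonglongrightarrow> 0" if \<delta>: "0 < \<delta>" for \<delta>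
  proof (rule tendsto_sandwich[OF _ _ tendsto_const])
    let ?c = "(real DIM(real^'n) + 2) / (2 * omega DIM(real^'n))" and ?t = "sphere_area DIM(real^'n) / 4 * \<delta> powr (- 4)"
    show "\<forall>\<^sub>F m in sequentially. 0 \<le> (LINT z::real^'n|lborel. keps (inverse (real (Suc m))) z * indicat_real {\<delta>..} (norm z))"
      by (intro always_eventually allI Bochner_Integration.integral_nonneg mult_nonneg_nonneg keps_nonneg) simp
    show "\<forall>\<^sub>F m in sequentially. (LINT z::real^'n|lborel. keps (inverse (real (Suc m))) z * indicat_real {\<delta>..} (norm z)) \<le> ?c * (inverse (real (Suc m)))\<^sup>2 * ?t"
      by (intro always_eventually allI keps_tail \<delta>) simp
    have "(\<lambda>m. ?c * (inverse (real (Suc m)))\<^sup>2 * ?t) \<longlonglongrightarrow> ?c * 0\<^sup>2 * ?t"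
      by (intro tendsto_intros LIMSEQ_inverse_real_of_nat)
    then show "(\<lambda>m. ?c * (inverse (real (Suc m)))\<^sup>2 * ?t) \<longlonglongrightarrow> 0" by simp
  qed
  \<comment> \<open>The outer radius is at least R1, so |u| \<le> 1 beyond it, as
    \<open>Kcut_limit_error\<close> requires.\<close>
  have step: "AE x in lebesgue. x \<in> {x. R0 < norm x \<and> norm x < max 0 R1 + real k} \<longrightarrow> \<bar>u x - A' x\<bar> \<le> G x" for k
  proof -
    define \<rho> where "\<rho> = max 0 R1 + real k"
    define W where "W = {x::real^'n. R0 < norm x \<and> norm x < \<rho>}"
    have \<rho>: "0 \<le> \<rho>" "R1 \<le> \<rho>" by (auto simp: \<rho>_def)
    have \<rho>1: "AE y in lborel. \<rho> \<le> norm y \<longrightarrow> \<bar>u y\<bar> \<le> 1" using R1 by eventually_elim (use \<rho> in auto)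
    have Wo: "open W" unfolding W_def by (intro open_Collect_conj open_Collect_less continuous_intros)
    then have [measurable]: "W \<in> sets borel" by simp
    define w where "w y = indicat_real (cball 0 (2 * \<rho> + 1)) y * u y" for y
    have wi: "integrable lborel w" and wm: "w \<in> borel_measurable borel" using loc[of "2 * \<rho> + 1"] by (simp_all add: w_def[abs_def])
    have wW: "w x = u x" if "x \<in> W" for x using that \<rho> by (simp add: w_def W_def)
    obtain \<eta> where \<eta>: "\<eta> \<longlonglongrightarrow> 0"
      "\<And>m x. norm x \<le> \<rho> \<Longrightarrow> \<bar>(LINT y|lborel. u y * Kcut m (y - x)) - (LINT y|lborel. w y * keps (inverse (real (Suc m))) (y - x))\<bar> \<le> \<eta> m"
      using Kcut_limit_error[OF loc decay \<rho>(1) \<rho>1] unfolding w_def by blast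
    let ?k = "\<lambda>m. keps (inverse (real (Suc m))) :: real^'n \<Rightarrow> real"
    have ki: "integrable lborel (?k m)" "?k m \<in> borel_measurable borel" "0 \<le> ?k m z" "(LINT z|lborel. ?k m z) = 1" for m z
      by (simp_all add: keps_integral keps_nonneg)
    have app: "(\<lambda>m. LINT x|lborel. indicat_real (cbox p q) x * (LINT y|lborel. w y * ?k m (y - x))) \<longlonglongrightarrow> (LINT x|lborel. indicat_real (cbox p q) x * w x)"
      "integrable lborel (\<lambda>x. indicat_real (cbox p q) x * (LINT y|lborel. w y * ?k m (y - x)))" for p q m
      using approx_identity_cbox[OF wi wm ki conc] by blast+
    have bi: "integrable lborel (\<lambda>x. indicat_real X x * H x)"
      if "X \<subseteq> W" "X \<in> sets borel" "H \<in> borel_measurable borel" "\<And>x. R0 \<le> norm x \<Longrightarrow> \<bar>H x\<bar> \<le> D" for X and H :: "real^'n \<Rightarrow> real"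
    proof (rule Bochner_Integration.integrable_bound[of _ "\<lambda>x. D * indicat_real (cball 0 \<rho>) x"])
      show "integrable lborel (\<lambda>x::real^'n. D * indicat_real (cball 0 \<rho>) x)"
        by (intro integrable_mult_right integrable_real_indicator emeasure_lborel_cball_finite) simp
      show "(\<lambda>x. indicat_real X x * H x) \<in> borel_measurable lborel" using that(2,3) by measurable
      show "AE x in lborel. norm (indicat_real X x * H x) \<le> norm (D * indicat_real (cball 0 \<rho>) x)"
      proof (rule AE_I2)
        fix x :: "real^'n"
        show "norm (indicat_real X x * H x) \<le> norm (D * indicat_real (cball 0 \<rho>) x)"
        proof (cases "x \<in> X")
          case True
          then have "R0 \<le> norm x" "norm x \<le> \<rho>" using that(1) by (auto simp: W_def)
          then show ?thesis using True that(4)[of x] by simp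
        qed simp
      qed
    qed
    have "AE x in lebesgue. x \<in> W \<longrightarrow> \<bar>indicat_real W x * (w x - B x)\<bar> \<le> indicat_real W x * G x"
    proof (rule AE_le_of_cbox_integrals[OF _ _ Wo])
      have iB: "integrable lborel (\<lambda>x. indicat_real X x * B x)" and iG: "integrable lborel (\<lambda>x. indicat_real X x * G x)"
        and iA: "integrable lborel (\<lambda>x. indicat_real X x * A m x)" if "X \<subseteq> W" "X \<in> sets borel" for X m
        by (rule bi[OF that]; use B_bd bd in simp)+
      have iw: "integrable lborel (\<lambda>x. indicat_real X x * w x)" if "X \<in> sets borel" for X
        using integrable_real_mult_indicator[OF _ wi, of X] that by (simp add: mult.commute)
      show "integrable lborel (\<lambda>x. indicat_real W x * (w x - B x))"
        unfolding right_diff_distrib by (intro Bochner_Integration.integrable_diff iw iB) auto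
      show "integrable lborel (\<lambda>x. indicat_real W x * G x)" by (intro iG) auto
      fix p q :: "real^'n"
      assume Q: "cbox p q \<subseteq> W"
      let ?I = "indicat_real (cbox p q)"
      have I_W: "?I x * (indicat_real W x * H) = ?I x * H" for x H using Q by (auto simp: indicator_def)
      have ci: "integrable lborel ?I" by (intro integrable_real_indicator emeasure_lborel_cbox_finite) simp
      define K where "K m x = (LINT y|lborel. w y * ?k m (y - x))" for m x
      have Ki: "integrable lborel (\<lambda>x. ?I x * K m x)" for m unfolding K_def by (rule app(2))
      note iQ = iB[OF Q] iG[OF Q] iA[OF Q]
      have Alim: "(\<lambda>m. LINT x|lborel. ?I x * A m x) \<longlonglongrightarrow> (LINT x|lborel. ?I x * B x)"
      proof (rule integral_dominated_convergence[where w="\<lambda>x. D * ?I x"])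
        show "AE x in lborel. (\<lambda>m. ?I x * A m x) \<longlonglongrightarrow> ?I x * B x"
        proof (rule AE_I2)
          fix x
          show "(\<lambda>m. ?I x * A m x) \<longlonglongrightarrow> ?I x * B x"
            using Q lim[of x] B_eq[of x] by (cases "x \<in> cbox p q") (auto simp: W_def subset_iff)
        qed
        show "AE x in lborel. norm (?I x * A m x) \<le> D * ?I x" for m
        proof (rule AE_I2)
          fix x
          show "norm (?I x * A m x) \<le> D * ?I x"
            using Q bd(1)[of x m] by (cases "x \<in> cbox p q") (auto simp: W_def subset_iff)
        qed
      qed (use ci in auto)
      have "(\<lambda>m. \<bar>(LINT x|lborel. ?I x * K m x) - (LINT x|lborel. ?I x * A m x)\<bar>) \<longlonglongrightarrow> \<bar>(LINT x|lborel. ?I x * w x) - (LINT x|lborel. ?I x * B x)\<bar>"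
        unfolding K_def by (intro tendsto_rabs tendsto_diff app(1) Alim)
      moreover have "(\<lambda>m. (LINT x|lborel. ?I x * G x) + \<eta> m * (LINT x|lborel. ?I x)) \<longlonglongrightarrow> (LINT x|lborel. ?I x * G x) + 0 * (LINT x|lborel. ?I x)"
        by (intro tendsto_intros \<eta>(1))
      moreover have "\<bar>(LINT x|lborel. ?I x * K m x) - (LINT x|lborel. ?I x * A m x)\<bar> \<le> (LINT x|lborel. ?I x * G x) + \<eta> m * (LINT x|lborel. ?I x)" for m
      proof -
        have "\<bar>(LINT x|lborel. ?I x * K m x) - (LINT x|lborel. ?I x * A m x)\<bar> = norm (LINT x|lborel. ?I x * K m x - ?I x * A m x)"
          using Ki iQ(3) by (subst Bochner_Integration.integral_diff) auto
        also have "\<dots> \<le> (LINT x|lborel. norm (?I x * K m x - ?I x * A m x))" by (rule integral_norm_bound)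
        also have "\<dots> \<le> (LINT x|lborel. ?I x * G x + \<eta> m * ?I x)"
        proof (rule integral_mono)
          show "integrable lborel (\<lambda>x. norm (?I x * K m x - ?I x * A m x))"
            by (intro integrable_norm Bochner_Integration.integrable_diff Ki iQ(3)) simp
          show "integrable lborel (\<lambda>x. ?I x * G x + \<eta> m * ?I x)"
            by (intro Bochner_Integration.integrable_add iQ(2) integrable_mult_right ci) simp
          fix x
          show "norm (?I x * K m x - ?I x * A m x) \<le> ?I x * G x + \<eta> m * ?I x"
          proof (cases "x \<in> cbox p q")
            case True
            then have "R0 \<le> norm x" "norm x \<le> \<rho>" using Q by (auto simp: W_def subset_iff)
            from est[OF this(1), of m] \<eta>(2)[OF this(2), of m] have "\<bar>K m x - A m x\<bar> \<le> G x + \<eta> m"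
              unfolding K_def by linarith
            then show ?thesis using True by simp
          qed simp
        qed
        also have "\<dots> = (LINT x|lborel. ?I x * G x) + \<eta> m * (LINT x|lborel. ?I x)"
          using iQ(2) ci by (subst Bochner_Integration.integral_add) auto
        finally show ?thesis .
      qed
      ultimately have "\<bar>(LINT x|lborel. ?I x * w x) - (LINT x|lborel. ?I x * B x)\<bar> \<le> (LINT x|lborel. ?I x * G x) + 0 * (LINT x|lborel. ?I x)"
        by (intro LIMSEQ_le) auto
      moreover have "(LINT x|lborel. ?I x * w x) - (LINT x|lborel. ?I x * B x) = (LINT x|lborel. ?I x * (w x - B x))"
        unfolding right_diff_distrib using iw[of "cbox p q"] iQ(1) by (subst Bochner_Integration.integral_diff) auto
      ultimately show "\<bar>LINT x|lborel. ?I x * (indicat_real W x * (w x - B x))\<bar> \<le> (LINT x|lborel. ?I x * (indicat_real W x * G x))"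
        unfolding I_W by simp
    qed
    then show ?thesis unfolding \<rho>_def[symmetric] W_def[symmetric]
    proof eventually_elim
      case (elim x)
      show ?case
      proof
        assume x: "x \<in> W"
        then have "R0 \<le> norm x" by (simp add: W_def)
        then show "\<bar>u x - A' x\<bar> \<le> G x" using elim x wW[OF x] B_eq[of x] by simp
      qed
    qed
  qed
  then have "AE x in lebesgue. \<forall>k. x \<in> {x. R0 < norm x \<and> norm x < max 0 R1 + real k} \<longrightarrow> \<bar>u x - A' x\<bar> \<le> G x"
    by (simp only: AE_all_countable) blast
  then show ?thesis
  proof eventually_elim
    case (elim x)
    obtain k where "norm x < real k" using reals_Archimedean2 by blast
    then have "norm x < max 0 R1 + real k" by linarith
    then show ?case using elim by blast
  qed
qed

section \<open>Asymptotics of v\<close>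

lemma japanese_ge_1: "1 \<le> japanese x"
  unfolding japanese_def by (simp add: real_le_rsqrt)

lemma remainder_bound_measurable [measurable]: "remainder_bound a \<in> borel_measurable borel"
  unfolding remainder_bound_def[abs_def] japanese_def[abs_def] by measurable

text \<open>The exponent min n (a - 2) is at least 1, and this power absorbs the logarithm through 1
  + ln y \<le> y. It makes the error an admissible dominating function.\<close>

lemma remainder_bound_le_1:
  fixes x :: "real^'n::finite"
  assumes "3 \<le> a" "1 \<le> CARD('n)"
  shows "0 \<le> remainder_bound a x" "remainder_bound a x \<le> 1"
proof -
  let ?y = "japanese x" and ?L = "if a = real CARD('n) + 2 then ln (japanese x) else 0"
  have y: "1 \<le> ?y" by (rule japanese_ge_1)
  have L: "0 \<le> ?L" "1 + ?L \<le> ?y" using y ln_le_minus_one[of ?y] ln_ge_zero[of ?y] by auto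
  then show "0 \<le> remainder_bound a x" unfolding remainder_bound_def by simp
  have "?y powr (- min (real CARD('n)) (a - 2)) \<le> ?y powr (- 1)"
    using assms y by (intro powr_mono) auto
  also have "\<dots> = 1 / ?y" using y by (simp add: powr_minus_divide)
  finally have "remainder_bound a x \<le> (1 / ?y) * ?y"
    unfolding remainder_bound_def using L y by (intro mult_mono) auto
  then show "remainder_bound a x \<le> 1" using y by simp
qed

lemma kQ_bound:
  fixes x :: "real^'n::finite"
  assumes "kchain (real CARD('n)) B F0 F1 F2 F3" and x: "1 \<le> norm x"
  shows "\<bar>kQ F1 F2 i x\<bar> \<le> (16 + 4 * real CARD('n)) * B"
proof -
  let ?n = "real CARD('n)" and ?r = "norm x"
  have B: "0 \<le> B" by (rule kchain_B_nonneg[OF assms(1)])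
  have x0: "x \<noteq> 0" using x by auto
  note b = kchain_bounds[OF assms(1) x0]
  define Y where "Y = B * ?r powr (- ?n)"
  have "\<bar>(4 + 2 * ?n) * F1 (x \<bullet> x)\<bar> \<le> (4 + 2 * ?n) * Y"
    using b(1) unfolding Y_def by (simp add: abs_mult mult_left_mono)
  moreover have "\<bar>4 * (x \<bullet> x) * F2 (x \<bullet> x)\<bar> \<le> 4 * Y" using b(2) unfolding Y_def by (simp add: mult.assoc abs_mult)
  ultimately have "\<bar>(4 + 2 * ?n) * F1 (x \<bullet> x) + 4 * (x \<bullet> x) * F2 (x \<bullet> x)\<bar> \<le> (8 + 2 * ?n) * Y"
    by (simp add: distrib_right)
  moreover have "\<bar>- 2 * x $ i\<bar> \<le> 2 * ?r" using component_le_norm_cart[of x i] by simp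
  ultimately have "\<bar>kQ F1 F2 i x\<bar> \<le> (2 * ?r) * ((8 + 2 * ?n) * Y)"
    unfolding kQ_def abs_mult[of "- 2 * x $ i"] by (intro mult_mono) auto
  also have "\<dots> = (16 + 4 * ?n) * (B * (?r * ?r powr (- ?n)))" by (simp add: Y_def algebra_simps)
  also have "\<dots> \<le> (16 + 4 * ?n) * (B * 1)"
  proof -
    have "?r powr (- ?n) \<le> ?r powr (- 1)" using x by (intro powr_mono) (auto simp: Suc_le_eq)
    also have "\<dots> = 1 / ?r" using x by (simp add: powr_minus_divide)
    finally have "?r * ?r powr (- ?n) \<le> ?r * (1 / ?r)" using x by (intro mult_left_mono) auto
    then have "?r * ?r powr (- ?n) \<le> 1" using x0 by simp
    then show ?thesis using B by (intro mult_left_mono) auto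
  qed
  finally show ?thesis by simp
qed

context stokes_exterior
begin

text \<open>v is Lebesgue measurable on \<Omega> only, whereas the limit argument convolves Borel
  functions on the whole space; the component of v is extended by zero and replaced by an equivalent
  Borel function.\<close>

lemma borel_extension:
  obtains u :: "real^'n \<Rightarrow> real" where "u \<in> borel_measurable borel"
    "AE y in lebesgue. u y = (if y \<in> \<Omega> then v y $ i else 0)"
    "\<And>R. integrable lborel (\<lambda>y. indicat_real (cball 0 R) y * u y)"
    "\<And>\<epsilon>. 0 < \<epsilon> \<Longrightarrow> \<exists>R. AE y in lborel. R \<le> norm y \<longrightarrow> \<bar>u y\<bar> \<le> \<epsilon>"
    "\<And>g. g \<in> borel_measurable borel \<Longrightarrow> (LINT y|M. v y $ i * g y) = (LINT y|lborel. u y * g y)"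
proof -
  have m: "(\<lambda>y. if y \<in> \<Omega> then v y $ i else 0) \<in> borel_measurable lebesgue"
    using L2_v[of i] by (simp only: borel_measurable_if[OF \<Omega>_sets] L2_loc_cl_def)
  obtain u where u: "u \<in> borel_measurable lborel" and eq: "AE y in lborel. (if y \<in> \<Omega> then v y $ i else 0) = u y"
    using completion_ex_borel_measurable_real[OF m] by blast
  from u have um [measurable]: "u \<in> borel_measurable borel" by simp
  have eq': "AE y in lebesgue. u y = (if y \<in> \<Omega> then v y $ i else 0)"
    using AE_completion[OF eq] by eventually_elim simp
  have tr: "(LINT y|M. v y $ i * g y) = (LINT y|lborel. u y * g y)" if [measurable]: "g \<in> borel_measurable borel" for g
  proof -
    have "(LINT y|M. v y $ i * g y) = (LINT y|lebesgue. (if y \<in> \<Omega> then v y $ i else 0) * g y)"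
      using \<Omega>_sets by (subst integral_restrict_space) (auto simp: indicator_def intro!: Bochner_Integration.integral_cong)
    also have "\<dots> = (LINT y|lebesgue. u y * g y)"
    proof (rule integral_cong_AE)
      show "(\<lambda>y. (if y \<in> \<Omega> then v y $ i else 0) * g y) \<in> borel_measurable lebesgue"
        by (intro borel_measurable_times m) (simp add: measurable_completion)
      show "(\<lambda>y. u y * g y) \<in> borel_measurable lebesgue" by (rule measurable_completion) simp
      show "AE y in lebesgue. (if y \<in> \<Omega> then v y $ i else 0) * g y = u y * g y" using eq' by eventually_elim simp
    qed
    also have "\<dots> = (LINT y|lborel. u y * g y)" by (rule integral_completion) simp
    finally show ?thesis .
  qed
  have loc: "integrable lborel (\<lambda>y. indicat_real (cball 0 R) y * u y)" for R
  proof -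
    have lm: "(\<lambda>y. indicat_real (cball 0 R) y * u y) \<in> borel_measurable borel"
      by (intro borel_measurable_times borel_measurable_indicator um) simp
    have "set_integrable lebesgue \<Omega> (\<lambda>y. v y $ i * indicat_real (cball 0 R) y)"
      by (rule L2_loc_set_integrable[OF L2_v \<Omega>_sets, where C=1 and R=R]) (auto simp: indicator_def)
    then have "integrable lebesgue (\<lambda>y. indicat_real \<Omega> y * (v y $ i * indicat_real (cball 0 R) y))"
      by (simp add: set_integrable_def)
    then have "integrable lebesgue (\<lambda>y. indicat_real (cball 0 R) y * u y)"
    proof (rule integrable_cong_AE_imp)
      show "(\<lambda>y. indicat_real (cball 0 R) y * u y) \<in> borel_measurable lebesgue" by (rule measurable_completion) (simp add: lm)
      show "AE y in lebesgue. indicat_real \<Omega> y * (v y $ i * indicat_real (cball 0 R) y) = indicat_real (cball 0 R) y * u y"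
        using eq' by eventually_elim (simp add: indicator_def)
    qed
    then show ?thesis by (subst (asm) integrable_completion) (simp_all add: lm)
  qed
  have dec: "\<exists>R. AE y in lborel. R \<le> norm y \<longrightarrow> \<bar>u y\<bar> \<le> \<epsilon>" if \<epsilon>: "0 < \<epsilon>" for \<epsilon>
  proof -
    obtain R where "AE x in M. R \<le> norm x \<longrightarrow> norm (v x) \<le> \<epsilon>" using v_decay[OF \<epsilon>] by blast
    then have "AE x in lebesgue. x \<in> \<Omega> \<longrightarrow> (R \<le> norm x \<longrightarrow> norm (v x) \<le> \<epsilon>)"
      using \<Omega>_sets by (simp add: AE_restrict_space_iff)
    then have "AE y in lebesgue. R \<le> norm y \<longrightarrow> \<bar>u y\<bar> \<le> \<epsilon>"
      using eq'
    proof eventually_elim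
      case (elim y)
      show ?case using elim \<epsilon> component_le_norm_cart[of "v y" i] by (cases "y \<in> \<Omega>") auto
    qed
    then show ?thesis by (subst (asm) AE_completion_iff) blast
  qed
  show ?thesis by (rule that[OF um eq' loc dec tr])
qed

text \<open>Kept general in the profiles, so that the same expression serves the regularised kernels
  and their singular limit.\<close>

definition leading :: "(real \<Rightarrow> real) \<Rightarrow> (real \<Rightarrow> real) \<Rightarrow> 'n \<Rightarrow> real^'n \<Rightarrow> real" where
  "leading F1 F2 i x = coeff_b0 S \<nu> vb * kQ F1 F2 i x + (\<Sum>j\<in>UNIV. \<Sum>k\<in>UNIV. dphi F1 F2 i j k x * Bm j k)"

lemma leading_bound:
  assumes K: "kchain (real CARD('n)) B F0 F1 F2 F3" and x: "1 \<le> norm x"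
  shows "\<bar>leading F1 F2 i x\<bar> \<le> \<bar>coeff_b0 S \<nu> vb\<bar> * ((16 + 4 * real CARD('n)) * B)
    + (\<Sum>j\<in>UNIV. \<Sum>k\<in>UNIV. (4 * real CARD('n) + 28) * B * \<bar>Bm j k\<bar>)"
proof -
  have B: "0 \<le> B" by (rule kchain_B_nonneg[OF K])
  have x0: "x \<noteq> 0" using x by auto
  have d: "\<bar>dphi F1 F2 i j k x * Bm j k\<bar> \<le> (4 * real CARD('n) + 28) * B * \<bar>Bm j k\<bar>" for j k
  proof -
    have "norm x powr (1 - real CARD('n)) \<le> norm x powr 0" using x dim by (intro powr_mono) auto
    then have "norm x powr (1 - real CARD('n)) \<le> 1" using x0 by simp
    then have "(4 * real CARD('n) + 28) * (B * norm x powr (1 - real CARD('n))) \<le> (4 * real CARD('n) + 28) * (B * 1)"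
      using B by (intro mult_left_mono) auto
    with kernel_bounds(1)[OF K x0, of i j k] have "\<bar>dphi F1 F2 i j k x\<bar> \<le> (4 * real CARD('n) + 28) * B" by linarith
    then show ?thesis unfolding abs_mult[of _ "Bm j k"] by (rule mult_right_mono) simp
  qed
  have "\<bar>coeff_b0 S \<nu> vb * kQ F1 F2 i x\<bar> \<le> \<bar>coeff_b0 S \<nu> vb\<bar> * ((16 + 4 * real CARD('n)) * B)"
    unfolding abs_mult by (intro mult_left_mono kQ_bound[OF K x]) simp
  moreover have "\<bar>\<Sum>j\<in>UNIV. \<Sum>k\<in>UNIV. dphi F1 F2 i j k x * Bm j k\<bar> \<le> (\<Sum>j\<in>UNIV. \<Sum>k\<in>UNIV. (4 * real CARD('n) + 28) * B * \<bar>Bm j k\<bar>)"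
    by (intro order_trans[OF sum_abs] sum_mono d)
  ultimately show ?thesis unfolding leading_def by linarith
qed

lemma leading_asymptotics:
  "\<exists>C R. AE x in M. R \<le> norm x \<longrightarrow>
    \<bar>v x $ i - leading (\<lambda>t. kc CARD('n) * P1 (real CARD('n)) t) (\<lambda>t. kc CARD('n) * P2 (real CARD('n)) t) i x\<bar> \<le> C * remainder_bound a x"
proof -
  let ?n = "real CARD('n)" and ?c = "kc CARD('n)"
  have c: "0 \<le> ?c" using kc_pos[of "CARD('n)"] by simp
  define B where "B = ?c * (2 * qconst ?n)"
  define F0 where "F0 m t = H0 ?c ?n (real (Suc m)) (t + inverse (real (Suc m)))" for m t
  define F1 where "F1 m t = H1 ?c ?n (real (Suc m)) (t + inverse (real (Suc m)))" for m t
  define F2 where "F2 m t = H2 ?c ?n (real (Suc m)) (t + inverse (real (Suc m)))" for m t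
  define F3 where "F3 m t = H3 ?c ?n (real (Suc m)) (t + inverse (real (Suc m)))" for m t
  have K: "kchain ?n B (F0 m) (F1 m) (F2 m) (F3 m)" for m
    unfolding F0_def[abs_def] F1_def[abs_def] F2_def[abs_def] F3_def[abs_def] B_def by (rule kchain_H[OF c]) auto
  have KK: "kK (F1 m) (F2 m) (F3 m) = (Kcut m :: real^'n \<Rightarrow> real)" for m
    unfolding F1_def[abs_def] F2_def[abs_def] F3_def[abs_def] Kcut_def ..
  have B: "0 \<le> B" by (rule kchain_B_nonneg[OF K])
  obtain C R0 where C: "0 \<le> C" and me: "\<And>F0 F1 F2 F3 B x i. kchain ?n B F0 F1 F2 F3 \<Longrightarrow> R0 \<le> norm x \<Longrightarrow>
      \<bar>(LINT y|M. v y $ i * kK F1 F2 F3 (y - x)) - leading F1 F2 i x\<bar> \<le> C * B * remainder_bound a x"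
    using main_estimate unfolding leading_def by blast
  obtain u where u: "u \<in> borel_measurable borel"
    "AE y in lebesgue. u y = (if y \<in> \<Omega> then v y $ i else 0)"
    "\<And>R. integrable lborel (\<lambda>y. indicat_real (cball 0 R) y * u y)"
    "\<And>\<epsilon>. 0 < \<epsilon> \<Longrightarrow> \<exists>R. AE y in lborel. R \<le> norm y \<longrightarrow> \<bar>u y\<bar> \<le> \<epsilon>"
    "\<And>g. g \<in> borel_measurable borel \<Longrightarrow> (LINT y|M. v y $ i * g y) = (LINT y|lborel. u y * g y)"
    using borel_extension[of i] by blast
  \<comment> \<open>Radius at least 1 is what \<open>leading_bound\<close> needs for bounds uniform
    in m.\<close>
  define R where "R = max 1 R0"
  define E where "E = \<bar>coeff_b0 S \<nu> vb\<bar> * ((16 + 4 * ?n) * B) + (\<Sum>j\<in>UNIV. \<Sum>k\<in>UNIV. (4 * ?n + 28) * B * \<bar>Bm j k\<bar>)"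
  have E: "0 \<le> E" unfolding E_def using B by (intro add_nonneg_nonneg mult_nonneg_nonneg sum_nonneg) auto
  have rb: "0 \<le> remainder_bound a x" "remainder_bound a x \<le> 1" for x :: "real^'n"
    using remainder_bound_le_1[of a x] a dim by auto
  have "AE x in lebesgue. R < norm x \<longrightarrow> \<bar>u x - leading (\<lambda>t. ?c * P1 ?n t) (\<lambda>t. ?c * P2 ?n t) i x\<bar> \<le> C * B * remainder_bound a x"
  proof (rule kernel_limit_bound[OF u(1) u(3) u(4), where A="\<lambda>m. leading (F1 m) (F2 m) i" and D="E + C * B"])
    fix m and x :: "real^'n"
    assume x: "R \<le> norm x"
    then have "(LINT y|M. v y $ i * Kcut m (y - x)) = (LINT y|lborel. u y * Kcut m (y - x))"
      by (intro u(5)) measurable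
    then show "\<bar>(LINT y|lborel. u y * Kcut m (y - x)) - leading (F1 m) (F2 m) i x\<bar> \<le> C * B * remainder_bound a x"
      using me[OF K[of m], of x i] x unfolding KK R_def by simp
    have "\<bar>leading (F1 m) (F2 m) i x\<bar> \<le> E" unfolding E_def by (rule leading_bound[OF K]) (use x in \<open>simp add: R_def\<close>)
    then show "\<bar>leading (F1 m) (F2 m) i x\<bar> \<le> E + C * B" using C B by (intro add_increasing2) auto
  next
    fix x :: "real^'n"
    assume x: "R \<le> norm x"
    have "\<bar>C * B * remainder_bound a x\<bar> \<le> C * B * 1" using rb[of x] C B by (simp add: mult_left_le)
    then show "\<bar>C * B * remainder_bound a x\<bar> \<le> E + C * B" using E by simp
    have "x \<noteq> 0" using x by (auto simp: R_def)
    then have t: "0 < x \<bullet> x" by simp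
    have n0: "0 < ?n" by simp
    have "(\<lambda>m. F1 m (x \<bullet> x)) \<longlonglongrightarrow> ?c * P1 ?n (x \<bullet> x)" "(\<lambda>m. F2 m (x \<bullet> x)) \<longlonglongrightarrow> ?c * P2 ?n (x \<bullet> x)"
      unfolding F1_def F2_def by (rule H_limits[OF c n0 t])+
    then show "(\<lambda>m. leading (F1 m) (F2 m) i x) \<longlonglongrightarrow> leading (\<lambda>t. ?c * P1 ?n t) (\<lambda>t. ?c * P2 ?n t) i x"
      unfolding leading_def kQ_def dphi_def by (intro tendsto_intros)
  next
    fix m
    have "continuous_on UNIV (kQ (F1 m) (F2 m) i :: real^'n \<Rightarrow> real)" "continuous_on UNIV (dphi (F1 m) (F2 m) i j k :: real^'n \<Rightarrow> real)" for j k
      using kchain_C1(2,3)[OF K[of m]] by (blast intro: C1_grad_continuous)+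
    then show "leading (F1 m) (F2 m) i \<in> borel_measurable borel"
      unfolding leading_def[abs_def] by (intro borel_measurable_continuous_onI continuous_intros)
    show "(\<lambda>x::real^'n. C * B * remainder_bound a x) \<in> borel_measurable borel" by measurable
  qed
  \<comment> \<open>R + 1 turns the strict inequality R < norm x into a weak one.\<close>
  then have "AE x in lebesgue. x \<in> \<Omega> \<longrightarrow> (R + 1 \<le> norm x \<longrightarrow>
      \<bar>v x $ i - leading (\<lambda>t. ?c * P1 ?n t) (\<lambda>t. ?c * P2 ?n t) i x\<bar> \<le> C * B * remainder_bound a x)"
    using u(2) by eventually_elim auto
  then have "AE x in M. R + 1 \<le> norm x \<longrightarrow>
      \<bar>v x $ i - leading (\<lambda>t. ?c * P1 ?n t) (\<lambda>t. ?c * P2 ?n t) i x\<bar> \<le> C * B * remainder_bound a x"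
    using \<Omega>_sets by (simp add: AE_restrict_space_iff)
  then show ?thesis by blast
qed

lemma Bm_boundary_moment: "Bm j k = boundary_moment S \<nu> vb Gb pb j k - (LINT y:\<Omega>|lebesgue. y $ k * f y $ j)"
proof -
  have "boundary_moment S \<nu> vb Gb pb j k = (LINT q|S. vb q $ j * \<nu> q $ k - gb j q * q $ k)"
    unfolding boundary_moment_def
    by (intro Bochner_Integration.integral_cong refl) (simp add: gb_def inner_vec_def algebra_simps)
  also have "\<dots> = (LINT q|S. vb q $ j * \<nu> q $ k) - (LINT q|S. gb j q * q $ k)"
    by (intro Bochner_Integration.integral_diff integrable_S_normal integrable_vb integrable_mult_cont_S integrable_gb continuous_intros)
  finally show ?thesis
    unfolding Bm_def Lfun_def set_integral_lebesgue_on(1)[OF \<Omega>_sets] by (simp add: mult.commute)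
qed

text \<open>In particular the coefficient with index (N, N) is zero, so the sum of the theorem may
  be taken over all pairs.\<close>

lemma coeff_b_Bm: "coeff_b N \<Omega> S \<nu> f vb Gb pb j k = Bm j k - dlt j k * Bm N N"
proof (cases "j = k")
  case True
  have i: "integrable M (\<lambda>y. y $ k * f y $ l)" for k l
    using f_nth_integrable[of l k] by (simp add: mult.commute)
  have "(LINT y:\<Omega>|lebesgue. y $ N * f y $ N - y $ j * f y $ j)
    = (LINT y:\<Omega>|lebesgue. y $ N * f y $ N) - (LINT y:\<Omega>|lebesgue. y $ j * f y $ j)"
    unfolding set_integral_lebesgue_on(1)[OF \<Omega>_sets] by (rule Bochner_Integration.integral_diff[OF i i])
  then show ?thesis using True by (simp add: coeff_b_def Bm_boundary_moment)
next
  case False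
  then show ?thesis by (simp add: coeff_b_def Bm_boundary_moment dlt_def)
qed

text \<open>Subtracting a multiple of the identity from the coefficient matrix does not change the sum
  because \<open>\<Sum>\<^sub>j \<Phi>\<^sup>j\<^sup>j\<close> is the divergence of the rows of the Lorentz tensor, which vanishes.\<close>

lemma leading_eq:
  assumes x: "x \<noteq> 0"
  shows "leading (\<lambda>t. kc CARD('n) * P1 (real CARD('n)) t) (\<lambda>t. kc CARD('n) * P2 (real CARD('n)) t) i x
    = coeff_b0 S \<nu> vb * grad_E x $ i + (\<Sum>(j,k)\<in>UNIV - {(N, N)}. Phi j k i x * coeff_b N \<Omega> S \<nu> f vb Gb pb j k)"
proof -
  let ?D = "\<lambda>j k. Phi j k i x"
  \<comment> \<open>The omitted pair has coefficient zero.\<close>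
  have "(\<Sum>(j,k)\<in>UNIV - {(N, N)}. ?D j k * coeff_b N \<Omega> S \<nu> f vb Gb pb j k) = (\<Sum>(j,k)\<in>UNIV. ?D j k * (Bm j k - dlt j k * Bm N N))"
    by (rule sum.mono_neutral_cong_left) (auto simp: coeff_b_Bm)
  also have "\<dots> = (\<Sum>j\<in>UNIV. \<Sum>k\<in>UNIV. ?D j k * (Bm j k - dlt j k * Bm N N))"
    by (simp add: UNIV_Times_UNIV[symmetric] sum.cartesian_product del: UNIV_Times_UNIV)
  also have "\<dots> = (\<Sum>j\<in>UNIV. (\<Sum>k\<in>UNIV. ?D j k * Bm j k) - ?D j j * Bm N N)"
  proof (rule sum.cong[OF refl])
    fix j
    have "(\<Sum>k\<in>UNIV. ?D j k * (Bm j k - dlt j k * Bm N N)) = (\<Sum>k\<in>UNIV. ?D j k * Bm j k - dlt j k * (?D j k * Bm N N))"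
      by (intro sum.cong refl) (simp add: algebra_simps)
    then show "(\<Sum>k\<in>UNIV. ?D j k * (Bm j k - dlt j k * Bm N N)) = (\<Sum>k\<in>UNIV. ?D j k * Bm j k) - ?D j j * Bm N N"
      by (simp add: sum_subtractf)
  qed
  also have "\<dots> = (\<Sum>j\<in>UNIV. \<Sum>k\<in>UNIV. ?D j k * Bm j k) - (\<Sum>j\<in>UNIV. ?D j j) * Bm N N"
    by (simp add: sum_subtractf sum_distrib_right)
  also have "(\<Sum>j\<in>UNIV. ?D j j) = 0" unfolding Phi_dphi[OF dim x] by (rule dphi_div)
  finally show ?thesis unfolding leading_def grad_E_kQ[OF dim x] Phi_dphi[OF dim x] by simp
qed

end

theorem proposition4p6:
  fixes \<Omega> :: "(real^'n::finite) set"
    and S :: "(real^'n) measure"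
    and \<nu> :: "real^'n \<Rightarrow> real^'n"
    and v f :: "real^'n \<Rightarrow> real^'n"
    and p :: "real^'n \<Rightarrow> real"
    and vb :: "real^'n \<Rightarrow> real^'n"
    and Gb :: "real^'n \<Rightarrow> real^'n^'n"
    and pb :: "real^'n \<Rightarrow> real"
    and a :: real
    and N :: 'n
  assumes dim: "CARD('n) \<ge> 2"
    and dom: "exterior_lipschitz_domain \<Omega>" and zero: "0 \<notin> closure \<Omega>"
    and surf: "surface_measure \<Omega> S"
    and normal: "outer_unit_normal \<Omega> S \<nu>"
    and v_reg: "\<And>i. H2_loc_cl \<Omega> (\<lambda>x. v x $ i)"
    and p_reg: "H1_loc_cl \<Omega> p"
    and v_trace: "\<And>i. has_trace \<Omega> S (\<lambda>x. v x $ i) (\<lambda>x. vb x $ i)"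
    and grad_v_trace: "\<And>i l. has_trace \<Omega> S (weak_pderiv \<Omega> l (\<lambda>x. v x $ i)) (\<lambda>x. Gb x $ i $ l)"
    and p_trace: "has_trace \<Omega> S p pb"
    and momentum: "\<And>i. AE x in lebesgue_on \<Omega>.
        - (\<Sum>k\<in>UNIV. weak_pderiv \<Omega> k (weak_pderiv \<Omega> k (\<lambda>x. v x $ i)) x) + weak_pderiv \<Omega> i p x
        = f x $ i"
    and divfree: "AE x in lebesgue_on \<Omega>. (\<Sum>i\<in>UNIV. weak_pderiv \<Omega> i (\<lambda>x. v x $ i) x) = 0"
    and a: "a > real CARD('n) + 1"
    and f_decay: "\<exists>C. AE x in lebesgue_on \<Omega>. norm (f x) \<le> C * japanese x powr (- a)"
    and net_force: "\<And>j. (LINT y:\<Omega>|lebesgue. f y $ j)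
        + (LINT y|S. (\<Sum>l\<in>UNIV. \<nu> y $ l * Gb y $ j $ l) - pb y * \<nu> y $ j) = 0"
    and v_decay: "\<And>\<epsilon>. \<epsilon> > 0 \<Longrightarrow>
        \<exists>R. AE x in lebesgue_on \<Omega>. norm x \<ge> R \<longrightarrow> norm (v x) \<le> \<epsilon>"
  shows "(\<forall>x::real^'n. x \<noteq> 0 \<longrightarrow>
            grad_E x = - (1 / (real CARD('n) * omega CARD('n) * norm x ^ CARD('n))) *\<^sub>R x) \<and>
         (\<forall>i. \<exists>C R. AE x in lebesgue_on \<Omega>. norm x \<ge> R \<longrightarrow>
            \<bar>v x $ i - (coeff_b0 S \<nu> vb * grad_E x $ i
               + (\<Sum>(j,k)\<in>UNIV - {(N, N)}. Phi j k i x * coeff_b N \<Omega> S \<nu> f vb Gb pb j k))\<bar>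
            \<le> C * remainder_bound a x)"
proof (intro conjI allI impI)
  show "grad_E x = - (1 / (real CARD('n) * omega CARD('n) * norm x ^ CARD('n))) *\<^sub>R x" if "x \<noteq> 0" for x :: "real^'n"
    by (rule grad_E_eq[OF dim that])
next
  interpret stokes_exterior \<Omega> S \<nu> v f p vb Gb pb a
    by (rule stokes_exterior.intro[OF dim dom zero surf normal v_reg p_reg v_trace grad_v_trace p_trace momentum divfree a f_decay net_force v_decay])
  fix i
  obtain C R where CR: "AE x in lebesgue_on \<Omega>. R \<le> norm x \<longrightarrow>
    \<bar>v x $ i - leading (\<lambda>t. kc CARD('n) * P1 (real CARD('n)) t) (\<lambda>t. kc CARD('n) * P2 (real CARD('n)) t) i x\<bar> \<le> C * remainder_bound a x"
    using leading_asymptotics[of i] by blast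
  \<comment> \<open>The lower bound 1 keeps x away from 0, where the identification of the kernels
    fails.\<close>
  have "AE x in lebesgue_on \<Omega>. norm x \<ge> max 1 R \<longrightarrow>
    \<bar>v x $ i - (coeff_b0 S \<nu> vb * grad_E x $ i
       + (\<Sum>(j,k)\<in>UNIV - {(N, N)}. Phi j k i x * coeff_b N \<Omega> S \<nu> f vb Gb pb j k))\<bar>
    \<le> C * remainder_bound a x"
    using CR
  proof eventually_elim
    case (elim x)
    show ?case
    proof
      assume x: "norm x \<ge> max 1 R"
      then have "x \<noteq> 0" by auto
      from leading_eq[OF this, of i N] elim x show "\<bar>v x $ i - (coeff_b0 S \<nu> vb * grad_E x $ i
         + (\<Sum>(j,k)\<in>UNIV - {(N, N)}. Phi j k i x * coeff_b N \<Omega> S \<nu> f vb Gb pb j k))\<bar> \<le> C * remainder_bound a x"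
        by simp
    qed
  qed
  then show "\<exists>C R. AE x in lebesgue_on \<Omega>. norm x \<ge> R \<longrightarrow>
    \<bar>v x $ i - (coeff_b0 S \<nu> vb * grad_E x $ i
       + (\<Sum>(j,k)\<in>UNIV - {(N, N)}. Phi j k i x * coeff_b N \<Omega> S \<nu> f vb Gb pb j k))\<bar>
    \<le> C * remainder_bound a x" by blast
qed

end
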